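(* Let $a_1,\dots,a_n\in\mathbb{Z}^d$ be non-zero vectors which generate $\mathbb{Z}^d$, such that no linear functional on $\mathbb{R}^d$ is non-zero on exactly one of $a_1,\dots,a_n$ and zero on all the others, and let $A$ be the Lawrence lifting of $a_1,\dots,a_n$. Let $f\in\mathbb{C}(x_1,\dots,x_n,y_1,\dots,y_n)$ be a rational $A$-hypergeometric function of some degree $\alpha\in\mathbb{Z}^{n+d}$. Then there exist $u,v\in\mathbb{N}^n$ such that the iterated derivative $\partial_x^u\partial_y^vf$ is a (finite, possibly empty) $\mathbb{C}$-linear combination of toric residues associated with facial subsets of $A$.
   Context: **Lawrence lifting and hypergeometric functions.** The Lawrence lifting is the $(n+d)\times 2n$ matrix $A=\begin{pmatrix} I_n & I_n\\ 0 & a_1\cdots a_n\end{pmatrix}$. A function of $(x,y)=(x_1,\dots,x_n,y_1,\dots,y_n)$ is $A$-hypergeometric of degree $\alpha=(-\beta,-\gamma)$, $\beta\in\mathbb{Z}^n$, $\gamma\in\mathbb{Z}^d$, if it is annihilated by: (i) $\partial_x^u\partial_y^v-\partial_x^v\partial_y^u$ for all $u,v\in\mathbb{N}^n$ with $\sum_i u_ia_i=\sum_i v_ia_i$; (ii) $x_i\partial_{x_i}+y_i\partial_{y_i}+\beta_i$ for $i=1,\dots,n$; (iii) $\sum_{i=1}^n a_{ji}y_i\partial_{y_i}+\gamma_j$ for $j=1,\dots,d$, where $a_{ji}$ is the $j$-th coordinate of $a_i$. **Facial subsets.** A facial subset of $A$ is the set of those columns of $A$ that lie on a given face of the cone spanned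 by the columns of $A$ (the whole set $A$ is allowed). For every non-empty $S\subseteq\{1,\dots,n\}$, the set $A_S$ of columns with indices $i$ and $n+i$, $i\in S$, is a facial subset. **Toric residues.** Let $L_S\subseteq\mathbb{Z}^d$ be the lattice generated by $a_i$, $i\in S$, of rank $e$; choose a basis of $L_S$, let $t_1,\dots,t_e$ be the corresponding coordinates on the torus $(\mathbb{C}^* )^e$ with character lattice $L_S$, and put $f_i=x_i+y_it^{a_i}$ for $i\in S$. The toric residues associated with the facial subset $A_S$ are the following rational functions, for $I=\{i_1<\cdots<i_e\}\subseteq S$ with $a_{i_1},\dots,a_{i_e}$ linearly independent, $\beta\in\mathbb{Z}_{>0}^S$ and $\gamma\in L_S$: for generic $(x,y)$, the sum over all points $\xi$ of the finite set $\{\xi\in(\mathbb{C}^* )^e: f_i(\xi)=0\ \forall i\in I\}$ of the local Grothendieck residues at $\xi$, relative to the divisors $\{f_{i_1}=0\},\dots,\{f_{i_e}=0\}$, of the form $\frac{t^\gamma}{\prod_{i\in S}f_i^{\beta_i}}\frac{dt_1}{t_1}\wedge\cdots\wedge\frac{dt_e}{t_e}$. *)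

theory Defs
  imports "Jordan_Normal_Form.Determinant" "HOL-Analysis.Analysis"
begin

no_notation Matrix.vec_index (infixl "$" 100)

section \<open>Rational functions of $(x,y)$\<close>

text \<open>
  Functions of $(x,y) = (x_1,\dots,x_n,y_1,\dots,y_n)$ are curried, with \<open>n = CARD('n)\<close>; the linear
  order on the index type \<open>'n\<close> is the order of $1,\dots,n$.  Since the complex numbers form an infinite field, polynomials
  are the same as polynomial functions.
\<close>

type_synonym 'n xy_fun = "(complex, 'n) Finite_Cartesian_Product.vec
  \<Rightarrow> (complex, 'n) Finite_Cartesian_Product.vec \<Rightarrow> complex"

inductive polynomial_fun :: "'n::finite xy_fun \<Rightarrow> bool" where
  const: "polynomial_fun (\<lambda>x y. c)"
| x: "polynomial_fun (\<lambda>x y. x $ i)"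
| y: "polynomial_fun (\<lambda>x y. y $ i)"
| add: "polynomial_fun p \<Longrightarrow> polynomial_fun q \<Longrightarrow> polynomial_fun (\<lambda>x y. p x y + q x y)"
| mult: "polynomial_fun p \<Longrightarrow> polynomial_fun q \<Longrightarrow> polynomial_fun (\<lambda>x y. p x y * q x y)"

text \<open>
  Rational functions are quotients of polynomials.  The values on the zero set of the chosen denominator
  (where Isabelle's division returns $0$) carry no information, so identities between rational
  functions are always stated for generic $(x,y)$, i.e. on a non-empty Zariski open set.
\<close>

definition rational_fun :: "'n::finite xy_fun \<Rightarrow> bool" where
  "rational_fun f \<longleftrightarrow>
     (\<exists>p q. polynomial_fun p \<and> polynomial_fun q \<and> (\<exists>x y. q x y \<noteq> 0) \<and> f = (\<lambda>x y. p x y / q x y))"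

definition generically :: "(complex ^ 'n \<Rightarrow> complex ^ 'n \<Rightarrow> bool) \<Rightarrow> bool" where
  "generically P \<longleftrightarrow>
     (\<exists>g. polynomial_fun g \<and> (\<exists>x y. g x y \<noteq> 0) \<and> (\<forall>x y. g x y \<noteq> 0 \<longrightarrow> P x y))"

definition dx :: "'n::finite \<Rightarrow> 'n xy_fun \<Rightarrow> 'n xy_fun" where
  "dx i f = (\<lambda>x y. deriv (\<lambda>z. f (x + axis i z) y) 0)"

definition dy :: "'n::finite \<Rightarrow> 'n xy_fun \<Rightarrow> 'n xy_fun" where
  "dy i f = (\<lambda>x y. deriv (\<lambda>z. f x (y + axis i z)) 0)"

text \<open>
  The iterated derivative $\partial^u$.  Away from the zero set of the denominator of a rational function
  it does not depend on the order in which the derivatives are taken.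
\<close>

definition iter_deriv :: "('n::{finite,linorder} \<Rightarrow> 'f \<Rightarrow> 'f) \<Rightarrow> ('n \<Rightarrow> nat) \<Rightarrow> 'f \<Rightarrow> 'f" where
  "iter_deriv D u f = fold (\<lambda>i. D i ^^ u i) (sorted_list_of_set UNIV) f"

abbreviation dxy :: "('n::{finite,linorder} \<Rightarrow> nat) \<Rightarrow> ('n \<Rightarrow> nat) \<Rightarrow> 'n xy_fun \<Rightarrow> 'n xy_fun" where
  "dxy u v f \<equiv> iter_deriv dx u (iter_deriv dy v f)"


section \<open>The Lawrence lifting and hypergeometric functions\<close>

definition real_vec :: "int ^ 'm \<Rightarrow> real ^ 'm" where
  "real_vec v = (\<chi> j. real_of_int (v $ j))"

text \<open>The columns \<open>Inl i\<close>, \<open>Inr i\<close> have the indices $i$ and $n+i$ in the usual numbering.\<close>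

definition lawrence :: "('n::finite \<Rightarrow> int ^ 'd) \<Rightarrow> int ^ ('n + 'n) ^ ('n + 'd)" where
  "lawrence a = (\<chi> r c. case r of
       Inl i \<Rightarrow> (case c of Inl k \<Rightarrow> of_bool (i = k) | Inr k \<Rightarrow> of_bool (i = k))
     | Inr j \<Rightarrow> (case c of Inl k \<Rightarrow> 0 | Inr k \<Rightarrow> a k $ j))"

text \<open>A facial subset is represented by the set of indices of its columns.\<close>

definition facial_subset :: "int ^ 'c ^ 'r \<Rightarrow> 'c set \<Rightarrow> bool" where
  "facial_subset A J \<longleftrightarrow>
     (\<exists>F. F face_of (convex_cone hull range (\<lambda>c. real_vec (column c A))) \<and> F \<noteq> {} \<and>
          J = {c. real_vec (column c A) \<in> F})"

text \<open>$A$-hypergeometric functions of degree $(-\beta,-\gamma)$, for the Lawrence lifting $A$ of $a$.\<close>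

definition hypergeometric ::
    "('n::{finite,linorder} \<Rightarrow> int ^ 'd) \<Rightarrow> ('n \<Rightarrow> int) \<Rightarrow> int ^ 'd
      \<Rightarrow> 'n xy_fun \<Rightarrow> bool" where
  "hypergeometric a \<beta> \<gamma> f \<longleftrightarrow>
     (\<forall>u v :: 'n \<Rightarrow> nat. (\<Sum>i\<in>UNIV. int (u i) *s a i) = (\<Sum>i\<in>UNIV. int (v i) *s a i) \<longrightarrow>
        generically (\<lambda>x y. dxy u v f x y - dxy v u f x y = 0)) \<and>
     (\<forall>i. generically (\<lambda>x y. x $ i * dx i f x y + y $ i * dy i f x y + of_int (\<beta> i) * f x y = 0)) \<and>
     (\<forall>j. generically (\<lambda>x y.
        (\<Sum>i\<in>UNIV. of_int (a i $ j) * y $ i * dy i f x y) + of_int (\<gamma> $ j) * f x y = 0))"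


section \<open>Local Grothendieck residues\<close>

text \<open>
  Points of $\mathbb{C}^e$ and $\mathbb{R}^e$ are extensional functions on \<open>{..<e}\<close>, since the
  dimension \<open>e\<close> varies.
\<close>

definition dets :: "nat \<Rightarrow> (nat \<Rightarrow> nat \<Rightarrow> 'a) \<Rightarrow> 'a::comm_ring_1" where
  "dets e M = Determinant.det (Matrix.mat e e (\<lambda>(j, k). M j k))"

definition pdiff :: "nat \<Rightarrow> ((nat \<Rightarrow> real) \<Rightarrow> complex) \<Rightarrow> (nat \<Rightarrow> real) \<Rightarrow> complex" where
  "pdiff k g s = vector_derivative (\<lambda>r. g (s(k := r))) (at (s k))"

definition C1_map :: "nat \<Rightarrow> ((nat \<Rightarrow> real) \<Rightarrow> nat \<Rightarrow> complex) \<Rightarrow> bool" where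
  "C1_map e \<phi> \<longleftrightarrow> (\<forall>j<e. \<forall>k<e.
     (\<forall>s \<in> {..<e} \<rightarrow>\<^sub>E UNIV. (\<lambda>r. \<phi> (s(k := r)) j) differentiable at (s k)) \<and>
     continuous_on ({..<e} \<rightarrow>\<^sub>E UNIV) (pdiff k (\<lambda>s. \<phi> s j)))"

definition polydisc :: "nat \<Rightarrow> (nat \<Rightarrow> complex) \<Rightarrow> real \<Rightarrow> (nat \<Rightarrow> complex) set" where
  "polydisc e \<xi> r = {t \<in> {..<e} \<rightarrow>\<^sub>E UNIV. \<forall>k<e. dist (t k) (\<xi> k) < r}"

definition residue_cycle :: "nat \<Rightarrow> (nat \<Rightarrow> (nat \<Rightarrow> complex) \<Rightarrow> complex) \<Rightarrow> (nat \<Rightarrow> complex) set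
    \<Rightarrow> (nat \<Rightarrow> real) \<Rightarrow> (nat \<Rightarrow> complex) set" where
  "residue_cycle e F U \<epsilon> = {t \<in> U. \<forall>k<e. cmod (F k t) = \<epsilon> k}"

text \<open>
  \<open>has_cycle_integral e F \<Gamma> h J\<close>: the integral of the form
  $h\, dt_1 \wedge \dots \wedge dt_e$ over the real $e$-dimensional manifold $\Gamma$ is $J$, where $\Gamma$
  carries the orientation in which $d\arg F_1 \wedge \dots \wedge d\arg F_e$ is positive.
  $\Gamma$ is cut into the images of finitely many half-open unit cubes under orientation-preserving
  $C^1$ maps, and the form is pulled back to the cubes; note that
  $d\arg F_j = \mathrm{Im}\,(dF_j / F_j)$.
\<close>

definition has_cycle_integral :: "nat \<Rightarrow> (nat \<Rightarrow> (nat \<Rightarrow> complex) \<Rightarrow> complex) \<Rightarrow> (nat \<Rightarrow> complex) set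
    \<Rightarrow> ((nat \<Rightarrow> complex) \<Rightarrow> complex) \<Rightarrow> complex \<Rightarrow> bool" where
  "has_cycle_integral e F \<Gamma> h J \<longleftrightarrow> (\<exists>(N::nat) \<phi>.
     bij_betw (\<lambda>(m, s). \<phi> m s) ({..<N} \<times> ({..<e} \<rightarrow>\<^sub>E {0..<1})) \<Gamma> \<and>
     (\<forall>m<N. C1_map e (\<phi> m)) \<and>
     (\<forall>m<N. \<forall>s \<in> {..<e} \<rightarrow>\<^sub>E {0..<1}.
        dets e (\<lambda>j k. Im (pdiff k (\<lambda>s. F j (\<phi> m s)) s / F j (\<phi> m s))) > 0) \<and>
     J = (\<Sum>m<N. LINT s : ({..<e} \<rightarrow>\<^sub>E {0..<1}) | PiM {..<e} (\<lambda>_. lborel).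
            h (\<phi> m s) * dets e (\<lambda>j k. pdiff k (\<lambda>s. \<phi> m s j) s)))"

text \<open>
  \<open>has_local_residue e F h \<xi> R\<close>: $R$ is the local residue at $\xi$ of the meromorphic form
  $h\, dt_1 \wedge \dots \wedge dt_e$, relative to the divisors $\{F_1 = 0\},\dots,\{F_e = 0\}$, i.e.
  $R = (2\pi i)^{-e}\int_\Gamma h\, dt_1 \wedge \dots \wedge dt_e$ with
  $\Gamma = \{t \in U : |F_k(t)| = \varepsilon_k \text{ for all } k\}$ for a small
  neighbourhood $U$ of the isolated common zero $\xi$ of the $F_k$ and small $\varepsilon$ for which
  the $F_k$ are local coordinates along $\Gamma$.  The denominator of the form is part of $h$.
\<close>

definition has_local_residue :: "nat \<Rightarrow> (nat \<Rightarrow> (nat \<Rightarrow> complex) \<Rightarrow> complex)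
    \<Rightarrow> ((nat \<Rightarrow> complex) \<Rightarrow> complex) \<Rightarrow> (nat \<Rightarrow> complex) \<Rightarrow> complex \<Rightarrow> bool" where
  "has_local_residue e F h \<xi> R \<longleftrightarrow>
     (\<forall>\<^sub>F r in at_right 0.
        {t \<in> polydisc e \<xi> r. \<forall>k<e. F k t = 0} = {\<xi>} \<and>
        (\<exists>\<delta>>0. \<forall>\<epsilon>. (\<forall>k<e. 0 < \<epsilon> k \<and> \<epsilon> k < \<delta>) \<and>
           (\<forall>t \<in> residue_cycle e F (polydisc e \<xi> r) \<epsilon>.
              dets e (\<lambda>j k. deriv (\<lambda>z. F j (t(k := z))) (t k)) \<noteq> 0) \<longrightarrow>
           has_cycle_integral e F (residue_cycle e F (polydisc e \<xi> r) \<epsilon>) h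
             ((2 * of_real pi * \<i>) ^ e * R)))"


section \<open>Toric residues\<close>

definition int_lattice :: "('i \<Rightarrow> int ^ 'd) \<Rightarrow> 'i set \<Rightarrow> (int ^ 'd) set" where
  "int_lattice a S = range (\<lambda>c. \<Sum>i\<in>S. c i *s a i)"

definition independent_family :: "('i \<Rightarrow> int ^ 'd) \<Rightarrow> 'i set \<Rightarrow> bool" where
  "independent_family a S \<longleftrightarrow> (\<forall>c. (\<Sum>i\<in>S. c i *s a i) = 0 \<longrightarrow> (\<forall>i\<in>S. c i = 0))"

definition lattice_basis :: "nat \<Rightarrow> (nat \<Rightarrow> int ^ 'd) \<Rightarrow> (int ^ 'd) set \<Rightarrow> bool" where
  "lattice_basis e b L \<longleftrightarrow> independent_family b {..<e} \<and> int_lattice b {..<e} = L"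

definition coords :: "nat \<Rightarrow> (nat \<Rightarrow> int ^ 'd) \<Rightarrow> int ^ 'd \<Rightarrow> nat \<Rightarrow> int" where
  "coords e b v = (THE m. m \<in> extensional {..<e} \<and> v = (\<Sum>k<e. m k *s b k))"

text \<open>The character $t^v$, in the coordinates on the torus given by the basis \<open>b\<close> of its character lattice.\<close>

definition monomial :: "nat \<Rightarrow> (nat \<Rightarrow> int ^ 'd) \<Rightarrow> int ^ 'd \<Rightarrow> (nat \<Rightarrow> complex) \<Rightarrow> complex" where
  "monomial e b v t = (\<Prod>k<e. t k powi coords e b v k)"

definition binom_fun :: "('n::finite \<Rightarrow> int ^ 'd) \<Rightarrow> nat \<Rightarrow> (nat \<Rightarrow> int ^ 'd)
    \<Rightarrow> complex ^ 'n \<Rightarrow> complex ^ 'n \<Rightarrow> 'n \<Rightarrow> (nat \<Rightarrow> complex) \<Rightarrow> complex" where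
  "binom_fun a e b x y i t = x $ i + y $ i * monomial e b (a i) t"

definition torus :: "nat \<Rightarrow> (nat \<Rightarrow> complex) set" where
  "torus e = ({..<e} \<rightarrow>\<^sub>E - {0})"

text \<open>
  The rational function \<open>R\<close> is a toric residue associated with the facial subset $A_S$, for the given
  $I$, $\beta$, $\gamma$ and the basis \<open>b\<close> of $L_S$.  Changing the basis changes
  the residue at most by a sign.
\<close>

definition toric_residue_data :: "('n::{finite,linorder} \<Rightarrow> int ^ 'd) \<Rightarrow> 'n set \<Rightarrow> nat
    \<Rightarrow> (nat \<Rightarrow> int ^ 'd) \<Rightarrow> 'n set \<Rightarrow> ('n \<Rightarrow> nat) \<Rightarrow> int ^ 'd
    \<Rightarrow> 'n xy_fun \<Rightarrow> bool" where
  "toric_residue_data a S e b I \<beta> \<gamma> R \<longleftrightarrow>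
     rational_fun R \<and>
     generically (\<lambda>x y.
       let f = binom_fun a e b x y;
           Z = {\<xi> \<in> torus e. \<forall>i\<in>I. f i \<xi> = 0}
       in finite Z \<and>
          (\<exists>\<rho>. (\<forall>\<xi>\<in>Z. has_local_residue e (\<lambda>k. f (sorted_list_of_set I ! k))
                   (\<lambda>t. monomial e b \<gamma> t / (\<Prod>i\<in>S. f i t ^ \<beta> i) / (\<Prod>k<e. t k)) \<xi> (\<rho> \<xi>)) \<and>
               R x y = (\<Sum>\<xi>\<in>Z. \<rho> \<xi>)))"

definition toric_residue :: "('n::{finite,linorder} \<Rightarrow> int ^ 'd) \<Rightarrow> 'n set
    \<Rightarrow> 'n xy_fun \<Rightarrow> bool" where
  "toric_residue a S R \<longleftrightarrow>
     (\<exists>e b I \<beta> \<gamma>. lattice_basis e b (int_lattice a S) \<and>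
        I \<subseteq> S \<and> card I = e \<and> independent_family a I \<and>
        (\<forall>i\<in>S. \<beta> i > 0) \<and> \<gamma> \<in> int_lattice a S \<and>
        toric_residue_data a S e b I \<beta> \<gamma> R)"

end

theory Submission
  imports Defs "HOL-Complex_Analysis.Complex_Analysis"
begin

text \<open>
  Expand a rational hypergeometric function as a formal Laurent series that is bounded below in a generic
  integer weight \<open>w\<close>. By homogeneity its exponents lie in one coset of the lattice of relations
  between the \<open>a i\<close>, and the toric equations determine the coefficients on all exponents of a given
  sign pattern from a single one of them. After sufficiently many derivatives only full-dimensional
  sign patterns survive, and \<open>w\<close>-positivity writes the remaining function of the sign pattern as a
  combination of indicator functions of the simplicial cones given by the cobases \<open>J\<close> of the lattice.
  The series supported on such a cone is the expansion of the sum of the residues at the common zeros of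
  the \<open>f i\<close>, \<open>i \<notin> J\<close>: for exponents \<open>\<beta> i = 1\<close> this sum is computed by character
  orthogonality as a product of geometric series, and higher exponents arise by differentiation in the
  \<open>x i\<close>, which the Cauchy integral formula turns into higher order residues.
  The face of the cone can always be taken to be the whole cone, with \<open>S = UNIV\<close>.
\<close>

section \<open>Sign cones in a lattice\<close>

text \<open>The weight has three tasks. It separates the exponents of the denominator, so that a
  term of least weight exists and can be inverted. It is nonzero on the elementary relations (the
  circuits of the relation lattice), so that each edge of a cobasis cone has a definite side. And
  because the series is bounded below, the closed cone of a sign pattern that occurs contains no
  relation of negative weight. This positivity is indispensable: in rank one all cobasis cones are
  the same half line, and a nonzero constant is no combination of them. The obstacle is that a
  derivative annihilates every monomial whose exponent it would carry from nonnegative to negative.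
  At such a wall a toric equation loses one of the two coefficients that it relates. Differentiating
  equally often in all variables discards the exponents near the walls and makes all \<beta> i
  positive. Then each sign pattern carries, up to a scalar, one universal solution, made of the
  coefficients of the expansions of the factors (x i + y i t^(a i))^(-\<beta> i).\<close>

definition closed_comb :: "('n \<Rightarrow> int) set \<Rightarrow> bool" where
  "closed_comb L \<longleftrightarrow> (\<lambda>_. 0) \<in> L \<and> (\<forall>d\<in>L. \<forall>e\<in>L. \<forall>a b. (\<lambda>i. a * d i + b * e i) \<in> L)"

definition wt :: "('n::finite \<Rightarrow> int) \<Rightarrow> ('n \<Rightarrow> int) \<Rightarrow> int" where
  "wt W d = (\<Sum>i\<in>UNIV. W i * d i)"

text \<open>The circuits of \<open>L\<close>, seen through the coordinates in \<open>T\<close>: the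
  zeros on \<open>T\<close> fix the vector up to a rational factor, which is written with two
  integers because lattice vectors cannot be divided.\<close>

definition elementary :: "('n \<Rightarrow> int) set \<Rightarrow> 'n set \<Rightarrow> ('n \<Rightarrow> int) \<Rightarrow> bool" where
  "elementary L T e \<longleftrightarrow> e \<in> L \<and> e \<noteq> (\<lambda>_. 0) \<and>
     (\<forall>e'\<in>L. (\<forall>j\<in>T. e j = 0 \<longrightarrow> e' j = 0) \<longrightarrow> (\<exists>a b. a \<noteq> 0 \<and> (\<forall>i. a * e' i = b * e i)))"

definition spanning :: "('n \<Rightarrow> int) set \<Rightarrow> 'n set \<Rightarrow> bool" where
  "spanning L J \<longleftrightarrow> (\<forall>e\<in>L. (\<forall>j\<in>J. e j = 0) \<longrightarrow> e = (\<lambda>_. 0))"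

text \<open>For the relation lattice of generating vectors \<open>a i\<close> this says that the
  \<open>a i\<close> with \<open>i \<notin> J\<close> form a rational basis (Gale duality). The
  vectors demanded for the single \<open>j\<close> are a dual basis of \<open>L\<close> up to
  denominators.\<close>

definition cobasis :: "('n \<Rightarrow> int) set \<Rightarrow> 'n set \<Rightarrow> bool" where
  "cobasis L J \<longleftrightarrow> spanning L J \<and> (\<forall>j\<in>J. \<exists>e\<in>L. e j > 0 \<and> (\<forall>j'\<in>J - {j}. e j' = 0))"

text \<open>The open simplicial cone whose edges, the dual vectors taken with the sign of
  \<open>d j\<close>, all have positive weight. Quantifying over all dual vectors avoids a choice;
  those for the same \<open>j\<close> are positive multiples of each other once \<open>J\<close> is
  spanning.\<close>

definition sign_cone :: "('n::finite \<Rightarrow> int) \<Rightarrow> ('n \<Rightarrow> int) set \<Rightarrow> 'n set \<Rightarrow> ('n \<Rightarrow> int) \<Rightarrow> bool" where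
  "sign_cone W L J d \<longleftrightarrow>
     (\<forall>j\<in>J. \<forall>e\<in>L. (\<forall>j'\<in>J - {j}. e j' = 0) \<and> e j > 0 \<longrightarrow> wt W e * d j > 0)"

lemma wt_comb: "wt W (\<lambda>i. a * d i + b * e i) = a * wt W d + b * wt W e"
  by (simp add: wt_def sum.distrib sum_distrib_left algebra_simps)

lemma wt_scale: "wt W (\<lambda>i. a * d i) = a * wt W d"
  using wt_comb[of W a d 0 d] by simp

lemma wt_sum: "wt W (\<lambda>i. \<Sum>j\<in>J. g j i) = (\<Sum>j\<in>J. wt W (g j))"
  by (simp add: wt_def sum_distrib_left) (rule sum.swap)

lemma closed_comb_sum:
  assumes "closed_comb L" "finite J" "\<And>j. j \<in> J \<Longrightarrow> g j \<in> L"
  shows "(\<lambda>i. \<Sum>j\<in>J. g j i) \<in> L"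
  using assms(2,3)
proof (induction J rule: finite_induct)
  case empty
  then show ?case using assms(1) by (simp add: closed_comb_def)
next
  case (insert x F)
  then have "g x \<in> L" "(\<lambda>i. \<Sum>j\<in>F. g j i) \<in> L" by auto
  with assms(1) have "(\<lambda>i. 1 * g x i + 1 * (\<Sum>j\<in>F. g j i)) \<in> L"
    unfolding closed_comb_def by (elim conjE) (drule (1) bspec, drule (1) bspec, drule spec[of _ 1], drule spec[of _ 1], assumption)
  with insert show ?case by simp
qed

lemma closed_comb_scale: "closed_comb L \<Longrightarrow> d \<in> L \<Longrightarrow> (\<lambda>i. a * d i) \<in> L"
  unfolding closed_comb_def
  by (drule conjunct2, drule bspec, assumption, drule bspec, assumption,
      drule spec[of _ a], drule spec[of _ 0]) simp

lemma closed_comb2: "closed_comb L \<Longrightarrow> d \<in> L \<Longrightarrow> e \<in> L \<Longrightarrow> (\<lambda>i. a * d i + b * e i) \<in> L"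
  unfolding closed_comb_def by (elim conjE) (drule (1) bspec, drule (1) bspec, drule spec, drule spec, assumption)

lemma spanning_eq:
  assumes "closed_comb L" "spanning L J" "d \<in> L" "e \<in> L" "\<And>j. j \<in> J \<Longrightarrow> a * d j = b * e j"
  shows "a * d i = b * e i"
proof -
  have l: "(\<lambda>i. a * d i + (-b) * e i) \<in> L" using assms(1,3,4) by (rule closed_comb2)
  have "(\<lambda>i. a * d i + (-b) * e i) = (\<lambda>_. 0)"
    by (rule assms(2)[unfolded spanning_def, rule_format, OF l]) (simp add: assms(5))
  from fun_cong[OF this, of i] show ?thesis by simp
qed

text \<open>Cramer's rule in the dual basis, without denominators.\<close>

lemma dual_expansion:
  assumes "closed_comb L" "spanning L J" "finite J" "d \<in> L"
    and g: "\<And>j. j \<in> J \<Longrightarrow> g j \<in> L \<and> (\<forall>j'\<in>J - {j}. g j j' = 0)"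
  shows "(\<Prod>j\<in>J. g j j) * d i = (\<Sum>j\<in>J. d j * (\<Prod>l\<in>J - {j}. g l l) * g j i)"
proof -
  let ?s = "\<lambda>i. \<Sum>j\<in>J. d j * (\<Prod>l\<in>J - {j}. g l l) * g j i"
  have s: "?s \<in> L"
    by (rule closed_comb_sum[OF assms(1,3)], rule closed_comb_scale[OF assms(1)]) (use g in blast)
  have "(\<Prod>j\<in>J. g j j) * d i = 1 * ?s i"
  proof (rule spanning_eq[OF assms(1,2,4) s])
    fix j assume j: "j \<in> J"
    have "?s j = (\<Sum>l\<in>{j}. d l * (\<Prod>l'\<in>J - {l}. g l' l') * g l j)"
      by (rule sum.mono_neutral_right) (use j g assms(3) in auto)
    also have "\<dots> = d j * (\<Prod>j\<in>J. g j j)" using j assms(3) by (simp add: prod.remove)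
    finally show "(\<Prod>j\<in>J. g j j) * d j = 1 * ?s j" by simp
  qed
  then show ?thesis by simp
qed

lemma sgn_mult_cong: "sgn (a::int) = sgn b \<Longrightarrow> (x * a > 0) = (x * b > 0)"
  by (auto simp: sgn_if zero_less_mult_iff split: if_splits)

lemma sign_cone_sgn_cong:
  assumes "\<And>j. j \<in> J \<Longrightarrow> sgn (d j) = sgn (d' j)"
  shows "sign_cone W L J d = sign_cone W L J d'"
  unfolding sign_cone_def using sgn_mult_cong[OF assms] by auto

text \<open>Proportionality of the dual vectors for the same \<open>j\<close> lets one test vector
  per coordinate replace the quantifier in \<open>sign_cone\<close>.\<close>

lemma sign_cone_dual:
  assumes "closed_comb L" "spanning L J" 
    and g: "\<And>j. j \<in> J \<Longrightarrow> g j \<in> L \<and> g j j > 0 \<and> (\<forall>j'\<in>J - {j}. g j j' = 0)"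
  shows "sign_cone W L J d \<longleftrightarrow> (\<forall>j\<in>J. wt W (g j) * d j > 0)"
proof
  assume "sign_cone W L J d"
  then show "\<forall>j\<in>J. wt W (g j) * d j > 0" unfolding sign_cone_def using g by blast
next
  assume R: "\<forall>j\<in>J. wt W (g j) * d j > 0"
  show "sign_cone W L J d" unfolding sign_cone_def
  proof (intro ballI impI)
    fix j e assume j: "j \<in> J" and e: "e \<in> L" "(\<forall>j'\<in>J - {j}. e j' = 0) \<and> e j > 0"
    have "g j j * e i = e j * g j i" for i
    proof (rule spanning_eq[OF assms(1,2) e(1)])
      fix j' assume "j' \<in> J"
      then show "g j j * e j' = e j * g j j'" using e g[OF j] by (cases "j' = j") auto
    qed (use g j in blast)
    then have "g j j * wt W e = e j * wt W (g j)" by (simp flip: wt_scale)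
    then have "g j j * (wt W e * d j) = e j * (wt W (g j) * d j)" by (simp flip: mult.assoc)
    also have "\<dots> > 0" using R j e by simp
    finally show "wt W e * d j > 0" using g[OF j] by (simp add: zero_less_mult_iff)
  qed
qed

lemma cobasis_dual:
  assumes "cobasis L J"
  obtains g where "\<And>j. j \<in> J \<Longrightarrow> g j \<in> L \<and> g j j > 0 \<and> (\<forall>j'\<in>J - {j}. g j j' = 0)"
proof -
  from assms have "\<forall>j. \<exists>g. j \<in> J \<longrightarrow> g \<in> L \<and> g j > 0 \<and> (\<forall>j'\<in>J - {j}. g j' = 0)"
    unfolding cobasis_def by blast
  from choice[OF this] show ?thesis using that by blast
qed

text \<open>A vector of \<open>L\<close> that vanishes on \<open>J - {j}\<close> is determined by
  its entry at \<open>j\<close>, so the zeros of \<open>g\<close> inside \<open>T\<close> already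
  force proportionality. This is how genericity of the weight on circuits reaches the edges of the
  cones.\<close>

lemma dual_elementary:
  assumes "closed_comb L" "spanning L J" "J \<subseteq> T" "j \<in> J"
    and g: "g \<in> L \<and> g j > 0 \<and> (\<forall>j'\<in>J - {j}. g j' = 0)"
  shows "elementary L T g"
  unfolding elementary_def
proof (intro conjI ballI impI)
  fix e' assume e: "e' \<in> L" "\<forall>j\<in>T. g j = 0 \<longrightarrow> e' j = 0"
  have "g j * e' i = e' j * g i" for i
  proof (rule spanning_eq[OF assms(1,2) e(1)])
    fix j' assume "j' \<in> J"
    then show "g j * e' j' = e' j * g j'" using e g assms by (cases "j' = j") auto
  qed (use g in auto)
  then show "\<exists>a b. a \<noteq> 0 \<and> (\<forall>i. a * e' i = b * g i)" using g by (metis less_irrefl)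
qed (use g in auto)

text \<open>In the expansion of \<open>e\<close> in the dual basis, each coefficient
  \<open>e j\<close> is 0 or has the sign of \<open>d j\<close>, and so has the weight of the dual
  vector; no summand is negative. Thus indicators of cobasis cones have the positivity that the
  decomposition asks of \<open>H\<close>.\<close>

lemma sign_cone_weight_nonneg:
  assumes "closed_comb L" "cobasis L J" "finite J" "sign_cone W L J d" "e \<in> L" "\<And>j. j \<in> J \<Longrightarrow> d j * e j \<ge> 0"
  shows "wt W e \<ge> 0"
proof -
  obtain g where g: "\<And>j. j \<in> J \<Longrightarrow> g j \<in> L \<and> g j j > 0 \<and> (\<forall>j'\<in>J - {j}. g j j' = 0)"
    using cobasis_dual[OF assms(2)] by blast
  have sp: "spanning L J" using assms(2) cobasis_def by blast
  let ?P = "\<Prod>j\<in>J. g j j"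
  have "?P * wt W e = wt W (\<lambda>i. ?P * e i)" by (simp add: wt_scale)
  also have "\<dots> = wt W (\<lambda>i. \<Sum>j\<in>J. e j * (\<Prod>l\<in>J - {j}. g l l) * g j i)"
    using dual_expansion[OF assms(1) sp assms(3,5)] g by (simp)
  also have "\<dots> = (\<Sum>j\<in>J. e j * (\<Prod>l\<in>J - {j}. g l l) * wt W (g j))"
    by (simp add: wt_sum wt_scale)
  also have "\<dots> \<ge> 0"
  proof (rule sum_nonneg)
    fix j assume j: "j \<in> J"
    have "wt W (g j) * d j > 0" using assms(4) sign_cone_dual[OF assms(1) sp g] j by blast
    then have "wt W (g j) * e j \<ge> 0" using assms(6)[OF j]
      by (smt (verit) mult_nonneg_nonneg mult_nonpos_nonpos mult_pos_neg mult_neg_pos zero_less_mult_iff)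
    moreover have "(\<Prod>l\<in>J - {j}. g l l) \<ge> 0" by (rule prod_nonneg) (use g less_imp_le in blast)
    ultimately have "(\<Prod>l\<in>J - {j}. g l l) * (wt W (g j) * e j) \<ge> 0" by (rule mult_nonneg_nonneg[rotated])
    then show "e j * (\<Prod>l\<in>J - {j}. g l l) * wt W (g j) \<ge> 0" by (simp add: mult_ac)
  qed
  finally have "?P * wt W e \<ge> 0" .
  moreover have "?P > 0" by (rule prod_pos) (use g in blast)
  ultimately show ?thesis by (simp add: zero_le_mult_iff)
qed

text \<open>The integral substitute for moving \<open>d\<close> by an infinitesimal multiple of
  \<open>e\<close>: the factor exceeds every entry of \<open>e\<close>, so nonzero signs of
  \<open>d\<close> persist.\<close>

lemma sgn_shift:
  fixes d e :: "'n::finite \<Rightarrow> int"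
  assumes "d j \<noteq> 0"
  shows "sgn ((1 + (\<Sum>i\<in>UNIV. \<bar>e i\<bar>)) * d j + e j) = sgn (d j)"
    and "sgn ((1 + (\<Sum>i\<in>UNIV. \<bar>e i\<bar>)) * d j - e j) = sgn (d j)"
proof -
  define M where "M = 1 + (\<Sum>i\<in>UNIV. \<bar>e i\<bar>)"
  have "\<bar>e j\<bar> \<le> (\<Sum>i\<in>UNIV. \<bar>e i\<bar>)" by (rule member_le_sum) auto
  then have M: "\<bar>e j\<bar> < M" by (simp add: M_def)
  consider "d j \<ge> 1" | "d j \<le> -1" using assms by linarith
  then have "sgn (M * d j + e j) = sgn (d j) \<and> sgn (M * d j - e j) = sgn (d j)"
  proof cases
    case 1
    then have "M * 1 \<le> M * d j" using M by (intro mult_left_mono) auto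
    then show ?thesis using 1 M by (auto simp: sgn_if)
  next
    case 2
    then have "M * d j \<le> M * (-1)" using M by (intro mult_left_mono) auto
    then show ?thesis using 2 M by (auto simp: sgn_if)
  qed
  then show "sgn ((1 + (\<Sum>i\<in>UNIV. \<bar>e i\<bar>)) * d j + e j) = sgn (d j)"
    and "sgn ((1 + (\<Sum>i\<in>UNIV. \<bar>e i\<bar>)) * d j - e j) = sgn (d j)"
    by (simp_all add: M_def)
qed

text \<open>The dual vector for \<open>n\<close> is \<open>e\<close> freed from its components along
  the dual basis of the hyperplane \<open>d n = 0\<close>; the factor \<open>P\<close> clears
  denominators. In the second claim \<open>sgn k = k * 1\<close> makes \<open>k\<close> a sign: the
  side of the hyperplane on which the new cone lies, unless the weight vanishes on that dual
  vector.\<close>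

lemma cobasis_insert:
  assumes L: "closed_comb L" and J: "cobasis {d\<in>L. d n = 0} J" "finite J" "n \<notin> J"
    and e: "e \<in> L" "e n > 0"
  shows "cobasis L (insert n J)"
    and "\<exists>k::int. k \<noteq> 0 \<and> sgn k = k * 1 \<and> (\<forall>D. sign_cone W L (insert n J) D \<longleftrightarrow> k * D n > 0 \<and> sign_cone W {d\<in>L. d n = 0} J D)
       \<or> (\<exists>g. elementary L (insert n J) g \<and> wt W g = 0)"
proof -
  let ?L = "{d\<in>L. d n = 0}"
  obtain g where g: "\<And>j. j \<in> J \<Longrightarrow> g j \<in> ?L \<and> g j j > 0 \<and> (\<forall>j'\<in>J - {j}. g j j' = 0)"
    using cobasis_dual[OF J(1)] by blast
  have sp: "spanning L (insert n J)"
    using J(1) unfolding cobasis_def spanning_def by auto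
  define P where "P = (\<Prod>j\<in>J. g j j)"
  have P: "P > 0" unfolding P_def by (rule prod_pos) (use g in blast)
  define s where "s = (\<lambda>i. \<Sum>j\<in>J. e j * (\<Prod>l\<in>J - {j}. g l l) * g j i)"
  have s: "s \<in> L" unfolding s_def
    by (rule closed_comb_sum[OF L J(2)], rule closed_comb_scale[OF L]) (use g in blast)
  define h where "h = (\<lambda>i. P * e i + (-1) * s i)"
  have hL: "h \<in> L" unfolding h_def using L e(1) s by (rule closed_comb2)
  have "s n = 0" unfolding s_def using g by (auto intro!: sum.neutral)
  then have hn: "h n > 0" using P e(2) by (simp add: h_def)
  have hJ: "h j = 0" if j: "j \<in> J" for j
  proof -
    have "s j = (\<Sum>l\<in>{j}. e l * (\<Prod>l'\<in>J - {l}. g l' l') * g l j)"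
      unfolding s_def by (rule sum.mono_neutral_right) (use j g J(2) in auto)
    also have "\<dots> = P * e j" using j J(2) by (simp add: prod.remove P_def)
    finally show ?thesis by (simp add: h_def)
  qed
  define g' where "g' = g(n := h)"
  have g': "j \<in> insert n J \<Longrightarrow> g' j \<in> L \<and> g' j j > 0 \<and> (\<forall>j'\<in>insert n J - {j}. g' j j' = 0)" for j
    using g hL hn hJ J(3) unfolding g'_def by auto
  show "cobasis L (insert n J)" unfolding cobasis_def using sp g' by metis
  have elem: "elementary L (insert n J) h"
    using dual_elementary[OF L sp order_refl, of n h] g'[of n] by (simp add: g'_def)
  have sp': "spanning ?L J" using J(1) cobasis_def by blast
  have L': "closed_comb ?L" using L unfolding closed_comb_def by auto
  have c: "sign_cone W L (insert n J) D \<longleftrightarrow> wt W h * D n > 0 \<and> sign_cone W ?L J D" for D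
  proof -
    have "sign_cone W L (insert n J) D \<longleftrightarrow> (\<forall>j\<in>insert n J. wt W (g' j) * D j > 0)"
      by (rule sign_cone_dual[OF L sp g'])
    moreover have "sign_cone W ?L J D \<longleftrightarrow> (\<forall>j\<in>J. wt W (g j) * D j > 0)"
      by (rule sign_cone_dual[OF L' sp' g])
    moreover have "\<forall>j\<in>J. g' j = g j" using J(3) by (auto simp: g'_def)
    moreover have "g' n = h" by (simp add: g'_def)
    ultimately show ?thesis by simp
  qed
  show "\<exists>k::int. k \<noteq> 0 \<and> sgn k = k * 1 \<and> (\<forall>D. sign_cone W L (insert n J) D \<longleftrightarrow> k * D n > 0 \<and> sign_cone W ?L J D)
       \<or> (\<exists>g. elementary L (insert n J) g \<and> wt W g = 0)"
  proof (cases "wt W h = 0")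
    case True then show ?thesis using elem by blast
  next
    case False
    have "(wt W h * D n > 0) = (sgn (wt W h) * D n > 0)" for D :: "'a \<Rightarrow> int"
      using False by (auto simp: sgn_if zero_less_mult_iff)
    then have "sgn (wt W h) \<noteq> 0 \<and> sgn (sgn (wt W h)) = sgn (wt W h) * 1 \<and>
      (\<forall>D. sign_cone W L (insert n J) D \<longleftrightarrow> sgn (wt W h) * D n > 0 \<and> sign_cone W ?L J D)"
      using False c by (simp add: sgn_eq_0_iff)
    then show ?thesis by blast
  qed
qed

text \<open>
  Induction on the number of hyperplanes: the jump of \<open>H\<close> across the hyperplane of \<open>n \<in> T\<close> lives on the
  sublattice of vectors vanishing at \<open>n\<close>. Subtracting the cones \<open>insert n J'\<close>, for the cobases \<open>J'\<close>
  of that sublattice that occur in the jump, leaves a function that does not depend on the sign at \<open>n\<close>.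
\<close>

theorem sign_cone_decomposition:
  fixes L :: "('n::finite \<Rightarrow> int) set" and H :: "('n \<Rightarrow> int) \<Rightarrow> complex"
  assumes "closed_comb L" "spanning L T" "\<And>e. elementary L T e \<Longrightarrow> wt W e \<noteq> 0"
    and "\<And>d d'. d \<in> L \<Longrightarrow> d' \<in> L \<Longrightarrow> (\<And>j. j \<in> T \<Longrightarrow> d j \<noteq> 0 \<and> sgn (d j) = sgn (d' j)) \<Longrightarrow> H d = H d'"
    and "\<And>d e. d \<in> L \<Longrightarrow> (\<And>j. j \<in> T \<Longrightarrow> d j \<noteq> 0) \<Longrightarrow> H d \<noteq> 0 \<Longrightarrow> e \<in> L \<Longrightarrow>
            (\<And>j. j \<in> T \<Longrightarrow> d j * e j \<ge> 0) \<Longrightarrow> wt W e \<ge> 0"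
  shows "\<exists>c. \<forall>d\<in>L. (\<forall>j\<in>T. d j \<noteq> 0) \<longrightarrow>
           H d = (\<Sum>J | J \<subseteq> T \<and> cobasis L J. c J * of_bool (sign_cone W L J d))"
  using assms
proof (induction "card T" arbitrary: L T H rule: less_induct)
  case less
  note L = less.prems(1) and sp = less.prems(2) and gen = less.prems(3)
    and h1 = less.prems(4) and h2 = less.prems(5)
  have finT: "finite T" by simp
  show ?case
  proof (cases "\<exists>e\<in>L. \<forall>j\<in>T. e j \<noteq> 0")
    case False
    then show ?thesis by blast
  next
    case True
    then obtain e0 where e0: "e0 \<in> L" "\<And>j. j \<in> T \<Longrightarrow> e0 j \<noteq> 0" by blast
    show ?thesis
    proof (cases "T = {}")
      case True
      have zero: "d = (\<lambda>_. 0)" if "d \<in> L" for d using sp that True unfolding spanning_def by auto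
      have B: "{J. J \<subseteq> T \<and> cobasis L J} = {{}}" using True sp by (auto simp: cobasis_def)
      have c: "sign_cone W L {} d" for d by (simp add: sign_cone_def)
      have "\<forall>d\<in>L. H d = H (\<lambda>_. 0) * of_bool (sign_cone W L {} d)" using zero c by auto
      then show ?thesis unfolding B by (intro exI[of _ "\<lambda>_. H (\<lambda>_. 0)"]) simp
    next
      case False
      then obtain n where n: "n \<in> T" by blast
      define e where "e = (\<lambda>i. sgn (e0 n) * e0 i)"
      have eL: "e \<in> L" unfolding e_def by (rule closed_comb_scale[OF L e0(1)])
      have e_nz: "e j \<noteq> 0" if "j \<in> T" for j using e0(2)[OF that] e0(2)[OF n] by (simp add: e_def sgn_if)
      have en: "e n > 0" using e0(2)[OF n] by (simp add: e_def sgn_if)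
      define M where "M = 1 + (\<Sum>i\<in>UNIV. \<bar>e i\<bar>)"
      \<comment> \<open>\<open>up d\<close> and \<open>dn d\<close> are \<open>d\<close> pushed
        slightly to the positive and to the negative side of the hyperplane \<open>n\<close>. The
        scaling by \<open>M\<close> is harmless because \<open>H\<close> reads signs only.\<close>
      define up where "up d = (\<lambda>i. M * d i + 1 * e i)" for d
      define dn where "dn d = (\<lambda>i. M * d i + (-1) * e i)" for d
      have upL: "d \<in> L \<Longrightarrow> up d \<in> L" and dnL: "d \<in> L \<Longrightarrow> dn d \<in> L" for d
        unfolding up_def dn_def by (rule closed_comb2[OF L _ eL]; assumption)+
      have sgn_up: "d j \<noteq> 0 \<Longrightarrow> sgn (up d j) = sgn (d j)"
        and sgn_dn: "d j \<noteq> 0 \<Longrightarrow> sgn (dn d j) = sgn (d j)" for d j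
        using sgn_shift[of d j e] by (simp_all add: up_def dn_def M_def)
      define L' where "L' = {d\<in>L. d n = 0}"
      have L'L: "d \<in> L' \<Longrightarrow> d \<in> L" for d by (simp add: L'_def)
      \<comment> \<open>Coordinates that vanish identically on \<open>L'\<close> must be dropped;
        otherwise no point of \<open>L'\<close> would be generic and the induction hypothesis would
        say nothing.\<close>
      define T' where "T' = {j\<in>T - {n}. \<exists>d\<in>L'. d j \<noteq> 0}"
      have T'T: "T' \<subseteq> T" "n \<notin> T'" by (auto simp: T'_def)
      have vanish: "d j = 0" if "d \<in> L'" "j \<in> T" "j \<notin> T'" for d j
        using that by (cases "j = n") (auto simp: T'_def L'_def)
      have L'c: "closed_comb L'" using L unfolding closed_comb_def L'_def by auto
      have sp': "spanning L' T'"
        unfolding spanning_def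
      proof (intro ballI impI)
        fix d assume d: "d \<in> L'" "\<forall>j\<in>T'. d j = 0"
        then have "\<forall>j\<in>T. d j = 0" using vanish by blast
        with d(1) sp show "d = (\<lambda>_. 0)" by (auto simp: spanning_def L'_def)
      qed
      have elem': "elementary L T d" if d: "elementary L' T' d" for d
        unfolding elementary_def
      proof (intro conjI ballI impI)
        show "d \<in> L" "d \<noteq> (\<lambda>_. 0)" using d by (auto simp: elementary_def L'_def)
        fix x assume x: "x \<in> L" "\<forall>j\<in>T. d j = 0 \<longrightarrow> x j = 0"
        have "d n = 0" using d by (auto simp: elementary_def L'_def)
        then have "x \<in> L'" using x n by (auto simp: L'_def)
        moreover have "\<forall>j\<in>T'. d j = 0 \<longrightarrow> x j = 0" using x T'T by blast
        ultimately show "\<exists>a b. a \<noteq> 0 \<and> (\<forall>i. a * x i = b * d i)"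
          using d unfolding elementary_def by blast
      qed
      define Jmp where "Jmp d = H (up d) - H (dn d)" for d
      have signs: "up d j \<noteq> 0 \<and> dn d j \<noteq> 0"
        if "d \<in> L'" "\<And>j. j \<in> T' \<Longrightarrow> d j \<noteq> 0" "j \<in> T" for d j
      proof (cases "j \<in> T'")
        case True
        then have "d j \<noteq> 0" using that by blast
        then show ?thesis using sgn_up[of d j] sgn_dn[of d j] by (metis sgn_0_0)
      next
        case False
        then have "d j = 0" using vanish that by blast
        then show ?thesis using e_nz that by (simp add: up_def dn_def)
      qed
      have "\<exists>c. \<forall>d\<in>L'. (\<forall>j\<in>T'. d j \<noteq> 0) \<longrightarrow>
           Jmp d = (\<Sum>J | J \<subseteq> T' \<and> cobasis L' J. c J * of_bool (sign_cone W L' J d))"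
      proof (rule less.hyps)
        show "card T' < card T" using T'T n finT by (intro psubset_card_mono) auto
        show "closed_comb L'" "spanning L' T'" by fact+
        show "wt W d \<noteq> 0" if "elementary L' T' d" for d using gen elem' that by blast
        show "Jmp d = Jmp d'" if d: "d \<in> L'" "d' \<in> L'"
          and s: "\<And>j. j \<in> T' \<Longrightarrow> d j \<noteq> 0 \<and> sgn (d j) = sgn (d' j)" for d d'
        proof -
          have nz: "d' j \<noteq> 0" if "j \<in> T'" for j using s[OF that] by (metis sgn_0_0)
          have *: "sgn (up d j) = sgn (up d' j) \<and> sgn (dn d j) = sgn (dn d' j)" if j: "j \<in> T" for j
          proof (cases "j \<in> T'")
            case True
            then show ?thesis using s nz sgn_up sgn_dn by simp
          next
            case False
            then have "d j = 0" "d' j = 0" using vanish d j by blast+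
            then show ?thesis by (simp add: up_def dn_def)
          qed
          have "H (up d) = H (up d')" by (rule h1) (use * signs d s upL L'L in blast)+
          moreover have "H (dn d) = H (dn d')" by (rule h1) (use * signs d s dnL L'L in blast)+
          ultimately show ?thesis by (simp add: Jmp_def)
        qed
        show "wt W x \<ge> 0" if d: "d \<in> L'" "\<And>j. j \<in> T' \<Longrightarrow> d j \<noteq> 0" "Jmp d \<noteq> 0"
          and x: "x \<in> L'" "\<And>j. j \<in> T' \<Longrightarrow> d j * x j \<ge> 0" for d x
        proof -
          have *: "up d j * x j \<ge> 0 \<and> dn d j * x j \<ge> 0" if j: "j \<in> T" for j
          proof (cases "j \<in> T'")
            case True
            have "sgn (up d j) = sgn (d j)" "sgn (dn d j) = sgn (d j)"
              using d(2)[OF True] sgn_up sgn_dn by auto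
            then show ?thesis using x(2)[OF True] d(2)[OF True]
              by (auto simp: sgn_if zero_le_mult_iff split: if_splits)
          next
            case False
            have "x j = 0" by (rule vanish[OF x(1) j False])
            then show ?thesis by simp
          qed
          have "H (up d) \<noteq> 0 \<or> H (dn d) \<noteq> 0" using d(3) by (auto simp: Jmp_def)
          then show ?thesis
          proof
            assume H: "H (up d) \<noteq> 0"
            show ?thesis
              by (rule h2[OF upL[OF L'L[OF d(1)]] _ H L'L[OF x(1)]]) (use signs[OF d(1,2)] * in blast)+
          next
            assume H: "H (dn d) \<noteq> 0"
            show ?thesis
              by (rule h2[OF dnL[OF L'L[OF d(1)]] _ H L'L[OF x(1)]]) (use signs[OF d(1,2)] * in blast)+
          qed
        qed
      qed
      then obtain c' where c': "\<And>d. d \<in> L' \<Longrightarrow> (\<And>j. j \<in> T' \<Longrightarrow> d j \<noteq> 0) \<Longrightarrow>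
           Jmp d = (\<Sum>J | J \<subseteq> T' \<and> cobasis L' J. c' J * of_bool (sign_cone W L' J d))" by blast
      define B' where "B' = {J. J \<subseteq> T' \<and> cobasis L' J}"
      have finB': "finite B'" unfolding B'_def by simp
      have "\<forall>J. \<exists>k::int. J \<in> B' \<longrightarrow> cobasis L (insert n J) \<and> k \<noteq> 0 \<and> sgn k = k \<and>
          (\<forall>D. sign_cone W L (insert n J) D \<longleftrightarrow> k * D n > 0 \<and> sign_cone W L' J D)"
      proof
        fix J
        show "\<exists>k::int. J \<in> B' \<longrightarrow> cobasis L (insert n J) \<and> k \<noteq> 0 \<and> sgn k = k \<and>
          (\<forall>D. sign_cone W L (insert n J) D \<longleftrightarrow> k * D n > 0 \<and> sign_cone W L' J D)"
        proof (cases "J \<in> B'")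
          case True
          then have J: "cobasis {d\<in>L. d n = 0} J" "finite J" "n \<notin> J" "J \<subseteq> T"
            using T'T by (auto simp: B'_def L'_def)
          have no: "\<not> (\<exists>g. elementary L (insert n J) g \<and> wt W g = 0)"
          proof
            assume "\<exists>g. elementary L (insert n J) g \<and> wt W g = 0"
            then obtain g where g: "elementary L (insert n J) g" "wt W g = 0" by blast
            have "elementary L T g" using g(1) n J(4) unfolding elementary_def by blast
            with gen g show False by blast
          qed
          from cobasis_insert(1)[OF L J(1-3) eL en] cobasis_insert(2)[OF L J(1-3) eL en, where W = W] no
          show ?thesis unfolding L'_def by (metis (no_types, lifting) mult.right_neutral)
        qed auto
      qed
      then obtain \<kappa> where \<kappa>: "\<And>J. J \<in> B' \<Longrightarrow> cobasis L (insert n J)"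
          "\<And>J. J \<in> B' \<Longrightarrow> \<kappa> J \<noteq> (0::int)" "\<And>J. J \<in> B' \<Longrightarrow> sgn (\<kappa> J) = \<kappa> J"
          "\<And>J D. J \<in> B' \<Longrightarrow> sign_cone W L (insert n J) D \<longleftrightarrow> \<kappa> J * D n > 0 \<and> sign_cone W L' J D"
        by (metis (no_types, lifting))
      \<comment> \<open>The cone of \<open>insert n J\<close> meets one side of the hyperplane only,
        the side \<kappa> J, where it agrees with the cone of \<open>J\<close>. With the coefficient
        \<open>c' J * \<kappa> J\<close> its jump is therefore the term of \<open>J\<close> in
        \<open>Jmp\<close>, and the jump of \<open>H2\<close> is 0.\<close>
      define H2 where "H2 D = H D - (\<Sum>J\<in>B'. c' J * of_int (\<kappa> J) * of_bool (sign_cone W L (insert n J) D))" for D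
      have B'T: "J \<in> B' \<Longrightarrow> insert n J \<subseteq> T" for J using n T'T by (auto simp: B'_def)
      have H2_1: "H2 d = H2 d'" if d: "d \<in> L" "d' \<in> L"
         and s: "\<And>j. j \<in> T \<Longrightarrow> d j \<noteq> 0 \<and> sgn (d j) = sgn (d' j)" for d d'
      proof -
        have "H d = H d'" using h1 d s by blast
        moreover have "sign_cone W L (insert n J) d = sign_cone W L (insert n J) d'" if "J \<in> B'" for J
          by (rule sign_cone_sgn_cong) (use B'T[OF that] s in blast)
        ultimately show ?thesis by (simp add: H2_def)
      qed
      have H2_2: "wt W x \<ge> 0" if d: "d \<in> L" "\<And>j. j \<in> T \<Longrightarrow> d j \<noteq> 0" "H2 d \<noteq> 0"
         and x: "x \<in> L" "\<And>j. j \<in> T \<Longrightarrow> d j * x j \<ge> 0" for d x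
      proof (cases "H d = 0")
        case False
        then show ?thesis using h2 d x by blast
      next
        case True
        then have "(\<Sum>J\<in>B'. c' J * of_int (\<kappa> J) * of_bool (sign_cone W L (insert n J) d)) \<noteq> 0"
          using d(3) by (simp add: H2_def)
        then obtain J where J: "J \<in> B'" "c' J * of_int (\<kappa> J) * of_bool (sign_cone W L (insert n J) d) \<noteq> 0"
          by (meson sum.neutral)
        then have cn: "sign_cone W L (insert n J) d" by (auto split: if_splits)
        show ?thesis
          by (rule sign_cone_weight_nonneg[OF L \<kappa>(1)[OF J(1)] _ cn x(1)]) (use x(2) B'T[OF J(1)] in auto)
      qed
      have nojump: "H2 (up d) = H2 (dn d)" if d: "d \<in> L'" "\<And>j. j \<in> T' \<Longrightarrow> d j \<noteq> 0" for d
      proof -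
        have *: "of_int (\<kappa> J) * of_bool (sign_cone W L (insert n J) (up d))
                - of_int (\<kappa> J) * of_bool (sign_cone W L (insert n J) (dn d)) = (of_bool (sign_cone W L' J d) :: complex)"
          if J: "J \<in> B'" for J
        proof -
          have JT: "J \<subseteq> T'" using J by (auto simp: B'_def)
          have "sign_cone W L' J (up d) = sign_cone W L' J d" "sign_cone W L' J (dn d) = sign_cone W L' J d"
            by (rule sign_cone_sgn_cong; use JT d sgn_up sgn_dn in blast)+
          moreover have "up d n = e n" "dn d n = - e n" using d by (auto simp: L'_def up_def dn_def)
          moreover have "\<kappa> J = 1 \<or> \<kappa> J = -1" using \<kappa>(2,3)[OF J] by (auto simp: sgn_if split: if_splits)
          ultimately show ?thesis unfolding \<kappa>(4)[OF J] using en by auto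
        qed
        have "H2 (up d) - H2 (dn d) = Jmp d - (\<Sum>J\<in>B'. c' J * (of_int (\<kappa> J) * of_bool (sign_cone W L (insert n J) (up d))
                - of_int (\<kappa> J) * of_bool (sign_cone W L (insert n J) (dn d))))"
          by (simp add: H2_def Jmp_def algebra_simps sum_subtractf)
        also have "\<dots> = Jmp d - (\<Sum>J\<in>B'. c' J * of_bool (sign_cone W L' J d))"
          using * by simp
        also have "\<dots> = 0" using c'[OF d] by (simp add: B'_def)
        finally show ?thesis by simp
      qed
      define T'' where "T'' = T - {n}"
      have up_gen: "up d j \<noteq> 0" if "d \<in> L" "\<And>j. j \<in> T'' \<Longrightarrow> d j \<noteq> 0" "j \<in> T" for d j
      proof (cases "d j = 0")
        case True
        then have "j = n" using that by (auto simp: T''_def)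
        then show ?thesis using True en by (simp add: up_def)
      next
        case False
        then show ?thesis using sgn_up[of d j] by (metis sgn_0_0)
      qed
      have flip_aux: "H2 D = H2 D'" if D: "D \<in> L" "D' \<in> L" "\<And>j. j \<in> T \<Longrightarrow> D j \<noteq> 0"
          "\<And>j. j \<in> T'' \<Longrightarrow> sgn (D j) = sgn (D' j)" "D n > 0" "D' n < 0" for D D'
      proof -
        \<comment> \<open>A combination of \<open>D\<close> and \<open>D'\<close> with positive
          coefficients that lands on the hyperplane \<open>n\<close>. It keeps the common signs on
          \<open>T''\<close>, so \<open>D\<close> and \<open>D'\<close> are its two perturbations up
          to signs, and the vanishing jump identifies their values.\<close>
        define d where "d = (\<lambda>i. (- D' n) * D i + D n * D' i)"
        have dL: "d \<in> L'" using closed_comb2[OF L D(1,2), of "- D' n" "D n"] by (simp add: d_def L'_def)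
        have ds: "sgn (d j) = sgn (D j)" "d j \<noteq> 0" if "j \<in> T''" for j
        proof -
          have nz: "D j \<noteq> 0" and eq: "sgn (D j) = sgn (D' j)" using D that by (auto simp: T''_def)
          consider "D j > 0" "D' j > 0" | "D j < 0" "D' j < 0"
            using nz eq by (auto simp: sgn_if split: if_splits)
          then have "sgn (d j) = sgn (D j) \<and> d j \<noteq> 0"
          proof cases
            case 1
            then have "(- D' n) * D j > 0" "D n * D' j > 0" using D(5,6) by (auto intro: mult_pos_pos mult_neg_pos simp: mult_less_0_iff)
            then have "d j > 0" unfolding d_def by linarith
            then show ?thesis using 1 by simp
          next
            case 2
            then have "(- D' n) * D j < 0" "D n * D' j < 0" using D(5,6) by (auto simp: mult_less_0_iff zero_less_mult_iff)
            then have "d j < 0" unfolding d_def by linarith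
            then show ?thesis using 2 by simp
          qed
          then show "sgn (d j) = sgn (D j)" "d j \<noteq> 0" by auto
        qed
        have gen': "j \<in> T' \<Longrightarrow> d j \<noteq> 0" for j using ds(2) by (auto simp: T'_def T''_def)
        have "H2 (up d) = H2 D"
        proof (rule H2_1[OF upL[OF L'L[OF dL]] D(1)])
          fix j assume j: "j \<in> T"
          show "up d j \<noteq> 0 \<and> sgn (up d j) = sgn (D j)"
          proof (cases "j = n")
            case True
            then show ?thesis using dL en D(5) by (simp add: L'_def up_def)
          next
            case False
            then have jT: "j \<in> T''" using j by (simp add: T''_def)
            then show ?thesis using sgn_up[of d j] ds[OF jT] by (metis sgn_0_0)
          qed
        qed
        moreover have "H2 (dn d) = H2 D'"
        proof (rule H2_1[OF dnL[OF L'L[OF dL]] D(2)])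
          fix j assume j: "j \<in> T"
          show "dn d j \<noteq> 0 \<and> sgn (dn d j) = sgn (D' j)"
          proof (cases "j = n")
            case True
            then show ?thesis using dL en D(6) by (simp add: L'_def dn_def)
          next
            case False
            then have jT: "j \<in> T''" using j by (simp add: T''_def)
            then show ?thesis using sgn_dn[of d j] ds[OF jT] D(4)[OF jT] by (metis sgn_0_0)
          qed
        qed
        ultimately show ?thesis using nojump[OF dL gen'] by simp
      qed
      have flip: "H2 D = H2 D'" if D: "D \<in> L" "D' \<in> L" "\<And>j. j \<in> T \<Longrightarrow> D j \<noteq> 0" "\<And>j. j \<in> T \<Longrightarrow> D' j \<noteq> 0"
          "\<And>j. j \<in> T'' \<Longrightarrow> sgn (D j) = sgn (D' j)" for D D'
      proof -
        have "D n \<noteq> 0" "D' n \<noteq> 0" using D n by auto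
        then consider "D n > 0" "D' n < 0" | "D n < 0" "D' n > 0" | "sgn (D n) = sgn (D' n)"
          by (auto simp: sgn_if) (metis linorder_neqE)+
        then show ?thesis
        proof cases
          case 1
          show ?thesis by (rule flip_aux[OF D(1,2,3,5) 1])
        next
          case 2
          show ?thesis by (rule flip_aux[OF D(2,1,4) _ 2(2,1), symmetric]) (use D(5) in auto)
        next
          case 3
          show ?thesis by (rule H2_1[OF D(1,2)]) (use D 3 in \<open>auto simp: T''_def\<close>)
        qed
      qed
      have H2_3: "wt W x \<ge> 0" if D: "D \<in> L" "\<And>j. j \<in> T \<Longrightarrow> D j \<noteq> 0" "H2 D \<noteq> 0"
         and x: "x \<in> L" "\<And>j. j \<in> T'' \<Longrightarrow> D j * x j \<ge> 0" for D x
      proof (cases "D n * x n \<ge> 0")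
        case True
        show ?thesis by (rule H2_2[OF D x(1)]) (use x(2) True in \<open>auto simp: T''_def\<close>)
      next
        case False
        then have neg: "D n * x n < 0" by simp
        \<comment> \<open>The factor 2 makes \<open>x\<close> outweigh \<open>D\<close> at
          \<open>n\<close>, so \<open>D'\<close> is on the side of \<open>x\<close> there, while on
          \<open>T''\<close> it keeps the signs of \<open>D\<close>. Since \<open>H2\<close> ignores
          the side, the positivity for \<open>T\<close> may be applied at \<open>D'\<close>.\<close>
        define D' where "D' = (\<lambda>i. \<bar>x n\<bar> * D i + 2 * \<bar>D n\<bar> * x i)"
        have D'L: "D' \<in> L" unfolding D'_def by (rule closed_comb2[OF L D(1) x(1)])
        have xn: "x n \<noteq> 0" "D n \<noteq> 0" using neg by auto
        have D'n: "D' n * x n > 0"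
        proof -
          have "D' n * x n = \<bar>x n\<bar> * (D n * x n) + 2 * \<bar>D n\<bar> * (x n * x n)" by (simp add: D'_def algebra_simps)
          also have "\<bar>x n\<bar> * (D n * x n) = - (\<bar>D n\<bar> * (x n * x n))"
            using neg by (auto simp: abs_if mult_less_0_iff algebra_simps)
          moreover have "x n * x n > 0" using xn by (simp add: less_le)
          then have "\<bar>D n\<bar> * (x n * x n) > 0" using xn by simp
          ultimately show ?thesis by linarith
        qed
        have s: "sgn (D j) = sgn (D' j)" if "j \<in> T''" for j
        proof -
          have nz: "D j \<noteq> 0" and w: "D j * x j \<ge> 0" using D x that by (auto simp: T''_def)
          consider "D j > 0" "x j \<ge> 0" | "D j < 0" "x j \<le> 0" using nz w by (auto simp: zero_le_mult_iff)
          then show ?thesis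
          proof cases
            case 1
            then have "\<bar>x n\<bar> * D j > 0" "2 * \<bar>D n\<bar> * x j \<ge> 0" using xn by auto
            then have "D' j > 0" unfolding D'_def by linarith
            then show ?thesis using 1 by simp
          next
            case 2
            then have "\<bar>x n\<bar> * D j < 0" "2 * \<bar>D n\<bar> * x j \<le> 0" using xn by (auto simp: mult_less_0_iff mult_le_0_iff)
            then have "D' j < 0" unfolding D'_def by linarith
            then show ?thesis using 2 by simp
          qed
        qed
        have D'nz: "D' j \<noteq> 0" if "j \<in> T" for j
        proof (cases "j = n")
          case True
          then show ?thesis using D'n by auto
        next
          case False
          then show ?thesis using s[of j] D(2)[OF that] that by (auto simp: T''_def sgn_0_0)
        qed
        have "H2 D' = H2 D" by (rule flip[OF D'L D(1) D'nz D(2)]) (use s in auto)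
        then have nz: "H2 D' \<noteq> 0" using D(3) by simp
        show ?thesis
        proof (rule H2_2[OF D'L D'nz nz x(1)])
          fix j assume j: "j \<in> T"
          show "D' j * x j \<ge> 0"
          proof (cases "j = n")
            case True then show ?thesis using D'n by simp
          next
            case False
            then have jT: "j \<in> T''" using j by (simp add: T''_def)
            show ?thesis using s[OF jT] x(2)[OF jT] D(2)[OF j]
              by (auto simp: sgn_if zero_le_mult_iff split: if_splits)
          qed
        qed
      qed
      \<comment> \<open>The induction hypothesis for \<open>T''\<close> also ranges over points with
        \<open>d n = 0\<close>, where \<open>H2\<close> is uncontrolled; \<open>up\<close> moves
        them off the hyperplane.\<close>
      define H3 where "H3 d = H2 (up d)" for d
      have H3_H2: "H3 d = H2 d" if "d \<in> L" "\<And>j. j \<in> T \<Longrightarrow> d j \<noteq> 0" for d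
        unfolding H3_def
        by (rule flip[OF upL that(1)]) (use that up_gen sgn_up in \<open>auto simp: T''_def\<close>)
      have "\<exists>c. \<forall>d\<in>L. (\<forall>j\<in>T. d j \<noteq> 0) \<longrightarrow>
           H2 d = (\<Sum>J | J \<subseteq> T'' \<and> cobasis L J. c J * of_bool (sign_cone W L J d))"
      proof (cases "spanning L T''")
        case True
        have "\<exists>c. \<forall>d\<in>L. (\<forall>j\<in>T''. d j \<noteq> 0) \<longrightarrow>
           H3 d = (\<Sum>J | J \<subseteq> T'' \<and> cobasis L J. c J * of_bool (sign_cone W L J d))"
        proof (rule less.hyps)
          show "card T'' < card T" unfolding T''_def using n finT by (intro psubset_card_mono) auto
          show "closed_comb L" "spanning L T''" by fact+
          show "wt W d \<noteq> 0" if "elementary L T'' d" for d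
          proof (rule gen)
            show "elementary L T d" using that unfolding elementary_def T''_def by blast
          qed
          show "H3 d = H3 d'" if d: "d \<in> L" "d' \<in> L"
             and s: "\<And>j. j \<in> T'' \<Longrightarrow> d j \<noteq> 0 \<and> sgn (d j) = sgn (d' j)" for d d'
          proof -
            have nz: "d' j \<noteq> 0" if "j \<in> T''" for j using s[OF that] by (metis sgn_0_0)
            show ?thesis unfolding H3_def
            proof (rule flip[OF upL[OF d(1)] upL[OF d(2)]])
              show "up d j \<noteq> 0" if "j \<in> T" for j using up_gen[OF d(1) _ that] s by blast
              show "up d' j \<noteq> 0" if "j \<in> T" for j using up_gen[OF d(2) _ that] nz by blast
              show "sgn (up d j) = sgn (up d' j)" if "j \<in> T''" for j
                using s[OF that] nz[OF that] sgn_up by simp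
            qed
          qed
          show "wt W x \<ge> 0" if d: "d \<in> L" "\<And>j. j \<in> T'' \<Longrightarrow> d j \<noteq> 0" "H3 d \<noteq> 0"
             and x: "x \<in> L" "\<And>j. j \<in> T'' \<Longrightarrow> d j * x j \<ge> 0" for d x
          proof (rule H2_3[OF upL[OF d(1)] _ _ x(1)])
            show "up d j \<noteq> 0" if "j \<in> T" for j using up_gen[OF d(1) _ that] d(2) by blast
            show "H2 (up d) \<noteq> 0" using d(3) by (simp add: H3_def)
            show "up d j * x j \<ge> 0" if "j \<in> T''" for j
              using sgn_up[of d j] x(2)[OF that] d(2)[OF that]
              by (auto simp: sgn_if zero_le_mult_iff split: if_splits)
          qed
        qed
        then obtain c where c: "\<And>d. d \<in> L \<Longrightarrow> (\<And>j. j \<in> T'' \<Longrightarrow> d j \<noteq> 0) \<Longrightarrow>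
           H3 d = (\<Sum>J | J \<subseteq> T'' \<and> cobasis L J. c J * of_bool (sign_cone W L J d))" by blast
        have "H2 d = (\<Sum>J | J \<subseteq> T'' \<and> cobasis L J. c J * of_bool (sign_cone W L J d))"
          if d: "d \<in> L" "\<forall>j\<in>T. d j \<noteq> 0" for d
        proof -
          have "H3 d = H2 d" by (rule H3_H2) (use d in auto)
          moreover have "H3 d = (\<Sum>J | J \<subseteq> T'' \<and> cobasis L J. c J * of_bool (sign_cone W L J d))"
            by (rule c) (use d in \<open>auto simp: T''_def\<close>)
          ultimately show ?thesis by simp
        qed
        then show ?thesis by blast
      next
        case False
        then obtain x where x: "x \<in> L" "\<forall>j\<in>T''. x j = 0" "x \<noteq> (\<lambda>_. 0)" unfolding spanning_def by blast
        have "elementary L T x"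
          unfolding elementary_def
        proof (intro conjI ballI impI)
          fix x' assume x': "x' \<in> L" "\<forall>j\<in>T. x j = 0 \<longrightarrow> x' j = 0"
          have xn: "x n \<noteq> 0"
          proof
            assume "x n = 0"
            then have "\<forall>j\<in>T. x j = 0" using x by (auto simp: T''_def)
            then show False using sp x unfolding spanning_def by blast
          qed
          have "x n * x' i = x' n * x i" for i
          proof (rule spanning_eq[OF L sp x'(1) x(1)])
            fix j assume "j \<in> T"
            then show "x n * x' j = x' n * x j" using x x' by (cases "j = n") (auto simp: T''_def)
          qed
          then show "\<exists>a b. a \<noteq> 0 \<and> (\<forall>i. a * x' i = b * x i)" using xn by metis
        qed (use x in auto)
        then have wx: "wt W x \<noteq> 0" by (rule gen)
        \<comment> \<open>Both \<open>x\<close> and its negative vanish on \<open>T''\<close>, so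
          positivity for \<open>T''\<close> applies to both and contradicts the nonzero weight of
          \<open>x\<close>.\<close>
        have "H2 d = 0" if d: "d \<in> L" "\<forall>j\<in>T. d j \<noteq> 0" for d
        proof (rule ccontr)
          assume nz: "H2 d \<noteq> 0"
          have "wt W x \<ge> 0" by (rule H2_3[OF d(1) _ nz x(1)]) (use d x in auto)
          moreover have "wt W (\<lambda>i. -1 * x i) \<ge> 0"
            by (rule H2_3[OF d(1) _ nz closed_comb_scale[OF L x(1)]]) (use d x in auto)
          ultimately show False using wx unfolding wt_scale by simp
        qed
        then show ?thesis by (intro exI[of _ "\<lambda>_. 0"]) auto
      qed
      then obtain c2 where c2: "\<And>d. d \<in> L \<Longrightarrow> (\<And>j. j \<in> T \<Longrightarrow> d j \<noteq> 0) \<Longrightarrow>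
           H2 d = (\<Sum>J | J \<subseteq> T'' \<and> cobasis L J. c2 J * of_bool (sign_cone W L J d))" by blast
      define B2 where "B2 = {J. J \<subseteq> T'' \<and> cobasis L J}"
      define c where "c J = (if J \<in> B2 then c2 J else 0) +
          (if n \<in> J \<and> J - {n} \<in> B' then c' (J - {n}) * of_int (\<kappa> (J - {n})) else 0)" for J
      define B where "B = {J. J \<subseteq> T \<and> cobasis L J}"
      have finB: "finite B" by (simp add: B_def)
      have sub: "B2 \<subseteq> B" "insert n ` B' \<subseteq> B"
        using \<kappa>(1) B'T by (auto simp: B2_def B_def T''_def)
      have nB': "n \<notin> J" if "J \<in> B'" for J using that T'T by (auto simp: B'_def)
      have inj: "inj_on (insert n) B'"
        by (rule inj_onI) (use nB' in \<open>metis Diff_insert_absorb\<close>)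
      have "H d = (\<Sum>J\<in>B. c J * of_bool (sign_cone W L J d))" if d: "d \<in> L" "\<forall>j\<in>T. d j \<noteq> 0" for d
      proof -
        have "H d = H2 d + (\<Sum>J\<in>B'. c' J * of_int (\<kappa> J) * of_bool (sign_cone W L (insert n J) d))"
          by (simp add: H2_def)
        also have "H2 d = (\<Sum>J\<in>B2. c2 J * of_bool (sign_cone W L J d))"
          using c2 d by (simp add: B2_def)
        also have "\<dots> = (\<Sum>J\<in>B. (if J \<in> B2 then c2 J else 0) * of_bool (sign_cone W L J d))"
          by (rule sum.mono_neutral_cong_left) (use finB sub in auto)
        also have "(\<Sum>J\<in>B'. c' J * of_int (\<kappa> J) * of_bool (sign_cone W L (insert n J) d))
           = (\<Sum>K\<in>insert n ` B'. c' (K - {n}) * of_int (\<kappa> (K - {n})) * of_bool (sign_cone W L K d))"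
          using nB' by (simp add: sum.reindex[OF inj])
        also have "\<dots> = (\<Sum>K\<in>B. (if n \<in> K \<and> K - {n} \<in> B' then c' (K - {n}) * of_int (\<kappa> (K - {n})) else 0) * of_bool (sign_cone W L K d))"
        proof (rule sum.mono_neutral_cong_left)
          show "\<forall>K\<in>B - insert n ` B'. (if n \<in> K \<and> K - {n} \<in> B' then c' (K - {n}) * of_int (\<kappa> (K - {n})) else 0) * of_bool (sign_cone W L K d) = 0"
          proof
            fix K assume K: "K \<in> B - insert n ` B'"
            have "\<not> (n \<in> K \<and> K - {n} \<in> B')" using K by (metis Diff_iff image_eqI insert_Diff)
            then show "(if n \<in> K \<and> K - {n} \<in> B' then c' (K - {n}) * of_int (\<kappa> (K - {n})) else 0) * of_bool (sign_cone W L K d) = 0"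
              by (simp only: if_False mult_zero_left)
          qed
        qed (use finB sub nB' in auto)
        finally show ?thesis by (simp add: c_def sum.distrib algebra_simps)
      qed
      then show ?thesis unfolding B_def by blast
    qed
  qed
qed

section \<open>Formal Laurent series of rational functions\<close>

type_synonym 'v series = "('v \<Rightarrow> int) \<Rightarrow> complex"

definition shift :: "'v \<Rightarrow> 'v series \<Rightarrow> 'v series" where
  "shift v c = (\<lambda>m. c (m(v := m v - 1)))"

definition sder :: "'v \<Rightarrow> 'v series \<Rightarrow> 'v series" where
  "sder v c = (\<lambda>m. of_int (m v + 1) * c (m(v := m v + 1)))"

definition unit_series :: "'v series" where
  "unit_series = (\<lambda>m. of_bool (m = (\<lambda>_. 0)))"

text \<open>\<open>pol p P\<close>: the polynomial function \<open>p\<close> acts on Laurent series by multiplication as \<open>P\<close>.\<close>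

inductive pol :: "(('v \<Rightarrow> complex) \<Rightarrow> complex) \<Rightarrow> ('v series \<Rightarrow> 'v series) \<Rightarrow> bool" where
  pol_const: "pol (\<lambda>z. a) (\<lambda>c m. a * c m)"
| pol_var: "pol (\<lambda>z. z v) (shift v)"
| pol_add: "pol p P \<Longrightarrow> pol q Q \<Longrightarrow> pol (\<lambda>z. p z + q z) (\<lambda>c m. P c m + Q c m)"
| pol_mult: "pol p P \<Longrightarrow> pol q Q \<Longrightarrow> pol (\<lambda>z. p z * q z) (\<lambda>c. P (Q c))"

lemma pol_linear: "pol p P \<Longrightarrow> P (\<lambda>m. a * c m + b * d m) = (\<lambda>m. a * P c m + b * P d m)"
proof (induction arbitrary: c d rule: pol.induct)
  case (pol_mult p P q Q)
  show ?case by (simp only: pol_mult.IH)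
qed (auto simp: shift_def algebra_simps)

lemma pol_zero: "pol p P \<Longrightarrow> P (\<lambda>_. 0) = (\<lambda>_. 0)"
  using pol_linear[of p P 0 "\<lambda>_. 0" 0 "\<lambda>_. 0"] by simp

lemma pol_add_series: "pol p P \<Longrightarrow> P (\<lambda>m. c m + d m) = (\<lambda>m. P c m + P d m)"
  using pol_linear[of p P 1 c 1 d] by simp

lemma pol_diff_series: "pol p P \<Longrightarrow> P (\<lambda>m. c m - d m) = (\<lambda>m. P c m - P d m)"
  using pol_linear[of p P 1 c "-1" d] by simp

lemma pol_scale_series: "pol p P \<Longrightarrow> P (\<lambda>m. a * c m) = (\<lambda>m. a * P c m)"
  using pol_linear[of p P a c 0 c] by simp

lemma pol_commute_shift: "pol p P \<Longrightarrow> P (shift v c) = shift v (P c)"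
proof (induction arbitrary: c rule: pol.induct)
  case (pol_var u)
  show ?case by (cases "u = v") (auto simp: shift_def fun_upd_twist)
qed (auto simp: shift_def)

lemma pol_commute: "pol p P \<Longrightarrow> pol q Q \<Longrightarrow> P (Q c) = Q (P c)"
proof (induction arbitrary: c rule: pol.induct)
  case (pol_const a)
  then show ?case by (simp add: pol_scale_series)
next
  case (pol_var v)
  then show ?case by (simp add: pol_commute_shift)
next
  case (pol_add p P q' Q')
  then show ?case by (simp add: pol_add_series)
qed auto

lemma pol_diff: "pol p P \<Longrightarrow> pol q Q \<Longrightarrow> pol (\<lambda>z. p z - q z) (\<lambda>c m. P c m - Q c m)"
  using pol_add[OF _ pol_mult[OF pol_const[of "-1"]], of p P q Q] by simp

lemma pol_0: "pol (\<lambda>z. 0) (\<lambda>c m. 0)"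
  using pol_const[of 0] by simp

lemma pol_1: "pol (\<lambda>z. 1) (\<lambda>c. c)"
  using pol_const[of 1] by simp

text \<open>The Leibniz rule: the commutator of the formal derivative with multiplication by
  \<open>p\<close> is multiplication by the derivative of \<open>p\<close>. Function and operator
  are produced by one induction, so that they are guaranteed to match.\<close>

lemma pol_deriv:
  assumes "pol p P"
  shows "\<exists>p' P'. pol p' P' \<and> (\<forall>z. ((\<lambda>t. p (z(v := t))) has_field_derivative p' z) (at (z v))) \<and>
           (\<forall>c. sder v (P c) = (\<lambda>m. P' c m + P (sder v c) m))"
  using assms
proof (induction rule: pol.induct)
  case (pol_const a)
  show ?case
    by (rule exI[of _ "\<lambda>z. 0"], rule exI[of _ "\<lambda>c m. 0"])
       (auto intro!: pol_0 derivative_eq_intros simp: sder_def)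
next
  case (pol_var u)
  show ?case
  proof (cases "u = v")
    case True
    show ?thesis
      by (rule exI[of _ "\<lambda>z. 1"], rule exI[of _ "\<lambda>c. c"])
         (use True in \<open>auto intro!: pol_1 derivative_eq_intros simp: sder_def shift_def algebra_simps\<close>)
  next
    case False
    show ?thesis
      by (rule exI[of _ "\<lambda>z. 0"], rule exI[of _ "\<lambda>c m. 0"])
         (use False in \<open>auto intro!: pol_0 derivative_eq_intros simp: sder_def shift_def fun_upd_twist\<close>)
  qed
next
  case (pol_add p P q Q)
  from pol_add.IH(1) obtain p' P' where
    "pol p' P'" "\<forall>z. ((\<lambda>t. p (z(v := t))) has_field_derivative p' z) (at (z v))"
    "\<forall>c. sder v (P c) = (\<lambda>m. P' c m + P (sder v c) m)" by (elim exE conjE)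
  moreover from pol_add.IH(2) obtain q' Q' where
    "pol q' Q'" "\<forall>z. ((\<lambda>t. q (z(v := t))) has_field_derivative q' z) (at (z v))"
    "\<forall>c. sder v (Q c) = (\<lambda>m. Q' c m + Q (sder v c) m)" by (elim exE conjE)
  ultimately have h: "pol p' P'" "\<forall>z. ((\<lambda>t. p (z(v := t))) has_field_derivative p' z) (at (z v))"
    "\<forall>c. sder v (P c) = (\<lambda>m. P' c m + P (sder v c) m)"
    "pol q' Q'" "\<forall>z. ((\<lambda>t. q (z(v := t))) has_field_derivative q' z) (at (z v))"
    "\<forall>c. sder v (Q c) = (\<lambda>m. Q' c m + Q (sder v c) m)" by simp_all
  have s: "sder v (\<lambda>m. x m + y m) = (\<lambda>m. sder v x m + sder v y m)" for x y
    by (auto simp: sder_def algebra_simps)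
  have "pol (\<lambda>z. p' z + q' z) (\<lambda>c m. P' c m + Q' c m)" by (intro pol.pol_add h)
  moreover have "((\<lambda>t. p (z(v := t)) + q (z(v := t))) has_field_derivative p' z + q' z) (at (z v))" for z
    by (intro DERIV_add) (use h in blast)+
  moreover have "sder v (\<lambda>m. P c m + Q c m) = (\<lambda>m. (P' c m + Q' c m) + (P (sder v c) m + Q (sder v c) m))" for c
    using h(3,6) by (simp add: s algebra_simps)
  ultimately show ?case by blast
next
  case (pol_mult p P q Q)
  from pol_mult.IH(1) obtain p' P' where
    "pol p' P'" "\<forall>z. ((\<lambda>t. p (z(v := t))) has_field_derivative p' z) (at (z v))"
    "\<forall>c. sder v (P c) = (\<lambda>m. P' c m + P (sder v c) m)" by (elim exE conjE)
  moreover from pol_mult.IH(2) obtain q' Q' where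
    "pol q' Q'" "\<forall>z. ((\<lambda>t. q (z(v := t))) has_field_derivative q' z) (at (z v))"
    "\<forall>c. sder v (Q c) = (\<lambda>m. Q' c m + Q (sder v c) m)" by (elim exE conjE)
  ultimately have h: "pol p' P'" "\<forall>z. ((\<lambda>t. p (z(v := t))) has_field_derivative p' z) (at (z v))"
    "\<forall>c. sder v (P c) = (\<lambda>m. P' c m + P (sder v c) m)"
    "pol q' Q'" "\<forall>z. ((\<lambda>t. q (z(v := t))) has_field_derivative q' z) (at (z v))"
    "\<forall>c. sder v (Q c) = (\<lambda>m. Q' c m + Q (sder v c) m)" by simp_all
  have "pol (\<lambda>z. p' z * q z + p z * q' z) (\<lambda>c m. P' (Q c) m + P (Q' c) m)"
    by (intro pol.pol_add pol.pol_mult h pol_mult.hyps)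
  moreover have "((\<lambda>t. p (z(v := t)) * q (z(v := t))) has_field_derivative p' z * q z + p z * q' z) (at (z v))" for z
    using h(2,5) by (auto intro!: derivative_eq_intros)
  moreover have "sder v (P (Q c)) = (\<lambda>m. P' (Q c) m + P (Q' c) m + P (Q (sder v c)) m)" for c
    using h(3,6) pol_add_series[OF pol_mult.hyps(1)] by (simp add: algebra_simps)
  ultimately show ?case by blast
qed

text \<open>One list of monomials, exponents \<open>K\<close> and coefficients \<open>a\<close>
  (zero allowed), that describes the operator and the function at the same time.\<close>

definition nform :: "('v::finite series \<Rightarrow> 'v series) \<Rightarrow> (('v \<Rightarrow> complex) \<Rightarrow> complex) \<Rightarrow> ('v \<Rightarrow> int) set \<Rightarrow> (('v \<Rightarrow> int) \<Rightarrow> complex) \<Rightarrow> bool" where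
  "nform P p K a \<longleftrightarrow> finite K \<and> (\<forall>\<kappa>\<in>K. \<forall>v. \<kappa> v \<ge> 0) \<and>
     (\<forall>c m. P c m = (\<Sum>\<kappa>\<in>K. a \<kappa> * c (\<lambda>v. m v - \<kappa> v))) \<and>
     (\<forall>z. p z = (\<Sum>\<kappa>\<in>K. a \<kappa> * (\<Prod>v\<in>UNIV. z v ^ nat (\<kappa> v))))"

lemma sum_extend_zero:
  fixes F :: "'a \<Rightarrow> complex"
  assumes "finite K'" "K \<subseteq> K'"
  shows "(\<Sum>x\<in>K. a x * F x) = (\<Sum>x\<in>K'. (if x \<in> K then a x else 0) * F x)"
  by (rule sum.mono_neutral_cong_left) (use assms in auto)

lemma pol_nform:
  assumes "pol p P"
  shows "\<exists>K a. nform P p K a"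
  using assms
proof (induction rule: pol.induct)
  case (pol_const b)
  show ?case
    by (rule exI[of _ "{\<lambda>_. 0}"], rule exI[of _ "\<lambda>_. b"]) (simp add: nform_def)
next
  case (pol_var v)
  have e: "m(v := m v - 1) = (\<lambda>u. m u - of_bool (u = v))" for m :: "'a \<Rightarrow> int" by auto
  have "(\<Prod>u\<in>UNIV. z u ^ nat (of_bool (u = v))) = z v" for z :: "'a \<Rightarrow> complex"
  proof -
    have "(\<Prod>u\<in>UNIV. z u ^ nat (of_bool (u = v))) = (\<Prod>u\<in>{v}. z u ^ nat (of_bool (u = v)))"
      by (rule prod.mono_neutral_right) auto
    then show ?thesis by simp
  qed
  then show ?case
    by (intro exI[of _ "{\<lambda>u. of_bool (u = v)}"] exI[of _ "\<lambda>_. 1"]) (simp add: nform_def shift_def e)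
next
  case (pol_add p P q Q)
  then obtain K a L b where h: "nform P p K a" "nform Q q L b" by blast
  define d where "d \<kappa> = (if \<kappa> \<in> K then a \<kappa> else 0) + (if \<kappa> \<in> L then b \<kappa> else 0)" for \<kappa>
  have fin: "finite (K \<union> L)" using h by (simp add: nform_def)
  have *: "(\<Sum>x\<in>K. a x * F x) + (\<Sum>x\<in>L. b x * F x) = (\<Sum>x\<in>K \<union> L. d x * F x)" for F :: "('a \<Rightarrow> int) \<Rightarrow> complex"
    unfolding sum_extend_zero[OF fin Un_upper1] sum_extend_zero[OF fin Un_upper2]
    by (simp add: d_def sum.distrib algebra_simps)
  have "nform (\<lambda>c m. P c m + Q c m) (\<lambda>z. p z + q z) (K \<union> L) d"
    using h * fin unfolding nform_def by auto
  then show ?case by blast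
next
  case (pol_mult p P q Q)
  then obtain K a L b where h: "nform P p K a" "nform Q q L b" by blast
  define add :: "('a \<Rightarrow> int) \<times> ('a \<Rightarrow> int) \<Rightarrow> 'a \<Rightarrow> int" where "add = (\<lambda>(k,l) v. k v + l v)"
  define N where "N = add ` (K \<times> L)"
  define d where "d \<nu> = (\<Sum>x\<in>{x\<in>K \<times> L. add x = \<nu>}. a (fst x) * b (snd x))" for \<nu>
  have fin: "finite (K \<times> L)" using h by (simp add: nform_def)
  have key: "(\<Sum>k\<in>K. \<Sum>l\<in>L. a k * b l * F (\<lambda>v. k v + l v)) = (\<Sum>\<nu>\<in>N. d \<nu> * F \<nu>)" for F :: "('a \<Rightarrow> int) \<Rightarrow> complex"
  proof -
    have "(\<Sum>k\<in>K. \<Sum>l\<in>L. a k * b l * F (\<lambda>v. k v + l v)) = (\<Sum>x\<in>K \<times> L. a (fst x) * b (snd x) * F (add x))"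
      by (simp add: sum.cartesian_product add_def split_def)
    also have "\<dots> = (\<Sum>\<nu>\<in>N. \<Sum>x\<in>{x\<in>K \<times> L. add x = \<nu>}. a (fst x) * b (snd x) * F (add x))"
      unfolding N_def by (rule sum.image_gen[OF fin])
    also have "\<dots> = (\<Sum>\<nu>\<in>N. d \<nu> * F \<nu>)"
      by (rule sum.cong) (auto simp: d_def sum_distrib_right intro!: sum.cong)
    finally show ?thesis .
  qed
  have "P (Q c) m = (\<Sum>k\<in>K. \<Sum>l\<in>L. a k * b l * c (\<lambda>v. m v - (k v + l v)))" for c m
    using h by (simp add: nform_def sum_distrib_left algebra_simps)
  then have 1: "P (Q c) m = (\<Sum>\<nu>\<in>N. d \<nu> * c (\<lambda>v. m v - \<nu> v))" for c m
    using key[of "\<lambda>n. c (\<lambda>v. m v - n v)"] by simp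
  have "p z * q z = (\<Sum>k\<in>K. \<Sum>l\<in>L. a k * b l * (\<Prod>v\<in>UNIV. z v ^ nat (k v + l v)))" for z
  proof -
    have "p z * q z = (\<Sum>k\<in>K. \<Sum>l\<in>L. (a k * (\<Prod>v\<in>UNIV. z v ^ nat (k v))) * (b l * (\<Prod>v\<in>UNIV. z v ^ nat (l v))))"
      using h by (simp add: nform_def sum_product)
    also have "\<dots> = (\<Sum>k\<in>K. \<Sum>l\<in>L. a k * b l * (\<Prod>v\<in>UNIV. z v ^ nat (k v + l v)))"
      by (intro sum.cong refl) (use h in \<open>auto simp: nform_def nat_add_distrib power_add prod.distrib\<close>)
    finally show ?thesis .
  qed
  then have 2: "p z * q z = (\<Sum>\<nu>\<in>N. d \<nu> * (\<Prod>v\<in>UNIV. z v ^ nat (\<nu> v)))" for z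
    using key[of "\<lambda>n. \<Prod>v\<in>UNIV. z v ^ nat (n v)"] by simp
  have "nform (\<lambda>c. P (Q c)) (\<lambda>z. p z * q z) N d"
    using 1 2 h fin unfolding nform_def N_def add_def by auto
  then show ?case by blast
qed

section \<open>Generic weights and the identity principle for polynomials\<close>

text \<open>With the weights \<open>B ^ idx v\<close>, the weight of \<open>e\<close> is the value
  at \<open>B\<close> of a nonzero integer polynomial with the entries of \<open>e\<close> as
  coefficients; \<open>B\<close> only has to avoid finitely many roots.\<close>

lemma ex_generic_weight:
  fixes E :: "('v::finite \<Rightarrow> int) set"
  assumes "finite E" "(\<lambda>_. 0) \<notin> E"
  shows "\<exists>w. (\<forall>v. w v \<ge> 0) \<and> (\<forall>e\<in>E. wt w e \<noteq> 0)"
proof -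
  obtain idx :: "'v \<Rightarrow> nat" where idx: "bij_betw idx UNIV {0..<card (UNIV :: 'v set)}"
    using ex_bij_betw_finite_nat[OF finite_class.finite_UNIV] by blast
  then have inj: "inj idx" by (simp add: bij_betw_def)
  define pl :: "('v \<Rightarrow> int) \<Rightarrow> int poly" where "pl e = (\<Sum>v\<in>UNIV. monom (e v) (idx v))" for e
  have coeff: "coeff (pl e) (idx v) = e v" for e v
  proof -
    have "coeff (pl e) (idx v) = (\<Sum>u\<in>UNIV. if u = v then e u else 0)"
      unfolding pl_def coeff_sum by (rule sum.cong) (auto simp: inj_eq[OF inj])
    then show ?thesis by simp
  qed
  have nz: "pl e \<noteq> 0" if "e \<in> E" for e
  proof
    assume "pl e = 0"
    then have "e v = 0" for v using coeff[of e v] by simp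
    then have "e = (\<lambda>_. 0)" by (rule ext)
    then show False using that assms(2) by simp
  qed
  have "finite (\<Union>e\<in>E. {x. poly (pl e) x = 0})"
    using assms(1) nz by (auto intro!: poly_roots_finite)
  then have "finite (int -` (\<Union>e\<in>E. {x. poly (pl e) x = 0}))"
    by (rule finite_vimageI) simp
  then obtain B :: nat where "B \<notin> int -` (\<Union>e\<in>E. {x. poly (pl e) x = 0})"
    using ex_new_if_finite[OF infinite_UNIV_nat] by blast
  then have "poly (pl e) (int B) \<noteq> 0" if "e \<in> E" for e using that by auto
  then have "\<forall>e\<in>E. wt (\<lambda>v. int B ^ idx v) e \<noteq> 0"
    by (simp add: wt_def pl_def poly_sum poly_monom mult.commute)
  then show ?thesis by (intro exI[of _ "\<lambda>v. int B ^ idx v"]) simp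
qed

definition separates :: "('v::finite \<Rightarrow> int) \<Rightarrow> ('v \<Rightarrow> int) set \<Rightarrow> bool" where
  "separates w K \<longleftrightarrow> (\<forall>\<kappa>\<in>K. \<forall>\<kappa>'\<in>K. \<kappa> \<noteq> \<kappa>' \<longrightarrow> wt w (\<lambda>v. \<kappa> v - \<kappa>' v) \<noteq> 0)"

lemma ex_separating_weight:
  fixes K E :: "('v::finite \<Rightarrow> int) set"
  assumes "finite K" "finite E" "(\<lambda>_. 0) \<notin> E"
  shows "\<exists>w. (\<forall>v. w v \<ge> 0) \<and> separates w K \<and> (\<forall>e\<in>E. wt w e \<noteq> 0)"
proof -
  let ?E = "(\<lambda>(\<kappa>,\<kappa>') v. \<kappa> v - \<kappa>' v) ` {x\<in>K \<times> K. fst x \<noteq> snd x} \<union> E"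
  have "(\<lambda>_. 0) \<notin> ?E"
  proof
    assume "(\<lambda>_. 0) \<in> ?E"
    then have "(\<lambda>_. 0) \<in> (\<lambda>(\<kappa>,\<kappa>') v. \<kappa> v - \<kappa>' v) ` {x\<in>K \<times> K. fst x \<noteq> snd x}"
      using assms(3) by simp
    then obtain x where x: "x \<in> K \<times> K" "fst x \<noteq> snd x" "(case x of (\<kappa>,\<kappa>') \<Rightarrow> \<lambda>v. \<kappa> v - \<kappa>' v) = (\<lambda>_. 0)"
    proof (rule imageE)
      fix x assume "(\<lambda>_. 0) = (case x of (\<kappa>,\<kappa>') \<Rightarrow> \<lambda>v. \<kappa> v - \<kappa>' v)" "x \<in> {x\<in>K \<times> K. fst x \<noteq> snd x}"
      then show thesis using that[of x] by simp
    qed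
    obtain \<kappa> \<kappa>' where xe: "x = (\<kappa>, \<kappa>')" by (cases x)
    have "\<kappa> v = \<kappa>' v" for v using fun_cong[OF x(3), of v] by (simp add: xe)
    then have "\<kappa> = \<kappa>'" by (rule ext)
    then show False using x(2) by (simp add: xe)
  qed
  moreover have "finite ?E" using assms by auto
  ultimately obtain w where w: "\<forall>v. w v \<ge> 0" "\<forall>e\<in>?E. wt w e \<noteq> 0" using ex_generic_weight[of ?E] by blast
  have "separates w K" unfolding separates_def
  proof (intro ballI impI)
    fix \<kappa> \<kappa>' assume "\<kappa> \<in> K" "\<kappa>' \<in> K" "\<kappa> \<noteq> \<kappa>'"
    then have "(\<lambda>v. \<kappa> v - \<kappa>' v) \<in> ?E" by (intro UnI1 image_eqI[of _ _ "(\<kappa>, \<kappa>')"]) simp_all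
    then show "wt w (\<lambda>v. \<kappa> v - \<kappa>' v) \<noteq> 0" using w by blast
  qed
  then show ?thesis using w by blast
qed

lemma wt_diff: "wt w (\<lambda>v. a v - b v) = wt w a - wt w b"
  by (simp add: wt_def sum_subtractf algebra_simps)

lemma wt_add: "wt w (\<lambda>v. a v + b v) = wt w a + wt w b"
  by (simp add: wt_def sum.distrib algebra_simps)

text \<open>Kronecker substitution: replacing each variable by a power of one variable
  \<open>s\<close>, with a separating weight as exponents, keeps all monomials apart, so the
  coefficients of a one-variable zero polynomial are found.\<close>

lemma nform_identity:
  assumes "nform P p K a" "\<And>z. p z = 0" "\<kappa> \<in> K"
  shows "a \<kappa> = 0"
proof -
  have fin: "finite K" and pos: "\<And>\<kappa> v. \<kappa> \<in> K \<Longrightarrow> \<kappa> v \<ge> 0" using assms(1) by (auto simp: nform_def)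
  obtain w where w: "\<forall>v. w v \<ge> 0" "separates w K"
    using ex_separating_weight[OF fin, of "{}"] by auto
  have inj: "\<kappa> = \<kappa>'" if "\<kappa> \<in> K" "\<kappa>' \<in> K" "nat (wt w \<kappa>) = nat (wt w \<kappa>')" for \<kappa> \<kappa>'
  proof (rule ccontr)
    assume "\<kappa> \<noteq> \<kappa>'"
    then have "wt w \<kappa> \<noteq> wt w \<kappa>'" using w(2) that unfolding separates_def wt_diff by auto
    moreover have "wt w \<kappa> \<ge> 0" "wt w \<kappa>' \<ge> 0" using pos that w(1) by (auto simp: wt_def intro!: sum_nonneg)
    ultimately show False using that(3) by simp
  qed
  define q where "q = (\<Sum>\<kappa>\<in>K. monom (a \<kappa>) (nat (wt w \<kappa>)))"
  have "poly q s = 0" for s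
  proof -
    have "(\<Prod>v\<in>UNIV. (s ^ nat (w v)) ^ nat (\<kappa> v)) = s ^ nat (wt w \<kappa>)" if "\<kappa> \<in> K" for \<kappa>
    proof -
      have "nat (wt w \<kappa>) = (\<Sum>v\<in>UNIV. nat (w v) * nat (\<kappa> v))"
      proof -
        have "wt w \<kappa> \<ge> 0" using pos[OF that] w(1) by (auto simp: wt_def intro!: sum_nonneg)
        then have "int (nat (wt w \<kappa>)) = wt w \<kappa>" by simp
        also have "\<dots> = int (\<Sum>v\<in>UNIV. nat (w v) * nat (\<kappa> v))"
          using w(1) pos[OF that] by (simp add: wt_def)
        finally show ?thesis by (simp only: of_nat_eq_iff)
      qed
      then show ?thesis by (simp add: power_sum power_mult)
    qed
    then have "poly q s = p (\<lambda>v. s ^ nat (w v))"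
      using assms(1) by (simp add: q_def nform_def poly_sum poly_monom)
    then show ?thesis using assms(2) by simp
  qed
  then have "q = 0" using poly_all_0_iff_0 by blast
  then have "0 = coeff q (nat (wt w \<kappa>))" by simp
  also have "\<dots> = (\<Sum>\<kappa>'\<in>K. if \<kappa>' = \<kappa> then a \<kappa>' else 0)"
    unfolding q_def coeff_sum by (rule sum.cong) (use inj assms(3) in auto)
  also have "\<dots> = a \<kappa>" using fin assms(3) by simp
  finally show ?thesis by simp
qed

lemma pol_identity:
  fixes P :: "'v::finite series \<Rightarrow> 'v series"
  assumes "pol p P" "\<And>z. p z = 0"
  shows "P c = (\<lambda>_. 0)"
proof -
  obtain K a where n: "nform P p K a" using pol_nform[OF assms(1)] by blast
  have "P c m = 0" for m using n nform_identity[OF n assms(2)] by (simp add: nform_def)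
  then show ?thesis by auto
qed

text \<open>Applied to the unit series, \<open>P\<close> returns the list of coefficients of
  \<open>p\<close>.\<close>

lemma pol_identity':
  fixes P :: "'v::finite series \<Rightarrow> 'v series"
  assumes "pol p P" "P unit_series = (\<lambda>_. 0)"
  shows "p z = 0"
proof -
  obtain K a where n: "nform P p K a" using pol_nform[OF assms(1)] by blast
  have "a \<kappa> = 0" if "\<kappa> \<in> K" for \<kappa>
  proof -
    have "0 = P unit_series \<kappa>" using assms(2) by simp
    also have "\<dots> = (\<Sum>\<kappa>'\<in>K. a \<kappa>' * unit_series (\<lambda>v. \<kappa> v - \<kappa>' v))" using n by (simp add: nform_def)
    also have "\<dots> = (\<Sum>\<kappa>'\<in>K. if \<kappa>' = \<kappa> then a \<kappa>' else 0)"
    proof (rule sum.cong[OF refl])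
      fix \<kappa>'
      have "((\<lambda>v. \<kappa> v - \<kappa>' v) = (\<lambda>_. 0)) = (\<kappa>' = \<kappa>)"
        by (auto simp: fun_eq_iff)
      then show "a \<kappa>' * unit_series (\<lambda>v. \<kappa> v - \<kappa>' v) = (if \<kappa>' = \<kappa> then a \<kappa>' else 0)"
        by (auto simp: unit_series_def)
    qed
    also have "\<dots> = a \<kappa>" using n that by (simp add: nform_def)
    finally show ?thesis by simp
  qed
  then show ?thesis using n by (simp add: nform_def)
qed

section \<open>Expansions of rational functions as series bounded below\<close>

text \<open>The exponents of a given weight may be infinite in number. A lower bound is enough,
  since polynomial operators touch only finitely many coefficients at a time and every argument is a
  descent in the weight.\<close>

definition bdd :: "('v::finite \<Rightarrow> int) \<Rightarrow> 'v series \<Rightarrow> bool" where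
  "bdd w c \<longleftrightarrow> (\<exists>L. \<forall>m. c m \<noteq> 0 \<longrightarrow> L \<le> wt w m)"

definition reg_op :: "('v::finite \<Rightarrow> int) \<Rightarrow> ('v series \<Rightarrow> 'v series) \<Rightarrow> bool" where
  "reg_op w Q \<longleftrightarrow> (\<forall>c. bdd w c \<longrightarrow> Q c = (\<lambda>_. 0) \<longrightarrow> c = (\<lambda>_. 0))"

definition gen :: "(('v::finite \<Rightarrow> complex) \<Rightarrow> bool) \<Rightarrow> bool" where
  "gen A \<longleftrightarrow> (\<exists>g G. pol g G \<and> (\<exists>z. g z \<noteq> 0) \<and> (\<forall>z. g z \<noteq> 0 \<longrightarrow> A z))"

text \<open>
  Two series bounded below cannot be multiplied by a denominator and become equal without being equal;
  this is why the regularity of \<open>Q\<close> is required only on such series.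
\<close>

definition expands :: "('v::finite \<Rightarrow> int) \<Rightarrow> (('v \<Rightarrow> complex) \<Rightarrow> complex) \<Rightarrow> 'v series \<Rightarrow> bool" where
  "expands w f c \<longleftrightarrow> (\<exists>p P q Q. pol p P \<and> pol q Q \<and> reg_op w Q \<and> bdd w c \<and>
      Q c = P unit_series \<and> gen (\<lambda>z. f z * q z = p z))"

definition pd :: "'v \<Rightarrow> (('v \<Rightarrow> complex) \<Rightarrow> complex) \<Rightarrow> ('v \<Rightarrow> complex) \<Rightarrow> complex" where
  "pd v f z = deriv (\<lambda>t. f (z(v := t))) (z v)"

lemma wt_upd: "wt w (m(v := x)) = wt w m + w v * (x - m v)"
proof -
  have "wt w (m(v := x)) = (\<Sum>u\<in>UNIV. w u * m u + (if u = v then w v * (x - m v) else 0))"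
    unfolding wt_def by (rule sum.cong) (auto simp: algebra_simps)
  then show ?thesis by (simp add: sum.distrib wt_def)
qed

lemma bdd_zero: "bdd w (\<lambda>_. 0)"
  by (simp add: bdd_def)

lemma bdd_unit: "bdd w unit_series"
  unfolding bdd_def unit_series_def by (rule exI[of _ 0]) (auto simp: wt_def)

lemma bdd_lin:
  assumes "bdd w c" "bdd w d"
  shows "bdd w (\<lambda>m. a * c m + b * d m)"
proof -
  obtain L L' where "\<forall>m. c m \<noteq> 0 \<longrightarrow> L \<le> wt w m" "\<forall>m. d m \<noteq> 0 \<longrightarrow> L' \<le> wt w m"
    using assms unfolding bdd_def by blast
  note h = this
  have "\<forall>m. a * c m + b * d m \<noteq> 0 \<longrightarrow> min L L' \<le> wt w m"
  proof (intro allI impI)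
    fix m assume "a * c m + b * d m \<noteq> 0"
    then have "c m \<noteq> 0 \<or> d m \<noteq> 0" by auto
    then have "L \<le> wt w m \<or> L' \<le> wt w m" using h by blast
    then show "min L L' \<le> wt w m" by auto
  qed
  then show ?thesis unfolding bdd_def by blast
qed

lemma bdd_add: "bdd w c \<Longrightarrow> bdd w d \<Longrightarrow> bdd w (\<lambda>m. c m + d m)"
  using bdd_lin[of w c d 1 1] by simp

lemma bdd_scale: "bdd w c \<Longrightarrow> bdd w (\<lambda>m. a * c m)"
  using bdd_lin[of w c c a 0] by simp

lemma bdd_shift:
  assumes "bdd w c" shows "bdd w (shift v c)"
proof -
  obtain L where L: "\<forall>m. c m \<noteq> 0 \<longrightarrow> L \<le> wt w m" using assms unfolding bdd_def by blast
  have "\<forall>m. shift v c m \<noteq> 0 \<longrightarrow> L + w v \<le> wt w m"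
  proof (intro allI impI)
    fix m assume "shift v c m \<noteq> 0"
    then have "L \<le> wt w (m(v := m v - 1))" using L by (auto simp: shift_def)
    then show "L + w v \<le> wt w m" by (simp add: wt_upd)
  qed
  then show ?thesis unfolding bdd_def by blast
qed

lemma bdd_sder:
  assumes "bdd w c" shows "bdd w (sder v c)"
proof -
  obtain L where L: "\<forall>m. c m \<noteq> 0 \<longrightarrow> L \<le> wt w m" using assms unfolding bdd_def by blast
  have "\<forall>m. sder v c m \<noteq> 0 \<longrightarrow> L - w v \<le> wt w m"
  proof (intro allI impI)
    fix m assume "sder v c m \<noteq> 0"
    then have "L \<le> wt w (m(v := m v + 1))" using L by (auto simp: sder_def)
    then show "L - w v \<le> wt w m" by (simp add: wt_upd)
  qed
  then show ?thesis unfolding bdd_def by blast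
qed

lemma bdd_pol: "pol p P \<Longrightarrow> bdd w c \<Longrightarrow> bdd w (P c)"
  by (induction arbitrary: c rule: pol.induct) (auto intro: bdd_scale bdd_shift bdd_add)

lemma reg_op_compose:
  assumes "reg_op w P" "reg_op w Q" "pol q Q"
  shows "reg_op w (\<lambda>c. P (Q c))"
  unfolding reg_op_def
proof (intro allI impI)
  fix c assume c: "bdd w c" "P (Q c) = (\<lambda>_. 0)"
  have "Q c = (\<lambda>_. 0)"
    using assms(1) bdd_pol[OF assms(3) c(1)] c(2) by (simp add: reg_op_def)
  then show "c = (\<lambda>_. 0)" using assms(2) c(1) by (simp add: reg_op_def)
qed

lemma reg_op_nonzero:
  assumes "reg_op w Q" "pol q Q"
  shows "\<exists>z. q z \<noteq> 0"
proof (rule ccontr)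
  assume "\<not> ?thesis"
  then have "Q unit_series = (\<lambda>_. 0)" by (intro pol_identity[OF assms(2)]) simp
  then have "(unit_series :: 'a series) = (\<lambda>_. 0)" using assms(1) bdd_unit[of w] unfolding reg_op_def by (elim allE[of _ unit_series]) simp
  from fun_cong[OF this, of "\<lambda>_. 0"] show False by (simp add: unit_series_def)
qed

text \<open>A polynomial with a single term of least weight is that term times 1 plus terms of
  positive weight. Hence it can be divided by: the coefficient at \<open>m\<close> of a quotient is
  given by coefficients of smaller weight, which proves uniqueness and, by recursion,
  existence.\<close>

lemma nform_unique_min:
  assumes n: "nform Q q K a" and k0: "\<kappa>0 \<in> K" "a \<kappa>0 \<noteq> 0"
    and mn: "\<And>\<kappa>. \<kappa> \<in> K \<Longrightarrow> \<kappa> \<noteq> \<kappa>0 \<Longrightarrow> a \<kappa> \<noteq> 0 \<Longrightarrow> wt w \<kappa>0 < wt w \<kappa>"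
  shows "reg_op w Q" and "bdd w d \<Longrightarrow> \<exists>c. bdd w c \<and> Q c = d"
proof -
  have fin: "finite K" and Q: "Q c m = (\<Sum>\<kappa>\<in>K. a \<kappa> * c (\<lambda>v. m v - \<kappa> v))" for c m
    using n by (auto simp: nform_def)
  have Q': "Q c (\<lambda>v. m v + \<kappa>0 v) = a \<kappa>0 * c m + (\<Sum>\<kappa>\<in>K - {\<kappa>0}. a \<kappa> * c (\<lambda>v. m v + \<kappa>0 v - \<kappa> v))" for c m
    unfolding Q by (subst sum.remove[OF fin k0(1)]) simp
  have low: "wt w (\<lambda>v. m v + \<kappa>0 v - \<kappa> v) < wt w m" if "\<kappa> \<in> K - {\<kappa>0}" "a \<kappa> \<noteq> 0" for m \<kappa>
    using mn[of \<kappa>] that by (simp add: wt_diff wt_add)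
  show "reg_op w Q" unfolding reg_op_def
  proof (intro allI impI ext)
    fix c m assume c: "bdd w c" "Q c = (\<lambda>_. 0)"
    obtain L where L: "\<And>m. c m \<noteq> 0 \<Longrightarrow> L \<le> wt w m" using c(1) unfolding bdd_def by blast
    show "c m = 0"
    proof (induction "nat (wt w m - L + 1)" arbitrary: m rule: less_induct)
      case less
      show ?case
      proof (cases "wt w m < L")
        case True then show ?thesis using L by force
      next
        case False
        have "a \<kappa> * c (\<lambda>v. m v + \<kappa>0 v - \<kappa> v) = 0" if "\<kappa> \<in> K - {\<kappa>0}" for \<kappa>
        proof (cases "a \<kappa> = 0")
          case False2: False
          have "c (\<lambda>v. m v + \<kappa>0 v - \<kappa> v) = 0"
            by (rule less) (use low[OF that False2, of m] False in simp)
          then show ?thesis by simp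
        qed simp
        then have "(\<Sum>\<kappa>\<in>K - {\<kappa>0}. a \<kappa> * c (\<lambda>v. m v + \<kappa>0 v - \<kappa> v)) = 0"
          by (intro sum.neutral) blast
        then have "Q c (\<lambda>v. m v + \<kappa>0 v) = a \<kappa>0 * c m" unfolding Q' by simp
        then show ?thesis using c(2) k0 by simp
      qed
    qed
  qed
  assume "bdd w d"
  then obtain L0 where L0: "\<And>m. d m \<noteq> 0 \<Longrightarrow> L0 \<le> wt w m" unfolding bdd_def by blast
  define L where "L = L0 - wt w \<kappa>0"
  \<comment> \<open>One pass of the equation \<open>Q c = d\<close> solved for the coefficient that
    belongs to the least term. Nothing can occur below \<open>L\<close>, and each pass settles one
    more weight level, so the iterates are stationary at \<open>m\<close> after
    \<open>wt w m - L + 1\<close> passes.\<close>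
  define F where "F c m = (if wt w m < L then 0 else
      (d (\<lambda>v. m v + \<kappa>0 v) - (\<Sum>\<kappa>\<in>K - {\<kappa>0}. a \<kappa> * c (\<lambda>v. m v + \<kappa>0 v - \<kappa> v))) / a \<kappa>0)" for c m
  define C where "C n = (F ^^ n) (\<lambda>_. 0)" for n
  have CS: "C (Suc n) = F (C n)" for n by (simp add: C_def)
  have C0: "C n m = 0" if "wt w m < L" for n m
    using that by (cases n) (simp_all add: C_def F_def)
  have stab: "C n m = C n' m" if "nat (wt w m - L + 1) \<le> n" "nat (wt w m - L + 1) \<le> n'" for n n' m
    using that
  proof (induction "nat (wt w m - L + 1)" arbitrary: m n n' rule: less_induct)
    case less
    show ?case
    proof (cases "wt w m < L")
      case True then show ?thesis using C0 by simp
    next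
      case False
      then have "n > 0" "n' > 0" using less.prems by auto
      then obtain k k' where k: "n = Suc k" "n' = Suc k'" by (meson gr0_implies_Suc)
      have "a \<kappa> * C k (\<lambda>v. m v + \<kappa>0 v - \<kappa> v) = a \<kappa> * C k' (\<lambda>v. m v + \<kappa>0 v - \<kappa> v)"
        if "\<kappa> \<in> K - {\<kappa>0}" for \<kappa>
      proof (cases "a \<kappa> = 0")
        case False2: False
        have "C k (\<lambda>v. m v + \<kappa>0 v - \<kappa> v) = C k' (\<lambda>v. m v + \<kappa>0 v - \<kappa> v)"
          by (rule less.hyps) (use low[OF that False2, of m] less.prems k False in auto)
        then show ?thesis by simp
      qed simp
      then have "(\<Sum>\<kappa>\<in>K - {\<kappa>0}. a \<kappa> * C k (\<lambda>v. m v + \<kappa>0 v - \<kappa> v)) = (\<Sum>\<kappa>\<in>K - {\<kappa>0}. a \<kappa> * C k' (\<lambda>v. m v + \<kappa>0 v - \<kappa> v))"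
        by (rule sum.cong[OF refl])
      then have "F (C k) m = F (C k') m" unfolding F_def by simp
      then show ?thesis by (simp add: k CS)
    qed
  qed
  define c where "c m = C (nat (wt w m - L + 1)) m" for m
  have cC: "c m = C n m" if "nat (wt w m - L + 1) \<le> n" for n m
    unfolding c_def by (rule stab) (use that in auto)
  have "bdd w c" unfolding bdd_def
  proof (intro exI allI impI)
    fix m assume "c m \<noteq> 0" then show "L \<le> wt w m" using C0 unfolding c_def by force
  qed
  moreover have "Q c = d"
  proof
    fix m'
    define m where "m = (\<lambda>v. m' v - \<kappa>0 v)"
    have m': "m' = (\<lambda>v. m v + \<kappa>0 v)" by (simp add: m_def)
    have "Q c (\<lambda>v. m v + \<kappa>0 v) = d (\<lambda>v. m v + \<kappa>0 v)"
    proof (cases "wt w m < L")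
      case True
      have "a \<kappa> * c (\<lambda>v. m v + \<kappa>0 v - \<kappa> v) = 0" if "\<kappa> \<in> K - {\<kappa>0}" for \<kappa>
      proof (cases "a \<kappa> = 0")
        case False2: False
        show ?thesis using C0 low[OF that False2, of m] True by (simp add: c_def)
      qed simp
      then have "(\<Sum>\<kappa>\<in>K - {\<kappa>0}. a \<kappa> * c (\<lambda>v. m v + \<kappa>0 v - \<kappa> v)) = 0"
        by (intro sum.neutral) blast
      then have "Q c (\<lambda>v. m v + \<kappa>0 v) = 0" unfolding Q' using C0[OF True] by (simp add: c_def)
      moreover have "d (\<lambda>v. m v + \<kappa>0 v) = 0" using L0[of "\<lambda>v. m v + \<kappa>0 v"] True by (force simp: L_def wt_add)
      ultimately show ?thesis by simp
    next
      case False
      define N where "N = nat (wt w m - L + 1)"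
      then have "c m = C (Suc N) m" by (intro cC) simp
      also have "\<dots> = (d (\<lambda>v. m v + \<kappa>0 v) - (\<Sum>\<kappa>\<in>K - {\<kappa>0}. a \<kappa> * C N (\<lambda>v. m v + \<kappa>0 v - \<kappa> v))) / a \<kappa>0"
        using False by (simp add: CS F_def)
      also have "(\<Sum>\<kappa>\<in>K - {\<kappa>0}. a \<kappa> * C N (\<lambda>v. m v + \<kappa>0 v - \<kappa> v)) = (\<Sum>\<kappa>\<in>K - {\<kappa>0}. a \<kappa> * c (\<lambda>v. m v + \<kappa>0 v - \<kappa> v))"
      proof (rule sum.cong[OF refl])
        fix \<kappa> assume k: "\<kappa> \<in> K - {\<kappa>0}"
        show "a \<kappa> * C N (\<lambda>v. m v + \<kappa>0 v - \<kappa> v) = a \<kappa> * c (\<lambda>v. m v + \<kappa>0 v - \<kappa> v)"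
        proof (cases "a \<kappa> = 0")
          case False2: False
          have "c (\<lambda>v. m v + \<kappa>0 v - \<kappa> v) = C N (\<lambda>v. m v + \<kappa>0 v - \<kappa> v)"
            by (rule cC) (use low[OF k False2, of m] in \<open>simp add: N_def\<close>)
          then show ?thesis by simp
        qed simp
      qed
      finally show ?thesis unfolding Q' using k0 by (simp add: field_simps)
    qed
    then show "Q c m' = d m'" by (simp add: m')
  qed
  ultimately show "\<exists>c. bdd w c \<and> Q c = d" by blast
qed

lemma separates_unique_min:
  assumes "nform Q q K a" "separates w K" "\<exists>z. q z \<noteq> 0"
  obtains \<kappa>0 where "\<kappa>0 \<in> K" "a \<kappa>0 \<noteq> 0"
     "\<And>\<kappa>. \<kappa> \<in> K \<Longrightarrow> \<kappa> \<noteq> \<kappa>0 \<Longrightarrow> a \<kappa> \<noteq> 0 \<Longrightarrow> wt w \<kappa>0 < wt w \<kappa>"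
proof -
  define K' where "K' = {\<kappa>\<in>K. a \<kappa> \<noteq> 0}"
  have "finite K'" using assms(1) by (simp add: nform_def K'_def)
  moreover have "K' \<noteq> {}"
  proof
    assume "K' = {}"
    then have "a \<kappa> = 0" if "\<kappa> \<in> K" for \<kappa> using that by (auto simp: K'_def)
    then have "q z = 0" for z using assms(1) by (simp add: nform_def)
    with assms(3) show False by simp
  qed
  ultimately have k: "arg_min_on (wt w) K' \<in> K'" "\<And>\<kappa>. \<kappa> \<in> K' \<Longrightarrow> wt w (arg_min_on (wt w) K') \<le> wt w \<kappa>"
    by (simp_all add: arg_min_if_finite(1) arg_min_least)
  define \<kappa>0 where "\<kappa>0 = arg_min_on (wt w) K'"
  note k = k[folded \<kappa>0_def]
  show thesis
  proof (rule that[of \<kappa>0])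
    fix \<kappa> assume "\<kappa> \<in> K" "\<kappa> \<noteq> \<kappa>0" "a \<kappa> \<noteq> 0"
    then have "wt w \<kappa>0 \<le> wt w \<kappa>" "wt w (\<lambda>v. \<kappa> v - \<kappa>0 v) \<noteq> 0"
      using k assms(2) by (auto simp: K'_def separates_def)
    then show "wt w \<kappa>0 < wt w \<kappa>" by (simp add: wt_diff)
  qed (use k in \<open>auto simp: K'_def\<close>)
qed

lemma nform_regular:
  assumes "nform Q q K a" "separates w K" "\<exists>z. q z \<noteq> 0"
  shows "reg_op w Q"
proof -
  obtain \<kappa>0 where k: "\<kappa>0 \<in> K" "a \<kappa>0 \<noteq> 0"
     "\<And>\<kappa>. \<kappa> \<in> K \<Longrightarrow> \<kappa> \<noteq> \<kappa>0 \<Longrightarrow> a \<kappa> \<noteq> 0 \<Longrightarrow> wt w \<kappa>0 < wt w \<kappa>"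
    using separates_unique_min[OF assms] by blast
  show ?thesis by (rule nform_unique_min(1)[OF assms(1) k])
qed

text \<open>Both operators are injective on series bounded below for a common separating weight,
  hence so is their composite, which therefore is not the zero operator. This is the irreducibility
  that lets generic conditions be combined.\<close>

lemma pol_nonzero_mult:
  assumes "pol p P" "pol q Q" "\<exists>z. p z \<noteq> 0" "\<exists>z. q z \<noteq> (0::complex)"
  shows "\<exists>z::'v::finite \<Rightarrow> complex. p z * q z \<noteq> 0"
proof -
  obtain K a where n1: "nform P p K a" using pol_nform[OF assms(1)] by (elim exE)
  obtain L b where n2: "nform Q q L b" using pol_nform[OF assms(2)] by (elim exE)
  note n = n1 n2
  have "finite (K \<union> L)" using n by (simp add: nform_def)
  then obtain w where w: "separates w (K \<union> L)" using ex_separating_weight[of "K \<union> L" "{}"] by auto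
  then have "separates w K" "separates w L" by (auto simp: separates_def)
  then have "reg_op w P" "reg_op w Q"
    using nform_regular[OF n(1) _ assms(3)] nform_regular[OF n(2) _ assms(4)] by simp_all
  then have "reg_op w (\<lambda>c. P (Q c))" by (rule reg_op_compose[OF _ _ assms(2)])
  then show ?thesis by (rule reg_op_nonzero[OF _ pol_mult[OF assms(1,2)]])
qed

lemma genI: "pol g G \<Longrightarrow> g z0 \<noteq> 0 \<Longrightarrow> (\<And>z. g z \<noteq> 0 \<Longrightarrow> A z) \<Longrightarrow> gen A"
  unfolding gen_def by (intro exI[of _ g] exI[of _ G] conjI exI[of _ z0] allI impI)

lemma genE:
  assumes "gen A"
  obtains g G z0 where "pol g G" "g z0 \<noteq> 0" "\<And>z. g z \<noteq> 0 \<Longrightarrow> A z"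
proof -
  from assms show thesis unfolding gen_def
  proof (elim exE conjE)
    fix g G z0 assume "pol g G" "\<forall>z. g z \<noteq> 0 \<longrightarrow> A z" "g z0 \<noteq> 0"
    then show thesis by (intro that[of g G z0]) simp_all
  qed
qed

lemma gen_mono: "gen A \<Longrightarrow> (\<And>z. A z \<Longrightarrow> B z) \<Longrightarrow> gen B"
proof (erule genE)
  fix g G z0 assume B: "\<And>z. A z \<Longrightarrow> B z" and g: "pol g G" "g z0 \<noteq> 0" "\<And>z. g z \<noteq> 0 \<Longrightarrow> A z"
  show "gen B" by (rule genI[OF g(1,2)]) (rule B[OF g(3)])
qed

lemma gen_conj:
  assumes "gen A" "gen B" shows "gen (\<lambda>z. A z \<and> B z)"
proof -
  obtain g G z0 where g: "pol g G" "g z0 \<noteq> 0" "\<And>z. g z \<noteq> 0 \<Longrightarrow> A z"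
    by (rule genE[OF assms(1)]) (rule that)
  obtain h H z1 where h: "pol h H" "h z1 \<noteq> 0" "\<And>z. h z \<noteq> 0 \<Longrightarrow> B z"
    by (rule genE[OF assms(2)]) (rule that)
  have "\<exists>z. g z * h z \<noteq> 0"
    by (rule pol_nonzero_mult[OF g(1) h(1) exI[of _ z0] exI[of _ z1]]) (rule g h)+
  then obtain z where "g z * h z \<noteq> 0" ..
  then show ?thesis
    by (rule genI[OF pol_mult[OF g(1) h(1)]]) (simp add: g(3) h(3))
qed

lemma gen_pol: "pol g G \<Longrightarrow> \<exists>z. g z \<noteq> 0 \<Longrightarrow> gen (\<lambda>z. g z \<noteq> 0)"
  by (erule exE) (rule genI)

lemma gen_True: "(\<And>z. A z) \<Longrightarrow> gen A"
  by (rule genI[OF pol_1]) simp_all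

lemma gen_ball:
  assumes "finite S" "\<And>i. i \<in> S \<Longrightarrow> gen (A i)"
  shows "gen (\<lambda>z. \<forall>i\<in>S. A i z)"
  using assms
proof (induction S rule: finite_induct)
  case empty
  then show ?case by (simp add: gen_True)
next
  case (insert x F)
  then have "gen (\<lambda>z. A x z \<and> (\<forall>i\<in>F. A i z))" by (intro gen_conj) auto
  then show ?case by simp
qed

lemma gen_pol_zero:
  assumes "gen (\<lambda>z. p z = 0)" "pol p P"
  shows "p z = 0"
proof (rule ccontr)
  assume "p z \<noteq> 0"
  then have "\<exists>z. p z \<noteq> 0" by (rule exI[of _ z])
  then have "gen (\<lambda>z. p z = 0 \<and> p z \<noteq> 0)" by (rule gen_conj[OF assms(1) gen_pol[OF assms(2)]])
  then show False by (rule genE) simp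
qed

lemma expandsI:
  assumes "pol p P" "pol q Q" "reg_op w Q" "bdd w c" "Q c = P unit_series" "gen (\<lambda>z. f z * q z = p z)"
  shows "expands w f c"
  unfolding expands_def
  by (rule exI[of _ p], rule exI[of _ P], rule exI[of _ q], rule exI[of _ Q]) (intro conjI assms)

lemma expands_cong:
  assumes "expands w f c" "gen (\<lambda>z. f z = g z)"
  shows "expands w g c"
proof -
  from assms(1) obtain p P q Q where h: "pol p P" "pol q Q" "reg_op w Q" "bdd w c"
    "Q c = P unit_series" "gen (\<lambda>z. f z * q z = p z)" unfolding expands_def by (elim exE conjE)
  have "gen (\<lambda>z. g z * q z = p z)"
    by (rule gen_mono[OF gen_conj[OF assms(2) h(6)]]) auto
  with h(1-5) show ?thesis by (rule expandsI)
qed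

text \<open>Together with \<open>expands_zero_fun\<close> this makes the passage between functions
  up to generic equality and their series injective in both directions, so an identity may be proved
  on whichever side is easier.\<close>

lemma expands_zero_series:
  assumes "expands w f (\<lambda>_. 0)" shows "gen (\<lambda>z. f z = 0)"
proof -
  from assms(1) obtain p P q Q where h: "pol p P" "pol q Q" "reg_op w Q"
    "Q (\<lambda>_. 0) = P unit_series" "gen (\<lambda>z. f z * q z = p z)" unfolding expands_def by (elim exE conjE)
  have "P unit_series = (\<lambda>_. 0)" using pol_zero[OF h(2)] by (simp add: h(4))
  then have p0: "p z = 0" for z by (rule pol_identity'[OF h(1)])
  have q0: "gen (\<lambda>z. q z \<noteq> 0)" by (rule gen_pol[OF h(2) reg_op_nonzero[OF h(3,2)]])
  show ?thesis by (rule gen_mono[OF gen_conj[OF h(5) q0]]) (auto simp: p0)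
qed

lemma expands_zero_fun:
  assumes "expands w f c" "gen (\<lambda>z. f z = 0)"
  shows "c = (\<lambda>_. 0)"
proof -
  from assms(1) obtain p P q Q where h: "pol p P" "pol q Q" "reg_op w Q" "bdd w c"
    "Q c = P unit_series" "gen (\<lambda>z. f z * q z = p z)" unfolding expands_def by (elim exE conjE)
  have "gen (\<lambda>z. p z = 0)"
    by (rule gen_mono[OF gen_conj[OF assms(2) h(6)]]) auto
  then have "p z = 0" for z by (rule gen_pol_zero[OF _ h(1)])
  then have "P unit_series = (\<lambda>_. 0)" by (rule pol_identity[OF h(1)])
  then show ?thesis using h(3,4,5) unfolding reg_op_def by simp
qed

lemma expands_add:
  assumes "expands w f c" "expands w g d"
  shows "expands w (\<lambda>z. f z + g z) (\<lambda>m. c m + d m)"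
proof -
  from assms(1) obtain p P q Q where h: "pol p P" "pol q Q" "reg_op w Q" "bdd w c"
    "Q c = P unit_series" "gen (\<lambda>z. f z * q z = p z)" unfolding expands_def by (elim exE conjE)
  from assms(2) obtain r R s S where k: "pol r R" "pol s S" "reg_op w S" "bdd w d"
    "S d = R unit_series" "gen (\<lambda>z. g z * s z = r z)" unfolding expands_def by (elim exE conjE)
  have 1: "pol (\<lambda>z. q z * s z) (\<lambda>c. Q (S c))" by (intro pol_mult h k)
  have 2: "pol (\<lambda>z. s z * p z + q z * r z) (\<lambda>c m. S (P c) m + Q (R c) m)" by (intro pol_add pol_mult h k)
  have 3: "reg_op w (\<lambda>c. Q (S c))" by (rule reg_op_compose[OF h(3) k(3,2)])
  have "Q (S (\<lambda>m. c m + d m)) = (\<lambda>m. Q (S c) m + Q (S d) m)"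
    using pol_add_series[OF 1] .
  moreover have "Q (S c) = S (P unit_series)" using pol_commute[OF h(2) k(2)] h(5) by simp
  ultimately have 4: "Q (S (\<lambda>m. c m + d m)) = (\<lambda>m. S (P unit_series) m + Q (R unit_series) m)"
    using k(5) by simp
  have 5: "gen (\<lambda>z. (f z + g z) * (q z * s z) = s z * p z + q z * r z)"
  proof (rule gen_mono[OF gen_conj[OF h(6) k(6)]])
    fix z assume "f z * q z = p z \<and> g z * s z = r z"
    then have e: "p z = f z * q z" "r z = g z * s z" by simp_all
    show "(f z + g z) * (q z * s z) = s z * p z + q z * r z" unfolding e by (simp add: algebra_simps)
  qed
  show ?thesis by (rule expandsI[OF 2 1 3 bdd_add[OF h(4) k(4)] 4 5])
qed

lemma expands_mult_pol:
  assumes "expands w f c" "pol r R"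
  shows "expands w (\<lambda>z. r z * f z) (R c)"
proof -
  from assms(1) obtain p P q Q where h: "pol p P" "pol q Q" "reg_op w Q" "bdd w c"
    "Q c = P unit_series" "gen (\<lambda>z. f z * q z = p z)" unfolding expands_def by (elim exE conjE)
  have 4: "Q (R c) = R (P unit_series)" using pol_commute[OF h(2) assms(2)] h(5) by simp
  have 5: "gen (\<lambda>z. r z * f z * q z = r z * p z)"
    by (rule gen_mono[OF h(6)]) simp
  show ?thesis by (rule expandsI[OF pol_mult[OF assms(2) h(1)] h(2,3) bdd_pol[OF assms(2) h(4)] 4 5])
qed

lemma expands_scale: "expands w f c \<Longrightarrow> expands w (\<lambda>z. a * f z) (\<lambda>m. a * c m)"
  by (rule expands_mult_pol[OF _ pol_const])

lemma expands_zero: "expands w (\<lambda>_. 0) (\<lambda>_. 0)"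
  by (rule expandsI[OF pol_0 pol_1]) (simp_all add: reg_op_def bdd_zero gen_True)

lemma expands_sum:
  assumes "finite A" "\<And>i. i \<in> A \<Longrightarrow> expands w (f i) (c i)"
  shows "expands w (\<lambda>z. \<Sum>i\<in>A. f i z) (\<lambda>m. \<Sum>i\<in>A. c i m)"
  using assms
proof (induction A rule: finite_induct)
  case empty
  then show ?case by (simp add: expands_zero)
next
  case (insert x F)
  then show ?case using expands_add[of w "f x" "c x"] by simp
qed

lemma expands_unique:
  assumes "expands w f c" "expands w g d" "gen (\<lambda>z. f z = g z)"
  shows "c = d"
proof -
  have "expands w (\<lambda>z. f z + (-1) * g z) (\<lambda>m. c m + (-1) * d m)"
    by (intro expands_add expands_scale assms)
  then have "(\<lambda>m. c m + (-1) * d m) = (\<lambda>_. 0)"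
    by (rule expands_zero_fun) (rule gen_mono[OF assms(3)], simp)
  then show ?thesis by (auto simp: fun_eq_iff)
qed

lemma expands_determines:
  assumes "expands w f c" "expands w g c"
  shows "gen (\<lambda>z. f z = g z)"
proof -
  have "expands w (\<lambda>z. f z + (-1) * g z) (\<lambda>m. c m + (-1) * c m)"
    by (intro expands_add expands_scale assms)
  then have "expands w (\<lambda>z. f z + (-1) * g z) (\<lambda>_. 0)" by simp
  from expands_zero_series[OF this] show ?thesis by (rule gen_mono) simp
qed

lemma expands_exists:
  assumes "pol p P" "pol q Q" "\<exists>z. q z \<noteq> 0" "nform Q q K a" "separates w K"
  shows "\<exists>c. expands w (\<lambda>z. p z / q z) c"
proof -
  obtain \<kappa>0 where k: "\<kappa>0 \<in> K" "a \<kappa>0 \<noteq> 0"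
     "\<And>\<kappa>. \<kappa> \<in> K \<Longrightarrow> \<kappa> \<noteq> \<kappa>0 \<Longrightarrow> a \<kappa> \<noteq> 0 \<Longrightarrow> wt w \<kappa>0 < wt w \<kappa>"
    using separates_unique_min[OF assms(4,5,3)] by blast
  obtain c where c: "bdd w c" "Q c = P unit_series"
    using nform_unique_min(2)[OF assms(4) k bdd_pol[OF assms(1) bdd_unit]] by blast
  have r: "reg_op w Q" by (rule nform_unique_min(1)[OF assms(4) k])
  have "gen (\<lambda>z. p z / q z * q z = p z)"
    by (rule gen_mono[OF gen_pol[OF assms(2,3)]]) simp
  then show ?thesis by (intro exI[of _ c] expandsI[OF assms(1,2) r c])
qed

lemma pol_isCont:
  assumes "pol g G" shows "isCont (\<lambda>t. g (z(v := t))) (z v)"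
proof -
  from pol_deriv[OF assms, of v] obtain g' G' where g': "pol g' G'"
    "\<forall>z. ((\<lambda>t. g (z(v := t))) has_field_derivative g' z) (at (z v))"
    "\<forall>c. sder v (G c) = (\<lambda>m. G' c m + G (sder v c) m)" by (elim exE conjE)
  from g'(2)[rule_format, of z]
  have "((\<lambda>t. g (z(v := t))) has_field_derivative g' z) (at (z v))" .
  then show ?thesis by (rule DERIV_isCont)
qed

lemma eventually_nonzero_nhds:
  fixes h :: "complex \<Rightarrow> complex"
  assumes "isCont h a" "h a \<noteq> 0"
  shows "eventually (\<lambda>t. h t \<noteq> 0) (nhds a)"
proof -
  have "eventually (\<lambda>t. h t \<noteq> 0) (at a)"
    using isContD[OF assms(1)] assms(2) by (rule tendsto_imp_eventually_ne)
  then show ?thesis unfolding eventually_at_filter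
  proof (rule eventually_mono)
    fix t assume "t \<noteq> a \<longrightarrow> t \<in> UNIV \<longrightarrow> h t \<noteq> 0"
    then show "h t \<noteq> 0" using assms(2) by (cases "t = a") simp_all
  qed
qed

lemma sder_unit: "sder v unit_series = (\<lambda>_. 0)"
proof
  fix m :: "'a \<Rightarrow> int"
  have "m v + 1 = 0" if "m(v := m v + 1) = (\<lambda>_. 0)" using fun_cong[OF that, of v] by simp
  then have "of_int (m v + 1) = (0::complex)" if "m(v := m v + 1) = (\<lambda>_. 0)" using that by (simp only: of_int_0)
  then show "sder v unit_series m = 0" by (cases "m(v := m v + 1) = (\<lambda>_. 0)") (simp_all only: sder_def unit_series_def of_bool_def if_True if_False mult_zero_left mult_zero_right)
qed

text \<open>Differentiating \<open>f q = p\<close> gives \<open>(\<partial>f) q\<^sup>2 = q \<partial>p - p \<partial>q\<close>, and the operators satisfy the same identity.\<close>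

lemma expands_pd:
  assumes "expands w f c" shows "expands w (pd v f) (sder v c)"
proof -
  from assms(1) obtain p P q Q where h: "pol p P" "pol q Q" "reg_op w Q" "bdd w c"
    "Q c = P unit_series" "gen (\<lambda>z. f z * q z = p z)" unfolding expands_def by (elim exE conjE)
  from pol_deriv[OF h(1), of v] obtain p' P' where
    p': "pol p' P'" "\<forall>z. ((\<lambda>t. p (z(v := t))) has_field_derivative p' z) (at (z v))"
    "\<forall>c. sder v (P c) = (\<lambda>m. P' c m + P (sder v c) m)" by (elim exE conjE)
  from pol_deriv[OF h(2), of v] obtain q' Q' where
    q': "pol q' Q'" "\<forall>z. ((\<lambda>t. q (z(v := t))) has_field_derivative q' z) (at (z v))"
    "\<forall>c. sder v (Q c) = (\<lambda>m. Q' c m + Q (sder v c) m)" by (elim exE conjE)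
  have 1: "pol (\<lambda>z. q z * q z) (\<lambda>c. Q (Q c))" by (intro pol_mult h)
  have 2: "pol (\<lambda>z. q z * p' z - q' z * p z) (\<lambda>c m. Q (P' c) m - Q' (P c) m)"
    by (intro pol_diff pol_mult h p'(1) q'(1))
  have 3: "reg_op w (\<lambda>c. Q (Q c))" by (rule reg_op_compose[OF h(3) h(3,2)])
  have "sder v (Q c) = sder v (P unit_series)" using h(5) by simp
  then have "(\<lambda>m. Q' c m + Q (sder v c) m) = P' unit_series"
    using p'(3) q'(3) by (simp add: sder_unit pol_zero[OF h(1)])
  then have e: "Q' c m + Q (sder v c) m = P' unit_series m" for m by (rule fun_cong)
  have "Q (sder v c) = (\<lambda>m. P' unit_series m - Q' c m)"
    by (rule ext) (simp flip: e)
  then have "Q (Q (sder v c)) = (\<lambda>m. Q (P' unit_series) m - Q (Q' c) m)"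
    by (simp add: pol_diff_series[OF h(2)])
  then have 4: "Q (Q (sder v c)) = (\<lambda>m. Q (P' unit_series) m - Q' (P unit_series) m)"
    using pol_commute[OF h(2) q'(1)] h(5) by simp
  obtain g G z0 where g: "pol g G" "g z0 \<noteq> 0" "\<And>z. g z \<noteq> 0 \<Longrightarrow> f z * q z = p z"
    by (rule genE[OF h(6)]) (rule that)
  have gz: "\<exists>z. g z \<noteq> 0" using g(2) by (rule exI[of _ z0])
  have 5: "gen (\<lambda>z. pd v f z * (q z * q z) = q z * p' z - q' z * p z)"
  proof (rule gen_mono[OF gen_conj[OF gen_pol[OF g(1) gz] gen_pol[OF h(2) reg_op_nonzero[OF h(3,2)]]]])
    fix z assume z: "g z \<noteq> 0 \<and> q z \<noteq> 0"
    \<comment> \<open>A generic identity at the single point would not survive differentiation; by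
      continuity it holds on a neighbourhood along the coordinate line.\<close>
    have "eventually (\<lambda>t. g (z(v := t)) \<noteq> 0 \<and> q (z(v := t)) \<noteq> 0) (nhds (z v))"
      using eventually_nonzero_nhds[OF pol_isCont[OF g(1), of z v]] eventually_nonzero_nhds[OF pol_isCont[OF h(2), of z v]] z
      by (simp add: eventually_conj_iff)
    then have ev: "eventually (\<lambda>t. f (z(v := t)) = p (z(v := t)) / q (z(v := t))) (nhds (z v))"
      by (rule eventually_mono) (use g(3) in \<open>auto simp: field_simps\<close>)
    have "((\<lambda>t. p (z(v := t)) / q (z(v := t))) has_field_derivative (p' z * q z - p z * q' z) / (q z * q z)) (at (z v))"
      using DERIV_divide[OF p'(2)[rule_format, of z] q'(2)[rule_format, of z]] z by simp
    then have "((\<lambda>t. f (z(v := t))) has_field_derivative (p' z * q z - p z * q' z) / (q z * q z)) (at (z v))"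
      by (rule DERIV_cong_ev[OF refl ev refl, THEN iffD2])
    then have "pd v f z = (p' z * q z - p z * q' z) / (q z * q z)"
      unfolding pd_def by (rule DERIV_imp_deriv)
    then have "pd v f z * (q z * q z) = p' z * q z - p z * q' z" using z by simp
    then show "pd v f z * (q z * q z) = q z * p' z - q' z * p z" by (simp add: algebra_simps)
  qed
  show ?thesis by (rule expandsI[OF 2 1 3 bdd_sder[OF h(4)] 4 5])
qed

section \<open>Hypergeometric series\<close>

text \<open>The formal derivative of order \<open>U v\<close> in each variable \<open>v\<close>, in
  closed form. Its factor at \<open>v\<close> vanishes exactly if the derivative carries a
  nonnegative exponent \<open>m v + U v\<close> to a negative \<open>m v\<close>; all walls of the
  theory come from this.\<close>

definition Dop :: "('v::finite \<Rightarrow> nat) \<Rightarrow> 'v series \<Rightarrow> 'v series" where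
  "Dop U c m = (\<Prod>v\<in>UNIV. pochhammer (of_int (m v) + 1) (U v)) * c (\<lambda>v. m v + int (U v))"

lemma Dop_Dop: "Dop U (Dop V c) = Dop (\<lambda>v. U v + V v) c"
proof
  fix m
  show "Dop U (Dop V c) m = Dop (\<lambda>v. U v + V v) c m"
    by (simp add: Dop_def pochhammer_product' algebra_simps flip: prod.distrib)
qed

text \<open>The exponents of \<open>x\<close> and \<open>y\<close> in the monomial \<open>x^(-\<beta> - k) y^k\<close>.\<close>

definition idx :: "('n \<Rightarrow> int) \<Rightarrow> ('n \<Rightarrow> int) \<Rightarrow> 'n + 'n \<Rightarrow> int" where
  "idx \<beta> k = case_sum (\<lambda>i. - \<beta> i - k i) k"

definition rel_lattice :: "('n::finite \<Rightarrow> int ^ 'd) \<Rightarrow> ('n \<Rightarrow> int) set" where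
  "rel_lattice a = {d. (\<Sum>i\<in>UNIV. d i *s a i) = 0}"

definition hyper_series :: "('n::finite \<Rightarrow> int ^ 'd) \<Rightarrow> ('n \<Rightarrow> int) \<Rightarrow> int ^ 'd \<Rightarrow> ('n + 'n) series \<Rightarrow> bool" where
  "hyper_series a \<beta> \<gamma> c \<longleftrightarrow>
     (\<forall>m. c m \<noteq> 0 \<longrightarrow> (\<forall>i. m (Inl i) + m (Inr i) = - \<beta> i) \<and> (\<Sum>i\<in>UNIV. m (Inr i) *s a i) = - \<gamma>) \<and>
     (\<forall>u v. (\<Sum>i\<in>UNIV. int (u i) *s a i) = (\<Sum>i\<in>UNIV. int (v i) *s a i) \<longrightarrow>
        Dop (case_sum u v) c = Dop (case_sum v u) c)"

lemma sum_smult_comb: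
  "(\<Sum>i\<in>UNIV. (x * d i + y * e i) *s a i) = x *s (\<Sum>i\<in>UNIV. d i *s a i) + y *s (\<Sum>i\<in>UNIV. e i *s (a i :: int ^ 'd))"
  by (simp add: Finite_Cartesian_Product.vec_eq_iff sum.distrib sum_distrib_left algebra_simps)

lemma sum_smult_add: "(\<Sum>i\<in>UNIV. (d i + e i) *s a i) = (\<Sum>i\<in>UNIV. d i *s a i) + (\<Sum>i\<in>UNIV. e i *s (a i :: int ^ 'd))"
  by (simp add: Finite_Cartesian_Product.vec_eq_iff sum.distrib algebra_simps)

lemma sum_smult_diff: "(\<Sum>i\<in>UNIV. (d i - e i) *s a i) = (\<Sum>i\<in>UNIV. d i *s a i) - (\<Sum>i\<in>UNIV. e i *s (a i :: int ^ 'd))"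
  by (simp add: Finite_Cartesian_Product.vec_eq_iff sum_subtractf algebra_simps)

lemma closed_comb_rel_lattice: "closed_comb (rel_lattice a)"
  unfolding closed_comb_def rel_lattice_def mem_Collect_eq sum_smult_comb by simp

lemma prod_Plus_UNIV: "(\<Prod>v\<in>UNIV. f v) = (\<Prod>i\<in>UNIV. f (Inl i) * f (Inr (i :: 'n::finite)) :: complex)"
proof -
  have "(\<Prod>v\<in>UNIV. f v) = (\<Prod>v\<in>UNIV <+> UNIV. f v)" by (simp add: UNIV_Plus_UNIV)
  also have "\<dots> = (\<Prod>i\<in>UNIV. f (Inl i)) * (\<Prod>i\<in>UNIV. f (Inr i))"
    by (subst prod.Plus) auto
  finally show ?thesis by (simp add: prod.distrib)
qed

lemma hyper_series_Dop:
  assumes "hyper_series a \<beta> \<gamma> c"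
  shows "hyper_series a (\<lambda>i. \<beta> i + int (U (Inl i)) + int (U (Inr i)))
     (\<gamma> + (\<Sum>i\<in>UNIV. int (U (Inr i)) *s a i)) (Dop U c)"
  unfolding hyper_series_def
proof (intro conjI allI impI)
  fix m assume "Dop U c m \<noteq> 0"
  then have nz: "c (\<lambda>v. m v + int (U v)) \<noteq> 0" by (auto simp: Dop_def)
  show "m (Inl i) + m (Inr i) = - (\<beta> i + int (U (Inl i)) + int (U (Inr i)))" for i
  proof -
    have "(m (Inl i) + int (U (Inl i))) + (m (Inr i) + int (U (Inr i))) = - \<beta> i"
      using assms nz unfolding hyper_series_def by blast
    then show ?thesis by simp
  qed
  have "(\<Sum>i\<in>UNIV. (m (Inr i) + int (U (Inr i))) *s a i) = - \<gamma>"
    using assms nz unfolding hyper_series_def by blast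
  then have "(\<Sum>i\<in>UNIV. m (Inr i) *s a i) + (\<Sum>i\<in>UNIV. int (U (Inr i)) *s a i) = - \<gamma>"
    by (simp only: sum_smult_add)
  then show "(\<Sum>i\<in>UNIV. m (Inr i) *s a i) = - (\<gamma> + (\<Sum>i\<in>UNIV. int (U (Inr i)) *s a i))"
    by (simp add: algebra_simps eq_diff_eq)
next
  fix u v :: "'a \<Rightarrow> nat" assume "(\<Sum>i\<in>UNIV. int (u i) *s a i) = (\<Sum>i\<in>UNIV. int (v i) *s a i)"
  then have e: "Dop (case_sum u v) c = Dop (case_sum v u) c"
    using assms unfolding hyper_series_def by blast
  have "Dop (case_sum u v) (Dop U c) = Dop U (Dop (case_sum u v) c)"
    unfolding Dop_Dop by (simp add: add.commute)
  also have "\<dots> = Dop (case_sum v u) (Dop U c)"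
    unfolding e by (simp add: Dop_Dop add.commute)
  finally show "Dop (case_sum u v) (Dop U c) = Dop (case_sum v u) (Dop U c)" .
qed

lemma pochhammer_int_zero_iff:
  "pochhammer (of_int t + 1 :: complex) n = 0 \<longleftrightarrow> t < 0 \<and> 0 \<le> t + int n"
proof -
  have "(\<exists>k<n. of_int t + 1 = - (of_nat k :: complex)) \<longleftrightarrow> (\<exists>k<n. t = - 1 - int k)"
  proof -
    have "(of_int t + 1 = - (of_nat k :: complex)) = (t = - 1 - int k)" for k
    proof -
      have "(of_int t + 1 = - (of_nat k :: complex)) = ((of_int (t + 1) :: complex) = of_int (- int k))" by simp
      also have "\<dots> = (t + 1 = - int k)" by (rule of_int_eq_iff)
      finally show ?thesis by linarith
    qed
    then show ?thesis by simp
  qed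
  also have "\<dots> \<longleftrightarrow> t < 0 \<and> 0 \<le> t + int n"
  proof
    assume "t < 0 \<and> 0 \<le> t + int n"
    then show "\<exists>k<n. t = - 1 - int k" by (intro exI[of _ "nat (- 1 - t)"]) auto
  qed auto
  finally show ?thesis by (simp add: pochhammer_eq_0_iff)
qed

text \<open>The contribution of the pair \<open>x i\<close>, \<open>y i\<close> to the factor in
  front of the coefficient at \<open>k\<close> when a toric equation compares it with the one at
  \<open>K\<close>. Since \<open>nat\<close> truncates, at most one of the two Pochhammer symbols is
  nontrivial.\<close>

definition rel_factor :: "('n \<Rightarrow> int) \<Rightarrow> ('n \<Rightarrow> int) \<Rightarrow> ('n \<Rightarrow> int) \<Rightarrow> 'n \<Rightarrow> complex" where
  "rel_factor \<beta> k K i = pochhammer (of_int (- \<beta> i - max (k i) (K i)) + 1) (nat (K i - k i))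
      * pochhammer (of_int (min (k i) (K i)) + 1) (nat (k i - K i))"

text \<open>The difference \<open>K - k\<close> is split into its positive and negative part, which
  are the orders of the toric operator; reading the equation at the coordinatewise minimum of the
  two exponents isolates their coefficients.\<close>

lemma hyper_series_relation:
  assumes c: "hyper_series a \<beta> \<gamma> c" and kK: "(\<lambda>i. K i - k i) \<in> rel_lattice a"
  shows "c (idx \<beta> k) * (\<Prod>i\<in>UNIV. rel_factor \<beta> k K i) = c (idx \<beta> K) * (\<Prod>i\<in>UNIV. rel_factor \<beta> K k i)"
proof -
  define u where "u i = nat (K i - k i)" for i
  define v where "v i = nat (k i - K i)" for i
  have uv: "K i - k i = int (u i) - int (v i)" for i by (simp add: u_def v_def)
  have "(\<Sum>i\<in>UNIV. int (u i) *s a i) = (\<Sum>i\<in>UNIV. int (v i) *s a i)"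
    using kK unfolding rel_lattice_def mem_Collect_eq uv sum_smult_diff by simp
  then have e: "Dop (case_sum u v) c = Dop (case_sum v u) c" using c unfolding hyper_series_def by blast
  define m where "m = case_sum (\<lambda>i. - \<beta> i - max (k i) (K i)) (\<lambda>i. min (k i) (K i))"
  have 1: "(\<lambda>s. m s + int (case_sum u v s)) = idx \<beta> k"
    by (rule ext) (auto simp: m_def idx_def u_def v_def split: sum.splits)
  have 2: "(\<lambda>s. m s + int (case_sum v u s)) = idx \<beta> K"
    by (rule ext) (auto simp: m_def idx_def u_def v_def split: sum.splits)
  from fun_cong[OF e, of m] show ?thesis
    unfolding Dop_def 1 2 prod_Plus_UNIV
    by (simp add: rel_factor_def m_def u_def v_def max.commute min.commute mult.commute)
qed

lemma rel_factor_zero_iff: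
  "rel_factor \<beta> k K i = 0 \<longleftrightarrow> (K i > k i \<and> - \<beta> i - K i < 0 \<and> 0 \<le> - \<beta> i - k i) \<or> (K i < k i \<and> K i < 0 \<and> 0 \<le> k i)"
  unfolding rel_factor_def mult_eq_0_iff pochhammer_int_zero_iff by linarith

section \<open>Universal solutions of the recursion and pure exponents\<close>

text \<open>Let \<open>b \<ge> 1\<close>. For \<open>k \<ge> 0\<close> this is
  \<open>(b - 1)!\<close> times the coefficient of x^(-b-k) (y t)^k in the expansion of (x + y
  t)^(-b) in powers of \<open>y t\<close>; for \<open>k \<le> - b\<close> it is minus the same
  multiple of the coefficient in the expansion in powers of \<open>x\<close>. One formula for both
  makes the recursion hold across the walls.\<close>

definition nrm1 :: "int \<Rightarrow> int \<Rightarrow> complex" where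
  "nrm1 b k = (if even k then 1 else -1) * pochhammer (of_int k + 1) (nat (b - 1))"

lemma nrm1_zero_iff: "b \<ge> 1 \<Longrightarrow> nrm1 b k = 0 \<longleftrightarrow> - b < k \<and> k < 0"
  unfolding nrm1_def mult_eq_0_iff pochhammer_int_zero_iff by auto

text \<open>Reflection turns the \<open>x\<close> factor into \<open>(-1)^n\<close> times a rising
  factorial that starts where the one in \<open>nrm1\<close> ends. Both sides are then the product
  of the same \<open>e + n\<close> consecutive factors from \<open>k + 1\<close> on, cut at
  different places.\<close>

lemma nrm1_rel_aux:
  fixes k K b :: int
  assumes "b \<ge> 1" "k \<le> K"
  shows "nrm1 b k * pochhammer (of_int (- b - K) + 1) (nat (K - k))
      = nrm1 b K * pochhammer (of_int k + 1) (nat (K - k))"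
proof -
  define n where "n = nat (K - k)"
  define e where "e = nat (b - 1)"
  have K: "K = k + int n" using assms by (simp add: n_def)
  have b: "b = int e + 1" using assms by (simp add: e_def)
  define x :: complex where "x = of_int k + 1"
  have "pochhammer (of_int (- b - K) + 1) n = pochhammer (- (of_int (k + int n + int e) :: complex)) n"
    by (rule arg_cong2[of _ _ _ _ pochhammer]) (simp_all add: K b)
  also have "\<dots> = (-1) ^ n * pochhammer (of_int (k + int n + int e) - of_nat n + 1) n"
    by (rule pochhammer_minus)
  also have "of_int (k + int n + int e) - of_nat n + 1 = x + of_nat e"
    by (simp add: x_def)
  finally have 1: "pochhammer (of_int (- b - K) + 1) n = (-1) ^ n * pochhammer (x + of_nat e) n" .
  have 2: "pochhammer x e * pochhammer (x + of_nat e) n = pochhammer x n * pochhammer (x + of_nat n) e"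
    by (simp add: add.commute flip: pochhammer_product')
  have 3: "(if even K then 1 else -1 :: complex) = (if even k then 1 else -1) * (-1) ^ n"
    unfolding K by (auto simp: minus_one_power_iff)
  have 4: "of_int K + 1 = x + of_nat n" by (simp add: K x_def)
  have "nrm1 b k * pochhammer (of_int (- b - K) + 1) n
     = (if even k then 1 else -1) * (-1) ^ n * (pochhammer x e * pochhammer (x + of_nat e) n)"
    unfolding nrm1_def 1 by (simp add: x_def e_def)
  also have "\<dots> = nrm1 b K * pochhammer (of_int k + 1) n"
    unfolding 2 nrm1_def 3 4 by (simp add: x_def e_def)
  finally show ?thesis by (simp add: n_def)
qed

lemma nrm1_rel:
  assumes "\<beta> i \<ge> 1"
  shows "nrm1 (\<beta> i) (k i) * rel_factor \<beta> k K i = nrm1 (\<beta> i) (K i) * rel_factor \<beta> K k i"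
proof (cases "k i \<le> K i")
  case True
  then show ?thesis using nrm1_rel_aux[OF assms True] by (simp add: rel_factor_def)
next
  case False
  then show ?thesis using nrm1_rel_aux[OF assms, of "K i" "k i"] by (simp add: rel_factor_def)
qed

definition nrm :: "('n::finite \<Rightarrow> int) \<Rightarrow> ('n \<Rightarrow> int) \<Rightarrow> complex" where
  "nrm \<beta> k = (\<Prod>i\<in>UNIV. nrm1 (\<beta> i) (k i))"

text \<open>For \<open>\<beta> i \<ge> 1\<close>, exactly one exponent of each pair is negative. The
  excluded values are those where both are.\<close>

definition pure :: "('n \<Rightarrow> int) \<Rightarrow> ('n \<Rightarrow> int) \<Rightarrow> bool" where
  "pure \<beta> k \<longleftrightarrow> (\<forall>i. k i \<ge> 0 \<or> k i \<le> - \<beta> i)"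

lemma nrm_zero_iff: "(\<And>i. \<beta> i \<ge> 1) \<Longrightarrow> nrm \<beta> k = 0 \<longleftrightarrow> \<not> pure \<beta> k"
  unfolding nrm_def pure_def by (simp add: nrm1_zero_iff not_le not_less) (metis linorder_not_le)

text \<open>\<open>c\<close> and \<open>nrm\<close> obey the same two-term relations, and for equal
  sign patterns no wall separates \<open>k\<close> from \<open>K\<close>, so the factor cancelled at
  the end is nonzero.\<close>

lemma hyper_series_proportional:
  assumes c: "hyper_series a \<beta> \<gamma> c" and kK: "(\<lambda>i. K i - k i) \<in> rel_lattice a"
    and b: "\<And>i. \<beta> i \<ge> 1" and pure: "pure \<beta> k" "pure \<beta> K"
    and s: "\<And>i. k i \<ge> 0 \<longleftrightarrow> K i \<ge> 0"
  shows "c (idx \<beta> k) * nrm \<beta> K = c (idx \<beta> K) * nrm \<beta> k"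
proof -
  let ?A = "\<Prod>i\<in>UNIV. rel_factor \<beta> k K i" and ?B = "\<Prod>i\<in>UNIV. rel_factor \<beta> K k i"
  have B: "?B \<noteq> 0"
  proof -
    have "rel_factor \<beta> K k i \<noteq> 0" for i
      using s[of i] pure b[of i] unfolding rel_factor_zero_iff pure_def by (smt (verit))
    then show ?thesis by simp
  qed
  have n: "nrm \<beta> k * ?A = nrm \<beta> K * ?B"
    unfolding nrm_def prod.distrib[symmetric] by (intro prod.cong refl nrm1_rel b)
  have r: "c (idx \<beta> k) * ?A = c (idx \<beta> K) * ?B" by (rule hyper_series_relation[OF c kK])
  have "c (idx \<beta> k) * nrm \<beta> K * ?B = c (idx \<beta> k) * (nrm \<beta> k * ?A)" by (simp add: n)
  also have "\<dots> = nrm \<beta> k * (c (idx \<beta> k) * ?A)" by simp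
  also have "\<dots> = c (idx \<beta> K) * nrm \<beta> k * ?B" unfolding r by simp
  finally show ?thesis using B by simp
qed

lemma hyper_series_idx:
  assumes "hyper_series a \<beta> \<gamma> c" "c m \<noteq> 0"
  shows "m = idx \<beta> (\<lambda>i. m (Inr i))" "(\<Sum>i\<in>UNIV. m (Inr i) *s a i) = - \<gamma>"
proof -
  have h: "\<And>i. m (Inl i) + m (Inr i) = - \<beta> i" "(\<Sum>i\<in>UNIV. m (Inr i) *s a i) = - \<gamma>"
    using assms unfolding hyper_series_def by blast+
  show "m = idx \<beta> (\<lambda>i. m (Inr i))"
  proof
    fix s show "m s = idx \<beta> (\<lambda>i. m (Inr i)) s"
      using h(1) by (cases s) (auto simp: idx_def algebra_simps eq_diff_eq)
  qed
  show "(\<Sum>i\<in>UNIV. m (Inr i) *s a i) = - \<gamma>" by fact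
qed

text \<open>A type records for each coordinate whether the value is nonnegative, at most
  \<open>- \<beta> i\<close>, or which value in between it is. Only finitely many types occur, so
  chosen representatives are bounded. An exponent far out lies beyond the representative
  \<open>r\<close> of its type, and \<open>k - r\<close> points strictly outwards and is 0 at the
  values in between.\<close>

lemma type_representatives:
  fixes S :: "('n::finite \<Rightarrow> int) set" and \<beta> :: "'n \<Rightarrow> int"
  shows "\<exists>M0\<ge>0. \<forall>M\<ge>M0. \<forall>k\<in>S. (\<forall>i. k i \<ge> M \<or> k i \<le> - \<beta> i - M \<or> (k i < 0 \<and> - \<beta> i < k i)) \<longrightarrow>
     (\<exists>r\<in>S. \<forall>i. (k i \<ge> 0 \<and> r i < k i) \<or> (k i \<le> - \<beta> i \<and> k i < 0 \<and> r i > k i) \<or> (k i < 0 \<and> - \<beta> i < k i \<and> r i = k i))"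
proof -
  define t :: "('n \<Rightarrow> int) \<Rightarrow> 'n \<Rightarrow> int \<times> int" where
    "t k i = (if k i \<ge> 0 then (1, 0) else if k i \<le> - \<beta> i then (2, 0) else (3, k i))" for k i
  define B where "B = (\<Sum>i\<in>UNIV. \<bar>\<beta> i\<bar>)"
  have B: "\<bar>\<beta> i\<bar> \<le> B" for i unfolding B_def by (rule member_le_sum) auto
  have "t ` S \<subseteq> Pi\<^sub>E UNIV (\<lambda>_. {1..3} \<times> {-B..0})"
  proof (rule image_subsetI)
    fix k
    have "t k i \<in> {1..3} \<times> {-B..0}" for i using B[of i] by (auto simp: t_def)
    then show "t k \<in> Pi\<^sub>E UNIV (\<lambda>_. {1..3} \<times> {-B..0})" by (simp add: PiE_UNIV_domain)
  qed
  moreover have "finite (Pi\<^sub>E (UNIV :: 'n set) (\<lambda>_. {1..3::int} \<times> {-B..0}))"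
    by (simp add: finite_PiE)
  ultimately have fin: "finite (t ` S)" by (rule finite_subset)
  define r where "r = inv_into S t"
  have r: "r x \<in> S" "t (r x) = x" if "x \<in> t ` S" for x
    unfolding r_def by (rule inv_into_into[OF that], rule f_inv_into_f[OF that])
  define M1 where "M1 = (\<Sum>x\<in>t ` S. \<Sum>i\<in>UNIV. \<bar>r x i\<bar>)"
  have M1: "\<bar>r x i\<bar> \<le> M1" if "x \<in> t ` S" for x i
  proof -
    have "\<bar>r x i\<bar> \<le> (\<Sum>i\<in>UNIV. \<bar>r x i\<bar>)" by (rule member_le_sum) auto
    also have "\<dots> \<le> M1" unfolding M1_def
      by (rule member_le_sum[OF that _ fin]) (auto intro: sum_nonneg)
    finally show ?thesis .
  qed
  have pos: "M1 \<ge> 0" "B \<ge> 0" by (auto simp: M1_def B_def intro!: sum_nonneg)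
  show ?thesis
  proof (intro exI[of _ "M1 + B + 1"] conjI allI impI ballI)
    fix M k assume M: "M1 + B + 1 \<le> M" and k: "k \<in> S"
      and ty: "\<forall>i. M \<le> k i \<or> k i \<le> - \<beta> i - M \<or> k i < 0 \<and> - \<beta> i < k i"
    have tk: "t k \<in> t ` S" using k by blast
    show "\<exists>r\<in>S. \<forall>i. (k i \<ge> 0 \<and> r i < k i) \<or> (k i \<le> - \<beta> i \<and> k i < 0 \<and> r i > k i) \<or> (k i < 0 \<and> - \<beta> i < k i \<and> r i = k i)"
    proof (rule bexI[OF _ r(1)[OF tk]], rule allI)
      fix i
      have e: "t (r (t k)) i = t k i" using r(2)[OF tk] by simp
      have b: "\<bar>r (t k) i\<bar> \<le> M1" by (rule M1[OF tk])
      show "(k i \<ge> 0 \<and> r (t k) i < k i) \<or> (k i \<le> - \<beta> i \<and> k i < 0 \<and> r (t k) i > k i)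
          \<or> (k i < 0 \<and> - \<beta> i < k i \<and> r (t k) i = k i)"
        using e b B[of i] M ty[rule_format, of i] pos unfolding t_def by (auto split: if_splits)
    qed
  qed (use pos in simp)
qed

locale no_coloop_vectors =
  fixes a :: "'n::finite \<Rightarrow> int ^ 'd"
  assumes no_coloop_rel: "\<And>i. \<exists>e\<in>rel_lattice a. e i > 0"
begin

text \<open>
  Moving from \<open>k\<close> far along \<open>d\<close>, and along a relation that is positive at \<open>i\<close>, the exponent of \<open>y i\<close>
  crosses \<open>0\<close>, where the recursion loses the coefficient, while no other exponent changes its sign.
\<close>

lemma mixed_coefficient_vanishes:
  assumes c: "hyper_series a \<beta> \<gamma> c" and d: "d \<in> rel_lattice a"
    and dk: "\<And>j. (k j \<ge> 0 \<and> - \<beta> j < k j \<and> d j > 0) \<or> (k j \<le> - \<beta> j \<and> k j < 0 \<and> d j < 0) \<or> (k j < 0 \<and> - \<beta> j < k j \<and> d j = 0)"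
    and i: "k i < 0" "- \<beta> i < k i"
  shows "c (idx \<beta> k) = 0"
proof -
  obtain e where e: "e \<in> rel_lattice a" "e i > 0" using no_coloop_rel by blast
  define s where "s = (\<Sum>j\<in>UNIV. \<bar>k i\<bar> * \<bar>e j\<bar>) + 1"
  have s: "\<bar>k i * e j\<bar> < s" for j
  proof -
    have "\<bar>k i\<bar> * \<bar>e j\<bar> \<le> (\<Sum>j\<in>UNIV. \<bar>k i\<bar> * \<bar>e j\<bar>)" by (rule member_le_sum) auto
    then show ?thesis by (simp add: s_def abs_mult)
  qed
  have "s > 0" using s[of i] by linarith
  \<comment> \<open>Since \<open>d i = 0\<close> and \<open>e i \<ge> 1\<close>, the multiple
    \<open>- k i\<close> of \<open>e\<close> lifts entry \<open>i\<close> to at least 0. Wherever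
    \<open>d j\<close> is nonzero, \<open>s * d j\<close> outweighs that multiple of
    \<open>e\<close>.\<close>
  define K where "K j = k j + (s * d j + (- k i) * e j)" for j
  have "(\<lambda>j. K j - k j) \<in> rel_lattice a"
    unfolding K_def using closed_comb2[OF closed_comb_rel_lattice d e(1), of s "- k i"] by simp
  note rel = hyper_series_relation[OF c this]
  have up: "K j \<ge> k j" if "d j > 0" for j
  proof -
    have "s * d j \<ge> s * 1" using that \<open>s > 0\<close> by (intro mult_left_mono) auto
    then show ?thesis using s[of j] by (auto simp: K_def)
  qed
  have dn: "K j \<le> k j" if "d j < 0" for j
  proof -
    have "s * d j \<le> s * (-1)" using that \<open>s > 0\<close> by (intro mult_left_mono) auto
    then show ?thesis using s[of j] by (auto simp: K_def)
  qed
  have "(- k i) * e i \<ge> (- k i) * 1" using e(2) i by (intro mult_left_mono) auto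
  then have Ki: "K i \<ge> 0" using dk[of i] i by (auto simp: K_def)
  have "rel_factor \<beta> K k i = 0" using Ki i by (simp add: rel_factor_zero_iff)
  then have B: "(\<Prod>i\<in>UNIV. rel_factor \<beta> K k i) = 0" by (meson finite prod_zero UNIV_I)
  \<comment> \<open>At coordinates with \<open>d j = 0\<close> both exponents of \<open>k\<close>
    are negative already, and lowering a negative exponent never produces a zero factor, wherever
    \<open>K j\<close> lies.\<close>
  have "rel_factor \<beta> k K j \<noteq> 0" for j
    using dk[of j] up[of j] dn[of j] unfolding rel_factor_zero_iff by (elim disjE) auto
  then have "(\<Prod>i\<in>UNIV. rel_factor \<beta> k K i) \<noteq> 0" by simp
  then show ?thesis using rel unfolding B by simp
qed

text \<open>\<open>M\<close> derivatives in every variable annihilate the exponents of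
  \<open>c\<close> in \<open>[0, M)\<close>. The survivors are so far from the walls that
  \<open>type_representatives\<close> supplies an outward relation \<open>d\<close>; with it,
  \<open>mixed_coefficient_vanishes\<close> excludes pairs with two negative exponents. The same
  \<open>d\<close> shows that the sign pattern of a pure exponent is realised by a relation without
  zeros.\<close>

theorem derivative_support:
  assumes c: "hyper_series a \<beta> \<gamma> c"
  obtains M :: nat where "\<And>i. \<beta> i + 2 * int M \<ge> 1"
    "\<And>m. Dop (\<lambda>_. M) c m \<noteq> 0 \<Longrightarrow> pure (\<lambda>i. \<beta> i + 2 * int M) (\<lambda>i. m (Inr i))"
    "\<And>k. pure (\<lambda>i. \<beta> i + 2 * int M) k \<Longrightarrow> (\<Sum>i\<in>UNIV. k i *s a i) = - (\<gamma> + (\<Sum>i\<in>UNIV. int M *s a i)) \<Longrightarrow>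
        \<exists>d\<in>rel_lattice a. \<forall>i. (k i \<ge> 0 \<and> d i > 0) \<or> (k i < 0 \<and> d i < 0)"
proof -
  define S where "S = {k. (\<Sum>i\<in>UNIV. k i *s a i) = - \<gamma>}"
  obtain M0 where M0: "M0 \<ge> 0" "\<forall>M\<ge>M0. \<forall>k\<in>S.
      (\<forall>i. k i \<ge> M \<or> k i \<le> - \<beta> i - M \<or> (k i < 0 \<and> - \<beta> i < k i)) \<longrightarrow>
     (\<exists>r\<in>S. \<forall>i. (k i \<ge> 0 \<and> r i < k i) \<or> (k i \<le> - \<beta> i \<and> k i < 0 \<and> r i > k i) \<or> (k i < 0 \<and> - \<beta> i < k i \<and> r i = k i))"
    using type_representatives[where \<beta> = \<beta> and S = S] by (elim exE conjE)
  define B where "B = (\<Sum>i\<in>UNIV. \<bar>\<beta> i\<bar>)"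
  have B: "\<bar>\<beta> i\<bar> \<le> B" for i unfolding B_def by (rule member_le_sum) auto
  have "B \<ge> 0" by (auto simp: B_def intro!: sum_nonneg)
  \<comment> \<open>\<open>M0\<close> reaches beyond the representatives; the surplus over
    \<open>B\<close> makes \<open>\<beta> i + 2 * M\<close> positive even for negative
    \<open>\<beta> i\<close>.\<close>
  define M where "M = nat (M0 + B + 1)"
  have M: "int M = M0 + B + 1" using M0(1) \<open>B \<ge> 0\<close> by (simp add: M_def)
  define \<beta>' where "\<beta>' = (\<lambda>i. \<beta> i + 2 * int M)"
  have far: "\<exists>d\<in>rel_lattice a. \<forall>i. (k i \<ge> 0 \<and> - \<beta> i < k i \<and> d i > 0) \<or> (k i \<le> - \<beta> i \<and> k i < 0 \<and> d i < 0) \<or> (k i < 0 \<and> - \<beta> i < k i \<and> d i = 0)"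
    if k: "k \<in> S" "\<forall>i. k i \<ge> int M \<or> k i \<le> - \<beta> i - int M \<or> (k i < 0 \<and> - \<beta> i < k i)" for k
  proof -
    have "int M \<ge> M0" using M \<open>B \<ge> 0\<close> by simp
    from M0(2)[rule_format, OF this k(1) k(2)[rule_format]] obtain r where r: "r \<in> S"
      "\<And>i. (k i \<ge> 0 \<and> r i < k i) \<or> (k i \<le> - \<beta> i \<and> k i < 0 \<and> r i > k i) \<or> (k i < 0 \<and> - \<beta> i < k i \<and> r i = k i)" by blast
    have "(\<lambda>i. k i - r i) \<in> rel_lattice a"
      using r(1) k(1) unfolding S_def rel_lattice_def mem_Collect_eq sum_smult_diff by simp
    moreover have "(k i \<ge> 0 \<and> - \<beta> i < k i \<and> k i - r i > 0) \<or> (k i \<le> - \<beta> i \<and> k i < 0 \<and> k i - r i < 0) \<or> (k i < 0 \<and> - \<beta> i < k i \<and> k i - r i = 0)" for i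
      using r(2)[of i] k(2)[rule_format, of i] B[of i] M M0(1) by (smt (verit))
    ultimately show ?thesis by (intro bexI[of _ "\<lambda>i. k i - r i"]) blast+
  qed
  show thesis
  proof (rule that[of M])
    show "\<beta> i + 2 * int M \<ge> 1" for i using B[of i] M M0(1) by linarith
  next
    fix m assume nz: "Dop (\<lambda>_. M) c m \<noteq> 0"
    then have cm: "c (\<lambda>v. m v + int M) \<noteq> 0"
      and p: "\<And>v. \<not> (m v < 0 \<and> 0 \<le> m v + int M)"
      by (auto simp: Dop_def pochhammer_int_zero_iff)
    define k where "k = (\<lambda>i. m (Inr i) + int M)"
    have id: "(\<lambda>v. m v + int M) = idx \<beta> k" and kS: "k \<in> S"
      using hyper_series_idx[OF c cm] by (simp_all add: k_def S_def)
    have il: "m (Inl i) = - \<beta> i - k i - int M" for i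
      using fun_cong[OF id, of "Inl i"] by (simp add: idx_def)
    have ty: "\<forall>i. k i \<ge> int M \<or> k i \<le> - \<beta> i - int M \<or> (k i < 0 \<and> - \<beta> i < k i)"
    proof
      fix i
      show "k i \<ge> int M \<or> k i \<le> - \<beta> i - int M \<or> (k i < 0 \<and> - \<beta> i < k i)"
        using p[of "Inl i"] p[of "Inr i"] il[of i] by (auto simp: k_def)
    qed
    from far[OF kS ty] obtain d where d: "d \<in> rel_lattice a"
      "\<And>i. (k i \<ge> 0 \<and> - \<beta> i < k i \<and> d i > 0) \<or> (k i \<le> - \<beta> i \<and> k i < 0 \<and> d i < 0) \<or> (k i < 0 \<and> - \<beta> i < k i \<and> d i = 0)" by blast
    have "\<not> (k i < 0 \<and> - \<beta> i < k i)" for i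
    proof
      assume "k i < 0 \<and> - \<beta> i < k i"
      then have "c (idx \<beta> k) = 0" by (intro mixed_coefficient_vanishes[OF c d]) auto
      then show False using cm id by simp
    qed
    then show "pure (\<lambda>i. \<beta> i + 2 * int M) (\<lambda>i. m (Inr i))"
      unfolding pure_def using ty by (force simp: k_def)
  next
    fix k assume k: "pure (\<lambda>i. \<beta> i + 2 * int M) k" "(\<Sum>i\<in>UNIV. k i *s a i) = - (\<gamma> + (\<Sum>i\<in>UNIV. int M *s a i))"
    have kS: "(\<lambda>i. k i + int M) \<in> S"
      unfolding S_def mem_Collect_eq sum_smult_add k(2) by simp
    have ty: "k i + int M \<ge> int M \<or> k i + int M \<le> - \<beta> i - int M" for i
      using k(1) unfolding pure_def by (auto dest!: spec[of _ i])
    from far[OF kS] ty obtain d where d: "d \<in> rel_lattice a"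
      "\<And>i. (k i + int M \<ge> 0 \<and> - \<beta> i < k i + int M \<and> d i > 0) \<or> (k i + int M \<le> - \<beta> i \<and> k i + int M < 0 \<and> d i < 0) \<or> (k i + int M < 0 \<and> - \<beta> i < k i + int M \<and> d i = 0)"
      by blast
    have "(k i \<ge> 0 \<and> d i > 0) \<or> (k i < 0 \<and> d i < 0)" for i
      using d(2)[of i] ty[of i] B[of i] M M0(1) by linarith
    then show "\<exists>d\<in>rel_lattice a. \<forall>i. (k i \<ge> 0 \<and> d i > 0) \<or> (k i < 0 \<and> d i < 0)" using d(1) by blast
  qed
qed

end

definition weight_diff :: "('n + 'n \<Rightarrow> int) \<Rightarrow> 'n \<Rightarrow> int" where
  "weight_diff w i = w (Inr i) - w (Inl i)"

lemma wt_idx: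
  fixes k :: "'n::finite \<Rightarrow> int"
  shows "wt w (idx \<beta> k) = wt (weight_diff w) k - (\<Sum>i\<in>UNIV. w (Inl i) * \<beta> i)"
proof -
  have "wt w (idx \<beta> k) = (\<Sum>v\<in>UNIV <+> UNIV. w v * idx \<beta> k v)" by (simp add: UNIV_Plus_UNIV wt_def)
  also have "\<dots> = (\<Sum>i\<in>UNIV. w (Inl i) * (- \<beta> i - k i)) + (\<Sum>i\<in>UNIV. w (Inr i) * k i)"
    by (subst sum.Plus) (auto simp: idx_def)
  finally show ?thesis
    by (simp add: wt_def weight_diff_def algebra_simps sum.distrib sum_subtractf sum_negf)
qed

text \<open>Zero counts as positive, because the wall of an exponent lies between -1 and 0.\<close>

definition sg :: "('n \<Rightarrow> int) \<Rightarrow> 'n \<Rightarrow> int" where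
  "sg k i = (if k i \<ge> 0 then 1 else -1)"

text \<open>The universal solution restricted to one cobasis cone. The exponents fill a coset of the
  lattice, not the lattice, hence the detour through \<open>sg\<close>: only signs enter
  \<open>sign_cone\<close>, so its argument need not be a relation.\<close>

definition residue_series :: "('n::finite + 'n \<Rightarrow> int) \<Rightarrow> ('n \<Rightarrow> int ^ 'd) \<Rightarrow> ('n \<Rightarrow> int) \<Rightarrow> int ^ 'd \<Rightarrow> 'n set \<Rightarrow> ('n + 'n) series" where
  "residue_series w a \<beta> \<gamma> J m =
     (if (\<forall>i. m (Inl i) + m (Inr i) = - \<beta> i) \<and> (\<Sum>i\<in>UNIV. m (Inr i) *s a i) = - \<gamma>
      then nrm \<beta> (\<lambda>i. m (Inr i)) * of_bool (sign_cone (weight_diff w) (rel_lattice a) J (sg (\<lambda>i. m (Inr i)))) else 0)"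

text \<open>\<open>H d\<close> is the constant ratio of \<open>c\<close> to \<open>nrm\<close> over
  the pure exponents with the signs of \<open>d\<close>. Boundedness of \<open>c\<close> gives the
  positivity of \<open>H\<close>, and \<open>full\<close> ensures that the pattern of each pure
  exponent is that of a relation, where the decomposition of \<open>H\<close> can be read.\<close>

theorem series_decomposition:
  fixes a :: "'n::finite \<Rightarrow> int ^ 'd"
  assumes c: "hyper_series a \<beta> \<gamma> c" "bdd w c"
    and b: "\<And>i. \<beta> i \<ge> 1"
    and supp: "\<And>m. c m \<noteq> 0 \<Longrightarrow> pure \<beta> (\<lambda>i. m (Inr i))"
    and full: "\<And>k. pure \<beta> k \<Longrightarrow> (\<Sum>i\<in>UNIV. k i *s a i) = - \<gamma> \<Longrightarrow>
        \<exists>d\<in>rel_lattice a. \<forall>i. (k i \<ge> 0 \<and> d i > 0) \<or> (k i < 0 \<and> d i < 0)"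
    and gen: "\<And>e. elementary (rel_lattice a) UNIV e \<Longrightarrow> wt (weight_diff w) e \<noteq> 0"
  shows "\<exists>x. c = (\<lambda>m. \<Sum>J | cobasis (rel_lattice a) J. x J * residue_series w a \<beta> \<gamma> J m)"
proof -
  let ?L = "rel_lattice a"
  define C where "C d = {k. (\<Sum>i\<in>UNIV. k i *s a i) = - \<gamma> \<and> pure \<beta> k \<and> (\<forall>i. k i \<ge> 0 \<longleftrightarrow> d i > 0)}" for d :: "'n \<Rightarrow> int"
  define H where "H d = (if C d = {} then 0 else c (idx \<beta> (SOME k. k \<in> C d)) / nrm \<beta> (SOME k. k \<in> C d))" for d
  have cprop: "c (idx \<beta> k) * nrm \<beta> K = c (idx \<beta> K) * nrm \<beta> k" if "k \<in> C d" "K \<in> C d" for k K d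
  proof (rule hyper_series_proportional[OF c(1) _ b])
    show "(\<lambda>i. K i - k i) \<in> ?L"
      using that unfolding C_def rel_lattice_def mem_Collect_eq sum_smult_diff by simp
  qed (use that in \<open>auto simp: C_def\<close>)
  have nz: "nrm \<beta> k \<noteq> 0" if "k \<in> C d" for k d using that nrm_zero_iff[of \<beta>, OF b] by (auto simp: C_def)
  have H: "H d = c (idx \<beta> k) / nrm \<beta> k" if "k \<in> C d" for k d
  proof -
    have s: "(SOME k. k \<in> C d) \<in> C d" by (rule someI[of "\<lambda>k. k \<in> C d", OF that])
    have "C d \<noteq> {}" using that by blast
    then have "H d = c (idx \<beta> (SOME k. k \<in> C d)) / nrm \<beta> (SOME k. k \<in> C d)" by (simp add: H_def)
    also have "\<dots> = c (idx \<beta> k) / nrm \<beta> k"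
      using cprop[OF that s] nz[OF that] nz[OF s] by (simp add: frac_eq_eq)
    finally show ?thesis .
  qed
  have "\<exists>x. \<forall>d\<in>?L. (\<forall>j\<in>UNIV. d j \<noteq> 0) \<longrightarrow>
           H d = (\<Sum>J | J \<subseteq> UNIV \<and> cobasis ?L J. x J * of_bool (sign_cone (weight_diff w) ?L J d))"
  proof (rule sign_cone_decomposition[OF closed_comb_rel_lattice])
    show "spanning ?L UNIV" by (auto simp: spanning_def)
    show "wt (weight_diff w) e \<noteq> 0" if "elementary ?L UNIV e" for e using gen that .
    show "H d = H d'" if "\<And>j. j \<in> UNIV \<Longrightarrow> d j \<noteq> 0 \<and> sgn (d j) = sgn (d' j)" for d d' :: "'n \<Rightarrow> int"
    proof -
      have "(d j > 0) = (d' j > 0)" for j using that[of j] by (auto simp: sgn_if split: if_splits)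
      then have "C d = C d'" by (simp add: C_def)
      then show ?thesis by (simp add: H_def)
    qed
    show "wt (weight_diff w) e \<ge> 0"
      if d: "d \<in> ?L" "\<And>j. j \<in> UNIV \<Longrightarrow> d j \<noteq> 0" "H d \<noteq> 0" and e: "e \<in> ?L" "\<And>j. j \<in> UNIV \<Longrightarrow> d j * e j \<ge> 0" for d e
    proof (rule ccontr)
      assume neg: "\<not> wt (weight_diff w) e \<ge> 0"
      obtain k where k: "k \<in> C d" using d(3) by (auto simp: H_def split: if_splits)
      have ck: "c (idx \<beta> k) \<noteq> 0" using H[OF k] d(3) by auto
      obtain l where l: "\<And>m. c m \<noteq> 0 \<Longrightarrow> l \<le> wt w m" using c(2) unfolding bdd_def by blast
      \<comment> \<open>From \<open>k\<close>, going \<open>s\<close> times along a relation of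
        negative weight stays in the same sign pattern, where coefficients are nonzero, but passes
        the lower bound \<open>l\<close>.\<close>
      define s where "s = \<bar>wt w (idx \<beta> k) - l\<bar> + 1"
      define K where "K i = k i + s * e i" for i
      have "K \<in> C d"
      proof -
        have "(\<Sum>i\<in>UNIV. K i *s a i) = - \<gamma>"
        proof -
          have "(\<lambda>i. s * e i) \<in> ?L" by (rule closed_comb_scale[OF closed_comb_rel_lattice e(1)])
          then show ?thesis using k unfolding K_def sum_smult_add rel_lattice_def C_def by simp
        qed
        moreover have "(K i \<ge> 0 \<or> K i \<le> - \<beta> i) \<and> (K i \<ge> 0 \<longleftrightarrow> d i > 0)" for i
        proof (cases "d i > 0")
          case True
          then have "e i \<ge> 0" using e(2)[of i] by (simp add: zero_le_mult_iff)
          then have "s * e i \<ge> 0" by (simp add: s_def)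
          moreover have "k i \<ge> 0" using k True by (simp add: C_def)
          ultimately show ?thesis using True by (simp add: K_def)
        next
          case False
          then have "d i < 0" using d(2)[of i] by auto
          then have "e i \<le> 0" using e(2)[of i] by (simp add: zero_le_mult_iff)
          then have "s * e i \<le> 0" by (simp add: s_def mult_le_0_iff)
          moreover have "k i < 0" "k i \<le> - \<beta> i" using k False by (auto simp: C_def pure_def not_le[symmetric])
          ultimately show ?thesis using False by (simp add: K_def)
        qed
        ultimately show ?thesis unfolding C_def pure_def by blast
      qed
      then have "c (idx \<beta> K) \<noteq> 0" using cprop[OF k, of K] ck nz[of K d] by auto
      then have "l \<le> wt w (idx \<beta> K)" by (rule l)
      also have "wt w (idx \<beta> K) = wt w (idx \<beta> k) + s * wt (weight_diff w) e"
        unfolding wt_idx K_def by (simp add: wt_def sum.distrib sum_distrib_left algebra_simps)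
      also have "s * wt (weight_diff w) e \<le> s * (-1)" using neg by (intro mult_left_mono) (auto simp: s_def)
      finally show False by (simp add: s_def)
    qed
  qed
  then obtain x where x: "\<And>d. d \<in> ?L \<Longrightarrow> (\<And>j. d j \<noteq> 0) \<Longrightarrow>
      H d = (\<Sum>J | cobasis ?L J. x J * of_bool (sign_cone (weight_diff w) ?L J d))" by auto
  have "c m = (\<Sum>J | cobasis ?L J. x J * residue_series w a \<beta> \<gamma> J m)" for m
  proof (cases "(\<forall>i. m (Inl i) + m (Inr i) = - \<beta> i) \<and> (\<Sum>i\<in>UNIV. m (Inr i) *s a i) = - \<gamma>")
    case False
    then have "c m = 0" using c(1) unfolding hyper_series_def by blast
    then show ?thesis unfolding residue_series_def if_not_P[OF False] by simp
  next
    case True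
    define k where "k = (\<lambda>i. m (Inr i))"
    have m: "m = idx \<beta> k"
    proof
      fix s show "m s = idx \<beta> k s"
        using True by (cases s) (auto simp: idx_def k_def algebra_simps eq_diff_eq)
    qed
    have rs: "residue_series w a \<beta> \<gamma> J m = nrm \<beta> k * of_bool (sign_cone (weight_diff w) ?L J (sg k))" for J
      unfolding residue_series_def k_def if_P[OF True] ..
    show ?thesis
    proof (cases "pure \<beta> k")
      case False
      then have "c m = 0" "nrm \<beta> k = 0" using supp nrm_zero_iff[of \<beta>, OF b] by (auto simp: k_def)
      then show ?thesis unfolding rs by simp
    next
      case pk: True
      obtain d where d: "d \<in> ?L" "\<And>i. (k i \<ge> 0 \<and> d i > 0) \<or> (k i < 0 \<and> d i < 0)"
        using full[OF pk] True unfolding k_def by (elim conjE) blast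
      have kC: "k \<in> C d" using True pk d(2) by (force simp: C_def k_def)
      have cone: "sign_cone (weight_diff w) ?L J d = sign_cone (weight_diff w) ?L J (sg k)" for J
      proof (rule sign_cone_sgn_cong)
        fix j show "sgn (d j) = sgn (sg k j)" using d(2)[of j] by (auto simp: sg_def)
      qed
      have "H d = (\<Sum>J | cobasis ?L J. x J * of_bool (sign_cone (weight_diff w) ?L J (sg k)))"
      proof -
        have "d i \<noteq> 0" for i using d(2)[of i] by auto
        from x[OF d(1) this] show ?thesis unfolding cone .
      qed
      then have "c m / nrm \<beta> k = (\<Sum>J | cobasis ?L J. x J * of_bool (sign_cone (weight_diff w) ?L J (sg k)))"
        using H[OF kC] m by simp
      then have "c m = nrm \<beta> k * (\<Sum>J | cobasis ?L J. x J * of_bool (sign_cone (weight_diff w) ?L J (sg k)))"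
        using nz[OF kC] by (simp add: field_simps)
      then show ?thesis unfolding rs by (simp only: sum_distrib_left mult.left_commute)
    qed
  qed
  then show ?thesis by blast
qed

section \<open>Expansion of residue sums\<close>

definition lmono :: "('v::finite \<Rightarrow> int) \<Rightarrow> ('v \<Rightarrow> complex) \<Rightarrow> complex" where
  "lmono m z = (\<Prod>v\<in>UNIV. z v powi m v)"

definition trans_series :: "('v \<Rightarrow> int) \<Rightarrow> 'v series \<Rightarrow> 'v series" where
  "trans_series m c = (\<lambda>n. c (\<lambda>v. n v - m v))"

lemma lmono_add: "(\<And>v. z v \<noteq> 0) \<Longrightarrow> lmono (\<lambda>v. m v + n v) z = lmono m z * lmono n z"
  by (simp add: lmono_def power_int_add prod.distrib)

lemma trans_series_trans: "trans_series m (trans_series n c) = trans_series (\<lambda>v. m v + n v) c"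
  by (simp add: trans_series_def algebra_simps)

lemma pol_lmono:
  assumes "\<And>v. m v \<ge> 0"
  shows "pol (lmono m) (trans_series m)"
proof -
  have pw: "pol (\<lambda>z. z v ^ n) (trans_series (\<lambda>u. if u = v then int n else 0))" for v :: 'a and n
  proof (induction n)
    case 0
    have "trans_series (\<lambda>u. if u = v then int 0 else 0) = (\<lambda>c :: 'a series. c)"
      by (intro ext) (simp add: trans_series_def if_distrib cong: if_cong)
    then show ?case using pol_1 by simp
  next
    case (Suc n)
    have e: "shift v c = trans_series (\<lambda>u. if u = v then 1 else 0) c" for c :: "'a series"
    proof
      fix m :: "'a \<Rightarrow> int"
      have "m(v := m v - 1) = (\<lambda>u. m u - (if u = v then 1 else 0))" by auto
      then show "shift v c m = trans_series (\<lambda>u. if u = v then 1 else 0) c m"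
        by (simp add: shift_def trans_series_def)
    qed
    have s: "(\<lambda>u. (if u = v then 1 else 0) + (if u = v then int n else 0)) = (\<lambda>u. if u = v then int (Suc n) else 0)" by auto
    from pol_mult[OF pol_var[of v] Suc] show ?case unfolding e trans_series_trans s by simp
  qed
  have "pol (\<lambda>z. \<Prod>v\<in>S. z v ^ nat (m v)) (trans_series (\<lambda>u. if u \<in> S then m u else 0))" if "finite S" for S
    using that
  proof (induction S rule: finite_induct)
    case empty
    show ?case using pol_1 by (simp add: trans_series_def)
  next
    case (insert x F)
    have s: "(\<lambda>u. (if u = x then int (nat (m x)) else 0) + (if u \<in> F then m u else 0)) = (\<lambda>u. if u \<in> insert x F then m u else 0)"
      using insert.hyps assms by auto
    from pol_mult[OF pw[of x "nat (m x)"] insert.IH] insert.hyps show ?case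
      unfolding trans_series_trans s by simp
  qed
  from this[of UNIV] have "pol (\<lambda>z. \<Prod>v\<in>UNIV. z v ^ nat (m v)) (trans_series m)" by simp
  moreover have "(\<lambda>z. \<Prod>v\<in>UNIV. z v ^ nat (m v)) = lmono m"
    by (rule ext) (simp add: lmono_def power_int_def assms)
  ultimately show ?thesis by simp
qed

lemma bdd_trans_series:
  assumes "bdd w c" shows "bdd w (trans_series m c)"
proof -
  obtain L where L: "\<And>n. c n \<noteq> 0 \<Longrightarrow> L \<le> wt w n" using assms unfolding bdd_def by blast
  have "L + wt w m \<le> wt w n" if "trans_series m c n \<noteq> 0" for n
    using L[of "\<lambda>v. n v - m v"] that by (simp add: trans_series_def wt_diff)
  then show ?thesis unfolding bdd_def by blast
qed

lemma reg_op_trans_series: "reg_op w (trans_series m)"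
  unfolding reg_op_def
proof (intro allI impI ext)
  fix c n assume "trans_series m c = (\<lambda>_. 0)"
  from fun_cong[OF this, of "\<lambda>v. n v + m v"] show "c n = 0" by (simp add: trans_series_def)
qed

text \<open>If the two shifted copies of \<open>c\<close> cancel, every nonzero coefficient is
  matched by another one of strictly smaller weight, and the descent contradicts
  boundedness.\<close>

lemma reg_op_binomial:
  assumes w: "wt w m \<noteq> wt w n" and s: "s \<noteq> 0" "t \<noteq> 0"
  shows "reg_op w (\<lambda>c k. s * trans_series m c k + t * trans_series n c k)"
  unfolding reg_op_def
proof (intro allI impI)
  fix c assume c: "bdd w c" "(\<lambda>k. s * trans_series m c k + t * trans_series n c k) = (\<lambda>_. 0)"
  have eq: "s * c (\<lambda>v. k v - m v) + t * c (\<lambda>v. k v - n v) = 0" for k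
    using fun_cong[OF c(2), of k] by (simp add: trans_series_def)
  obtain L where L: "\<And>n. c n \<noteq> 0 \<Longrightarrow> L \<le> wt w n" using c(1) unfolding bdd_def by blast
  have step: "\<exists>k'. wt w k' < wt w k \<and> c k' \<noteq> 0" if "c k \<noteq> 0" for k
  proof (cases "wt w m < wt w n")
    case True
    have "s * c k + t * c (\<lambda>v. k v + m v - n v) = 0" using eq[of "\<lambda>v. k v + m v"] by simp
    then have "c (\<lambda>v. k v + m v - n v) \<noteq> 0" using that s by auto
    moreover have "wt w (\<lambda>v. k v + m v - n v) < wt w k" using True by (simp add: wt_diff wt_add)
    ultimately show ?thesis by blast
  next
    case False
    then have "wt w n < wt w m" using w by simp
    moreover have "s * c (\<lambda>v. k v + n v - m v) + t * c k = 0" using eq[of "\<lambda>v. k v + n v"] by simp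
    then have "c (\<lambda>v. k v + n v - m v) \<noteq> 0" using that s by auto
    moreover have "wt w (\<lambda>v. k v + n v - m v) < wt w k" if "wt w n < wt w m" using that by (simp add: wt_diff wt_add)
    ultimately show ?thesis by blast
  qed
  show "c = (\<lambda>_. 0)"
  proof
    fix k show "c k = 0"
    proof (induction "nat (wt w k - L)" arbitrary: k rule: less_induct)
      case less
      show ?case
      proof (rule ccontr)
        assume nz: "c k \<noteq> 0"
        then obtain k' where k': "wt w k' < wt w k" "c k' \<noteq> 0" using step by blast
        have "nat (wt w k' - L) < nat (wt w k - L)" using k'(1) L[OF nz] L[OF k'(2)] by simp
        from less.hyps[OF this] k'(2) show False by simp
      qed
    qed
  qed
qed

lemma gen_all_nonzero: "gen (\<lambda>z :: 'v::finite \<Rightarrow> complex. \<forall>v. z v \<noteq> 0)"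
proof -
  have "gen (\<lambda>z :: 'v \<Rightarrow> complex. \<forall>v\<in>UNIV. z v \<noteq> 0)"
  proof (rule gen_ball[OF finite_class.finite_UNIV])
    fix v :: 'v
    have "\<exists>z :: 'v \<Rightarrow> complex. z v \<noteq> 0" by (rule exI[of _ "\<lambda>_. 1"]) simp
    then show "gen (\<lambda>z :: 'v \<Rightarrow> complex. z v \<noteq> 0)" by (rule gen_pol[OF pol_var])
  qed
  then show ?thesis by simp
qed

text \<open>The negative part of \<open>m\<close>: the exponents that clear the denominator of a
  Laurent monomial.\<close>

definition pos_part :: "('v \<Rightarrow> int) \<Rightarrow> 'v \<Rightarrow> int" where "pos_part m v = max 0 (- m v)"

lemma pos_part_nonneg: "pos_part m v \<ge> 0" "pos_part m v + m v \<ge> 0"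
  by (auto simp: pos_part_def)

lemma expands_lmono: "expands w (lmono m) (trans_series m unit_series)"
proof -
  let ?N = "pos_part m"
  have N: "pol (lmono ?N) (trans_series ?N)" by (rule pol_lmono) (rule pos_part_nonneg)
  have Nm: "pol (lmono (\<lambda>v. ?N v + m v)) (trans_series (\<lambda>v. ?N v + m v))" by (rule pol_lmono) (rule pos_part_nonneg)
  have g: "gen (\<lambda>z. lmono m z * lmono ?N z = lmono (\<lambda>v. ?N v + m v) z)"
    by (rule gen_mono[OF gen_all_nonzero]) (simp add: lmono_add)
  show ?thesis
    by (rule expandsI[OF Nm N reg_op_trans_series bdd_trans_series[OF bdd_unit] trans_series_trans g])
qed

lemma gen_binomial_nonzero:
  assumes w: "wt w m \<noteq> 0" and s: "s \<noteq> 0"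
  shows "gen (\<lambda>z. 1 - s * lmono m z \<noteq> 0)"
proof -
  let ?N = "pos_part m"
  have N: "pol (lmono ?N) (trans_series ?N)" by (rule pol_lmono) (rule pos_part_nonneg)
  have Nm: "pol (lmono (\<lambda>v. ?N v + m v)) (trans_series (\<lambda>v. ?N v + m v))" by (rule pol_lmono) (rule pos_part_nonneg)
  let ?q = "\<lambda>z. 1 * lmono ?N z + (-s) * lmono (\<lambda>v. ?N v + m v) z"
  have q: "pol ?q (\<lambda>c k. 1 * trans_series ?N c k + (-s) * trans_series (\<lambda>v. ?N v + m v) c k)"
    by (rule pol_add[OF pol_mult[OF pol_const N] pol_mult[OF pol_const Nm]])
  have "reg_op w (\<lambda>c k. 1 * trans_series ?N c k + (-s) * trans_series (\<lambda>v. ?N v + m v) c k)"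
    by (rule reg_op_binomial) (use w s in \<open>simp_all add: wt_add\<close>)
  then have "\<exists>z. ?q z \<noteq> 0" by (rule reg_op_nonzero[OF _ q])
  from gen_pol[OF q this] have "gen (\<lambda>z. ?q z \<noteq> 0)" .
  from gen_conj[OF this gen_all_nonzero] show ?thesis
    by (rule gen_mono) (auto simp: lmono_add)
qed

text \<open>Of the two geometric expansions of \<open>1 / (1 - s z^m)\<close>, boundedness of
  \<open>c\<close> selects the one that fits the sign of the weight of \<open>m\<close>; the
  argument need not distinguish them.\<close>

lemma expands_geometric:
  assumes h: "expands w h (\<lambda>n. c n - s * trans_series m c n)" and c: "bdd w c"
    and w: "wt w m \<noteq> 0" and s: "s \<noteq> 0"
  shows "expands w (\<lambda>z. h z / (1 - s * lmono m z)) c"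
proof -
  let ?N = "pos_part m"
  have N: "pol (lmono ?N) (trans_series ?N)" by (rule pol_lmono) (rule pos_part_nonneg)
  have Nm: "pol (lmono (\<lambda>v. ?N v + m v)) (trans_series (\<lambda>v. ?N v + m v))" by (rule pol_lmono) (rule pos_part_nonneg)
  let ?q = "\<lambda>z. 1 * lmono ?N z + (-s) * lmono (\<lambda>v. ?N v + m v) z"
  let ?Q = "\<lambda>c k. 1 * trans_series ?N c k + (-s) * trans_series (\<lambda>v. ?N v + m v) c k"
  have q: "pol ?q ?Q"
    by (rule pol_add[OF pol_mult[OF pol_const N] pol_mult[OF pol_const Nm]])
  have reg: "reg_op w ?Q"
    by (rule reg_op_binomial) (use w s in \<open>simp_all add: wt_add\<close>)
  from h obtain p P r R where k: "pol p P" "pol r R" "reg_op w R"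
    "R (\<lambda>n. c n - s * trans_series m c n) = P unit_series" "gen (\<lambda>z. h z * r z = p z)"
    unfolding expands_def by (elim exE conjE)
  have 1: "?Q c = trans_series ?N (\<lambda>n. c n - s * trans_series m c n)"
    by (rule ext) (simp add: trans_series_def algebra_simps)
  have 2: "R (?Q c) = trans_series ?N (P unit_series)"
    unfolding 1 using pol_commute[OF k(2) N] k(4) by simp
  have 3: "gen (\<lambda>z. h z / (1 - s * lmono m z) * (r z * ?q z) = lmono ?N z * p z)"
  proof (rule gen_mono[OF gen_conj[OF gen_conj[OF k(5) gen_all_nonzero] gen_binomial_nonzero[OF w s]]])
    fix z assume z: "(h z * r z = p z \<and> (\<forall>v. z v \<noteq> 0)) \<and> 1 - s * lmono m z \<noteq> 0"
    have "?q z = lmono ?N z * (1 - s * lmono m z)" using z by (simp add: lmono_add algebra_simps)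
    then have "h z / (1 - s * lmono m z) * (r z * ?q z) = (h z * r z) * lmono ?N z" using z by simp
    also have "h z * r z = p z" using z by blast
    finally show "h z / (1 - s * lmono m z) * (r z * ?q z) = lmono ?N z * p z" by simp
  qed
  show ?thesis
    by (rule expandsI[OF pol_mult[OF N k(1)] pol_mult[OF k(2) q] reg_op_compose[OF k(3) reg q] c 2 3])
qed

lemma sder_eq_Dop: "sder v = Dop (\<lambda>u. if u = v then 1 else 0)"
proof (intro ext)
  fix c and m :: "'a \<Rightarrow> int"
  have 1: "(\<lambda>u. m u + int (if u = v then 1 else 0)) = m(v := m v + 1)" by auto
  have "(\<Prod>u\<in>UNIV. pochhammer (of_int (m u) + 1 :: complex) (if u = v then 1 else 0))
     = (\<Prod>u\<in>{v}. of_int (m u) + 1)"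
    by (rule prod.mono_neutral_cong_right) auto
  then show "sder v c m = Dop (\<lambda>u. if u = v then 1 else 0) c m"
    unfolding Dop_def 1 by (simp add: sder_def)
qed

lemma Dop_zero: "Dop (\<lambda>_. 0) c = c"
  by (rule ext) (simp add: Dop_def)

lemma sder_pow: "(sder v ^^ n) c = Dop (\<lambda>u. if u = v then n else 0) c"
proof (induction n)
  case 0
  have "(\<lambda>u. if u = v then 0 else 0) = (\<lambda>_. 0 :: nat)" by auto
  then show ?case by (simp add: Dop_zero)
next
  case (Suc n)
  have "(\<lambda>u. (if u = v then 1 else 0) + (if u = v then n else 0)) = (\<lambda>u. if u = v then Suc n else 0)" by auto
  then show ?case unfolding funpow.simps o_apply Suc unfolding sder_eq_Dop Dop_Dop by simp
qed

lemma expands_pd_pow: "expands w f c \<Longrightarrow> expands w ((pd v ^^ n) f) ((sder v ^^ n) c)"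
  by (induction n) (auto intro: expands_pd)

lemma expands_fold_pd:
  assumes "expands w f c" "distinct xs"
  shows "expands w (fold (\<lambda>v. pd v ^^ U v) xs f) (Dop (\<lambda>v. if v \<in> set xs then U v else 0) c)"
  using assms
proof (induction xs arbitrary: f c)
  case Nil
  then show ?case by (simp add: Dop_zero)
next
  case (Cons x xs)
  have "expands w (fold (\<lambda>v. pd v ^^ U v) xs ((pd x ^^ U x) f)) (Dop (\<lambda>v. if v \<in> set xs then U v else 0) ((sder x ^^ U x) c))"
    by (rule Cons.IH[OF expands_pd_pow[OF Cons.prems(1)]]) (use Cons.prems in simp)
  moreover have "(\<lambda>v. (if v \<in> set xs then U v else 0) + (if v = x then U x else 0)) = (\<lambda>v. if v \<in> set (x # xs) then U v else 0)"
    using Cons.prems(2) by auto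
  ultimately show ?case by (simp add: sder_pow Dop_Dop)
qed

lemma wt_idx0: "wt w (idx (\<lambda>_. 0) d) = wt (weight_diff w) d"
  by (simp add: wt_idx)

abbreviation nrm_one :: "('n::finite \<Rightarrow> int) \<Rightarrow> complex" where
  "nrm_one \<equiv> nrm (\<lambda>_. 1)"

lemma nrm_one: "nrm_one k = (\<Prod>i\<in>UNIV. if even (k i) then 1 else -1)"
  by (simp add: nrm_def nrm1_def)

lemma nrm_one_add: "nrm_one (\<lambda>i. k i + d i) = nrm_one k * nrm_one d"
  unfolding nrm_one prod.distrib[symmetric] by (rule prod.cong) auto

lemma nrm_one_nonzero: "nrm_one k \<noteq> 0"
  unfolding nrm_one by simp

section \<open>The generating function of a cobasis cone\<close>

locale cobasis_data =
  fixes a :: "'n::finite \<Rightarrow> int ^ 'd" and J :: "'n set" and g :: "'n \<Rightarrow> 'n \<Rightarrow> int" and \<gamma> :: "int ^ 'd"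
  assumes span: "spanning (rel_lattice a) J"
    and g: "\<And>j. j \<in> J \<Longrightarrow> g j \<in> rel_lattice a \<and> g j j > 0 \<and> (\<forall>j'\<in>J - {j}. g j j' = 0)"
begin

text \<open>The fundamental box: adding \<open>g j\<close> changes, among the coordinates in
  \<open>J\<close>, only the one at \<open>j\<close>, by \<open>g j j\<close>. So these are
  representatives of the solutions modulo the lattice spanned by the \<open>g j\<close>.\<close>

definition fin_part :: "('n \<Rightarrow> int) set" where
  "fin_part = {k. (\<Sum>i\<in>UNIV. k i *s a i) = - \<gamma> \<and> (\<forall>j\<in>J. 0 \<le> k j \<and> k j < g j j)}"

lemma finite_fin_part: "finite fin_part"
proof -
  have "inj_on (\<lambda>k. restrict k J) fin_part"
  proof (rule inj_onI)
    fix k k' assume k: "k \<in> fin_part" "k' \<in> fin_part" "restrict k J = restrict k' J"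
    have "(\<lambda>i. k i - k' i) \<in> rel_lattice a"
      using k(1,2) unfolding fin_part_def rel_lattice_def mem_Collect_eq sum_smult_diff by simp
    moreover have "\<forall>j\<in>J. k j - k' j = 0" using k(3) by (metis restrict_apply' diff_self)
    ultimately have "(\<lambda>i. k i - k' i) = (\<lambda>_. 0)" using span unfolding spanning_def by simp
    then show "k = k'" by (simp add: fun_eq_iff)
  qed
  moreover have "(\<lambda>k. restrict k J) ` fin_part \<subseteq> Pi\<^sub>E J (\<lambda>j. {0..<g j j})"
    by (auto simp: fin_part_def)
  then have "finite ((\<lambda>k. restrict k J) ` fin_part)" by (rule finite_subset) (simp add: finite_PiE)
  ultimately show ?thesis by (rule finite_imageD[rotated])
qed

definition den :: "'n \<Rightarrow> ('n + 'n \<Rightarrow> complex) \<Rightarrow> complex" where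
  "den j z = 1 - nrm_one (g j) * lmono (idx (\<lambda>_. 0) (g j)) z"

text \<open>The rational generating function of a simplicial cone: the box divided by one geometric
  factor per edge.\<close>

definition closed_form :: "('n + 'n \<Rightarrow> complex) \<Rightarrow> complex" where
  "closed_form z = (\<Sum>k\<in>fin_part. nrm_one k * lmono (idx (\<lambda>_. 1) k) z) / (\<Prod>j\<in>J. den j z)"

definition coset_index :: "('n + 'n \<Rightarrow> int) \<Rightarrow> bool" where
  "coset_index m \<longleftrightarrow> (\<forall>i. m (Inl i) + m (Inr i) = - 1) \<and> (\<Sum>i\<in>UNIV. m (Inr i) *s a i) = - \<gamma>"

text \<open>The coefficients of the expansion of \<open>1 / (1 - t)\<close> in powers of \<open>t\<close> or of \<open>1 / t\<close>, whichever the weight selects.\<close>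

definition half :: "('n + 'n \<Rightarrow> int) \<Rightarrow> 'n \<Rightarrow> int \<Rightarrow> complex" where
  "half w j t = (if wt (weight_diff w) (g j) > 0 then of_bool (t \<ge> 0) else - of_bool (t < 0))"

text \<open>An interpolation between the box and the cone: the coordinates in \<open>T\<close> run
  over a half line, the other ones in \<open>J\<close> are still confined to one period. It permits
  dividing by one denominator at a time.\<close>

definition partial_series :: "('n + 'n \<Rightarrow> int) \<Rightarrow> 'n set \<Rightarrow> ('n + 'n) series" where
  "partial_series w T m = (if coset_index m then nrm_one (\<lambda>i. m (Inr i)) *
      (\<Prod>j\<in>J. if j \<in> T then half w j (m (Inr j)) else of_bool (0 \<le> m (Inr j) \<and> m (Inr j) < g j j)) else 0)"

lemma coset_index_shift:
  assumes "d \<in> rel_lattice a"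
  shows "coset_index (\<lambda>v. m v - idx (\<lambda>_. 0) d v) \<longleftrightarrow> coset_index m"
  using assms unfolding coset_index_def idx_def sum.case sum_smult_diff rel_lattice_def by simp

text \<open>Multiplication by \<open>den j\<close> telescopes: for either direction of the half
  line, its indicator (with the sign in \<open>half\<close>) minus the one shifted by
  \<open>g j j\<close> is the indicator of \<open>[0, g j j)\<close>.\<close>

lemma partial_series_step:
  assumes j: "j \<in> J" "j \<notin> T"
  shows "partial_series w (insert j T) n - nrm_one (g j) * trans_series (idx (\<lambda>_. 0) (g j)) (partial_series w (insert j T)) n
      = partial_series w T n"
proof -
  let ?G = "\<lambda>T m i. if i \<in> T then half w i (m (Inr i)) else of_bool (0 \<le> m (Inr i) \<and> m (Inr i) < g i i)"
  define n' where "n' = (\<lambda>v. n v - idx (\<lambda>_. 0) (g j) v)"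
  have n': "n' (Inr i) = n (Inr i) - g j i" for i by (simp add: n'_def idx_def)
  have ci: "coset_index n' \<longleftrightarrow> coset_index n"
    unfolding n'_def by (rule coset_index_shift) (use g j in blast)
  have s: "nrm_one (g j) * nrm_one (\<lambda>i. n' (Inr i)) = nrm_one (\<lambda>i. n (Inr i))"
    using nrm_one_add[of "\<lambda>i. n' (Inr i)" "g j"] by (simp add: n')
  have P: "(\<Prod>i\<in>J. ?G S m i) = ?G S m j * (\<Prod>i\<in>J - {j}. ?G S m i)" for S m
    by (rule prod.remove) (use j in auto)
  have o1: "(\<Prod>i\<in>J - {j}. ?G (insert j T) n' i) = (\<Prod>i\<in>J - {j}. ?G T n i)"
    by (rule prod.cong) (use g[OF j(1)] in \<open>auto simp: n'\<close>)
  have o2: "(\<Prod>i\<in>J - {j}. ?G (insert j T) n i) = (\<Prod>i\<in>J - {j}. ?G T n i)"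
    by (rule prod.cong) auto
  have h: "half w j (n (Inr j)) - half w j (n' (Inr j)) = of_bool (0 \<le> n (Inr j) \<and> n (Inr j) < g j j)"
    using g[OF j(1)] by (auto simp: half_def n')
  show ?thesis
  proof (cases "coset_index n")
    case False
    then show ?thesis using ci by (simp add: partial_series_def trans_series_def n'_def)
  next
    case True
    let ?R = "\<Prod>i\<in>J - {j}. ?G T n i"
    have 1: "partial_series w (insert j T) n = nrm_one (\<lambda>i. n (Inr i)) * (half w j (n (Inr j)) * ?R)"
      unfolding partial_series_def P o2 using True by simp
    have 2: "partial_series w (insert j T) n' = nrm_one (\<lambda>i. n' (Inr i)) * (half w j (n' (Inr j)) * ?R)"
      unfolding partial_series_def P o1 using True ci by simp
    have 3: "partial_series w T n = nrm_one (\<lambda>i. n (Inr i)) * (of_bool (0 \<le> n (Inr j) \<and> n (Inr j) < g j j) * ?R)"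
      unfolding partial_series_def P using True j(2) by simp
    have "partial_series w (insert j T) n - nrm_one (g j) * partial_series w (insert j T) n'
       = nrm_one (\<lambda>i. n (Inr i)) * ((half w j (n (Inr j)) - half w j (n' (Inr j))) * ?R)"
      unfolding 1 2 s[symmetric] by (simp add: algebra_simps)
    then show ?thesis unfolding h 3 by (simp add: trans_series_def n'_def)
  qed
qed

text \<open>Differences from a fixed exponent \<open>m0\<close> of the support are expanded in the
  dual basis. In coordinate \<open>j\<close> the support is unbounded at most on the side where the
  weight grows, so each summand is bounded below; \<open>B\<close> adds up these bounds, and
  \<open>P \<ge> 1\<close> is divided out.\<close>

lemma bdd_partial_series:
  shows "bdd w (partial_series w T)"
proof (cases "\<exists>m0. partial_series w T m0 \<noteq> 0")
  case False
  then have "partial_series w T = (\<lambda>_. 0)" by auto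
  then show ?thesis by (simp add: bdd_zero)
next
  case True
  then obtain m0 where m0: "partial_series w T m0 \<noteq> 0" by blast
  let ?W = "wt (weight_diff w)"
  define k0 where "k0 i = m0 (Inr i)" for i
  define P where "P = (\<Prod>j\<in>J. g j j)"
  have P: "P > 0" unfolding P_def by (rule prod_pos) (use g in blast)
  define C where "C j = (\<Prod>l\<in>J - {j}. g l l)" for j
  have C: "C j \<ge> 0" for j unfolding C_def by (rule prod_nonneg) (use g less_imp_le in blast)
  define B where "B = (\<Sum>j\<in>J. (g j j + \<bar>k0 j\<bar>) * (C j * \<bar>?W (g j)\<bar>))"
  have coset: "m = idx (\<lambda>_. 1) (\<lambda>i. m (Inr i))" if "partial_series w T m \<noteq> 0" for m
  proof
    fix s show "m s = idx (\<lambda>_. 1) (\<lambda>i. m (Inr i)) s"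
      using that by (cases s) (auto simp: idx_def partial_series_def coset_index_def algebra_simps eq_diff_eq split: if_splits)
  qed
  define Lb where "Lb = - B - \<bar>P * ?W k0\<bar> - \<bar>\<Sum>i\<in>UNIV. w (Inl i) * 1\<bar>"
  have "Lb \<le> wt w m" if m: "partial_series w T m \<noteq> 0" for m
  proof -
    define k where "k = (\<lambda>i. m (Inr i))"
    have kk: "(\<lambda>i. k i - k0 i) \<in> rel_lattice a"
      using m m0 unfolding partial_series_def coset_index_def k_def k0_def rel_lattice_def mem_Collect_eq sum_smult_diff
      by (auto split: if_splits)
    have nzj: "(if j \<in> T then half w j (k j) else of_bool (0 \<le> k j \<and> k j < g j j)) \<noteq> 0" if "j \<in> J" for j
      using m that by (auto simp: partial_series_def k_def split: if_splits)
    have "P * ?W (\<lambda>i. k i - k0 i) = ?W (\<lambda>i. P * (k i - k0 i))" by (simp add: wt_scale)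
    also have "(\<lambda>i. P * (k i - k0 i)) = (\<lambda>i. \<Sum>j\<in>J. (k j - k0 j) * C j * g j i)"
      unfolding P_def C_def using dual_expansion[OF closed_comb_rel_lattice span _ kk, of g] g by (intro ext) auto
    also have "?W \<dots> = (\<Sum>j\<in>J. (k j - k0 j) * C j * ?W (g j))"
      by (simp add: wt_sum wt_scale)
    also have "\<dots> \<ge> (\<Sum>j\<in>J. - ((g j j + \<bar>k0 j\<bar>) * (C j * \<bar>?W (g j)\<bar>)))"
    proof (rule sum_mono)
      fix j assume j: "j \<in> J"
      have gj: "g j j > 0" using g j by blast
      have "- ((g j j + \<bar>k0 j\<bar>) * \<bar>?W (g j)\<bar>) \<le> (k j - k0 j) * ?W (g j)"
      proof (cases "?W (g j) > 0")
        case True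
        then have "k j \<ge> 0" using nzj[OF j] by (auto simp: half_def split: if_splits)
        then have "- (g j j + \<bar>k0 j\<bar>) \<le> k j - k0 j" using gj by linarith
        then have "- (g j j + \<bar>k0 j\<bar>) * ?W (g j) \<le> (k j - k0 j) * ?W (g j)" using True by (intro mult_right_mono) auto
        then show ?thesis unfolding abs_of_pos[OF True] by (simp only: mult_minus_left)
      next
        case False
        then have "k j < g j j" using nzj[OF j] gj by (auto simp: half_def split: if_splits)
        then have "k j - k0 j \<le> g j j + \<bar>k0 j\<bar>" by linarith
        then have "(g j j + \<bar>k0 j\<bar>) * ?W (g j) \<le> (k j - k0 j) * ?W (g j)"
          using False by (intro mult_right_mono_neg) auto
        then show ?thesis using False by simp
      qed
      then have "C j * - ((g j j + \<bar>k0 j\<bar>) * \<bar>?W (g j)\<bar>) \<le> C j * ((k j - k0 j) * ?W (g j))"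
        using C by (intro mult_left_mono) auto
      then show "- ((g j j + \<bar>k0 j\<bar>) * (C j * \<bar>?W (g j)\<bar>)) \<le> (k j - k0 j) * C j * ?W (g j)"
        by (simp add: algebra_simps)
    qed
    finally have "- B \<le> P * (?W k - ?W k0)" unfolding B_def by (simp add: sum_negf wt_diff)
    then have 1: "- B - \<bar>P * ?W k0\<bar> \<le> P * ?W k" by (simp add: algebra_simps)
    have B: "B \<ge> 0" unfolding B_def
      by (intro sum_nonneg mult_nonneg_nonneg add_nonneg_nonneg) (use g[THEN conjunct2, THEN conjunct1, THEN less_imp_le] C in auto)
    have "- B - \<bar>P * ?W k0\<bar> \<le> ?W k"
    proof (cases "?W k \<ge> 0")
      case False
      then have "P * ?W k \<le> 1 * ?W k" using P by (intro mult_right_mono_neg) auto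
      then show ?thesis using 1 by simp
    qed (use B in linarith)
    moreover have "wt w m = ?W k - (\<Sum>i\<in>UNIV. w (Inl i) * 1)"
      unfolding k_def by (subst coset[OF m]) (rule wt_idx)
    ultimately show ?thesis unfolding Lb_def by linarith
  qed
  then show ?thesis unfolding bdd_def by blast
qed

lemma expands_partial:
  assumes w: "\<And>j. j \<in> J \<Longrightarrow> wt (weight_diff w) (g j) \<noteq> 0" and T: "T \<subseteq> J"
  shows "expands w (\<lambda>z. (\<Sum>k\<in>fin_part. nrm_one k * lmono (idx (\<lambda>_. 1) k) z) / (\<Prod>j\<in>T. den j z)) (partial_series w T)"
proof -
  have "finite T" using T finite_subset[OF _ finite_class.finite_UNIV] by blast
  then show ?thesis using T
  proof (induction T rule: finite_induct)
    case empty
    have "expands w (\<lambda>z. \<Sum>k\<in>fin_part. nrm_one k * lmono (idx (\<lambda>_. 1) k) z)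
        (\<lambda>m. \<Sum>k\<in>fin_part. nrm_one k * trans_series (idx (\<lambda>_. 1) k) unit_series m)"
      by (rule expands_sum[OF finite_fin_part]) (rule expands_scale[OF expands_lmono])
    moreover have "(\<Sum>k\<in>fin_part. nrm_one k * trans_series (idx (\<lambda>_. 1) k) unit_series m) = partial_series w {} m" for m
    proof -
      define k0 where "k0 = (\<lambda>i. m (Inr i))"
      have u: "trans_series (idx (\<lambda>_. 1) k) unit_series m = of_bool (k = k0 \<and> (\<forall>i. m (Inl i) + m (Inr i) = - 1))" for k
      proof -
        have "(\<lambda>v. m v - idx (\<lambda>_. 1) k v) = (\<lambda>_. 0) \<longleftrightarrow> (\<forall>v. m v = idx (\<lambda>_. 1) k v)"
          by (auto simp: fun_eq_iff)
        also have "\<dots> \<longleftrightarrow> (\<forall>i. m (Inl i) = - 1 - k i) \<and> (\<forall>i. m (Inr i) = k i)"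
          by (auto simp: idx_def split: sum.splits)
        also have "\<dots> \<longleftrightarrow> k = k0 \<and> (\<forall>i. m (Inl i) + m (Inr i) = - 1)"
          unfolding k0_def by (auto simp: fun_eq_iff algebra_simps eq_diff_eq)
        finally show ?thesis by (simp add: trans_series_def unit_series_def)
      qed
      have "(\<Sum>k\<in>fin_part. nrm_one k * trans_series (idx (\<lambda>_. 1) k) unit_series m)
         = (\<Sum>k\<in>fin_part. if k = k0 then nrm_one k0 * of_bool (\<forall>i. m (Inl i) + m (Inr i) = - 1) else 0)"
        unfolding u by (rule sum.cong) auto
      also have "\<dots> = (if k0 \<in> fin_part then nrm_one k0 * of_bool (\<forall>i. m (Inl i) + m (Inr i) = - 1) else 0)"
        using finite_fin_part by simp
      also have "\<dots> = partial_series w {} m"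
      proof -
        have "(\<Prod>j\<in>J. of_bool (0 \<le> m (Inr j) \<and> m (Inr j) < g j j) :: complex) = of_bool (\<forall>j\<in>J. 0 \<le> m (Inr j) \<and> m (Inr j) < g j j)"
        proof (cases "\<forall>j\<in>J. 0 \<le> m (Inr j) \<and> m (Inr j) < g j j")
          case False
          then show ?thesis by (auto intro!: prod_zero)
        qed auto
        then show ?thesis
          by (auto simp: partial_series_def coset_index_def fin_part_def k0_def)
      qed
      finally show ?thesis .
    qed
    ultimately show ?case by simp
  next
    case (insert j T)
    have j: "j \<in> J" "T \<subseteq> J" using insert.prems by auto
    have "expands w (\<lambda>z. (\<Sum>k\<in>fin_part. nrm_one k * lmono (idx (\<lambda>_. 1) k) z) / (\<Prod>j\<in>T. den j z))
       (\<lambda>n. partial_series w (insert j T) n - nrm_one (g j) * trans_series (idx (\<lambda>_. 0) (g j)) (partial_series w (insert j T)) n)"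
      unfolding partial_series_step[OF j(1) insert.hyps(2)] by (rule insert.IH[OF j(2)])
    from expands_geometric[OF this bdd_partial_series _ nrm_one_nonzero]
    have "expands w (\<lambda>z. (\<Sum>k\<in>fin_part. nrm_one k * lmono (idx (\<lambda>_. 1) k) z) / (\<Prod>j\<in>T. den j z) / den j z) (partial_series w (insert j T))"
      unfolding den_def using w[OF j(1)] by (simp add: wt_idx0)
    then show ?case using insert.hyps by (simp add: mult.commute)
  qed
qed

text \<open>One factor -1 for every edge along which the geometric series has to be expanded in the
  opposite direction.\<close>

definition orient :: "('n + 'n \<Rightarrow> int) \<Rightarrow> complex" where
  "orient w = (\<Prod>j\<in>J. if wt (weight_diff w) (g j) > 0 then 1 else -1)"

lemma orient_nonzero: "orient w \<noteq> 0"
  by (simp add: orient_def)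

lemma partial_series_full:
  assumes w: "\<And>j. j \<in> J \<Longrightarrow> wt (weight_diff w) (g j) \<noteq> 0"
  shows "partial_series w J = (\<lambda>m. orient w * residue_series w a (\<lambda>_. 1) \<gamma> J m)"
proof
  fix m :: "'n + 'n \<Rightarrow> int"
  let ?W = "wt (weight_diff w)"
  have "(\<Prod>j\<in>J. half w j (m (Inr j))) = (\<Prod>j\<in>J. (if ?W (g j) > 0 then 1 else -1) * of_bool (?W (g j) * sg (\<lambda>i. m (Inr i)) j > 0))"
    by (rule prod.cong[OF refl]) (use w in \<open>force simp: half_def sg_def\<close>)
  also have "\<dots> = orient w * (\<Prod>j\<in>J. of_bool (?W (g j) * sg (\<lambda>i. m (Inr i)) j > 0))"
    by (simp only: prod.distrib orient_def)
  also have "(\<Prod>j\<in>J. of_bool (?W (g j) * sg (\<lambda>i. m (Inr i)) j > 0) :: complex) = of_bool (\<forall>j\<in>J. ?W (g j) * sg (\<lambda>i. m (Inr i)) j > 0)"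
  proof (cases "\<forall>j\<in>J. ?W (g j) * sg (\<lambda>i. m (Inr i)) j > 0")
    case False
    then show ?thesis by (auto intro!: prod_zero)
  qed auto
  also have "(\<forall>j\<in>J. ?W (g j) * sg (\<lambda>i. m (Inr i)) j > 0) = sign_cone (weight_diff w) (rel_lattice a) J (sg (\<lambda>i. m (Inr i)))"
    by (rule sign_cone_dual[OF closed_comb_rel_lattice span g, symmetric])
  finally show "partial_series w J m = orient w * residue_series w a (\<lambda>_. 1) \<gamma> J m"
    by (simp add: partial_series_def residue_series_def coset_index_def)
qed

theorem expands_closed_form:
  assumes "\<And>j. j \<in> J \<Longrightarrow> wt (weight_diff w) (g j) \<noteq> 0"
  shows "expands w closed_form (\<lambda>m. orient w * residue_series w a (\<lambda>_. 1) \<gamma> J m)"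
proof -
  have "partial_series w J = (\<lambda>m. orient w * residue_series w a (\<lambda>_. 1) \<gamma> J m)"
    by (rule partial_series_full) (rule assms)
  moreover have "expands w (\<lambda>z. (\<Sum>k\<in>fin_part. nrm_one k * lmono (idx (\<lambda>_. 1) k) z) / (\<Prod>j\<in>J. den j z)) (partial_series w J)"
    by (rule expands_partial) (simp_all add: assms)
  ultimately show ?thesis unfolding closed_form_def[abs_def] by (simp only:)
qed

end

text \<open>Derivatives in the \<open>x i\<close> leave the exponents of the \<open>y i\<close>,
  hence the sign pattern, untouched. By reflection of the Pochhammer symbol they turn
  \<open>nrm1 1\<close> into \<open>nrm1 (b i + 1)\<close> up to a sign.\<close>

lemma Dop_residue_series:
  fixes b :: "'n::finite \<Rightarrow> nat"
  shows "Dop (case_sum b (\<lambda>_. 0)) (\<lambda>m. x * residue_series w a (\<lambda>_. 1) \<gamma> J m)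
     = (\<lambda>m. x * (-1) ^ (\<Sum>i\<in>UNIV. b i) * residue_series w a (\<lambda>i. int (b i) + 1) \<gamma> J m)"
proof
  fix m :: "'n + 'n \<Rightarrow> int"
  let ?m = "\<lambda>v. m v + int (case_sum b (\<lambda>_. 0) v)"
  have r: "?m (Inr i) = m (Inr i)" "?m (Inl i) = m (Inl i) + int (b i)" for i by simp_all
  show "Dop (case_sum b (\<lambda>_. 0)) (\<lambda>m. x * residue_series w a (\<lambda>_. 1) \<gamma> J m) m
     = x * (-1) ^ (\<Sum>i\<in>UNIV. b i) * residue_series w a (\<lambda>i. int (b i) + 1) \<gamma> J m"
  proof (cases "(\<forall>i. m (Inl i) + m (Inr i) = - (int (b i) + 1)) \<and> (\<Sum>i\<in>UNIV. m (Inr i) *s a i) = - \<gamma>")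
    case False
    then have "\<not> ((\<forall>i. ?m (Inl i) + ?m (Inr i) = - 1) \<and> (\<Sum>i\<in>UNIV. ?m (Inr i) *s a i) = - \<gamma>)"
      unfolding r by (auto simp: algebra_simps)
    then show ?thesis using False unfolding Dop_def residue_series_def by (simp only: if_False mult_zero_right)
  next
    case True
    then have T': "(\<forall>i. ?m (Inl i) + ?m (Inr i) = - 1) \<and> (\<Sum>i\<in>UNIV. ?m (Inr i) *s a i) = - \<gamma>"
      unfolding r by (auto simp: algebra_simps)
    have p: "pochhammer (of_int (m (Inl i)) + 1) (b i) * nrm1 1 (m (Inr i)) = (-1) ^ b i * nrm1 (int (b i) + 1) (m (Inr i))" for i
    proof -
      have "m (Inl i) = - (int (b i) + 1) - m (Inr i)" using True by (simp add: algebra_simps eq_diff_eq)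
      then have "(of_int (m (Inl i)) + 1 :: complex) = - (of_int (m (Inr i)) + of_nat (b i))" by simp
      then have "pochhammer (of_int (m (Inl i)) + 1 :: complex) (b i) = pochhammer (- (of_int (m (Inr i)) + of_nat (b i))) (b i)"
        by (simp only:)
      also have "\<dots> = (-1) ^ b i * pochhammer (of_int (m (Inr i)) + of_nat (b i) - of_nat (b i) + 1) (b i)"
        by (rule pochhammer_minus)
      finally have "pochhammer (of_int (m (Inl i)) + 1 :: complex) (b i) = (-1) ^ b i * pochhammer (of_int (m (Inr i)) + 1) (b i)"
        by simp
      then show ?thesis by (simp add: nrm1_def)
    qed
    have "(\<Prod>i\<in>UNIV. pochhammer (of_int (m (Inl i)) + 1) (b i)) * nrm_one (\<lambda>i. m (Inr i))
        = (-1) ^ (\<Sum>i\<in>UNIV. b i) * nrm (\<lambda>i. int (b i) + 1) (\<lambda>i. m (Inr i))"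
      unfolding nrm_def prod.distrib[symmetric] power_sum by (rule prod.cong[OF refl p])
    then show ?thesis
      unfolding Dop_def residue_series_def if_P[OF T'] if_P[OF True] prod_Plus_UNIV
      by (simp add: algebra_simps)
  qed
qed

section \<open>Characters of lattices and points of the torus\<close>

definition subgrp :: "(int ^ 'd) set \<Rightarrow> bool" where
  "subgrp L \<longleftrightarrow> 0 \<in> L \<and> (\<forall>u\<in>L. \<forall>v\<in>L. u - v \<in> L)"

definition char_on :: "(int ^ 'd) set \<Rightarrow> (int ^ 'd \<Rightarrow> complex) \<Rightarrow> bool" where
  "char_on L \<psi> \<longleftrightarrow> (\<forall>u\<in>L. \<forall>v\<in>L. \<psi> (u + v) = \<psi> u * \<psi> v) \<and> (\<forall>u\<in>L. \<psi> u \<noteq> 0)"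

lemma subgrp_uminus: "subgrp L \<Longrightarrow> u \<in> L \<Longrightarrow> - u \<in> L"
  unfolding subgrp_def by (metis diff_0)

lemma subgrp_add: "subgrp L \<Longrightarrow> u \<in> L \<Longrightarrow> v \<in> L \<Longrightarrow> u + v \<in> L"
  using subgrp_uminus[of L v] unfolding subgrp_def by (metis diff_minus_eq_add)

lemma subgrp_smult_nat: "subgrp L \<Longrightarrow> u \<in> L \<Longrightarrow> int n *s u \<in> L"
proof (induction n)
  case (Suc n)
  have "int (Suc n) *s u = int n *s u + u" by (simp add: Finite_Cartesian_Product.vec_eq_iff algebra_simps)
  then show ?case using Suc subgrp_add by metis
qed (simp add: subgrp_def)

lemma subgrp_smult: "subgrp L \<Longrightarrow> u \<in> L \<Longrightarrow> n *s u \<in> L"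
proof (cases "n \<ge> 0")
  case True
  then show "subgrp L \<Longrightarrow> u \<in> L \<Longrightarrow> n *s u \<in> L" using subgrp_smult_nat[of L u "nat n"] by simp
next
  case False
  have "n *s u = - (int (nat (- n)) *s u)" using False by (simp add: Finite_Cartesian_Product.vec_eq_iff)
  then show "subgrp L \<Longrightarrow> u \<in> L \<Longrightarrow> n *s u \<in> L" using subgrp_smult_nat[of L u "nat (- n)"] subgrp_uminus by metis
qed

lemma char_on_0: "subgrp L \<Longrightarrow> char_on L \<psi> \<Longrightarrow> \<psi> 0 = 1"
  unfolding subgrp_def char_on_def by (metis add_0 mult_cancel_right1)

lemma char_on_uminus: "subgrp L \<Longrightarrow> char_on L \<psi> \<Longrightarrow> u \<in> L \<Longrightarrow> \<psi> (- u) = inverse (\<psi> u)"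
proof -
  assume h: "subgrp L" "char_on L \<psi>" "u \<in> L"
  have "\<psi> (u + (- u)) = \<psi> u * \<psi> (- u)" using h subgrp_uminus unfolding char_on_def by blast
  then have "\<psi> u * \<psi> (- u) = 1" using char_on_0[OF h(1,2)] by simp
  then show "\<psi> (- u) = inverse (\<psi> u)" by (metis inverse_unique)
qed

lemma char_on_smult_nat: "subgrp L \<Longrightarrow> char_on L \<psi> \<Longrightarrow> u \<in> L \<Longrightarrow> \<psi> (int n *s u) = \<psi> u ^ n"
proof (induction n)
  case (Suc n)
  have e: "int (Suc n) *s u = int n *s u + u" by (simp add: Finite_Cartesian_Product.vec_eq_iff algebra_simps)
  have "\<psi> (int n *s u + u) = \<psi> (int n *s u) * \<psi> u"
    using Suc.prems subgrp_smult_nat[of L u n] unfolding char_on_def by blast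
  then show ?case unfolding e Suc.IH[OF Suc.prems] by (simp only: power_Suc mult.commute)
qed (simp add: char_on_0)

lemma char_on_smult: "subgrp L \<Longrightarrow> char_on L \<psi> \<Longrightarrow> u \<in> L \<Longrightarrow> \<psi> (n *s u) = \<psi> u powi n"
proof (cases "n \<ge> 0")
  case True
  then show "subgrp L \<Longrightarrow> char_on L \<psi> \<Longrightarrow> u \<in> L \<Longrightarrow> \<psi> (n *s u) = \<psi> u powi n"
    using char_on_smult_nat[of L \<psi> u "nat n"] by (simp add: power_int_def)
next
  case False
  assume h: "subgrp L" "char_on L \<psi>" "u \<in> L"
  define k where "k = nat (- n)"
  have n: "n = - int k" using False by (simp add: k_def)
  have e: "n *s u = - (int k *s u)" by (simp add: Finite_Cartesian_Product.vec_eq_iff n)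
  have "\<psi> (n *s u) = inverse (\<psi> u ^ k)"
    unfolding e char_on_uminus[OF h(1,2) subgrp_smult_nat[OF h(1,3)]] char_on_smult_nat[OF h] ..
  then show "\<psi> (n *s u) = \<psi> u powi n" by (simp add: n power_int_minus)
qed

text \<open>The value of \<psi>' is independent of the representation of its argument: two of them
  differ by a multiple of \<open>w\<close> in \<open>L\<close>, on which \<open>r\<close> agrees
  with \<psi>.\<close>

lemma char_extend_step:
  assumes L: "subgrp L" "char_on L \<psi>" and r: "r \<noteq> 0" "\<And>n. n *s w \<in> L \<Longrightarrow> \<psi> (n *s w) = r powi n"
  shows "\<exists>L' \<psi>'. subgrp L' \<and> char_on L' \<psi>' \<and> L \<subseteq> L' \<and> w \<in> L' \<and> (\<forall>u\<in>L. \<psi>' u = \<psi> u) \<and> \<psi>' w = r"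
proof -
  define L' where "L' = {u + n *s w | u n. u \<in> L}"
  define \<psi>' where "\<psi>' v = (SOME c. \<exists>u\<in>L. \<exists>n. v = u + n *s w \<and> c = \<psi> u * r powi n)" for v
  have val: "\<psi>' (u + n *s w) = \<psi> u * r powi n" if u: "u \<in> L" for u n
  proof -
    have "\<exists>c. \<exists>u'\<in>L. \<exists>n'. u + n *s w = u' + n' *s w \<and> c = \<psi> u' * r powi n'" using u by blast
    from someI_ex[OF this, folded \<psi>'_def] obtain u' n' where
      u': "u' \<in> L" "u + n *s w = u' + n' *s w" "\<psi>' (u + n *s w) = \<psi> u' * r powi n'" by blast
    have e: "u - u' = (n' - n) *s w" using u'(2) by (simp add: Finite_Cartesian_Product.vec_eq_iff algebra_simps)
    have m: "u - u' \<in> L" using L(1) u u'(1) by (simp add: subgrp_def)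
    then have "\<psi> (u - u') = r powi (n' - n)" using r(2)[of "n' - n"] e by simp
    moreover have "\<psi> (u' + (u - u')) = \<psi> u' * \<psi> (u - u')" using L(2) u'(1) m unfolding char_on_def by blast
    ultimately have "\<psi> u = \<psi> u' * r powi (n' - n)" by simp
    then show ?thesis using u'(3) r(1) by (simp add: power_int_diff)
  qed
  show ?thesis
  proof (rule exI[of _ L'], rule exI[of _ \<psi>'], intro conjI ballI)
    show "subgrp L'" unfolding subgrp_def
    proof (intro conjI ballI)
      have "0 = 0 + 0 *s w" by simp
      then show "0 \<in> L'" using L(1) unfolding L'_def subgrp_def by blast
      fix u v assume "u \<in> L'" "v \<in> L'"
      then obtain u0 n v0 k where h: "u = u0 + n *s w" "v = v0 + k *s w" "u0 \<in> L" "v0 \<in> L" unfolding L'_def by blast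
      have "u - v = (u0 - v0) + (n - k) *s w" using h by (simp add: Finite_Cartesian_Product.vec_eq_iff algebra_simps)
      moreover have "u0 - v0 \<in> L" using L(1) h unfolding subgrp_def by blast
      ultimately show "u - v \<in> L'" unfolding L'_def by blast
    qed
    show "char_on L' \<psi>'" unfolding char_on_def
    proof (intro conjI ballI)
      fix u v assume "u \<in> L'" "v \<in> L'"
      then obtain u0 n v0 k where h: "u = u0 + n *s w" "v = v0 + k *s w" "u0 \<in> L" "v0 \<in> L" unfolding L'_def by blast
      have "u + v = (u0 + v0) + (n + k) *s w" using h by (simp add: Finite_Cartesian_Product.vec_eq_iff algebra_simps)
      then have "\<psi>' (u + v) = \<psi> (u0 + v0) * r powi (n + k)" using val[OF subgrp_add[OF L(1) h(3,4)], of "n + k"] by (simp only:)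
      also have "\<psi> (u0 + v0) = \<psi> u0 * \<psi> v0" using L(2) h unfolding char_on_def by blast
      finally show "\<psi>' (u + v) = \<psi>' u * \<psi>' v" using val h r(1) by (simp add: power_int_add)
    next
      fix u assume "u \<in> L'"
      then obtain u0 n where "u = u0 + n *s w" "u0 \<in> L" unfolding L'_def by blast
      then show "\<psi>' u \<noteq> 0" using val L(2) r(1) unfolding char_on_def by simp
    qed
    show "L \<subseteq> L'"
    proof
      fix u assume "u \<in> L"
      moreover have "u = u + 0 *s w" by simp
      ultimately show "u \<in> L'" unfolding L'_def by blast
    qed
    have "w = 0 + 1 *s w" by simp
    moreover have "0 \<in> L" using L(1) by (simp add: subgrp_def)
    ultimately show "w \<in> L'" unfolding L'_def by blast
    show "\<psi>' u = \<psi> u" if "u \<in> L" for u using val[OF that, of 0] by simp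
    show "\<psi>' w = r" using val[of 0 1] \<open>0 \<in> L\<close> char_on_0[OF L] by simp
  qed
qed

lemma least_multiple_dvd:
  assumes L: "subgrp L" and m: "m > 0" "int m *s w \<in> L" "\<And>k. 0 < k \<Longrightarrow> int k *s w \<in> L \<Longrightarrow> m \<le> k"
    and n: "n *s w \<in> L"
  shows "int m dvd n"
proof (rule ccontr)
  assume "\<not> int m dvd n"
  then have r: "n mod int m > 0" using m(1) by (metis dvd_eq_mod_eq_0 mod_int_pos_iff pos_mod_sign order_le_less of_nat_0_less_iff)
  have "(n mod int m) *s w = n *s w - (n div int m) *s (int m *s w)"
    by (simp add: Finite_Cartesian_Product.vec_eq_iff minus_div_mult_eq_mod[symmetric] algebra_simps)
  also have "\<dots> \<in> L" using L n subgrp_smult[OF L m(2)] by (simp add: subgrp_def)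
  finally have "int (nat (n mod int m)) *s w \<in> L" using r by simp
  then have "m \<le> nat (n mod int m)" using m(3) r by simp
  moreover have "n mod int m < int m" using m(1) by simp
  ultimately show False using r by linarith
qed

text \<open>The multiples of \<open>w\<close> in \<open>L\<close> are generated by one,
  \<open>m *s w\<close>, and an \<open>m\<close>-th root of its value is compatible with all of
  them. If only 0 occurs, any nonzero value will do.\<close>

lemma ex_root_value:
  assumes L: "subgrp L" "char_on L \<psi>"
  shows "\<exists>r. r \<noteq> 0 \<and> (\<forall>n. n *s w \<in> L \<longrightarrow> \<psi> (n *s w) = r powi n)"
proof (cases "\<exists>m>0. int m *s w \<in> L")
  case False
  have "n = 0" if "n *s w \<in> L" for n
  proof (rule ccontr)
    assume "n \<noteq> 0"
    have "n *s w \<in> L \<and> (- n) *s w \<in> L"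
      using that subgrp_smult[OF L(1) that, of "-1"] by (simp add: vector_smult_assoc)
    then have "int (nat \<bar>n\<bar>) *s w \<in> L" by (cases "n \<ge> 0") auto
    then show False using False \<open>n \<noteq> 0\<close> by (metis zero_less_abs_iff zero_less_nat_eq)
  qed
  then have "\<psi> (n *s w) = 1 powi n" if "n *s w \<in> L" for n
    using that char_on_0[OF L] by (metis power_int_1_left vector_smult_lzero)
  then show ?thesis by (intro exI[of _ 1]) auto
next
  case True
  define m where "m = (LEAST m. m > 0 \<and> int m *s w \<in> L)"
  have m: "m > 0" "int m *s w \<in> L" using LeastI_ex[OF True] unfolding m_def by auto
  have least: "m \<le> k" if "0 < k" "int k *s w \<in> L" for k
    unfolding m_def by (rule Least_le) (use that in simp)
  obtain r where r: "\<psi> (int m *s w) = r ^ m" using exists_complex_root[of m] m(1) by (metis less_irrefl)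
  have r0: "r \<noteq> 0" using r L(2) m unfolding char_on_def by (metis power_eq_0_iff)
  have "\<psi> (n *s w) = r powi n" if n: "n *s w \<in> L" for n
  proof -
    have "int m dvd n" by (rule least_multiple_dvd[OF L(1) m _ n]) (rule least)
    then obtain q where q: "n = int m * q" by (elim dvdE)
    have "n *s w = q *s (int m *s w)" by (simp add: q vector_smult_assoc mult.commute)
    then have "\<psi> (n *s w) = (r ^ m) powi q" using char_on_smult[OF L m(2)] r by simp
    then show ?thesis by (simp add: q power_int_mult)
  qed
  then show ?thesis using r0 by blast
qed

text \<open>The multiplicative group of the complex numbers is divisible, so the unit vectors can be
  adjoined one after the other.\<close>

lemma char_extend:
  assumes L: "subgrp L" "char_on L \<psi>"
  obtains \<psi>' where "char_on UNIV \<psi>'" "\<And>u. u \<in> L \<Longrightarrow> \<psi>' u = \<psi> u"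
proof -
  have "\<exists>L' \<psi>'. subgrp L' \<and> char_on L' \<psi>' \<and> L \<subseteq> L' \<and> (\<forall>k\<in>K. axis k 1 \<in> L') \<and> (\<forall>u\<in>L. \<psi>' u = \<psi> u)"
    if "finite K" for K :: "'a set"
    using that
  proof (induction K rule: finite_induct)
    case empty
    show ?case using L by blast
  next
    case (insert x F)
    then obtain L1 \<psi>1 where 1: "subgrp L1" "char_on L1 \<psi>1" "L \<subseteq> L1" "\<forall>k\<in>F. axis k 1 \<in> L1" "\<forall>u\<in>L. \<psi>1 u = \<psi> u" by blast
    obtain r where r: "r \<noteq> 0" "\<And>n. n *s axis x 1 \<in> L1 \<Longrightarrow> \<psi>1 (n *s axis x 1) = r powi n"
      using ex_root_value[OF 1(1,2), of "axis x 1"] by blast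
    have "\<exists>L' \<psi>'. subgrp L' \<and> char_on L' \<psi>' \<and> L1 \<subseteq> L' \<and> axis x 1 \<in> L' \<and> (\<forall>u\<in>L1. \<psi>' u = \<psi>1 u) \<and> \<psi>' (axis x 1) = r"
      by (rule char_extend_step[OF 1(1,2) r(1)]) (rule r(2))
    then obtain L2 \<psi>2 where 2: "subgrp L2" "char_on L2 \<psi>2" "L1 \<subseteq> L2" "axis x 1 \<in> L2" "\<forall>u\<in>L1. \<psi>2 u = \<psi>1 u"
      "\<psi>2 (axis x 1) = r"
      by (elim exE conjE)
    show ?case
      by (rule exI[of _ L2], rule exI[of _ \<psi>2]) (use 1 2 in auto)
  qed
  from this[OF finite_class.finite_UNIV] obtain L' \<psi>' where
    h: "subgrp L'" "char_on L' \<psi>'" "\<forall>k. axis k 1 \<in> L'" "\<forall>u\<in>L. \<psi>' u = \<psi> u" by auto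
  have "v \<in> L'" for v
  proof -
    have "(\<Sum>k\<in>K. v $ k *s axis k 1) \<in> L'" if "finite K" for K
      using that
    proof (induction K rule: finite_induct)
      case empty
      then show ?case using h(1) by (simp add: subgrp_def)
    next
      case (insert x F)
      then show ?case using subgrp_add[OF h(1) subgrp_smult[OF h(1)]] h(3) by simp
    qed
    from this[OF finite_class.finite_UNIV] have "(\<Sum>k\<in>UNIV. v $ k *s axis k 1) \<in> L'" .
    moreover have "(\<Sum>k\<in>UNIV. v $ k *s axis k 1) = v"
      by (simp add: Finite_Cartesian_Product.vec_eq_iff axis_def if_distrib sum.delta cong: if_cong)
    ultimately show ?thesis by simp
  qed
  then have "L' = UNIV" by blast
  then show thesis using that h by blast
qed

text \<open>Trivial on \<open>L\<close>, and at \<open>v\<close> a primitive root of unity whose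
  order \<open>m\<close> is the order of \<open>v\<close> modulo \<open>L\<close>; this is
  consistent with \<open>L\<close> by construction.\<close>

lemma separating_character:
  assumes L: "subgrp L" "v \<notin> L" "N > 0" "int N *s v \<in> L"
  obtains \<psi> where "char_on UNIV \<psi>" "\<And>u. u \<in> L \<Longrightarrow> \<psi> u = 1" "\<psi> v \<noteq> 1"
proof -
  define m where "m = (LEAST m. m > 0 \<and> int m *s v \<in> L)"
  have ex: "\<exists>m>0. int m *s v \<in> L" using L by blast
  have m: "m > 0" "int m *s v \<in> L" using LeastI_ex[OF ex] unfolding m_def by auto
  have least: "m \<le> k" if "0 < k" "int k *s v \<in> L" for k
    unfolding m_def by (rule Least_le) (use that in simp)
  have "m \<noteq> 1" using L(2) m(2) by auto
  then have m2: "m \<ge> 2" using m(1) by linarith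
  define r where "r = cis (2 * pi / of_nat m)"
  have rm: "r ^ m = 1" 
  proof -
    have "r ^ m = cis (real m * (2 * pi / of_nat m))" unfolding r_def by (rule Complex.DeMoivre)
    then show ?thesis using m(1) by simp
  qed
  have r1: "r \<noteq> 1"
  proof
    assume "r = 1"
    then have "cos (2 * pi / of_nat m) = 1" by (simp add: r_def complex_eq_iff)
    then obtain k :: int where "2 * pi / of_nat m = of_int k * 2 * pi" using cos_one_2pi_int by blast
    then have "(2 * pi / of_nat m) / (2 * pi) = (of_int k * 2 * pi) / (2 * pi)" by (simp only:)
    then have "1 / of_nat m = (of_int k :: real)" by simp
    then have "of_int (k * int m) = (1 :: real)" using m(1) by (simp add: field_simps)
    then have "k * int m = 1" by (simp only: of_int_eq_1_iff)
    then show False using m2 by (simp add: zmult_eq_1_iff)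
  qed
  have c1: "char_on L (\<lambda>_. 1)" by (simp add: char_on_def)
  have "1 = r powi n" if n: "n *s v \<in> L" for n
  proof -
    have "int m dvd n" by (rule least_multiple_dvd[OF L(1) m _ n]) (rule least)
    then obtain q where q: "n = int m * q" by (elim dvdE)
    then show ?thesis by (simp add: power_int_mult rm)
  qed
  then have "\<exists>L' \<psi>'. subgrp L' \<and> char_on L' \<psi>' \<and> L \<subseteq> L' \<and> v \<in> L' \<and> (\<forall>u\<in>L. \<psi>' u = 1) \<and> \<psi>' v = r"
    by (intro char_extend_step[OF L(1) c1]) (simp_all add: r_def)
  then obtain L' \<psi>' where h: "subgrp L'" "char_on L' \<psi>'" "L \<subseteq> L'" "v \<in> L'" "\<forall>u\<in>L. \<psi>' u = 1" "\<psi>' v = r"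
    by (elim exE conjE)
  obtain \<psi> where "char_on UNIV \<psi>" "\<And>u. u \<in> L' \<Longrightarrow> \<psi> u = \<psi>' u" by (rule char_extend[OF h(1,2)]) (rule that)
  then show thesis using that[of \<psi>] h r1 by (metis subsetD)
qed

lemma int_latticeI: "v = (\<Sum>i\<in>S. c i *s a i) \<Longrightarrow> v \<in> int_lattice a S"
  by (auto simp: int_lattice_def)

lemma int_latticeE:
  assumes "v \<in> int_lattice a S" obtains c where "v = (\<Sum>i\<in>S. c i *s a i)"
  using assms by (auto simp: int_lattice_def)

lemma sum_int_lattice_closed:
  "subgrp (int_lattice a S)"
  unfolding subgrp_def
proof (intro conjI ballI)
  show "0 \<in> int_lattice a S"
    by (rule int_latticeI[where c = "\<lambda>_. 0"]) simp
next
  fix u v assume "u \<in> int_lattice a S" "v \<in> int_lattice a S"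
  then obtain c d where "u = (\<Sum>i\<in>S. c i *s a i)" "v = (\<Sum>i\<in>S. d i *s a i)" by (elim int_latticeE)
  then show "u - v \<in> int_lattice a S"
    by (intro int_latticeI[where c = "\<lambda>i. c i - d i"]) (simp add: Finite_Cartesian_Product.vec_eq_iff sum_subtractf algebra_simps)
qed

lemma char_on_sum:
  assumes "char_on UNIV \<psi>" "finite S"
  shows "\<psi> (\<Sum>i\<in>S. c i *s v i) = (\<Prod>i\<in>S. \<psi> (v i) powi c i)"
  using assms(2)
proof (induction S rule: finite_induct)
  case empty
  have "subgrp (UNIV :: (int ^ 'a) set)" by (simp add: subgrp_def)
  then show ?case using char_on_0 assms(1) by auto
next
  case (insert x F)
  have s: "subgrp (UNIV :: (int ^ 'a) set)" by (simp add: subgrp_def)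
  have "\<psi> (c x *s v x + (\<Sum>i\<in>F. c i *s v i)) = \<psi> (c x *s v x) * \<psi> (\<Sum>i\<in>F. c i *s v i)"
    using assms(1) unfolding char_on_def by blast
  also have "\<psi> (c x *s v x) = \<psi> (v x) powi c x" by (rule char_on_smult[OF s assms(1) UNIV_I])
  finally show ?case using insert by simp
qed

definition chr :: "nat \<Rightarrow> (nat \<Rightarrow> 'd::finite) \<Rightarrow> (nat \<Rightarrow> complex) \<Rightarrow> int ^ 'd \<Rightarrow> complex" where
  "chr e f t v = (\<Prod>k<e. t k powi (v $ f k))"

text \<open>The vectors generate Z^d, so the character lattice for \<open>S = UNIV\<close> has the
  unit vectors as a basis, numbered by \<open>fd\<close>. Points of the torus are then the same as
  characters of Z^d.\<close>

locale toric = cobasis_data a J g \<gamma>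
  for a :: "'n::finite \<Rightarrow> int ^ 'd" and J g \<gamma> +
  fixes ed :: nat and fd :: "nat \<Rightarrow> 'd"
  assumes fd: "bij_betw fd {..<ed} UNIV"
    and generate: "int_lattice a UNIV = UNIV"
begin

definition bas :: "nat \<Rightarrow> int ^ 'd" where "bas k = axis (fd k) 1"

lemma sum_bas_nth: "l < ed \<Longrightarrow> (\<Sum>k<ed. m k *s bas k) $ fd l = m l"
proof -
  assume l: "l < ed"
  have "(\<Sum>k<ed. m k *s bas k) $ fd l = (\<Sum>k<ed. if k = l then m k else 0)"
    unfolding sum_component
  proof (rule sum.cong[OF refl])
    fix k assume "k \<in> {..<ed}"
    then have "fd k = fd l \<longleftrightarrow> k = l" using fd l by (auto simp: bij_betw_def inj_on_def)
    then show "(m k *s bas k) $ fd l = (if k = l then m k else 0)" by (auto simp: bas_def axis_def)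
  qed
  then show ?thesis using l by simp
qed

lemma vec_eq_fd: "(\<And>l. l < ed \<Longrightarrow> u $ fd l = v $ fd l) \<Longrightarrow> u = v"
proof -
  assume h: "\<And>l. l < ed \<Longrightarrow> u $ fd l = v $ fd l"
  have "u $ i = v $ i" for i
  proof -
    have "i \<in> fd ` {..<ed}" using fd by (auto simp: bij_betw_def)
    then show ?thesis using h by auto
  qed
  then show "u = v" by (simp add: Finite_Cartesian_Product.vec_eq_iff)
qed

lemma bas_expansion: "(\<Sum>k<ed. (v $ fd k) *s bas k) = v"
  by (rule vec_eq_fd) (rule sum_bas_nth)

lemma coords_bas: "coords ed bas v = restrict (\<lambda>k. v $ fd k) {..<ed}"
  unfolding coords_def
proof (rule the_equality)
  have "(\<Sum>k<ed. restrict (\<lambda>k. v $ fd k) {..<ed} k *s bas k) = (\<Sum>k<ed. (v $ fd k) *s bas k)"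
    by (rule sum.cong) auto
  then show "restrict (\<lambda>k. v $ fd k) {..<ed} \<in> extensional {..<ed} \<and> v = (\<Sum>k<ed. restrict (\<lambda>k. v $ fd k) {..<ed} k *s bas k)"
    by (simp add: bas_expansion)
next
  fix m assume m: "m \<in> extensional {..<ed} \<and> v = (\<Sum>k<ed. m k *s bas k)"
  show "m = restrict (\<lambda>k. v $ fd k) {..<ed}"
  proof (rule extensionalityI[of _ "{..<ed}"])
    fix l assume "l \<in> {..<ed}"
    then show "m l = restrict (\<lambda>k. v $ fd k) {..<ed} l" using m sum_bas_nth[of l m] by simp
  qed (use m in auto)
qed

lemma monomial_chr: "monomial ed bas v t = chr ed fd t v"
  unfolding monomial_def chr_def coords_bas by (rule prod.cong) auto

lemma lattice_basis_bas: "lattice_basis ed bas (int_lattice a UNIV)"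
  unfolding lattice_basis_def independent_family_def generate
proof (intro conjI allI impI ballI)
  fix c k assume "(\<Sum>i<ed. c i *s bas i) = 0" "k \<in> {..<ed}"
  then show "c k = 0" using sum_bas_nth[of k c] by simp
next
  show "int_lattice bas {..<ed} = UNIV"
  proof (intro equalityI subsetI UNIV_I)
    fix v :: "int ^ 'd"
    show "v \<in> int_lattice bas {..<ed}"
      by (rule int_latticeI[where c = "\<lambda>k. v $ fd k"]) (simp add: bas_expansion)
  qed
qed

lemma char_on_chr:
  assumes "t \<in> torus ed" shows "char_on UNIV (chr ed fd t)"
proof -
  have "t k \<noteq> 0" if "k < ed" for k using assms that by (auto simp: torus_def PiE_iff)
  then show ?thesis unfolding char_on_def chr_def
    by (auto simp: power_int_add prod.distrib[symmetric] intro!: prod.cong)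
qed

lemma torus_of_char:
  assumes "char_on UNIV \<psi>"
  obtains t where "t \<in> torus ed" "\<And>v. chr ed fd t v = \<psi> v"
proof (rule that[of "restrict (\<lambda>k. \<psi> (bas k)) {..<ed}"])
  show "restrict (\<lambda>k. \<psi> (bas k)) {..<ed} \<in> torus ed"
    using assms by (auto simp: torus_def char_on_def)
  fix v
  have "\<psi> v = \<psi> (\<Sum>k<ed. (v $ fd k) *s bas k)" by (simp add: bas_expansion)
  also have "\<dots> = (\<Prod>k<ed. \<psi> (bas k) powi (v $ fd k))" by (rule char_on_sum[OF assms]) simp
  finally show "chr ed fd (restrict (\<lambda>k. \<psi> (bas k)) {..<ed}) v = \<psi> v" by (simp add: chr_def)
qed

lemma chr_mult: "chr ed fd (\<lambda>k\<in>{..<ed}. s k * t k) v = chr ed fd s v * chr ed fd t v"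
  by (simp add: chr_def power_int_mult_distrib prod.distrib)

lemma chr_add: "t \<in> torus ed \<Longrightarrow> chr ed fd t (u + v) = chr ed fd t u * chr ed fd t v"
  using char_on_chr[of t] by (simp add: char_on_def)

lemma chr_nonzero: "t \<in> torus ed \<Longrightarrow> chr ed fd t v \<noteq> 0"
  using char_on_chr[of t] by (simp add: char_on_def)

lemma chr_sum: "t \<in> torus ed \<Longrightarrow> finite S \<Longrightarrow> chr ed fd t (\<Sum>i\<in>S. c i *s v i) = (\<Prod>i\<in>S. chr ed fd t (v i) powi c i)"
  by (rule char_on_sum[OF char_on_chr])

lemma chr_smult: "t \<in> torus ed \<Longrightarrow> chr ed fd t (n *s v) = chr ed fd t v powi n"
  using chr_sum[of t "{0::nat}" "\<lambda>_. n" "\<lambda>_. v"] by simp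

abbreviation LI :: "(int ^ 'd) set" where "LI \<equiv> int_lattice a (- J)"

text \<open>A relation among the \<open>a i\<close> outside \<open>J\<close>, continued by 0, is a
  relation that vanishes on \<open>J\<close>.\<close>

lemma LI_independent: "independent_family a (- J)"
  unfolding independent_family_def
proof (intro allI impI ballI)
  fix c i assume c: "(\<Sum>i\<in>- J. c i *s a i) = 0" and i: "i \<in> - J"
  define d where "d i = (if i \<in> J then 0 else c i)" for i
  have "(\<Sum>i\<in>UNIV. d i *s a i) = (\<Sum>i\<in>- J. c i *s a i)"
    by (rule sum.mono_neutral_cong_right) (auto simp: d_def)
  then have "d \<in> rel_lattice a" using c by (simp add: rel_lattice_def)
  moreover have "\<forall>j\<in>J. d j = 0" by (simp add: d_def)
  ultimately have "d = (\<lambda>_. 0)" using span unfolding spanning_def by blast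
  from fun_cong[OF this, of i] show "c i = 0" using i by (simp add: d_def)
qed

text \<open>A number that annihilates the quotient of Z^d by \<open>LI\<close>, not necessarily its
  order: by \<open>g_relation\<close>, \<open>g j j *s a j\<close> lies in \<open>LI\<close> for
  each \<open>j\<close>, and the product serves all generators at once.\<close>

definition idxD :: nat where "idxD = nat (\<Prod>j\<in>J. g j j)"

lemma idxD_pos: "idxD > 0" and int_idxD: "int idxD = (\<Prod>j\<in>J. g j j)"
proof -
  have "(\<Prod>j\<in>J. g j j) > 0" by (rule prod_pos) (use g in blast)
  then show "idxD > 0" "int idxD = (\<Prod>j\<in>J. g j j)" by (simp_all add: idxD_def)
qed

lemma g_relation:
  assumes j: "j \<in> J" shows "g j j *s a j = - (\<Sum>i\<in>- J. g j i *s a i)"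
proof -
  have "(\<Sum>i\<in>UNIV. g j i *s a i) = (\<Sum>i\<in>insert j (- J). g j i *s a i)"
    by (rule sum.mono_neutral_right) (use g[OF j] in auto)
  also have "\<dots> = g j j *s a j + (\<Sum>i\<in>- J. g j i *s a i)" using j by simp
  finally have "g j j *s a j + (\<Sum>i\<in>- J. g j i *s a i) = 0"
    using g[OF j] by (simp add: rel_lattice_def)
  then show ?thesis by (rule eq_neg_iff_add_eq_0[THEN iffD2])
qed

lemma idxD_LI: "int idxD *s v \<in> LI"
proof -
  have sub: "subgrp LI" by (rule sum_int_lattice_closed)
  have "int idxD *s a i \<in> LI" for i
  proof (cases "i \<in> J")
    case True
    have "(\<Sum>l\<in>- J. g i l *s a l) \<in> LI" by (auto simp: int_lattice_def)
    then have "g i i *s a i \<in> LI" using g_relation[OF True] subgrp_uminus[OF sub] by simp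
    then have "(\<Prod>j\<in>J - {i}. g j j) *s (g i i *s a i) \<in> LI" by (rule subgrp_smult[OF sub])
    moreover have "int idxD = (\<Prod>j\<in>J - {i}. g j j) * g i i"
      unfolding int_idxD using True by (subst prod.remove[of J i]) (auto simp: mult.commute)
    ultimately show ?thesis by (simp add: vector_smult_assoc)
  next
    case False
    have "a i = (\<Sum>l\<in>- J. of_bool (l = i) *s a l)"
    proof -
      have "(\<Sum>l\<in>- J. of_bool (l = i) *s a l) = (\<Sum>l\<in>{i}. of_bool (l = i) *s a l)"
        by (rule sum.mono_neutral_right) (use False in auto)
      then show ?thesis by simp
    qed
    then have "a i \<in> LI" by (rule int_latticeI)
    then show ?thesis by (rule subgrp_smult[OF sub])
  qed
  note ai = this
  have "v \<in> int_lattice a UNIV" using generate by simp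
  then obtain c where "v = (\<Sum>i\<in>UNIV. c i *s a i)" by (rule int_latticeE)
  then have "int idxD *s v = (\<Sum>i\<in>UNIV. c i *s (int idxD *s a i))"
    by (simp add: Finite_Cartesian_Product.vec_eq_iff sum_distrib_left algebra_simps)
  also have "\<dots> \<in> LI"
  proof -
    have "(\<Sum>i\<in>S. c i *s (int idxD *s a i)) \<in> LI" if "finite S" for S
      using that
    proof (induction S rule: finite_induct)
      case empty
      then show ?case using sub by (simp add: subgrp_def)
    next
      case (insert x F)
      then show ?case using subgrp_add[OF sub subgrp_smult[OF sub ai]] by simp
    qed
    then show ?thesis by simp
  qed
  finally show ?thesis .
qed

section \<open>Common zeros as a translate of a finite group of characters\<close>

definition Sol :: "('n \<Rightarrow> complex) \<Rightarrow> (nat \<Rightarrow> complex) set" where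
  "Sol c = {t \<in> torus ed. \<forall>i\<in>- J. chr ed fd t (a i) = c i}"

lemma chr_Sol_LI:
  assumes "t \<in> Sol c" "v = (\<Sum>i\<in>- J. r i *s a i)"
  shows "chr ed fd t v = (\<Prod>i\<in>- J. c i powi r i)"
  using assms chr_sum[of t "- J" r a] by (auto simp: Sol_def)

text \<open>\<open>idxD\<close> times a basis vector lies in \<open>LI\<close>, so each coordinate
  of a solution has a prescribed \<open>idxD\<close>-th power.\<close>

lemma finite_Sol: "finite (Sol c)"
proof -
  have "\<exists>C. \<forall>t\<in>Sol c. t k ^ idxD = C" if k: "k < ed" for k
  proof -
    obtain r where r: "int idxD *s bas k = (\<Sum>i\<in>- J. r i *s a i)" by (rule int_latticeE[OF idxD_LI[of "bas k"]])
    have "t k ^ idxD = (\<Prod>i\<in>- J. c i powi r i)" if t: "t \<in> Sol c" for t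
    proof -
      have "chr ed fd t (bas k) = (\<Prod>l<ed. if l = k then t k else 1)"
        unfolding chr_def
      proof (rule prod.cong[OF refl])
        fix l assume "l \<in> {..<ed}"
        then have "fd k = fd l \<longleftrightarrow> l = k" using fd k by (auto simp: bij_betw_def inj_on_def)
        then show "t l powi (bas k $ fd l) = (if l = k then t k else 1)" by (auto simp: bas_def axis_def)
      qed
      then have "chr ed fd t (bas k) = t k" using k by simp
      moreover have "t \<in> torus ed" using t by (simp add: Sol_def)
      ultimately have "chr ed fd t (int idxD *s bas k) = t k ^ idxD" by (simp add: chr_smult)
      then show ?thesis using chr_Sol_LI[OF t r] by simp
    qed
    then show ?thesis by blast
  qed
  then have ex: "\<exists>C. \<forall>t\<in>Sol c. t k ^ idxD = C" if "k < ed" for k using that .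
  define C where "C k = (SOME C. \<forall>t\<in>Sol c. t k ^ idxD = C)" for k
  have C: "t k ^ idxD = C k" if "k < ed" "t \<in> Sol c" for k t
    using someI_ex[OF ex[OF that(1)], folded C_def] that(2) by blast
  have "Sol c \<subseteq> Pi\<^sub>E {..<ed} (\<lambda>k. {w. w ^ idxD = C k})"
  proof
    fix t assume t: "t \<in> Sol c"
    then have "t \<in> extensional {..<ed}" by (simp add: Sol_def torus_def PiE_iff)
    then show "t \<in> Pi\<^sub>E {..<ed} (\<lambda>k. {w. w ^ idxD = C k})" using C[OF _ t] by (simp add: PiE_iff)
  qed
  moreover have "finite (Pi\<^sub>E {..<ed} (\<lambda>k. {w :: complex. w ^ idxD = C k}))"
    by (rule finite_PiE) (auto intro: finite_nth_roots idxD_pos)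
  ultimately show ?thesis by (rule finite_subset)
qed

text \<open>By independence the prescribed values define a character of \<open>LI\<close>; an
  extension of it to Z^d is a point of the torus.\<close>

lemma Sol_nonempty:
  assumes c: "\<And>i. i \<in> - J \<Longrightarrow> c i \<noteq> 0" shows "Sol c \<noteq> {}"
proof -
  have sub: "subgrp LI" by (rule sum_int_lattice_closed)
  define \<psi> where "\<psi> v = (\<Prod>i\<in>- J. c i powi ((SOME r. v = (\<Sum>i\<in>- J. r i *s a i)) i))" for v
  have val: "\<psi> (\<Sum>i\<in>- J. r i *s a i) = (\<Prod>i\<in>- J. c i powi r i)" for r
  proof -
    define r' where "r' = (SOME r'. (\<Sum>i\<in>- J. r i *s a i) = (\<Sum>i\<in>- J. r' i *s a i))"
    have "(\<Sum>i\<in>- J. r i *s a i) = (\<Sum>i\<in>- J. r' i *s a i)" unfolding r'_def by (rule someI[of _ r]) simp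
    then have "(\<Sum>i\<in>- J. (r i - r' i) *s a i) = 0" by (simp add: Finite_Cartesian_Product.vec_eq_iff sum_subtractf algebra_simps)
    then have "r i - r' i = 0" if "i \<in> - J" for i
      using LI_independent[unfolded independent_family_def, rule_format, of "\<lambda>i. r i - r' i" i] that by blast
    then show ?thesis unfolding \<psi>_def r'_def[symmetric] by (intro prod.cong) auto
  qed
  have "char_on LI \<psi>" unfolding char_on_def
  proof (intro conjI ballI)
    fix u v assume "u \<in> LI" "v \<in> LI"
    then obtain r s where h: "u = (\<Sum>i\<in>- J. r i *s a i)" "v = (\<Sum>i\<in>- J. s i *s a i)" by (elim int_latticeE)
    have "u + v = (\<Sum>i\<in>- J. (r i + s i) *s a i)" unfolding h by (simp add: Finite_Cartesian_Product.vec_eq_iff sum.distrib algebra_simps)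
    then have "\<psi> (u + v) = (\<Prod>i\<in>- J. c i powi (r i + s i))" using val[of "\<lambda>i. r i + s i"] by simp
    also have "\<dots> = \<psi> u * \<psi> v" unfolding h val prod.distrib[symmetric]
      by (rule prod.cong) (use c in \<open>auto simp: power_int_add\<close>)
    finally show "\<psi> (u + v) = \<psi> u * \<psi> v" .
  next
    fix u assume "u \<in> LI"
    then obtain r where "u = (\<Sum>i\<in>- J. r i *s a i)" by (elim int_latticeE)
    then show "\<psi> u \<noteq> 0" using val c by simp
  qed
  then obtain \<psi>' where \<psi>': "char_on UNIV \<psi>'" "\<And>u. u \<in> LI \<Longrightarrow> \<psi>' u = \<psi> u"
    by (rule char_extend[OF sub]) (rule that)
  obtain t where t: "t \<in> torus ed" "\<And>v. chr ed fd t v = \<psi>' v" by (rule torus_of_char[OF \<psi>'(1)]) (rule that)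
  have "chr ed fd t (a i) = c i" if i: "i \<in> - J" for i
  proof -
    have e: "a i = (\<Sum>l\<in>- J. of_bool (l = i) *s a l)"
    proof -
      have "(\<Sum>l\<in>- J. of_bool (l = i) *s a l) = (\<Sum>l\<in>{i}. of_bool (l = i) *s a l)"
        by (rule sum.mono_neutral_right) (use i in auto)
      then show ?thesis by simp
    qed
    have "a i \<in> LI" by (rule int_latticeI[OF e])
    then have "chr ed fd t (a i) = \<psi> (a i)" using t(2) \<psi>'(2) by simp
    also have "\<dots> = (\<Prod>l\<in>- J. c l powi of_bool (l = i))" by (subst e) (rule val)
    also have "\<dots> = (\<Prod>l\<in>{i}. c l powi of_bool (l = i))"
      by (rule prod.mono_neutral_right) (use i in auto)
    finally show ?thesis by simp
  qed
  then have "t \<in> Sol c" using t(1) by (simp add: Sol_def)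
  then show ?thesis by blast
qed

text \<open>Multiplication in the torus moves one solution set onto another. It serves for counting,
  for the averaging argument of orthogonality, and for following the zeros when \<open>x\<close>
  varies.\<close>

lemma Sol_translate:
  assumes s: "s \<in> torus ed" "\<And>i. i \<in> - J \<Longrightarrow> chr ed fd s (a i) * c i = c' i"
  shows "bij_betw (\<lambda>t. \<lambda>k\<in>{..<ed}. s k * t k) (Sol c) (Sol c')"
proof (rule bij_betwI[where g = "\<lambda>t. \<lambda>k\<in>{..<ed}. inverse (s k) * t k"])
  have s0: "s k \<noteq> 0" if "k < ed" for k using s(1) that by (auto simp: torus_def PiE_iff)
  have si: "(\<lambda>k\<in>{..<ed}. inverse (s k)) \<in> torus ed" using s0 by (auto simp: torus_def)
  have ci: "chr ed fd (\<lambda>k\<in>{..<ed}. inverse (s k)) v = inverse (chr ed fd s v)" for v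
    using prod_inversef[of "\<lambda>k. s k powi v $ fd k" "{..<ed}"] by (simp add: chr_def power_int_inverse o_def)
  show "(\<lambda>t. \<lambda>k\<in>{..<ed}. s k * t k) \<in> Sol c \<rightarrow> Sol c'"
  proof
    fix t assume t: "t \<in> Sol c"
    then have "(\<lambda>k\<in>{..<ed}. s k * t k) \<in> torus ed" using s0 by (auto simp: torus_def Sol_def PiE_iff)
    then show "(\<lambda>k\<in>{..<ed}. s k * t k) \<in> Sol c'" using t s(2) by (auto simp: Sol_def chr_mult)
  qed
  show "(\<lambda>t. \<lambda>k\<in>{..<ed}. inverse (s k) * t k) \<in> Sol c' \<rightarrow> Sol c"
  proof
    fix t assume t: "t \<in> Sol c'"
    have e: "(\<lambda>k\<in>{..<ed}. inverse (s k) * t k) = (\<lambda>k\<in>{..<ed}. (\<lambda>k\<in>{..<ed}. inverse (s k)) k * t k)" by auto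
    have "(\<lambda>k\<in>{..<ed}. inverse (s k) * t k) \<in> torus ed" using s0 t by (auto simp: torus_def Sol_def PiE_iff)
    moreover have "chr ed fd (\<lambda>k\<in>{..<ed}. inverse (s k) * t k) (a i) = c i" if i: "i \<in> - J" for i
    proof -
      have "chr ed fd (\<lambda>k\<in>{..<ed}. inverse (s k) * t k) (a i) = inverse (chr ed fd s (a i)) * c' i"
        unfolding trans[OF arg_cong[OF e, of "\<lambda>x. chr ed fd x (a i)"] chr_mult] ci
        using t i by (simp add: Sol_def)
      also have "\<dots> = c i" unfolding s(2)[OF i, symmetric] using chr_nonzero[OF s(1), of "a i"] by simp
      finally show ?thesis .
    qed
    ultimately show "(\<lambda>k\<in>{..<ed}. inverse (s k) * t k) \<in> Sol c" by (simp add: Sol_def)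
  qed
  show "(\<lambda>k\<in>{..<ed}. inverse (s k) * (\<lambda>k\<in>{..<ed}. s k * t k) k) = t" if "t \<in> Sol c" for t
    by (rule extensionalityI[of _ "{..<ed}"]) (use that s0 in \<open>auto simp: Sol_def torus_def PiE_iff\<close>)
  show "(\<lambda>k\<in>{..<ed}. s k * (\<lambda>k\<in>{..<ed}. inverse (s k) * t k) k) = t" if "t \<in> Sol c'" for t
    by (rule extensionalityI[of _ "{..<ed}"]) (use that s0 in \<open>auto simp: Sol_def torus_def PiE_iff\<close>)
qed

lemma card_Sol:
  assumes c: "\<And>i. i \<in> - J \<Longrightarrow> c i \<noteq> 0" shows "card (Sol c) = card (Sol (\<lambda>_. 1))"
proof -
  obtain s where "s \<in> Sol c" using Sol_nonempty[of c] c by blast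
  then have "bij_betw (\<lambda>t. \<lambda>k\<in>{..<ed}. s k * t k) (Sol (\<lambda>_. 1)) (Sol c)"
    by (intro Sol_translate) (auto simp: Sol_def)
  from bij_betw_same_card[OF this] show ?thesis by simp
qed

lemma card_Sol_pos: "card (Sol (\<lambda>_. 1)) > 0"
  using finite_Sol Sol_nonempty[of "\<lambda>_. 1"] by (simp add: card_gt_0_iff)

lemma sum_chr_LI:
  assumes c: "\<And>i. i \<in> - J \<Longrightarrow> c i \<noteq> 0" and v: "v = (\<Sum>i\<in>- J. r i *s a i)"
  shows "(\<Sum>t\<in>Sol c. chr ed fd t v) = of_nat (card (Sol (\<lambda>_. 1))) * (\<Prod>i\<in>- J. c i powi r i)"
  using chr_Sol_LI[OF _ v] using card_Sol[of c] c by simp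

text \<open>Orthogonality: translation by a point that is trivial on \<open>LI\<close> but not at
  \<open>v\<close> permutes the solutions and multiplies the sum by a factor different from
  1.\<close>

lemma sum_chr_not_LI:
  assumes v: "v \<notin> LI"
  shows "(\<Sum>t\<in>Sol c. chr ed fd t v) = 0"
proof -
  obtain \<psi> where \<psi>: "char_on UNIV \<psi>" "\<And>u. u \<in> LI \<Longrightarrow> \<psi> u = 1" "\<psi> v \<noteq> 1"
    by (rule separating_character[OF sum_int_lattice_closed v idxD_pos idxD_LI]) (rule that)
  obtain s where s: "s \<in> torus ed" "\<And>v. chr ed fd s v = \<psi> v" by (rule torus_of_char[OF \<psi>(1)]) (rule that)
  have ai: "a i \<in> LI" if i: "i \<in> - J" for i
  proof -
    have "(\<Sum>l\<in>- J. of_bool (l = i) *s a l) = (\<Sum>l\<in>{i}. of_bool (l = i) *s a l)"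
      by (rule sum.mono_neutral_right) (use i in auto)
    then have "a i = (\<Sum>l\<in>- J. of_bool (l = i) *s a l)" by simp
    then show ?thesis by (rule int_latticeI)
  qed
  have b: "bij_betw (\<lambda>t. \<lambda>k\<in>{..<ed}. s k * t k) (Sol c) (Sol c)"
    by (rule Sol_translate[OF s(1)]) (simp add: s(2) \<psi>(2)[OF ai])
  have "(\<Sum>t\<in>Sol c. chr ed fd t v) = (\<Sum>t\<in>Sol c. chr ed fd (\<lambda>k\<in>{..<ed}. s k * t k) v)"
    by (rule sum.reindex_bij_betw[OF b, symmetric])
  also have "\<dots> = \<psi> v * (\<Sum>t\<in>Sol c. chr ed fd t v)" by (simp add: chr_mult s(2) sum_distrib_left)
  finally show ?thesis using \<psi>(3) by simp
qed

end

lemma sum_pow_geometric: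
  fixes x :: complex
  assumes "1 - x ^ n \<noteq> 0"
  shows "1 / (1 - x) = (\<Sum>l<n. x ^ l) / (1 - x ^ n)" "1 - x \<noteq> 0"
proof -
  show nz: "1 - x \<noteq> 0" using assms by auto
  have "(1 - x) * (\<Sum>l<n. x ^ l) = 1 - x ^ n" by (simp add: one_diff_power_eq)
  then show "1 / (1 - x) = (\<Sum>l<n. x ^ l) / (1 - x ^ n)" using assms nz by (simp add: field_simps)
qed

section \<open>The residue sum for exponents one\<close>

context toric
begin

definition cz :: "('n + 'n \<Rightarrow> complex) \<Rightarrow> 'n \<Rightarrow> complex" where
  "cz z i = - z (Inl i) / z (Inr i)"

definition fz :: "('n + 'n \<Rightarrow> complex) \<Rightarrow> 'n \<Rightarrow> (nat \<Rightarrow> complex) \<Rightarrow> complex" where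
  "fz z i t = z (Inl i) + z (Inr i) * chr ed fd t (a i)"

text \<open>For \<open>m = 1\<close> this is, up to a factor independent of \<open>z\<close>, the
  sum of the residues: at a common zero \<open>y i * t^(a i) = - x i\<close>, so the Jacobian of the
  \<open>f i\<close>, \<open>i \<notin> J\<close>, in logarithmic coordinates is a constant times
  the product of these \<open>x i\<close>.\<close>

definition Rsum :: "('n \<Rightarrow> nat) \<Rightarrow> ('n + 'n \<Rightarrow> complex) \<Rightarrow> complex" where
  "Rsum m z = (\<Sum>t\<in>Sol (cz z). chr ed fd t \<gamma> * (\<Prod>i\<in>- J. 1 / z (Inl i)) * (\<Prod>j\<in>J. 1 / fz z j t ^ m j))"

definition good :: "('n + 'n \<Rightarrow> complex) \<Rightarrow> bool" where
  "good z \<longleftrightarrow> (\<forall>v. z v \<noteq> 0) \<and> (\<forall>j\<in>J. den j z \<noteq> 0)"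

definition rho :: "('n + 'n \<Rightarrow> complex) \<Rightarrow> 'n \<Rightarrow> complex" where
  "rho z i = - (z (Inr i) / z (Inl i))"

lemma cz_rho: "cz z i = inverse (rho z i)"
  by (simp add: cz_def rho_def field_simps)

lemma rho_powi:
  assumes "\<And>v. z v \<noteq> 0"
  shows "nrm_one d * lmono (idx (\<lambda>_. 0) d) z = (\<Prod>i\<in>UNIV. rho z i powi d i)"
proof -
  have "rho z i powi d i = (if even (d i) then 1 else -1) * (z (Inl i) powi (- d i) * z (Inr i) powi d i)" for i
    by (simp add: rho_def power_int_minus_left power_int_divide_distrib power_int_minus field_simps)
  then show ?thesis
    unfolding nrm_one lmono_def prod_Plus_UNIV by (simp add: idx_def prod.distrib)
qed

lemma lmono_idx_one:
  assumes "\<And>v. z v \<noteq> 0"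
  shows "lmono (idx (\<lambda>_. 1) d) z = (\<Prod>i\<in>UNIV. 1 / z (Inl i)) * lmono (idx (\<lambda>_. 0) d) z"
proof -
  have "z (Inl i) powi (- 1 - d i) = (1 / z (Inl i)) * z (Inl i) powi (- d i)" for i
    using assms[of "Inl i"] by (simp add: power_int_diff power_int_minus field_simps)
  then show ?thesis
    unfolding lmono_def prod_Plus_UNIV by (simp add: idx_def prod.distrib prod_dividef)
qed

definition tau :: "('n + 'n \<Rightarrow> complex) \<Rightarrow> 'n \<Rightarrow> (nat \<Rightarrow> complex) \<Rightarrow> complex" where
  "tau z j t = rho z j * chr ed fd t (a j)"

lemma fz_tau: "z (Inl j) \<noteq> 0 \<Longrightarrow> fz z j t = z (Inl j) * (1 - tau z j t)"
  by (simp add: fz_def tau_def rho_def field_simps)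

text \<open>The relation \<open>g j\<close> expresses \<open>g j j *s a j\<close> by the
  \<open>a i\<close> outside \<open>J\<close>, whose characters are prescribed on
  \<open>Sol\<close>. So the power of \<open>tau\<close> is the same at all solutions, and it is the
  monomial in \<open>den j\<close>.\<close>

lemma tau_pow:
  assumes z: "\<And>v. z v \<noteq> 0" and j: "j \<in> J" and t: "t \<in> Sol (cz z)"
  shows "tau z j t ^ nat (g j j) = nrm_one (g j) * lmono (idx (\<lambda>_. 0) (g j)) z"
proof -
  have tt: "t \<in> torus ed" using t by (simp add: Sol_def)
  have gj: "g j j > 0" using g[OF j] by blast
  have "chr ed fd t (a j) ^ nat (g j j) = chr ed fd t (g j j *s a j)"
    using gj by (simp add: chr_smult[OF tt] power_int_def)
  also have "g j j *s a j = (\<Sum>i\<in>- J. (- g j i) *s a i)"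
    unfolding g_relation[OF j] by (simp add: Finite_Cartesian_Product.vec_eq_iff sum_negf)
  also have "chr ed fd t \<dots> = (\<Prod>i\<in>- J. cz z i powi (- g j i))" by (rule chr_Sol_LI[OF t refl])
  also have "\<dots> = (\<Prod>i\<in>- J. rho z i powi g j i)"
    by (simp add: cz_rho power_int_minus power_int_inverse)
  finally have 1: "chr ed fd t (a j) ^ nat (g j j) = (\<Prod>i\<in>- J. rho z i powi g j i)" .
  have "(\<Prod>i\<in>UNIV. rho z i powi g j i) = (\<Prod>i\<in>insert j (- J). rho z i powi g j i)"
    by (rule prod.mono_neutral_right) (use g[OF j] in auto)
  also have "\<dots> = rho z j powi g j j * (\<Prod>i\<in>- J. rho z i powi g j i)" using j by simp
  also have "rho z j powi g j j = rho z j ^ nat (g j j)" using gj by (simp add: power_int_def)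
  finally have "(\<Prod>i\<in>UNIV. rho z i powi g j i) = tau z j t ^ nat (g j j)"
    by (simp add: tau_def power_mult_distrib 1)
  then show ?thesis using rho_powi[of z "g j"] z by simp
qed

lemma fz_nonzero:
  assumes "good z" "j \<in> J" "t \<in> Sol (cz z)"
  shows "fz z j t \<noteq> 0"
proof -
  have z: "\<And>v. z v \<noteq> 0" and d: "den j z \<noteq> 0" using assms by (auto simp: good_def)
  have "1 - tau z j t ^ nat (g j j) \<noteq> 0" using d tau_pow[OF z assms(2,3)] by (simp add: den_def)
  then show ?thesis using sum_pow_geometric(2) z by (simp add: fz_tau)
qed

text \<open>Each \<open>1 / f j\<close> is rewritten as a finite geometric sum over the denominator
  \<open>den j\<close>, which all solutions share. What remains are sums of characters over the
  solutions, and orthogonality keeps only the terms of the box.\<close>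

theorem Rsum_closed_form:
  assumes "good z"
  shows "Rsum (\<lambda>_. 1) z = of_nat (card (Sol (\<lambda>_. 1))) * closed_form z"
proof -
  have z: "\<And>v. z v \<noteq> 0" and d: "\<And>j. j \<in> J \<Longrightarrow> den j z \<noteq> 0" using assms by (auto simp: good_def)
  define N where "N = (of_nat (card (Sol (\<lambda>_. 1))) :: complex)"
  define X where "X = (\<Prod>i\<in>UNIV. 1 / z (Inl i))"
  define P where "P = Pi\<^sub>E J (\<lambda>j. {..<nat (g j j)})"
  have cnz: "cz z i \<noteq> 0" for i using z by (simp add: cz_def)
  have rnz: "rho z i \<noteq> 0" for i using z by (simp add: rho_def)
  have summand: "(\<Prod>i\<in>- J. 1 / z (Inl i)) * (\<Prod>j\<in>J. 1 / fz z j t ^ 1)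
     = X / (\<Prod>j\<in>J. den j z) * (\<Sum>l\<in>P. \<Prod>j\<in>J. tau z j t ^ l j)" if t: "t \<in> Sol (cz z)" for t
  proof -
    have "(\<Prod>j\<in>J. 1 / fz z j t ^ 1) = (\<Prod>j\<in>J. (1 / z (Inl j)) * ((\<Sum>l<nat (g j j). tau z j t ^ l) / den j z))"
    proof (rule prod.cong[OF refl])
      fix j assume j: "j \<in> J"
      have e: "den j z = 1 - tau z j t ^ nat (g j j)" using tau_pow[OF z j t] by (simp add: den_def)
      have "1 / fz z j t ^ 1 = (1 / z (Inl j)) * (1 / (1 - tau z j t))" using z by (simp add: fz_tau)
      also have "1 / (1 - tau z j t) = (\<Sum>l<nat (g j j). tau z j t ^ l) / den j z"
        unfolding e by (rule sum_pow_geometric) (use d[OF j] e in simp)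
      finally show "1 / fz z j t ^ 1 = (1 / z (Inl j)) * ((\<Sum>l<nat (g j j). tau z j t ^ l) / den j z)" .
    qed
    also have "\<dots> = (\<Prod>j\<in>J. 1 / z (Inl j)) * ((\<Prod>j\<in>J. \<Sum>l<nat (g j j). tau z j t ^ l) / (\<Prod>j\<in>J. den j z))"
      by (simp only: prod.distrib prod_dividef)
    also have "(\<Prod>j\<in>J. \<Sum>l<nat (g j j). tau z j t ^ l) = (\<Sum>l\<in>P. \<Prod>j\<in>J. tau z j t ^ l j)"
      unfolding P_def by (rule prod_sum_PiE) auto
    finally have 1: "(\<Prod>j\<in>J. 1 / fz z j t ^ 1) = (\<Prod>j\<in>J. 1 / z (Inl j)) * ((\<Sum>l\<in>P. \<Prod>j\<in>J. tau z j t ^ l j) / (\<Prod>j\<in>J. den j z))" .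
    have "X = (\<Prod>i\<in>- J. 1 / z (Inl i)) * (\<Prod>j\<in>J. 1 / z (Inl j))"
      unfolding X_def by (subst prod.union_disjoint[symmetric]) (auto intro: prod.cong simp: Compl_partition2)
    then show ?thesis unfolding 1 by simp
  qed
  have "Rsum (\<lambda>_. 1) z = (\<Sum>t\<in>Sol (cz z). chr ed fd t \<gamma> * (X / (\<Prod>j\<in>J. den j z) * (\<Sum>l\<in>P. \<Prod>j\<in>J. tau z j t ^ l j)))"
    unfolding Rsum_def by (rule sum.cong[OF refl]) (simp only: summand mult.assoc)
  also have "\<dots> = X / (\<Prod>j\<in>J. den j z) * (\<Sum>l\<in>P. \<Sum>t\<in>Sol (cz z). chr ed fd t \<gamma> * (\<Prod>j\<in>J. tau z j t ^ l j))"
    by (subst sum.swap) (simp add: sum_distrib_left mult_ac)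
  also have "(\<Sum>l\<in>P. \<Sum>t\<in>Sol (cz z). chr ed fd t \<gamma> * (\<Prod>j\<in>J. tau z j t ^ l j))
     = (\<Sum>k\<in>fin_part. N * (\<Prod>i\<in>UNIV. rho z i powi k i))"
  proof -
    define F where "F l = (\<Sum>t\<in>Sol (cz z). chr ed fd t \<gamma> * (\<Prod>j\<in>J. tau z j t ^ l j))" for l
    have F: "F l = (\<Prod>j\<in>J. rho z j ^ l j) * (\<Sum>t\<in>Sol (cz z). chr ed fd t (\<gamma> + (\<Sum>j\<in>J. int (l j) *s a j)))" for l
    proof -
      have "chr ed fd t \<gamma> * (\<Prod>j\<in>J. tau z j t ^ l j) = (\<Prod>j\<in>J. rho z j ^ l j) * chr ed fd t (\<gamma> + (\<Sum>j\<in>J. int (l j) *s a j))"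
        if "t \<in> Sol (cz z)" for t
      proof -
        have tt: "t \<in> torus ed" using that by (simp add: Sol_def)
        have "chr ed fd t (\<Sum>j\<in>J. int (l j) *s a j) = (\<Prod>j\<in>J. chr ed fd t (a j) ^ l j)"
          by (simp add: chr_sum[OF tt])
        then show ?thesis by (simp add: chr_add[OF tt] tau_def power_mult_distrib prod.distrib)
      qed
      then show ?thesis unfolding F_def by (simp add: sum_distrib_left)
    qed
    \<comment> \<open>The tuples \<open>l\<close> whose character lies in \<open>LI\<close> are
      exactly the restrictions to \<open>J\<close> of the elements of \<open>fin_part\<close>: the
      entries outside \<open>J\<close> can be recovered from the coordinates of that character in
      the \<open>a i\<close>.\<close>
    define h where "h k = (\<lambda>j\<in>J. nat (k j))" for k :: "'n \<Rightarrow> int"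
    have hP: "h ` fin_part \<subseteq> P"
    proof (rule image_subsetI)
      fix k assume "k \<in> fin_part"
      then show "h k \<in> P" unfolding h_def P_def fin_part_def by (auto simp: nat_less_eq_zless)
    qed
    have inj: "inj_on h fin_part"
    proof (rule inj_onI)
      fix k k' assume k: "k \<in> fin_part" "k' \<in> fin_part" "h k = h k'"
      have "k j = k' j" if j: "j \<in> J" for j
      proof -
        have "nat (k j) = nat (k' j)" using fun_cong[OF k(3), of j] j by (simp add: h_def)
        then show ?thesis using k(1,2) j unfolding fin_part_def by (auto simp: nat_eq_iff2)
      qed
      moreover have "(\<lambda>i. k i - k' i) \<in> rel_lattice a"
        using k(1,2) unfolding fin_part_def rel_lattice_def mem_Collect_eq sum_smult_diff by simp
      ultimately have "(\<lambda>i. k i - k' i) = (\<lambda>_. 0)" using span unfolding spanning_def by simp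
      then show "k = k'" by (simp add: fun_eq_iff)
    qed
    have Fk: "F (h k) = N * (\<Prod>i\<in>UNIV. rho z i powi k i)" if k: "k \<in> fin_part" for k
    proof -
      have pos: "k j \<ge> 0" if "j \<in> J" for j using k that by (auto simp: fin_part_def)
      have split: "(\<Sum>i\<in>UNIV. k i *s a i) = (\<Sum>i\<in>- J. k i *s a i) + (\<Sum>j\<in>J. k j *s a j)"
        by (subst sum.union_disjoint[symmetric]) (auto intro: sum.cong simp: Compl_partition2)
      have "(\<Sum>j\<in>J. int (h k j) *s a j) = (\<Sum>j\<in>J. k j *s a j)"
        by (rule sum.cong) (use pos in \<open>auto simp: h_def\<close>)
      then have "\<gamma> + (\<Sum>j\<in>J. int (h k j) *s a j) = - (\<Sum>i\<in>- J. k i *s a i)"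
        using k split unfolding fin_part_def by (simp add: algebra_simps eq_neg_iff_add_eq_0)
      also have "\<dots> = (\<Sum>i\<in>- J. (- k i) *s a i)"
        by (simp add: Finite_Cartesian_Product.vec_eq_iff sum_negf)
      finally have "F (h k) = (\<Prod>j\<in>J. rho z j ^ h k j) * (N * (\<Prod>i\<in>- J. cz z i powi (- k i)))"
        unfolding F N_def using sum_chr_LI[of "cz z"] cnz by simp
      also have "(\<Prod>i\<in>- J. cz z i powi (- k i)) = (\<Prod>i\<in>- J. rho z i powi k i)"
        by (simp add: cz_rho power_int_minus power_int_inverse)
      also have "(\<Prod>j\<in>J. rho z j ^ h k j) = (\<Prod>j\<in>J. rho z j powi k j)"
        by (rule prod.cong) (use pos in \<open>auto simp: h_def power_int_def\<close>)
      also have "(\<Prod>j\<in>J. rho z j powi k j) * (N * (\<Prod>i\<in>- J. rho z i powi k i)) = N * ((\<Prod>i\<in>- J. rho z i powi k i) * (\<Prod>j\<in>J. rho z j powi k j))"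
        by simp
      also have "(\<Prod>i\<in>- J. rho z i powi k i) * (\<Prod>j\<in>J. rho z j powi k j) = (\<Prod>i\<in>UNIV. rho z i powi k i)"
        by (subst prod.union_disjoint[symmetric]) (auto intro: prod.cong simp: Compl_partition2)
      finally show ?thesis .
    qed
    have F0: "F l = 0" if l: "l \<in> P" "l \<notin> h ` fin_part" for l
    proof (cases "\<gamma> + (\<Sum>j\<in>J. int (l j) *s a j) \<in> LI")
      case False
      then show ?thesis unfolding F using sum_chr_not_LI by simp
    next
      case True
      then obtain r where r: "\<gamma> + (\<Sum>j\<in>J. int (l j) *s a j) = (\<Sum>i\<in>- J. r i *s a i)" by (rule int_latticeE)
      define k where "k i = (if i \<in> J then int (l i) else - r i)" for i
      have "(\<Sum>i\<in>UNIV. k i *s a i) = (\<Sum>i\<in>- J. k i *s a i) + (\<Sum>j\<in>J. k j *s a j)"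
        by (subst sum.union_disjoint[symmetric]) (auto intro: sum.cong simp: Compl_partition2)
      also have "(\<Sum>i\<in>- J. k i *s a i) = (\<Sum>i\<in>- J. (- r i) *s a i)" by (rule sum.cong) (auto simp: k_def)
      also have "\<dots> = - (\<Sum>i\<in>- J. r i *s a i)" by (simp add: Finite_Cartesian_Product.vec_eq_iff sum_negf)
      also have "(\<Sum>j\<in>J. k j *s a j) = (\<Sum>j\<in>J. int (l j) *s a j)" by (rule sum.cong) (auto simp: k_def)
      finally have "(\<Sum>i\<in>UNIV. k i *s a i) = - \<gamma>" unfolding r[symmetric] by simp
      moreover have "\<forall>j\<in>J. 0 \<le> k j \<and> k j < g j j"
        using l(1) by (auto simp: P_def k_def PiE_iff)
      ultimately have "k \<in> fin_part" by (simp add: fin_part_def)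
      moreover have "h k = l"
      proof (rule extensionalityI[of _ J])
        show "l \<in> extensional J" using l(1) by (simp add: P_def PiE_iff)
      qed (auto simp: h_def k_def)
      ultimately have False using l(2) by blast
      then show ?thesis ..
    qed
    have finP: "finite P" unfolding P_def by (rule finite_PiE) auto
    have "(\<Sum>l\<in>P. F l) = (\<Sum>l\<in>h ` fin_part. F l)"
      by (rule sum.mono_neutral_right[OF finP hP]) (use F0 in blast)
    also have "\<dots> = (\<Sum>k\<in>fin_part. F (h k))" by (simp add: sum.reindex[OF inj])
    also have "\<dots> = (\<Sum>k\<in>fin_part. N * (\<Prod>i\<in>UNIV. rho z i powi k i))" by (rule sum.cong[OF refl Fk])
    finally show ?thesis unfolding F_def .
  qed
  also have "(\<Sum>k\<in>fin_part. N * (\<Prod>i\<in>UNIV. rho z i powi k i)) = N * (\<Sum>k\<in>fin_part. nrm_one k * lmono (idx (\<lambda>_. 0) k) z)"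
    using z by (simp add: rho_powi sum_distrib_left)
  finally have "Rsum (\<lambda>_. 1) z = N * ((\<Sum>k\<in>fin_part. nrm_one k * (X * lmono (idx (\<lambda>_. 0) k) z)) / (\<Prod>j\<in>J. den j z))"
    by (simp add: sum_distrib_left sum_divide_distrib mult_ac)
  also have "(\<Sum>k\<in>fin_part. nrm_one k * (X * lmono (idx (\<lambda>_. 0) k) z)) = (\<Sum>k\<in>fin_part. nrm_one k * lmono (idx (\<lambda>_. 1) k) z)"
    using lmono_idx_one[of z] z unfolding X_def by simp
  finally show ?thesis unfolding closed_form_def N_def .
qed

lemma gen_good:
  assumes "\<And>j. j \<in> J \<Longrightarrow> wt (weight_diff w) (g j) \<noteq> 0"
  shows "gen good"
proof -
  have "gen (\<lambda>z. \<forall>j\<in>J. den j z \<noteq> 0)"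
  proof (rule gen_ball)
    fix j assume "j \<in> J"
    then show "gen (\<lambda>z. den j z \<noteq> 0)"
      unfolding den_def by (intro gen_binomial_nonzero[where w = w] nrm_one_nonzero) (simp add: wt_idx0 assms)
  qed simp
  from gen_conj[OF gen_all_nonzero this] show ?thesis unfolding good_def[abs_def] .
qed

end

section \<open>Local residues in a polydisc\<close>

text \<open>A multi-order spelt out as a list of first-order derivatives, so that proofs advance by
  one derivative at a time.\<close>

definition word_of :: "('a \<Rightarrow> nat) \<Rightarrow> 'a list \<Rightarrow> 'a list" where
  "word_of b ks = concat (map (\<lambda>k. replicate (b k) k) ks)"

text \<open>The factor 2 keeps \<open>u = \<zeta> k / x k\<close> in the disc of radius 1/2, where
  \<open>Ln (1 - u)\<close> is holomorphic and bounded by \<open>2 * cmod u\<close>.\<close>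

locale polydisc_algebra =
  fixes n :: nat and x :: "nat \<Rightarrow> complex" and \<delta> :: real
  assumes \<delta>: "\<delta> > 0" "\<And>k. k < n \<Longrightarrow> 2 * \<delta> < cmod (x k)"
begin

definition Pd :: "(nat \<Rightarrow> complex) set" where
  "Pd = {\<zeta>. \<forall>k<n. cmod (\<zeta> k) < \<delta>}"

text \<open>
  The branches of the solutions of \<open>f i = \<zeta>\<close> are exponentials of combinations of logarithms. The class of
  functions generated by them suffices for the residues, is closed under partial derivatives, and
  avoids a theory of holomorphic functions of several variables.
\<close>

inductive hol_alg :: "((nat \<Rightarrow> complex) \<Rightarrow> complex) \<Rightarrow> bool" where
  ha_const: "hol_alg (\<lambda>_. c)"
| ha_pw: "hol_alg (\<lambda>\<zeta>. exp (\<Sum>k<n. r k * Ln (1 - \<zeta> k / x k)))"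
| ha_add: "hol_alg f \<Longrightarrow> hol_alg g \<Longrightarrow> hol_alg (\<lambda>\<zeta>. f \<zeta> + g \<zeta>)"
| ha_mult: "hol_alg f \<Longrightarrow> hol_alg g \<Longrightarrow> hol_alg (\<lambda>\<zeta>. f \<zeta> * g \<zeta>)"
| ha_inv: "hol_alg g \<Longrightarrow> B > 0 \<Longrightarrow> (\<And>\<zeta>. \<zeta> \<in> Pd \<Longrightarrow> cmod (g \<zeta>) \<ge> B) \<Longrightarrow> hol_alg (\<lambda>\<zeta>. inverse (g \<zeta>))"

definition pder :: "nat \<Rightarrow> ((nat \<Rightarrow> complex) \<Rightarrow> complex) \<Rightarrow> ((nat \<Rightarrow> complex) \<Rightarrow> complex) \<Rightarrow> bool" where
  "pder k g g' \<longleftrightarrow> (\<forall>\<zeta>\<in>Pd. ((\<lambda>t. g (\<zeta>(k := t))) has_field_derivative g' \<zeta>) (at (\<zeta> k)))"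

lemma xk: "k < n \<Longrightarrow> x k \<noteq> 0"
  using \<delta>(1) \<delta>(2)[of k] by auto

lemma Pd_ratio:
  assumes "\<zeta> \<in> Pd" "k < n" shows "cmod (\<zeta> k / x k) < 1/2"
proof -
  have "cmod (\<zeta> k) < \<delta>" "2 * \<delta> < cmod (x k)" using assms \<delta> by (auto simp: Pd_def)
  moreover have "cmod (x k) > 0" using xk assms by simp
  ultimately show ?thesis by (simp add: norm_divide divide_less_eq)
qed

lemma Pd_slit:
  assumes "\<zeta> \<in> Pd" "k < n" shows "1 - \<zeta> k / x k \<notin> \<real>\<^sub>\<le>\<^sub>0"
proof
  assume "1 - \<zeta> k / x k \<in> \<real>\<^sub>\<le>\<^sub>0"
  then have "Re (1 - \<zeta> k / x k) \<le> 0" by (simp add: complex_nonpos_Reals_iff)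
  moreover have "Re (\<zeta> k / x k) \<le> cmod (\<zeta> k / x k)" by (rule complex_Re_le_cmod)
  ultimately show False using Pd_ratio[OF assms] by simp
qed

lemma Pd_upd: "\<zeta> \<in> Pd \<Longrightarrow> cmod t < \<delta> \<Longrightarrow> \<zeta>(k := t) \<in> Pd"
  by (auto simp: Pd_def)

lemma sum_upd:
  assumes "k < n"
  shows "(\<Sum>l<n. r l * Ln (1 - (\<zeta>(k := t)) l / x l)) = r k * Ln (1 - t / x k) + (\<Sum>l\<in>{..<n} - {k}. r l * Ln (1 - \<zeta> l / x l))"
  using assms by (subst sum.remove[of _ k]) (auto intro!: sum.cong)

text \<open>The inner derivative \<open>1 / (1 - \<zeta> k / x k)\<close> is again such an
  exponential, with coefficient -1 at \<open>k\<close>, so the derivative stays in the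
  class.\<close>

lemma pder_pw:
  assumes k: "k < n"
  shows "pder k (\<lambda>\<zeta>. exp (\<Sum>l<n. r l * Ln (1 - \<zeta> l / x l)))
     (\<lambda>\<zeta>. (- r k / x k) * (exp (\<Sum>l<n. r l * Ln (1 - \<zeta> l / x l)) * exp (\<Sum>l<n. (if l = k then -1 else 0) * Ln (1 - \<zeta> l / x l))))"
  unfolding pder_def
proof
  fix \<zeta> assume z: "\<zeta> \<in> Pd"
  have s: "1 - \<zeta> k / x k \<notin> \<real>\<^sub>\<le>\<^sub>0" by (rule Pd_slit[OF z k])
  then have nz: "1 - \<zeta> k / x k \<noteq> 0" by auto
  define R where "R = (\<Sum>l\<in>{..<n} - {k}. r l * Ln (1 - \<zeta> l / x l))"
  have "(\<Sum>l<n. (if l = k then -1 else 0) * Ln (1 - \<zeta> l / x l)) = (\<Sum>l<n. if l = k then - Ln (1 - \<zeta> k / x k) else 0)"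
    by (rule sum.cong) auto
  then have e: "exp (\<Sum>l<n. (if l = k then -1 else 0) * Ln (1 - \<zeta> l / x l)) = 1 / (1 - \<zeta> k / x k)"
    using k nz by (simp add: exp_minus field_simps)
  have e2: "(\<Sum>l<n. r l * Ln (1 - \<zeta> l / x l)) = r k * Ln (1 - \<zeta> k / x k) + R"
    unfolding R_def using sum_upd[OF k, of r \<zeta> "\<zeta> k"] by simp
  have dL: "((\<lambda>t. Ln (1 - t / x k)) has_field_derivative (- 1 / x k) / (1 - \<zeta> k / x k)) (at (\<zeta> k))"
    using s xk[OF k] by (auto intro!: derivative_eq_intros simp: field_simps)
  have "((\<lambda>t. exp (r k * Ln (1 - t / x k) + R)) has_field_derivative
      exp (r k * Ln (1 - \<zeta> k / x k) + R) * (r k * ((- 1 / x k) / (1 - \<zeta> k / x k)))) (at (\<zeta> k))"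
    using DERIV_add[OF DERIV_cmult[OF dL, of "r k"] DERIV_const[of R]]
    by (intro DERIV_chain2[OF DERIV_exp]) simp
  then show "((\<lambda>t. exp (\<Sum>l<n. r l * Ln (1 - (\<zeta>(k := t)) l / x l))) has_field_derivative
     (- r k / x k) * (exp (\<Sum>l<n. r l * Ln (1 - \<zeta> l / x l)) * exp (\<Sum>l<n. (if l = k then -1 else 0) * Ln (1 - \<zeta> l / x l)))) (at (\<zeta> k))"
    unfolding sum_upd[OF k] e R_def[symmetric] e2 by (simp add: field_simps)
qed

lemma pder_const: "pder k (\<lambda>_. c) (\<lambda>_. 0)"
  by (simp add: pder_def)

lemma pder_add: "pder k f f' \<Longrightarrow> pder k g g' \<Longrightarrow> pder k (\<lambda>\<zeta>. f \<zeta> + g \<zeta>) (\<lambda>\<zeta>. f' \<zeta> + g' \<zeta>)"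
  unfolding pder_def by (intro ballI DERIV_add) simp_all

lemma pder_mult: 
  assumes "pder k f f'" "pder k g g'" 
  shows "pder k (\<lambda>\<zeta>. f \<zeta> * g \<zeta>) (\<lambda>\<zeta>. f' \<zeta> * g \<zeta> + f \<zeta> * g' \<zeta>)"
  unfolding pder_def
proof
  fix \<zeta> assume z: "\<zeta> \<in> Pd"
  have "((\<lambda>t. f (\<zeta>(k := t)) * g (\<zeta>(k := t))) has_field_derivative f' \<zeta> * g (\<zeta>(k := \<zeta> k)) + g' \<zeta> * f (\<zeta>(k := \<zeta> k))) (at (\<zeta> k))"
    by (rule DERIV_mult) (use assms z in \<open>auto simp: pder_def\<close>)
  then show "((\<lambda>t. f (\<zeta>(k := t)) * g (\<zeta>(k := t))) has_field_derivative f' \<zeta> * g \<zeta> + f \<zeta> * g' \<zeta>) (at (\<zeta> k))"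
    by (simp add: algebra_simps)
qed

lemma pder_inv:
  assumes "pder k g g'" "\<And>\<zeta>. \<zeta> \<in> Pd \<Longrightarrow> g \<zeta> \<noteq> 0" 
  shows "pder k (\<lambda>\<zeta>. inverse (g \<zeta>)) (\<lambda>\<zeta>. (-1) * (g' \<zeta> * (inverse (g \<zeta>) * inverse (g \<zeta>))))"
  unfolding pder_def
proof
  fix \<zeta> assume z: "\<zeta> \<in> Pd"
  have "((\<lambda>t. inverse (g (\<zeta>(k := t)))) has_field_derivative - (inverse (g (\<zeta>(k := \<zeta> k))) * g' \<zeta> * inverse (g (\<zeta>(k := \<zeta> k))))) (at (\<zeta> k))"
    by (rule DERIV_inverse') (use assms z in \<open>auto simp: pder_def\<close>)
  then show "((\<lambda>t. inverse (g (\<zeta>(k := t)))) has_field_derivative (-1) * (g' \<zeta> * (inverse (g \<zeta>) * inverse (g \<zeta>)))) (at (\<zeta> k))"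
    by (simp add: algebra_simps)
qed

lemma pderI: "hol_alg g' \<Longrightarrow> pder k g g' \<Longrightarrow> \<exists>g'. hol_alg g' \<and> pder k g g'"
  by (rule exI[of _ g'], rule conjI)

lemma hol_alg_pder:
  assumes "hol_alg g" "k < n" shows "\<exists>g'. hol_alg g' \<and> pder k g g'"
  using assms
proof (induction rule: hol_alg.induct)
  case (ha_const c)
  show ?case by (rule pderI[OF hol_alg.ha_const[of 0] pder_const])
next
  case (ha_pw r)
  show ?case
    by (rule pderI[OF _ pder_pw[OF ha_pw]]) (intro hol_alg.ha_mult hol_alg.ha_const hol_alg.ha_pw)
next
  case (ha_add f g)
  from ha_add.IH(1)[OF ha_add.prems] obtain f' where f': "hol_alg f'" "pder k f f'" by (elim exE conjE)
  from ha_add.IH(2)[OF ha_add.prems] obtain g' where g': "hol_alg g'" "pder k g g'" by (elim exE conjE)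
  show ?case by (rule pderI[OF hol_alg.ha_add[OF f'(1) g'(1)] pder_add[OF f'(2) g'(2)]])
next
  case (ha_mult f g)
  from ha_mult.IH(1)[OF ha_mult.prems] obtain f' where f': "hol_alg f'" "pder k f f'" by (elim exE conjE)
  from ha_mult.IH(2)[OF ha_mult.prems] obtain g' where g': "hol_alg g'" "pder k g g'" by (elim exE conjE)
  show ?case
    by (rule pderI[OF hol_alg.ha_add[OF hol_alg.ha_mult[OF f'(1) ha_mult.hyps(2)] hol_alg.ha_mult[OF ha_mult.hyps(1) g'(1)]] pder_mult[OF f'(2) g'(2)]])
next
  case (ha_inv g B)
  from ha_inv.IH[OF ha_inv.prems] obtain g' where h: "hol_alg g'" "pder k g g'" by (elim exE conjE)
  have i: "hol_alg (\<lambda>\<zeta>. inverse (g \<zeta>))" by (rule hol_alg.ha_inv[OF ha_inv.hyps])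
  have nz: "g \<zeta> \<noteq> 0" if "\<zeta> \<in> Pd" for \<zeta> using ha_inv.hyps(2) ha_inv.hyps(3)[OF that] by auto
  show ?case
    by (rule pderI[OF hol_alg.ha_mult[OF hol_alg.ha_const hol_alg.ha_mult[OF h(1) hol_alg.ha_mult[OF i i]]] pder_inv[OF h(2) nz]])
qed

text \<open>The clause for inverses asks for a uniform lower bound so that this holds; boundedness
  is what makes the integrands integrable for Fubini.\<close>

lemma hol_alg_bounded:
  assumes "hol_alg g" shows "\<exists>B. \<forall>\<zeta>\<in>Pd. cmod (g \<zeta>) \<le> B"
  using assms
proof (induction rule: hol_alg.induct)
  case (ha_const c)
  show ?case by blast
next
  case (ha_pw r)
  have "cmod (exp (\<Sum>k<n. r k * Ln (1 - \<zeta> k / x k))) \<le> exp (\<Sum>k<n. cmod (r k))" if z: "\<zeta> \<in> Pd" for \<zeta>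
  proof -
    have "cmod (\<Sum>k<n. r k * Ln (1 - \<zeta> k / x k)) \<le> (\<Sum>k<n. cmod (r k))"
    proof (rule sum_norm_le)
      fix k assume "k \<in> {..<n}"
      then have u: "cmod (\<zeta> k / x k) < 1/2" using Pd_ratio[OF z] by simp
      have "cmod (Ln (1 + - (\<zeta> k / x k))) \<le> 2 * cmod (- (\<zeta> k / x k))"
        by (rule norm_Ln_le) (use u in \<open>simp only: norm_minus_cancel\<close>)
      then have "cmod (Ln (1 - \<zeta> k / x k)) \<le> 2 * cmod (\<zeta> k / x k)" by (simp only: norm_minus_cancel add_uminus_conv_diff)
      then have "cmod (Ln (1 - \<zeta> k / x k)) \<le> 1" using u by linarith
      then have "cmod (r k) * cmod (Ln (1 - \<zeta> k / x k)) \<le> cmod (r k) * 1" by (intro mult_left_mono) auto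
      then show "cmod (r k * Ln (1 - \<zeta> k / x k)) \<le> cmod (r k)" by (simp add: norm_mult)
    qed
    then show ?thesis by (metis exp_le_cancel_iff norm_exp order_trans)
  qed
  then show ?case by blast
next
  case (ha_add f g)
  then obtain A B where "\<forall>\<zeta>\<in>Pd. cmod (f \<zeta>) \<le> A" "\<forall>\<zeta>\<in>Pd. cmod (g \<zeta>) \<le> B" by blast
  then have "\<forall>\<zeta>\<in>Pd. cmod (f \<zeta> + g \<zeta>) \<le> A + B" by (meson add_mono norm_triangle_le)
  then show ?case by (rule exI[of _ "A + B"])
next
  case (ha_mult f g)
  then obtain A B where "\<forall>\<zeta>\<in>Pd. cmod (f \<zeta>) \<le> A" "\<forall>\<zeta>\<in>Pd. cmod (g \<zeta>) \<le> B" by blast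
  note AB = this
  have "cmod (f \<zeta> * g \<zeta>) \<le> A * B" if z: "\<zeta> \<in> Pd" for \<zeta>
  proof -
    have fA: "cmod (f \<zeta>) \<le> A" and gB: "cmod (g \<zeta>) \<le> B" using AB z by auto
    have "0 \<le> A" using fA norm_ge_zero[of "f \<zeta>"] by linarith
    then show ?thesis unfolding norm_mult by (intro mult_mono fA gB) auto
  qed
  then show ?case by (intro exI[of _ "A * B"] ballI)
next
  case (ha_inv g B)
  then have "\<forall>\<zeta>\<in>Pd. cmod (inverse (g \<zeta>)) \<le> inverse B"
    by (simp add: norm_inverse le_imp_inverse_le)
  then show ?case by blast
qed

lemma hol_alg_measurable:
  assumes "hol_alg g" "\<And>k. k < n \<Longrightarrow> (\<lambda>s. \<Phi> s k) \<in> borel_measurable M"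
  shows "(\<lambda>s. g (\<Phi> s)) \<in> borel_measurable M"
  using assms
proof (induction rule: hol_alg.induct)
  case (ha_pw r)
  have "(\<lambda>s. \<Sum>k<n. r k * Ln (1 - \<Phi> s k / x k)) \<in> borel_measurable M"
  proof (rule borel_measurable_sum)
    fix k assume "k \<in> {..<n}"
    then have [measurable]: "(\<lambda>s. \<Phi> s k) \<in> borel_measurable M" using ha_pw by simp
    show "(\<lambda>s. r k * Ln (1 - \<Phi> s k / x k)) \<in> borel_measurable M" by measurable
  qed
  then show ?case by measurable
qed auto

text \<open>A relation, because \<open>pder\<close> determines a derivative on \<open>Pd\<close>
  only and leaves its other values open. All intermediate derivatives are required to be in the
  class.\<close>

inductive ders :: "nat list \<Rightarrow> ((nat \<Rightarrow> complex) \<Rightarrow> complex) \<Rightarrow> ((nat \<Rightarrow> complex) \<Rightarrow> complex) \<Rightarrow> bool" where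
  ders_nil: "hol_alg g \<Longrightarrow> ders [] g g"
| ders_cons: "k < n \<Longrightarrow> hol_alg g \<Longrightarrow> pder k g g1 \<Longrightarrow> ders ks g1 h \<Longrightarrow> ders (k # ks) g h"

lemma ders_hol: "ders ks g h \<Longrightarrow> hol_alg g \<and> hol_alg h"
  by (induction rule: ders.induct) auto

lemma ders_exists: "hol_alg g \<Longrightarrow> (\<And>k. k \<in> set ks \<Longrightarrow> k < n) \<Longrightarrow> \<exists>h. ders ks g h"
proof (induction ks arbitrary: g)
  case Nil
  then show ?case using ders_nil by blast
next
  case (Cons k ks)
  obtain g1 where g1: "hol_alg g1" "pder k g g1" using hol_alg_pder[OF Cons.prems(1), of k] Cons.prems(2) by auto
  obtain h where "ders ks g1 h" using Cons.IH[OF g1(1)] Cons.prems(2) by auto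
  then show ?case using ders_cons[OF _ Cons.prems(1) g1(2)] Cons.prems(2) by auto
qed

lemma ders_add: "ders ks g h \<Longrightarrow> ders ks g' h' \<Longrightarrow> ders ks (\<lambda>\<zeta>. g \<zeta> + g' \<zeta>) (\<lambda>\<zeta>. h \<zeta> + h' \<zeta>)"
proof (induction arbitrary: g' h' rule: ders.induct)
  case (ders_nil g)
  from ders_nil(2) show ?case by cases (auto intro: ders.ders_nil ha_add ders_nil(1))
next
  case (ders_cons k g g1 ks h)
  from ders_cons.prems show ?case
  proof cases
    case (ders_cons g1')
    show ?thesis
      by (rule ders.ders_cons[OF ders_cons(1) ha_add pder_add]) (use ders_cons ders_cons.hyps ders_cons.IH in auto)
  qed
qed

lemma ders_Nil: "ders [] g h \<longleftrightarrow> hol_alg g \<and> h = g"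
  by (subst ders.simps) auto

lemma ders_Cons: "ders (k # ks) g h \<longleftrightarrow> k < n \<and> hol_alg g \<and> (\<exists>g1. pder k g g1 \<and> ders ks g1 h)"
  by (subst ders.simps) auto

lemma ders_appendE:
  assumes "ders (ks @ ls) g h"
  obtains h1 where "ders ks g h1" "ders ls h1 h"
  using assms
proof (induction ks arbitrary: g thesis)
  case Nil
  have "ders ls g h" using Nil(2) by simp
  then show ?case using Nil(1)[of g] ders_hol by (simp add: ders_Nil)
next
  case (Cons k ks)
  then obtain g1 where g1: "k < n" "hol_alg g" "pder k g g1" "ders (ks @ ls) g1 h" by (auto simp: ders_Cons)
  show ?case
  proof (rule Cons.IH[OF _ g1(4)])
    fix h1 assume "ders ks g1 h1" "ders ls h1 h"
    then show thesis using Cons.prems(1)[of h1] ders_cons[OF g1(1-3)] by simp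
  qed
qed

lemma ders_appendI: "ders ks g h1 \<Longrightarrow> ders ls h1 h \<Longrightarrow> ders (ks @ ls) g h"
  by (induction rule: ders.induct) (auto intro: ders_cons)

lemma ders_higher_deriv:
  assumes "ders (replicate b k) g h" "\<zeta> \<in> Pd" "cmod t < \<delta>"
  shows "(deriv ^^ b) (\<lambda>t. g (\<zeta>(k := t))) t = h (\<zeta>(k := t))"
  using assms(1,3)
proof (induction b arbitrary: g t)
  case 0
  then have "h = g" by (auto elim: ders.cases)
  then show ?case by simp
next
  case (Suc b)
  then obtain g1 where g1: "k < n" "pder k g g1" "ders (replicate b k) g1 h" by (auto elim: ders.cases)
  have d: "deriv (\<lambda>t. g (\<zeta>(k := t))) u = g1 (\<zeta>(k := u))" if "cmod u < \<delta>" for u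
  proof (rule DERIV_imp_deriv)
    show "((\<lambda>t. g (\<zeta>(k := t))) has_field_derivative g1 (\<zeta>(k := u))) (at u)"
      using g1(2) Pd_upd[OF assms(2) that, of k] unfolding pder_def by force
  qed
  have "eventually (\<lambda>u. u \<in> ball 0 \<delta>) (nhds t)"
    using Suc.prems(2) by (intro eventually_nhds_in_open) auto
  then have "eventually (\<lambda>u. deriv (\<lambda>t. g (\<zeta>(k := t))) u = g1 (\<zeta>(k := u))) (nhds t)"
    by (rule eventually_mono) (use d in auto)
  then have "(deriv ^^ b) (deriv (\<lambda>t. g (\<zeta>(k := t)))) t = (deriv ^^ b) (\<lambda>t. g1 (\<zeta>(k := t))) t"
    by (rule higher_deriv_cong_ev) simp
  also have "\<dots> = h (\<zeta>(k := t))" by (rule Suc.IH[OF g1(3) Suc.prems(2)])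
  finally show ?case by (simp only: funpow_Suc_right o_apply)
qed

end

section \<open>Cauchy's formula on a product of circles\<close>

definition cyc :: "real \<Rightarrow> real \<Rightarrow> complex" where
  "cyc \<epsilon> r = of_real \<epsilon> * exp (2 * of_real pi * \<i> * of_real r)"

lemma norm_cyc: "\<epsilon> > 0 \<Longrightarrow> cmod (cyc \<epsilon> r) = \<epsilon>"
  by (simp add: cyc_def norm_mult)

lemma cyc_nonzero: "\<epsilon> > 0 \<Longrightarrow> cyc \<epsilon> r \<noteq> 0"
  by (simp add: cyc_def)

lemma cyc_measurable [measurable]: "cyc \<epsilon> \<in> borel_measurable borel"
  unfolding cyc_def[abs_def] by measurable

text \<open>On the circle \<open>dw / w = 2 * pi * \<i> * dr\<close>, so the kernel
  \<open>1 / w^(b + 1)\<close> appears with exponent \<open>b\<close> only. The end point is a null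
  set, which allows the half-open interval used for cubes.\<close>

lemma cauchy_circle:
  assumes f: "continuous_on (cball 0 \<epsilon>) f" "f holomorphic_on ball 0 \<epsilon>" and e: "\<epsilon> > 0"
  shows "(LINT r : {0..<1} | lborel. f (cyc \<epsilon> r) * inverse (cyc \<epsilon> r) ^ b) = (deriv ^^ b) f 0 / fact b"
proof -
  let ?F = "\<lambda>r. f (cyc \<epsilon> r) * inverse (cyc \<epsilon> r) ^ b"
  have "((\<lambda>u. f u / (u - 0) ^ Suc b) has_contour_integral ((2 * pi * \<i>) / fact b * (deriv ^^ b) f 0)) (circlepath 0 \<epsilon>)"
    by (rule Cauchy_has_contour_integral_higher_derivative_circlepath[OF f]) (use e in simp)
  then have "((\<lambda>r. f (circlepath 0 \<epsilon> r) / (circlepath 0 \<epsilon> r - 0) ^ Suc b * vector_derivative (circlepath 0 \<epsilon>) (at r)) has_integral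
      ((2 * pi * \<i>) / fact b * (deriv ^^ b) f 0)) {0..1}"
    by (simp only: has_contour_integral)
  moreover have "f (circlepath 0 \<epsilon> r) / (circlepath 0 \<epsilon> r - 0) ^ Suc b * vector_derivative (circlepath 0 \<epsilon>) (at r)
      = (2 * pi * \<i>) * ?F r" for r
  proof -
    have 1: "circlepath 0 \<epsilon> r = cyc \<epsilon> r" by (simp add: circlepath cyc_def mult_ac)
    have 2: "vector_derivative (circlepath 0 \<epsilon>) (at r) = 2 * pi * \<i> * cyc \<epsilon> r"
      unfolding vector_derivative_circlepath by (simp add: cyc_def mult_ac)
    show ?thesis unfolding 1 2 using cyc_nonzero[OF e, of r] by (simp add: field_simps)
  qed
  ultimately have "((\<lambda>r. (2 * pi * \<i>) * ?F r) has_integral ((2 * pi * \<i>) * ((deriv ^^ b) f 0 / fact b))) {0..1}"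
    by (simp add: field_simps)
  from has_integral_mult_right[OF this, of "inverse (2 * pi * \<i>)"]
  have hi: "(?F has_integral ((deriv ^^ b) f 0 / fact b)) {0..1}"
    by (simp add: field_simps)
  have "continuous_on {0..1} ?F"
  proof -
    have c: "continuous_on {0..1} (cyc \<epsilon>)" unfolding cyc_def[abs_def] by (intro continuous_intros)
    have "continuous_on {0..1} (\<lambda>r. f (cyc \<epsilon> r))"
      by (rule continuous_on_compose2[OF f(1) c]) (use norm_cyc[OF e] in auto)
    then show ?thesis using cyc_nonzero[OF e] by (intro continuous_intros c) auto
  qed
  then have "set_integrable lborel {0..1} ?F" by (rule borel_integrable_atLeastAtMost')
  from set_borel_integral_eq_integral(2)[OF this] have "(LINT r : {0..1} | lborel. ?F r) = (deriv ^^ b) f 0 / fact b"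
    using hi by (simp add: integral_unique)
  moreover have "(LINT r : {0..<1} | lborel. ?F r) = (LINT r : {0..1} | lborel. ?F r)"
    by (rule set_integral_discrete_difference[where X = "{1}"]) auto
  ultimately show ?thesis by simp
qed

context polydisc_algebra
begin

lemma polydisc_cauchy_one:
  assumes d: "ders (replicate b k) g h" and k: "k < n" "0 < \<epsilon>" "\<epsilon> < \<delta>" and z: "\<zeta> \<in> Pd"
  shows "(LINT r : {0..<1} | lborel. g (\<zeta>(k := cyc \<epsilon> r)) * inverse (cyc \<epsilon> r) ^ b) = h (\<zeta>(k := 0)) / fact b"
proof -
  let ?f = "\<lambda>t. g (\<zeta>(k := t))"
  obtain g' where g': "pder k g g'" using hol_alg_pder[of g k] ders_hol[OF d] k by blast
  have D: "(?f has_field_derivative g' (\<zeta>(k := t))) (at t)" if "cmod t < \<delta>" for t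
    using g' Pd_upd[OF z that, of k] unfolding pder_def by force
  have "continuous_on (cball 0 \<epsilon>) ?f"
    by (rule DERIV_continuous_on) (rule DERIV_subset[OF D], use k in auto)
  moreover have "?f holomorphic_on ball 0 \<epsilon>"
  proof (rule holomorphic_onI)
    fix t :: complex assume "t \<in> ball 0 \<epsilon>"
    then have "cmod t < \<delta>" using k by simp
    from has_field_derivative_at_within[OF D[OF this]]
    have "(?f has_field_derivative g' (\<zeta>(k := t))) (at t within ball 0 \<epsilon>)" .
    then show "?f field_differentiable (at t within ball 0 \<epsilon>)"
      unfolding field_differentiable_def by (rule exI[of _ "g' (\<zeta>(k := t))"])
  qed
  ultimately have "(LINT r : {0..<1} | lborel. ?f (cyc \<epsilon> r) * inverse (cyc \<epsilon> r) ^ b) = (deriv ^^ b) ?f 0 / fact b"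
    using k by (intro cauchy_circle)
  also have "(deriv ^^ b) ?f 0 = h (\<zeta>(k := 0))"
    by (rule ders_higher_deriv[OF d z]) (use \<delta> in simp)
  finally show ?thesis .
qed

text \<open>Fubini peels off the first variable of \<open>ks\<close>, and the one-variable formula
  replaces it by a derivative at 0. The word lists the derivatives in the same order, so no
  interchange of partial derivatives is involved.\<close>

theorem polydisc_cauchy:
  assumes "distinct ks" "\<And>k. k \<in> set ks \<Longrightarrow> k < n \<and> 0 < \<epsilon> k \<and> \<epsilon> k < \<delta>" "ders (word_of b ks) g h" "\<zeta> \<in> Pd"
  shows "(LINT s : (set ks \<rightarrow>\<^sub>E {0..<1}) | PiM (set ks) (\<lambda>_. lborel).
      g (\<lambda>k. if k \<in> set ks then cyc (\<epsilon> k) (s k) else \<zeta> k) * (\<Prod>k\<in>set ks. inverse (cyc (\<epsilon> k) (s k)) ^ b k))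
    = h (\<lambda>k. if k \<in> set ks then 0 else \<zeta> k) / (\<Prod>k\<in>set ks. fact (b k))"
  using assms
proof (induction ks arbitrary: g \<zeta>)
  case Nil
  interpret product_sigma_finite "\<lambda>_::nat. lborel :: real measure" by standard
  have "h = g" using Nil by (simp add: word_of_def ders_Nil)
  then show ?case
    unfolding set_lebesgue_integral_def by (simp add: PiM_empty lebesgue_integral_count_space_finite)
next
  case (Cons k ks)
  interpret product_sigma_finite "\<lambda>_::nat. lborel :: real measure" by standard
  let ?K = "set ks" and ?M = "\<lambda>_::nat. lborel :: real measure"
  have k: "k < n" "0 < \<epsilon> k" "\<epsilon> k < \<delta>" "k \<notin> ?K" using Cons.prems by auto
  have ek: "\<And>l. l \<in> set (k # ks) \<Longrightarrow> l < n \<and> 0 < \<epsilon> l \<and> \<epsilon> l < \<delta>" using Cons.prems(2) by blast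
  have "word_of b (k # ks) = replicate (b k) k @ word_of b ks" by (simp add: word_of_def)
  then obtain h1 where h1: "ders (replicate (b k) k) g h1" "ders (word_of b ks) h1 h"
    using Cons.prems(3) by (auto elim: ders_appendE)
  have hg: "hol_alg g" using ders_hol[OF h1(1)] by blast
  define P where "P K s = (\<lambda>l. if l \<in> K then cyc (\<epsilon> l) (s l) else \<zeta> l)" for K and s :: "nat \<Rightarrow> real"
  define Q where "Q K s = (\<Prod>l\<in>K. inverse (cyc (\<epsilon> l) (s l)) ^ b l)" for K and s :: "nat \<Rightarrow> real"
  define A where "A K = (K \<rightarrow>\<^sub>E {0..<1::real})" for K :: "nat set"
  have Pd: "P K s \<in> Pd" if "K \<subseteq> set (k # ks)" for K s
    unfolding Pd_def P_def
  proof (intro CollectI allI impI)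
    fix l assume l: "l < n"
    show "cmod (if l \<in> K then cyc (\<epsilon> l) (s l) else \<zeta> l) < \<delta>"
    proof (cases "l \<in> K")
      case True
      then have "l \<in> set (k # ks)" using that by blast
      then show ?thesis using ek[of l] norm_cyc[of "\<epsilon> l"] True by simp
    next
      case False
      then show ?thesis using Cons.prems(4) l by (simp add: Pd_def)
    qed
  qed
  let ?F = "\<lambda>s. g (P (insert k ?K) s) * Q (insert k ?K) s"
  have int: "integrable (PiM (insert k ?K) ?M) (\<lambda>s. indicator (A (insert k ?K)) s *\<^sub>R ?F s)"
  proof -
    obtain B where B: "\<And>\<zeta>. \<zeta> \<in> Pd \<Longrightarrow> cmod (g \<zeta>) \<le> B" using hol_alg_bounded[OF hg] by blast
    have meas: "(\<lambda>s. P (insert k ?K) s l) \<in> borel_measurable (PiM (insert k ?K) ?M)" for l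
    proof (cases "l \<in> insert k ?K")
      case True
      have "(\<lambda>s. cyc (\<epsilon> l) (s l)) \<in> borel_measurable (PiM (insert k ?K) ?M)"
        by (rule measurable_compose[OF measurable_component_singleton[OF True]]) simp
      then show ?thesis using True by (simp add: P_def)
    qed (simp add: P_def)
    have 1: "A (insert k ?K) \<in> sets (PiM (insert k ?K) ?M)"
      unfolding A_def by (rule sets_PiM_I_finite) auto
    have 2: "?F \<in> borel_measurable (PiM (insert k ?K) ?M)"
    proof (rule borel_measurable_times)
      show "(\<lambda>s. g (P (insert k ?K) s)) \<in> borel_measurable (PiM (insert k ?K) ?M)"
        by (rule hol_alg_measurable[OF hg]) (rule meas)
      show "Q (insert k ?K) \<in> borel_measurable (PiM (insert k ?K) ?M)"
        unfolding Q_def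
      proof (rule borel_measurable_prod)
        fix l assume l: "l \<in> insert k ?K"
        have "(\<lambda>s. cyc (\<epsilon> l) (s l)) \<in> borel_measurable (PiM (insert k ?K) ?M)"
          by (rule measurable_compose[OF measurable_component_singleton[OF l]]) simp
        then show "(\<lambda>s. inverse (cyc (\<epsilon> l) (s l)) ^ b l) \<in> borel_measurable (PiM (insert k ?K) ?M)" by measurable
      qed
    qed
    have "emeasure (PiM (insert k ?K) ?M) (A (insert k ?K)) = (\<Prod>l\<in>insert k ?K. emeasure lborel {0..<1::real})"
      unfolding A_def by (rule emeasure_PiM) auto
    then have 3: "emeasure (PiM (insert k ?K) ?M) (A (insert k ?K)) < \<infinity>" by simp
    have "cmod (?F s) \<le> B * (\<Prod>l\<in>insert k ?K. inverse (\<epsilon> l) ^ b l)" for s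
    proof -
      have "cmod (Q (insert k ?K) s) = (\<Prod>l\<in>insert k ?K. inverse (\<epsilon> l) ^ b l)"
        unfolding Q_def prod_norm[symmetric]
        by (rule prod.cong) (use ek norm_cyc in \<open>auto simp: norm_power norm_inverse\<close>)
      moreover have "cmod (g (P (insert k ?K) s)) \<le> B" by (rule B[OF Pd]) simp
      moreover have "(\<Prod>l\<in>insert k ?K. inverse (\<epsilon> l) ^ b l) \<ge> 0"
        by (rule prod_nonneg) (use ek in \<open>auto simp: less_imp_le\<close>)
      ultimately show ?thesis by (simp add: norm_mult mult_right_mono)
    qed
    then have 4: "AE s in PiM (insert k ?K) ?M. s \<in> A (insert k ?K) \<longrightarrow> cmod (?F s) \<le> B * (\<Prod>l\<in>insert k ?K. inverse (\<epsilon> l) ^ b l)" by simp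
    show ?thesis by (rule integrableI_bounded_set_indicator[OF 1 2 3 4])
  qed
  have "(LINT s : A (insert k ?K) | PiM (insert k ?K) ?M. ?F s)
      = (LINT s | PiM ?K ?M. LINT r | lborel. indicator (A (insert k ?K)) (s(k := r)) *\<^sub>R ?F (s(k := r)))"
    unfolding set_lebesgue_integral_def
    by (rule product_integral_insert[OF _ k(4) int]) simp
  also have "\<dots> = (LINT s | PiM ?K ?M. indicator (A ?K) s *\<^sub>R ((h1 ((P ?K s)(k := 0)) / fact (b k)) * Q ?K s))"
  proof (rule Bochner_Integration.integral_cong[OF refl])
    fix s assume "s \<in> space (PiM ?K ?M)"
    then have s: "s \<in> extensional ?K" by (simp add: space_PiM PiE_iff)
    have "indicator (A (insert k ?K)) (s(k := r)) *\<^sub>R ?F (s(k := r))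
       = indicator {0..<1} r *\<^sub>R (g ((P ?K s)(k := cyc (\<epsilon> k) r)) * inverse (cyc (\<epsilon> k) r) ^ b k) * (indicator (A ?K) s *\<^sub>R Q ?K s)" for r
    proof -
      have "(s(k := r) \<in> A (insert k ?K)) \<longleftrightarrow> r \<in> {0..<1} \<and> s \<in> A ?K"
        using s k(4) unfolding A_def by (auto simp: PiE_iff extensional_def)
      then have 1: "indicator (A (insert k ?K)) (s(k := r)) = (indicator {0..<1} r * indicator (A ?K) s :: real)"
        by (auto simp: indicator_def)
      have 2: "P (insert k ?K) (s(k := r)) = (P ?K s)(k := cyc (\<epsilon> k) r)"
        using k(4) by (auto simp: P_def fun_eq_iff)
      have "(\<Prod>l\<in>?K. inverse (cyc (\<epsilon> l) ((s(k := r)) l)) ^ b l) = Q ?K s"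
        unfolding Q_def by (rule prod.cong) (use k(4) in auto)
      then have 3: "Q (insert k ?K) (s(k := r)) = inverse (cyc (\<epsilon> k) r) ^ b k * Q ?K s"
        unfolding Q_def using k(4) by simp
      show ?thesis unfolding 1 2 3 by (simp add: scaleR_conv_of_real)
    qed
    then have "(\<lambda>r. indicator (A (insert k ?K)) (s(k := r)) *\<^sub>R ?F (s(k := r)))
       = (\<lambda>r. indicator {0..<1} r *\<^sub>R (g ((P ?K s)(k := cyc (\<epsilon> k) r)) * inverse (cyc (\<epsilon> k) r) ^ b k) * (indicator (A ?K) s *\<^sub>R Q ?K s))"
      by (rule ext)
    then have "(LINT r | lborel. indicator (A (insert k ?K)) (s(k := r)) *\<^sub>R ?F (s(k := r)))
       = (LINT r | lborel. indicator {0..<1} r *\<^sub>R (g ((P ?K s)(k := cyc (\<epsilon> k) r)) * inverse (cyc (\<epsilon> k) r) ^ b k) * (indicator (A ?K) s *\<^sub>R Q ?K s))"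
      by (simp only:)
    also have "\<dots> = (LINT r : {0..<1} | lborel. g ((P ?K s)(k := cyc (\<epsilon> k) r)) * inverse (cyc (\<epsilon> k) r) ^ b k) * (indicator (A ?K) s *\<^sub>R Q ?K s)"
      unfolding set_lebesgue_integral_def by (rule integral_mult_left_zero)
    also have "(LINT r : {0..<1} | lborel. g ((P ?K s)(k := cyc (\<epsilon> k) r)) * inverse (cyc (\<epsilon> k) r) ^ b k) = h1 ((P ?K s)(k := 0)) / fact (b k)"
      by (rule polydisc_cauchy_one[OF h1(1) k(1-3) Pd]) auto
    finally show "(LINT r | lborel. indicator (A (insert k ?K)) (s(k := r)) *\<^sub>R ?F (s(k := r)))
       = indicator (A ?K) s *\<^sub>R ((h1 ((P ?K s)(k := 0)) / fact (b k)) * Q ?K s)" by (simp only: mult_scaleR_right)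
  qed
  also have "\<dots> = (LINT s | PiM ?K ?M. (indicator (A ?K) s *\<^sub>R (h1 ((P ?K s)(k := 0)) * Q ?K s)) / fact (b k))"
    by (rule Bochner_Integration.integral_cong[OF refl]) (simp add: scaleR_conv_of_real)
  also have "\<dots> = (LINT s : A ?K | PiM ?K ?M. h1 ((P ?K s)(k := 0)) * Q ?K s) / fact (b k)"
    unfolding set_lebesgue_integral_def by simp
  also have "(LINT s : A ?K | PiM ?K ?M. h1 ((P ?K s)(k := 0)) * Q ?K s)
     = h (\<lambda>l. if l \<in> ?K then 0 else (\<zeta>(k := 0)) l) / (\<Prod>l\<in>?K. fact (b l))"
  proof -
    have e: "(P ?K s)(k := 0) = (\<lambda>l. if l \<in> ?K then cyc (\<epsilon> l) (s l) else (\<zeta>(k := 0)) l)" for s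
      using k(4) by (auto simp: P_def fun_eq_iff)
    have z0: "\<zeta>(k := 0) \<in> Pd" by (rule Pd_upd[OF Cons.prems(4)]) (use \<delta> in simp)
    show ?thesis unfolding e A_def Q_def
      by (rule Cons.IH[OF _ _ h1(2) z0]) (use Cons.prems(1) ek in auto)
  qed
  also have "(\<lambda>l. if l \<in> ?K then 0 else (\<zeta>(k := 0)) l) = (\<lambda>l. if l \<in> insert k ?K then 0 else \<zeta> l)"
    by auto
  finally show ?case using k(4) unfolding A_def P_def Q_def by (simp add: mult.commute)
qed

end

section \<open>Words of derivatives, determinants, and exponentials close to one\<close>

lemma fold_word_of: "fold (\<lambda>k. F k ^^ b k) ks x = fold F (word_of b ks) x"
proof (induction ks arbitrary: x)
  case (Cons k ks)
  have "fold F (replicate m k) y = (F k ^^ m) y" for m y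
    by (induction m arbitrary: y) (simp_all add: funpow_swap1)
  with Cons show ?case by (simp add: word_of_def)
qed (simp add: word_of_def)

lemma map_word_of: "word_of b (map i ks) = map i (word_of (\<lambda>k. b (i k)) ks)"
  by (induction ks) (simp_all add: word_of_def)

lemma length_word_of: "length (word_of b ks) = sum_list (map b ks)"
  by (induction ks) (simp_all add: word_of_def)

lemma set_word_of: "set (word_of b ks) \<subseteq> set ks"
  by (auto simp: word_of_def)

lemma word_of_append: "word_of b (ks @ ls) = word_of b ks @ word_of b ls"
  by (simp add: word_of_def)

lemma dets_scale:
  fixes M :: "nat \<Rightarrow> nat \<Rightarrow> 'a::comm_ring_1"
  shows "dets e (\<lambda>j k. p j * M j k * q k) = (\<Prod>j<e. p j) * (\<Prod>k<e. q k) * dets e M"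
proof -
  let ?A = "Matrix.mat e e (\<lambda>(j, k). p j * M j k * q k)" and ?M = "Matrix.mat e e (\<lambda>(j, k). M j k)"
  have eq: "(\<Prod>i = 0..<e. ?A $$ (i, \<pi> i)) = (\<Prod>j<e. p j) * (\<Prod>k<e. q k) * (\<Prod>i = 0..<e. ?M $$ (i, \<pi> i))"
    if "\<pi> permutes {0..<e}" for \<pi>
  proof -
    have r: "\<pi> i < e" if "i < e" for i using permutes_in_image[OF \<open>\<pi> permutes {0..<e}\<close>, of i] that by simp
    have "(\<Prod>i = 0..<e. ?A $$ (i, \<pi> i)) = (\<Prod>i = 0..<e. p i * q (\<pi> i) * ?M $$ (i, \<pi> i))"
      by (rule prod.cong) (use r in \<open>auto simp: mult_ac\<close>)
    also have "\<dots> = (\<Prod>i = 0..<e. p i) * (\<Prod>i = 0..<e. q (\<pi> i)) * (\<Prod>i = 0..<e. ?M $$ (i, \<pi> i))"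
      by (simp only: prod.distrib)
    also have "(\<Prod>i = 0..<e. q (\<pi> i)) = (\<Prod>i = 0..<e. q i)"
      using prod.permute[OF that, of q] by (simp add: o_def)
    finally show ?thesis by (simp add: atLeast0LessThan)
  qed
  have "Determinant.det ?A = (\<Sum>\<pi>\<in>{\<pi>. \<pi> permutes {0..<e}}. signof \<pi> * (\<Prod>i = 0..<e. ?A $$ (i, \<pi> i)))"
    by (rule det_def') simp
  also have "\<dots> = (\<Sum>\<pi>\<in>{\<pi>. \<pi> permutes {0..<e}}. (\<Prod>j<e. p j) * (\<Prod>k<e. q k) * (signof \<pi> * (\<Prod>i = 0..<e. ?M $$ (i, \<pi> i))))"
  proof (rule sum.cong[OF refl])
    fix \<pi> assume "\<pi> \<in> {\<pi>. \<pi> permutes {0..<e}}"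
    then have "\<pi> permutes {0..<e}" by simp
    from eq[OF this] show "signof \<pi> * (\<Prod>i = 0..<e. ?A $$ (i, \<pi> i)) = (\<Prod>j<e. p j) * (\<Prod>k<e. q k) * (signof \<pi> * (\<Prod>i = 0..<e. ?M $$ (i, \<pi> i)))"
      by (simp only: mult_ac)
  qed
  also have "\<dots> = (\<Prod>j<e. p j) * (\<Prod>k<e. q k) * Determinant.det ?M"
    unfolding sum_distrib_left[symmetric] by (subst det_def'[of ?M e]) simp_all
  finally show ?thesis by (simp add: dets_def)
qed

lemma dets_cong: "(\<And>j k. j < e \<Longrightarrow> k < e \<Longrightarrow> M j k = N j k) \<Longrightarrow> dets e M = dets e N"
  unfolding dets_def by (rule arg_cong[of _ _ Determinant.det]) (auto intro!: eq_matI)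

lemma dets_one: "dets e (\<lambda>j k. of_bool (j = k)) = 1"
proof -
  have "Matrix.mat e e (\<lambda>(j, k). of_bool (j = k)) = (1\<^sub>m e :: 'a mat)" by (auto intro!: eq_matI)
  then show ?thesis by (simp add: dets_def)
qed

lemma dets_inverse_nonzero:
  fixes A M :: "nat \<Rightarrow> nat \<Rightarrow> 'a::{comm_ring_1}"
  assumes "\<And>k k'. k < e \<Longrightarrow> k' < e \<Longrightarrow> (\<Sum>l<e. A k l * M l k') = of_bool (k = k')"
  shows "dets e A * dets e M = 1"
proof -
  let ?A = "Matrix.mat e e (\<lambda>(j, k). A j k)" and ?M = "Matrix.mat e e (\<lambda>(j, k). M j k)"
  have "?A * ?M = Matrix.mat e e (\<lambda>(j, k). of_bool (j = k))"
    by (rule eq_matI) (auto simp: scalar_prod_def assms atLeast0LessThan)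
  then have "Determinant.det ?A * Determinant.det ?M = Determinant.det (Matrix.mat e e (\<lambda>(j, k). of_bool (j = k)))"
    using det_mult[of ?A e ?M] by simp
  then show ?thesis using dets_one[of e] by (simp add: dets_def)
qed

text \<open>The linear bound for \<open>Ln\<close> makes the exponent small uniformly in the
  polydisc. It is used to keep \<open>f j\<close>, \<open>j \<in> J\<close>, away from 0 and the
  branches close to their centre.\<close>

lemma exp_Ln_near_one:
  fixes n :: nat and x r :: "nat \<Rightarrow> complex" and \<theta> :: real
  assumes x: "\<And>k. k < n \<Longrightarrow> x k \<noteq> 0" and th: "\<theta> > 0"
  obtains \<delta>0 where "\<delta>0 > 0"
    "\<And>\<zeta>. (\<And>k. k < n \<Longrightarrow> cmod (\<zeta> k) < \<delta>0) \<Longrightarrow> cmod (exp (\<Sum>k<n. r k * Ln (1 - \<zeta> k / x k)) - 1) < \<theta>"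
proof -
  have "((\<lambda>S::complex. exp S) \<longlongrightarrow> exp 0) (nhds 0)" by (intro tendsto_intros filterlim_ident)
  then have "eventually (\<lambda>S::complex. dist (exp S) (exp 0) < \<theta>) (nhds 0)" using th by (rule tendstoD)
  then obtain \<eta> where \<eta>: "\<eta> > 0" "\<And>S. cmod S < \<eta> \<Longrightarrow> cmod (exp S - 1) < \<theta>"
    unfolding eventually_nhds_metric by (auto simp: dist_norm)
  define C where "C = (\<Sum>k<n. cmod (r k) * (2 / cmod (x k)))"
  have C: "C \<ge> 0" unfolding C_def by (intro sum_nonneg) auto
  define D where "D = Min (insert 1 ((\<lambda>k. cmod (x k)) ` {..<n}))"
  have D1: "D > 0" unfolding D_def using x by (subst Min_gr_iff) auto
  have D2: "D \<le> cmod (x k)" if "k < n" for k unfolding D_def using that by (intro Min_le) auto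
  note D = D1 D2
  define \<delta>0 where "\<delta>0 = min (D / 2) (\<eta> / (C + 1))"
  show thesis
  proof (rule that[of \<delta>0])
    show "\<delta>0 > 0" using D \<eta>(1) C by (simp add: \<delta>0_def)
    fix \<zeta> :: "nat \<Rightarrow> complex" assume z: "\<And>k. k < n \<Longrightarrow> cmod (\<zeta> k) < \<delta>0"
    have summand: "cmod (r k * Ln (1 - \<zeta> k / x k)) \<le> cmod (r k) * (2 / cmod (x k)) * \<delta>0" if k: "k < n" for k
    proof -
      have "cmod (\<zeta> k) < cmod (x k) / 2" using z[OF k] D(2)[OF k] unfolding \<delta>0_def by linarith
      then have u: "cmod (\<zeta> k / x k) < 1/2" using x[OF k] by (simp add: norm_divide divide_less_eq)
      have "cmod (Ln (1 + - (\<zeta> k / x k))) \<le> 2 * cmod (- (\<zeta> k / x k))"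
        by (rule norm_Ln_le) (use u in \<open>simp only: norm_minus_cancel\<close>)
      then have "cmod (Ln (1 - \<zeta> k / x k)) \<le> 2 * cmod (\<zeta> k / x k)" by (simp only: norm_minus_cancel add_uminus_conv_diff)
      also have "\<dots> \<le> (2 / cmod (x k)) * \<delta>0" using z[OF k] x[OF k] by (simp add: norm_divide field_simps)
      finally have "cmod (r k) * cmod (Ln (1 - \<zeta> k / x k)) \<le> cmod (r k) * ((2 / cmod (x k)) * \<delta>0)"
        by (intro mult_left_mono) auto
      then show ?thesis by (simp add: norm_mult)
    qed
    have "cmod (\<Sum>k<n. r k * Ln (1 - \<zeta> k / x k)) \<le> (\<Sum>k<n. cmod (r k) * (2 / cmod (x k)) * \<delta>0)"
      by (rule sum_norm_le) (use summand in simp)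
    also have "\<dots> = C * \<delta>0" by (simp add: C_def sum_distrib_right)
    also have "\<dots> \<le> C * (\<eta> / (C + 1))" using C by (intro mult_left_mono) (simp_all add: \<delta>0_def)
    also have "\<dots> < \<eta>" using C \<eta>(1) by (simp add: field_simps)
    finally show "cmod (exp (\<Sum>k<n. r k * Ln (1 - \<zeta> k / x k)) - 1) < \<theta>" by (rule \<eta>(2))
  qed
qed

context polydisc_algebra
begin

text \<open>
  Replacing \<open>x\<close> by \<open>x - \<zeta>\<close> replaces the equations \<open>f i = 0\<close> by \<open>f i = \<zeta>\<close>, so that derivatives in
  \<open>x\<close> become derivatives in the values of the coordinate functions \<open>f i\<close>.
\<close>

definition ev :: "('v \<Rightarrow> complex) \<Rightarrow> (nat \<Rightarrow> 'v) \<Rightarrow> (nat \<Rightarrow> complex) \<Rightarrow> 'v \<Rightarrow> complex" where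
  "ev z i \<zeta> v = z v - (\<Sum>k<n. if i k = v then \<zeta> k else 0)"

lemma ev_at: "inj_on i {..<n} \<Longrightarrow> k < n \<Longrightarrow> ev z i \<zeta> (i k) = z (i k) - \<zeta> k"
proof -
  assume i: "inj_on i {..<n}" and k: "k < n"
  have "(\<Sum>l<n. if i l = i k then \<zeta> l else 0) = (\<Sum>l<n. if l = k then \<zeta> l else 0)"
    by (rule sum.cong) (use i k in \<open>auto simp: inj_on_def\<close>)
  then show ?thesis using k by (simp add: ev_def)
qed

lemma ev_other: "v \<notin> i ` {..<n} \<Longrightarrow> ev z i \<zeta> v = z v"
  unfolding ev_def by (subst sum.neutral) auto

lemma ev_upd:
  assumes i: "inj_on i {..<n}" "k < n"
  shows "ev z i (\<zeta>(k := t)) = (ev z i \<zeta>)(i k := z (i k) - t)"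
proof
  fix v
  show "ev z i (\<zeta>(k := t)) v = ((ev z i \<zeta>)(i k := z (i k) - t)) v"
  proof (cases "v = i k")
    case True
    then show ?thesis using ev_at[OF i, of z "\<zeta>(k := t)"] by simp
  next
    case False
    then have "(\<Sum>l<n. if i l = v then (\<zeta>(k := t)) l else 0) = (\<Sum>l<n. if i l = v then \<zeta> l else 0)"
      by (intro sum.cong) auto
    then show ?thesis using False by (simp add: ev_def)
  qed
qed

text \<open>Each derivative in an \<open>x\<close> variable is minus the derivative in the
  corresponding \<zeta>, whence the sign. Agreement of \<open>F\<close> with \<open>g\<close> on the
  image of \<open>Pd\<close> suffices, as it contains a neighbourhood along every coordinate line in
  question.\<close>

lemma fold_pd_ders:
  assumes "ders ks g h" "inj_on i {..<n}" "\<And>\<zeta>. \<zeta> \<in> Pd \<Longrightarrow> F (ev z i \<zeta>) = c * g \<zeta>" "\<zeta> \<in> Pd"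
  shows "fold pd (map i ks) F (ev z i \<zeta>) = c * (-1) ^ length ks * h \<zeta>"
  using assms(1,3,4)
proof (induction arbitrary: F c \<zeta> rule: ders.induct)
  case (ders_nil g)
  then show ?case by simp
next
  case (ders_cons k g g1 ks h)
  have "pd (i k) F (ev z i \<xi>) = (- c) * g1 \<xi>" if x: "\<xi> \<in> Pd" for \<xi>
  proof -
    have k: "k < n" by fact
    have xk: "cmod (\<xi> k) < \<delta>" using x k by (simp add: Pd_def)
    have e: "ev z i \<xi> (i k) = z (i k) - \<xi> k" by (rule ev_at[OF assms(2) k])
    have D: "((\<lambda>t. g (\<xi>(k := t))) has_field_derivative g1 \<xi>) (at (z (i k) - (z (i k) - \<xi> k)))"
      using ders_cons.hyps(3) x by (simp add: pder_def)
    have "((\<lambda>u. g (\<xi>(k := z (i k) - u))) has_field_derivative g1 \<xi> * (- 1)) (at (z (i k) - \<xi> k))"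
      by (rule DERIV_chain2[where f = "\<lambda>t. g (\<xi>(k := t))" and g = "\<lambda>u. z (i k) - u", OF D]) (auto intro!: derivative_eq_intros)
    then have D2: "((\<lambda>u. c * g (\<xi>(k := z (i k) - u))) has_field_derivative c * (g1 \<xi> * (- 1))) (at (z (i k) - \<xi> k))"
      by (rule DERIV_cmult)
    have "eventually (\<lambda>u. u \<in> ball (z (i k)) \<delta>) (nhds (z (i k) - \<xi> k))"
      by (rule eventually_nhds_in_open) (use xk in \<open>auto simp: dist_norm\<close>)
    then have "eventually (\<lambda>u. F ((ev z i \<xi>)(i k := u)) = c * g (\<xi>(k := z (i k) - u))) (nhds (z (i k) - \<xi> k))"
    proof (rule eventually_mono)
      fix u assume "u \<in> ball (z (i k)) \<delta>"
      then have "cmod (z (i k) - u) < \<delta>" by (simp add: dist_norm)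
      then have "F (ev z i (\<xi>(k := z (i k) - u))) = c * g (\<xi>(k := z (i k) - u))"
        by (intro ders_cons.prems(1) Pd_upd[OF x])
      then show "F ((ev z i \<xi>)(i k := u)) = c * g (\<xi>(k := z (i k) - u))"
        unfolding ev_upd[OF assms(2) k] by simp
    qed
    then have "((\<lambda>u. F ((ev z i \<xi>)(i k := u))) has_field_derivative c * (g1 \<xi> * (- 1))) (at (z (i k) - \<xi> k))"
      using D2 by (simp add: DERIV_cong_ev)
    then show ?thesis unfolding pd_def e by (simp add: DERIV_imp_deriv)
  qed
  from ders_cons.IH[OF this ders_cons.prems(2)] show ?case by simp
qed

end

lemma exp_powi: "exp (x :: complex) powi m = exp (of_int m * x)"
proof (cases m)
  case (nonneg k)
  then show ?thesis by (simp add: exp_of_nat_mult)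
next
  case (neg k)
  have "exp (of_int m * x) = inverse (exp (of_nat (Suc k) * x))"
    unfolding neg by (simp add: exp_minus[symmetric] algebra_simps)
  then show ?thesis unfolding neg by (simp only: power_int_minus power_int_of_nat exp_of_nat_mult)
qed

lemma eventually_exp_Ln_near_one:
  fixes x r :: "nat \<Rightarrow> complex"
  assumes "\<And>k. k < n \<Longrightarrow> x k \<noteq> 0" "\<theta> > 0"
  shows "\<forall>\<^sub>F \<delta> in at_right 0. \<forall>\<zeta>. (\<forall>k<n. cmod (\<zeta> k) < \<delta>) \<longrightarrow> cmod (exp (\<Sum>k<n. r k * Ln (1 - \<zeta> k / x k)) - 1) < \<theta>"
proof -
  obtain \<delta>0 where d: "\<delta>0 > 0"
    "\<And>\<zeta>. (\<And>k. k < n \<Longrightarrow> cmod (\<zeta> k) < \<delta>0) \<Longrightarrow> cmod (exp (\<Sum>k<n. r k * Ln (1 - \<zeta> k / x k)) - 1) < \<theta>"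
    by (rule exp_Ln_near_one[of n x \<theta> r]) (use assms in auto)
  show ?thesis unfolding eventually_at_right_field
  proof (intro exI[of _ \<delta>0] conjI allI impI d)
    fix \<delta> :: real and \<zeta> :: "nat \<Rightarrow> complex" and k
    assume "0 < \<delta>" "\<delta> < \<delta>0" "\<forall>k<n. cmod (\<zeta> k) < \<delta>" "k < n"
    then have "cmod (\<zeta> k) < \<delta>" "\<delta> < \<delta>0" by auto
    then show "cmod (\<zeta> k) < \<delta>0" by linarith
  qed
qed

context polydisc_algebra
begin

abbreviation pw :: "(nat \<Rightarrow> complex) \<Rightarrow> (nat \<Rightarrow> complex) \<Rightarrow> complex" where
  "pw r \<zeta> \<equiv> exp (\<Sum>k<n. r k * Ln (1 - \<zeta> k / x k))"

lemma pw_add: "pw r \<zeta> * pw s \<zeta> = pw (\<lambda>k. r k + s k) \<zeta>"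
  by (simp add: exp_add[symmetric] sum.distrib[symmetric] algebra_simps)

lemma zero_Pd: "(\<lambda>_. 0) \<in> Pd"
  using \<delta>(1) by (simp add: Pd_def)

lemma pw_single:
  assumes "k < n" "\<zeta> \<in> Pd"
  shows "pw (\<lambda>l. of_bool (l = k)) \<zeta> = 1 - \<zeta> k / x k" "pw (\<lambda>l. - of_bool (l = k)) \<zeta> = inverse (1 - \<zeta> k / x k)"
proof -
  have nz: "1 - \<zeta> k / x k \<noteq> 0" using Pd_slit[OF assms(2,1)] by auto
  have "(\<Sum>l<n. of_bool (l = k) * Ln (1 - \<zeta> l / x l)) = (\<Sum>l<n. if l = k then Ln (1 - \<zeta> k / x k) else 0)"
    by (rule sum.cong) auto
  then have s: "(\<Sum>l<n. of_bool (l = k) * Ln (1 - \<zeta> l / x l)) = Ln (1 - \<zeta> k / x k)" using assms(1) by simp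
  show "pw (\<lambda>l. of_bool (l = k)) \<zeta> = 1 - \<zeta> k / x k" unfolding s using nz by simp
  have s': "(\<Sum>l<n. - of_bool (l = k) * Ln (1 - \<zeta> l / x l)) = - Ln (1 - \<zeta> k / x k)"
    unfolding s[symmetric] by (simp add: sum_negf)
  show "pw (\<lambda>l. - of_bool (l = k)) \<zeta> = inverse (1 - \<zeta> k / x k)" unfolding s' using nz by (simp add: exp_minus)
qed

lemma ha_prod: "finite A \<Longrightarrow> (\<And>a. a \<in> A \<Longrightarrow> hol_alg (F a)) \<Longrightarrow> hol_alg (\<lambda>\<zeta>. \<Prod>a\<in>A. F a \<zeta>)"
proof (induction A rule: finite_induct)
  case empty
  show ?case using ha_const[of 1] by simp
next
  case (insert u A)
  have "hol_alg (\<lambda>\<zeta>. F u \<zeta> * (\<Prod>a\<in>A. F a \<zeta>))" by (rule ha_mult) (use insert in auto)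
  then show ?case using insert.hyps by simp
qed

lemma ha_power: "hol_alg f \<Longrightarrow> hol_alg (\<lambda>\<zeta>. f \<zeta> ^ m)"
proof (induction m)
  case 0
  show ?case using ha_const[of 1] by simp
next
  case (Suc m)
  then show ?case using ha_mult[of f "\<lambda>\<zeta>. f \<zeta> ^ m"] by simp
qed

lemma pder_power: 
  assumes "pder k f f'" shows "pder k (\<lambda>\<zeta>. f \<zeta> ^ m) (\<lambda>\<zeta>. of_nat m * (f' \<zeta> * f \<zeta> ^ (m - 1)))"
  unfolding pder_def
proof
  fix \<zeta> assume "\<zeta> \<in> Pd"
  then have "((\<lambda>t. f (\<zeta>(k := t))) has_field_derivative f' \<zeta>) (at (\<zeta> k))" using assms by (simp add: pder_def)
  from DERIV_power[OF this, of m]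
  show "((\<lambda>t. f (\<zeta>(k := t)) ^ m) has_field_derivative of_nat m * (f' \<zeta> * f \<zeta> ^ (m - 1))) (at (\<zeta> k))" by simp
qed

lemma pder_cong: "pder k f f' \<Longrightarrow> (\<And>\<zeta>. \<zeta> \<in> Pd \<Longrightarrow> f' \<zeta> = g' \<zeta>) \<Longrightarrow> pder k f g'"
  by (simp add: pder_def)

lemma pder_pw_zero:
  assumes "k < n" "r k = 0" shows "pder k (pw r) (\<lambda>_. 0)"
  by (rule pder_cong[OF pder_pw[OF assms(1)]]) (simp add: assms(2))

lemma pder_cmult: "pder k f f' \<Longrightarrow> pder k (\<lambda>\<zeta>. c * f \<zeta>) (\<lambda>\<zeta>. c * f' \<zeta>)"
  using pder_mult[OF pder_const[of k c]] by simp

lemma pder_prod_zero: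
  "finite A \<Longrightarrow> (\<And>a. a \<in> A \<Longrightarrow> pder k (F a) (\<lambda>_. 0)) \<Longrightarrow> pder k (\<lambda>\<zeta>. \<Prod>a\<in>A. F a \<zeta>) (\<lambda>_. 0)"
proof (induction A rule: finite_induct)
  case empty
  show ?case using pder_const[of k 1] by simp
next
  case (insert u A)
  then have "pder k (\<lambda>\<zeta>. F u \<zeta> * (\<Prod>a\<in>A. F a \<zeta>)) (\<lambda>\<zeta>. 0 * (\<Prod>a\<in>A. F a \<zeta>) + F u \<zeta> * 0)"
    by (intro pder_mult) auto
  then show ?case using insert.hyps by simp
qed

lemma ders_sum:
  assumes "finite A" "\<And>k. k \<in> set ks \<Longrightarrow> k < n" "\<And>a. a \<in> A \<Longrightarrow> ders ks (F a) (H a)"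
  shows "ders ks (\<lambda>\<zeta>. \<Sum>a\<in>A. F a \<zeta>) (\<lambda>\<zeta>. \<Sum>a\<in>A. H a \<zeta>)"
  using assms(1,3)
proof (induction A rule: finite_induct)
  case empty
  have "ders ks (\<lambda>_. 0) (\<lambda>_. 0)" using assms(2)
  proof (induction ks)
    case Nil
    show ?case by (rule ders_nil[OF ha_const])
  next
    case (Cons k ks)
    show ?case by (rule ders_cons[OF _ ha_const pder_const]) (use Cons in auto)
  qed
  then show ?case by simp
next
  case (insert u A)
  then have "ders ks (\<lambda>\<zeta>. F u \<zeta> + (\<Sum>a\<in>A. F a \<zeta>)) (\<lambda>\<zeta>. H u \<zeta> + (\<Sum>a\<in>A. H a \<zeta>))"
    by (intro ders_add) auto
  then show ?case using insert.hyps by simp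
qed

lemma ders_cmult: "ders ks g h \<Longrightarrow> ders ks (\<lambda>\<zeta>. c * g \<zeta>) (\<lambda>\<zeta>. c * h \<zeta>)"
proof (induction rule: ders.induct)
  case (ders_nil g)
  show ?case by (rule ders.ders_nil[OF ha_mult[OF ha_const ders_nil]])
next
  case (ders_cons k g g1 ks h)
  show ?case by (rule ders.ders_cons[OF _ ha_mult[OF ha_const] pder_cmult]) (use ders_cons in auto)
qed

end

section \<open>Branches of the common zeros over a polydisc\<close>

context toric
begin

text \<open>Divided by \<open>idxD\<close>, this is the inverse of the matrix of the
  \<open>a i\<close>, \<open>i \<notin> J\<close>, continued by 0 on \<open>J\<close> (see
  \<open>mm_dual\<close>).\<close>

definition mm :: "nat \<Rightarrow> 'n \<Rightarrow> int" where
  "mm l = (SOME c. int idxD *s bas l = (\<Sum>i\<in>- J. c i *s a i) \<and> (\<forall>i\<in>J. c i = 0))"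

lemma mm: "int idxD *s bas l = (\<Sum>i\<in>- J. mm l i *s a i)" and mm_J: "i \<in> J \<Longrightarrow> mm l i = 0"
proof -
  obtain c where c: "int idxD *s bas l = (\<Sum>i\<in>- J. c i *s a i)" by (rule int_latticeE[OF idxD_LI[of "bas l"]])
  have "(\<Sum>i\<in>- J. (if i \<in> J then 0 else c i) *s a i) = (\<Sum>i\<in>- J. c i *s a i)" by (rule sum.cong) auto
  then have "int idxD *s bas l = (\<Sum>i\<in>- J. (if i \<in> J then 0 else c i) *s a i) \<and> (\<forall>i\<in>J. (if i \<in> J then 0 else c i) = 0)"
    using c by simp
  from someI[of "\<lambda>c. int idxD *s bas l = (\<Sum>i\<in>- J. c i *s a i) \<and> (\<forall>i\<in>J. c i = 0)", OF this]
  show "int idxD *s bas l = (\<Sum>i\<in>- J. mm l i *s a i)" "i \<in> J \<Longrightarrow> mm l i = 0"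
    unfolding mm_def by auto
qed

lemma mm_dual:
  assumes i: "i \<in> - J" "i' \<in> - J"
  shows "(\<Sum>l<ed. (a i $ fd l) * mm l i') = (if i = i' then int idxD else 0)"
proof -
  define c where "c k = (\<Sum>l<ed. (a i $ fd l) * mm l k) - (if i = k then int idxD else 0)" for k
  have "int idxD *s a i = (\<Sum>l<ed. (a i $ fd l) *s (int idxD *s bas l))"
    by (subst bas_expansion[of "a i", symmetric]) (simp add: Finite_Cartesian_Product.vec_eq_iff sum_distrib_left mult_ac)
  also have "\<dots> = (\<Sum>l<ed. (a i $ fd l) *s (\<Sum>k\<in>- J. mm l k *s a k))" by (simp only: mm)
  also have "\<dots> = (\<Sum>k\<in>- J. (\<Sum>l<ed. (a i $ fd l) * mm l k) *s a k)"
    by (simp add: Finite_Cartesian_Product.vec_eq_iff sum_distrib_left sum_distrib_right mult_ac) (intro allI sum.swap)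
  finally have 1: "int idxD *s a i = (\<Sum>k\<in>- J. (\<Sum>l<ed. (a i $ fd l) * mm l k) *s a k)" .
  have "(\<Sum>k\<in>- J. (if i = k then int idxD else 0) *s a k) = (\<Sum>k\<in>- J. if i = k then int idxD *s a k else 0)"
    by (rule sum.cong) auto
  also have "\<dots> = int idxD *s a i" using i by (subst sum.delta') auto
  finally have "(\<Sum>k\<in>- J. c k *s a k) = 0"
    using 1 unfolding c_def by (simp add: Finite_Cartesian_Product.vec_eq_iff sum_subtractf algebra_simps)
  then have "c i' = 0" using LI_independent i(2) unfolding independent_family_def by simp
  then show ?thesis by (simp add: c_def)
qed

text \<open>The trace of the product of the matrix of the \<open>a i\<close> with \<open>mm\<close>,
  taken in both orders, is \<open>idxD\<close> times the number of vectors and \<open>idxD\<close>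
  times the dimension.\<close>

lemma card_cobasis_complement: "card (- J) = ed"
proof -
  have "int idxD * int (card (- J)) = (\<Sum>i\<in>- J. \<Sum>l<ed. (a i $ fd l) * mm l i)"
    by (simp add: mm_dual)
  also have "\<dots> = (\<Sum>l<ed. \<Sum>i\<in>- J. (a i $ fd l) * mm l i)" by (rule sum.swap)
  also have "\<dots> = (\<Sum>l<ed. int idxD)"
  proof (rule sum.cong[OF refl])
    fix l
    have "(\<Sum>i\<in>- J. mm l i *s a i) $ fd l = int idxD" unfolding mm[symmetric] by (simp add: bas_def)
    then show "(\<Sum>i\<in>- J. (a i $ fd l) * mm l i) = int idxD" by (simp add: mult.commute)
  qed
  also have "\<dots> = int idxD * int ed" by simp
  finally show ?thesis using idxD_pos by simp
qed

text \<open>The rational coordinates of \<open>v\<close> in the basis \<open>a i\<close>,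
  \<open>i \<notin> J\<close>; they are the exponents with which the branches depend on the ratios
  \<open>1 - \<zeta> k / x k\<close>.\<close>

definition expo :: "int ^ 'd \<Rightarrow> 'n \<Rightarrow> complex" where
  "expo v i = (\<Sum>l<ed. of_int (v $ fd l) * (of_int (mm l i) / of_nat idxD))"

lemma expo_J: "i \<in> J \<Longrightarrow> expo v i = 0"
  by (simp add: expo_def mm_J)

lemma expo_a:
  assumes "i \<in> - J" shows "expo (a i) i' = of_bool (i' = i)"
proof (cases "i' \<in> J")
  case True
  then show ?thesis using assms by (auto simp: expo_J)
next
  case False
  have "expo (a i) i' = of_int (\<Sum>l<ed. (a i $ fd l) * mm l i') / of_nat idxD"
    by (simp add: expo_def sum_divide_distrib)
  then show ?thesis using mm_dual[OF assms, of i'] False idxD_pos by auto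
qed

end

text \<open>\<open>ii\<close> numbers the indices outside \<open>J\<close> first, so the coordinates
  below \<open>ed\<close> are values of the residue divisors and the later ones shift the
  \<open>x j\<close> with \<open>j \<in> J\<close>. The last assumption keeps the
  \<open>f j\<close>, \<open>j \<in> J\<close>, away from 0 on every branch, as inverses in
  \<open>hol_alg\<close> demand.\<close>

locale toric_germ = toric a J g \<gamma> ed fd + polydisc_algebra n "\<lambda>k. z (Inl (ii k))" \<delta>
  for a :: "'n::finite \<Rightarrow> int ^ 'd" and J g \<gamma> ed fd n and z :: "'n + 'n \<Rightarrow> complex" and ii \<delta> +
  assumes good: "good z" and ii: "bij_betw ii {..<n} UNIV" and iiI: "bij_betw ii {..<ed} (- J)" and ed_le: "ed \<le> n"
    and bound: "\<And>\<xi> j \<zeta>. \<xi> \<in> Sol (cz z) \<Longrightarrow> j \<in> J \<Longrightarrow> (\<And>k. k < n \<Longrightarrow> cmod (\<zeta> k) < \<delta>) \<Longrightarrow>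
       cmod (fz z j \<xi>) / 2 \<le> cmod (z (Inl j) * exp (\<Sum>k<n. of_bool (ii k = j) * Ln (1 - \<zeta> k / z (Inl (ii k))))
          + z (Inr j) * chr ed fd \<xi> (a j) * exp (\<Sum>k<n. expo (a j) (ii k) * Ln (1 - \<zeta> k / z (Inl (ii k)))))"
begin

lemma znz: "z v \<noteq> 0"
  using good by (simp add: good_def)

lemma ii_inj: "k < n \<Longrightarrow> l < n \<Longrightarrow> ii k = ii l \<longleftrightarrow> k = l"
  using ii by (auto simp: bij_betw_def inj_on_def)

lemma ii_ex: obtains k where "k < n" "i = ii k"
proof -
  have "i \<in> ii ` {..<n}" using ii by (auto simp: bij_betw_def)
  then show thesis using that by auto
qed

lemma iiI_mem: "k < ed \<Longrightarrow> ii k \<in> - J"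
  using iiI by (auto simp: bij_betw_def)

lemma iiJ: assumes "k < n" shows "ii k \<in> J \<longleftrightarrow> ed \<le> k"
proof
  assume J: "ii k \<in> J"
  show "ed \<le> k" proof (rule ccontr)
    assume "\<not> ed \<le> k" then show False using iiI_mem[of k] J by simp
  qed
next
  assume k: "ed \<le> k"
  show "ii k \<in> J" proof (rule ccontr)
    assume "ii k \<notin> J"
    then have "ii k \<in> ii ` {..<ed}" using iiI by (auto simp: bij_betw_def)
    then obtain l where "l < ed" "ii k = ii l" by auto
    then show False using ii_inj[OF assms, of l] k ed_le by simp
  qed
qed

lemma pw_ii:
  assumes "k < n" "\<zeta> \<in> Pd"
  shows "pw (\<lambda>l. of_bool (ii l = ii k)) \<zeta> = 1 - \<zeta> k / z (Inl (ii k))"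
    "pw (\<lambda>l. - of_bool (ii l = ii k)) \<zeta> = inverse (1 - \<zeta> k / z (Inl (ii k)))"
proof -
  have e: "(\<Sum>l<n. of_bool (ii l = ii k) * F l) = (\<Sum>l<n. of_bool (l = k) * F l)"
    "(\<Sum>l<n. - of_bool (ii l = ii k) * F l) = (\<Sum>l<n. - of_bool (l = k) * F l)" for F :: "nat \<Rightarrow> complex"
    by (rule sum.cong; use assms(1) ii_inj in simp)+
  show "pw (\<lambda>l. of_bool (ii l = ii k)) \<zeta> = 1 - \<zeta> k / z (Inl (ii k))"
    "pw (\<lambda>l. - of_bool (ii l = ii k)) \<zeta> = inverse (1 - \<zeta> k / z (Inl (ii k)))"
    unfolding e using pw_single[OF assms] by simp_all
qed

text \<open>The branch through \<open>\<xi>\<close> of the solutions of \<open>f i = \<zeta>\<close>, \<open>i \<notin> J\<close>.\<close>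

definition tt :: "(nat \<Rightarrow> complex) \<Rightarrow> (nat \<Rightarrow> complex) \<Rightarrow> nat \<Rightarrow> complex" where
  "tt \<xi> \<zeta> = (\<lambda>l\<in>{..<ed}. \<xi> l * pw (\<lambda>k. of_int (mm l (ii k)) / of_nat idxD) \<zeta>)"

lemma tt_torus: "\<xi> \<in> torus ed \<Longrightarrow> tt \<xi> \<zeta> \<in> torus ed"
  by (auto simp: torus_def tt_def PiE_iff)

lemma chr_tt: "chr ed fd (tt \<xi> \<zeta>) v = chr ed fd \<xi> v * pw (\<lambda>k. expo v (ii k)) \<zeta>"
proof -
  have "chr ed fd (tt \<xi> \<zeta>) v = chr ed fd \<xi> v * (\<Prod>l<ed. pw (\<lambda>k. of_int (mm l (ii k)) / of_nat idxD) \<zeta> powi (v $ fd l))"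
    by (simp add: chr_def tt_def power_int_mult_distrib prod.distrib)
  also have "(\<Prod>l<ed. pw (\<lambda>k. of_int (mm l (ii k)) / of_nat idxD) \<zeta> powi (v $ fd l))
    = exp (\<Sum>l<ed. of_int (v $ fd l) * (\<Sum>k<n. of_int (mm l (ii k)) / of_nat idxD * Ln (1 - \<zeta> k / z (Inl (ii k)))))"
    unfolding exp_powi by (rule exp_sum[symmetric]) simp
  also have "(\<Sum>l<ed. of_int (v $ fd l) * (\<Sum>k<n. of_int (mm l (ii k)) / of_nat idxD * Ln (1 - \<zeta> k / z (Inl (ii k)))))
    = (\<Sum>k<n. expo v (ii k) * Ln (1 - \<zeta> k / z (Inl (ii k))))"
    unfolding expo_def sum_distrib_left sum_distrib_right by (subst sum.swap) (simp only: mult.assoc)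
  finally show ?thesis .
qed

text \<open>Along the branch the character of \<open>a (ii k)\<close> is multiplied by
  \<open>1 - \<zeta> k / x\<close>, and at \<xi> it equals \<open>- x / y\<close>.\<close>

lemma fz_tt:
  assumes "\<xi> \<in> Sol (cz z)" "k < ed" "\<zeta> \<in> Pd"
  shows "fz z (ii k) (tt \<xi> \<zeta>) = \<zeta> k"
proof -
  have k: "k < n" using assms ed_le by simp
  have e: "chr ed fd \<xi> (a (ii k)) = - z (Inl (ii k)) / z (Inr (ii k))"
    using assms(1) iiI_mem[OF assms(2)] by (simp add: Sol_def cz_def)
  have "fz z (ii k) (tt \<xi> \<zeta>) = z (Inl (ii k)) + z (Inr (ii k)) * (- z (Inl (ii k)) / z (Inr (ii k)) * (1 - \<zeta> k / z (Inl (ii k))))"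
    unfolding fz_def chr_tt e expo_a[OF iiI_mem[OF assms(2)]] pw_ii(1)[OF k assms(3)] ..
  then show ?thesis using znz by (simp add: field_simps)
qed

text \<open>The value of \<open>f j\<close>, \<open>j \<in> J\<close>, on the branch through \<xi>
  when \<open>x j\<close> itself is also diminished by its \<zeta>.\<close>

definition fJ :: "(nat \<Rightarrow> complex) \<Rightarrow> 'n \<Rightarrow> (nat \<Rightarrow> complex) \<Rightarrow> complex" where
  "fJ \<xi> j \<zeta> = z (Inl j) * pw (\<lambda>k. of_bool (ii k = j)) \<zeta> + z (Inr j) * chr ed fd \<xi> (a j) * pw (\<lambda>k. expo (a j) (ii k)) \<zeta>"

text \<open>The summand of \<open>Rsum m\<close> that belongs to \<xi>, followed along its branch as
  all \<open>x\<close> are diminished by \<zeta>.\<close>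

definition G :: "(nat \<Rightarrow> complex) \<Rightarrow> ('n \<Rightarrow> nat) \<Rightarrow> (nat \<Rightarrow> complex) \<Rightarrow> complex" where
  "G \<xi> m \<zeta> = chr ed fd \<xi> \<gamma> * pw (\<lambda>k. expo \<gamma> (ii k)) \<zeta>
     * (\<Prod>i\<in>- J. inverse (z (Inl i)) * pw (\<lambda>k. - of_bool (ii k = i)) \<zeta>) * (\<Prod>j\<in>J. inverse (fJ \<xi> j \<zeta>) ^ m j)"

lemma fJ_bound:
  assumes "\<xi> \<in> Sol (cz z)" "j \<in> J" "\<zeta> \<in> Pd"
  shows "cmod (fz z j \<xi>) / 2 \<le> cmod (fJ \<xi> j \<zeta>)"
  unfolding fJ_def by (rule bound[OF assms(1,2)]) (use assms(3) in \<open>simp add: Pd_def\<close>)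

lemma fJ_nonzero:
  assumes "\<xi> \<in> Sol (cz z)" "j \<in> J" "\<zeta> \<in> Pd" shows "fJ \<xi> j \<zeta> \<noteq> 0"
  using fJ_bound[OF assms] fz_nonzero[OF good assms(2,1)] by auto

lemma ha_inverse_fJ: "\<xi> \<in> Sol (cz z) \<Longrightarrow> j \<in> J \<Longrightarrow> hol_alg (\<lambda>\<zeta>. inverse (fJ \<xi> j \<zeta>))"
proof -
  assume h: "\<xi> \<in> Sol (cz z)" "j \<in> J"
  have "hol_alg (\<lambda>\<zeta>. fJ \<xi> j \<zeta>)" unfolding fJ_def by (intro ha_add ha_mult ha_const ha_pw)
  then show ?thesis by (rule ha_inv[OF _ _ fJ_bound[OF h]]) (use fz_nonzero[OF good h(2,1)] in auto)
qed

lemma ha_G: "\<xi> \<in> Sol (cz z) \<Longrightarrow> hol_alg (G \<xi> m)"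
  unfolding G_def[abs_def] by (intro ha_mult ha_const ha_pw ha_prod ha_power ha_inverse_fJ) auto

lemma G_cong: "(\<And>j. j \<in> J \<Longrightarrow> m j = m' j) \<Longrightarrow> G \<xi> m = G \<xi> m'"
  by (intro ext) (simp add: G_def)

text \<open>\<open>expo\<close> vanishes on \<open>J\<close>, so the branch does not move with these
  \<zeta> k, which enter only through \<open>x j - \<zeta> k\<close>.\<close>

lemma pder_fJ:
  assumes k: "k < n" "ii k \<in> J" and j: "j \<in> J"
  shows "pder k (fJ \<xi> j) (\<lambda>_. if j = ii k then -1 else 0)"
proof -
  have e0: "expo (a j) (ii k) = 0" by (rule expo_J[OF k(2)])
  have s: "pder k (\<lambda>\<zeta>. z (Inr j) * chr ed fd \<xi> (a j) * pw (\<lambda>k. expo (a j) (ii k)) \<zeta>) (\<lambda>_. z (Inr j) * chr ed fd \<xi> (a j) * 0)"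
    by (rule pder_cmult[OF pder_pw_zero[OF k(1)]]) (rule e0)
  have "pder k (\<lambda>\<zeta>. z (Inl j) * pw (\<lambda>k. of_bool (ii k = j)) \<zeta>) (\<lambda>_. if j = ii k then -1 else 0)"
  proof (cases "j = ii k")
    case True
    have "pw (\<lambda>l. of_bool (ii l = j)) \<zeta> * pw (\<lambda>l. if l = k then -1 else 0) \<zeta> = 1" for \<zeta>
    proof -
      have "(\<Sum>l<n. (of_bool (ii l = j) + (if l = k then -1 else 0)) * Ln (1 - \<zeta> l / z (Inl (ii l)))) = 0"
        by (rule sum.neutral) (use True k ii_inj in auto)
      then show ?thesis unfolding pw_add by simp
    qed
    note e = this
    have "pder k (\<lambda>\<zeta>. z (Inl j) * pw (\<lambda>k. of_bool (ii k = j)) \<zeta>)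
      (\<lambda>\<zeta>. z (Inl j) * (- of_bool (ii k = j) / z (Inl (ii k)) * (pw (\<lambda>l. of_bool (ii l = j)) \<zeta> * pw (\<lambda>l. if l = k then -1 else 0) \<zeta>)))"
      by (rule pder_cmult[OF pder_pw[OF k(1)]])
    then show ?thesis unfolding e using True znz by simp
  next
    case False
    have "pder k (\<lambda>\<zeta>. z (Inl j) * pw (\<lambda>k. of_bool (ii k = j)) \<zeta>) (\<lambda>_. z (Inl j) * 0)"
      by (rule pder_cmult[OF pder_pw_zero[OF k(1)]]) (use False in simp)
    then show ?thesis using False by simp
  qed
  from pder_add[OF this s] show ?thesis unfolding fJ_def[abs_def] by simp
qed

text \<open>Consequently a derivative in such a direction only raises the exponent of one
  \<open>f j\<close>; the factors accumulate to factorials.\<close>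

lemma pder_G:
  assumes x: "\<xi> \<in> Sol (cz z)" and k: "k < n" "ii k \<in> J" "m (ii k) > 0"
  shows "pder k (G \<xi> m) (\<lambda>\<zeta>. of_nat (m (ii k)) * G \<xi> (m(ii k := Suc (m (ii k)))) \<zeta>)"
proof -
  let ?A = "\<lambda>\<zeta>. chr ed fd \<xi> \<gamma> * pw (\<lambda>k. expo \<gamma> (ii k)) \<zeta> * (\<Prod>i\<in>- J. inverse (z (Inl i)) * pw (\<lambda>k. - of_bool (ii k = i)) \<zeta>)"
  let ?P = "\<lambda>\<zeta>. \<Prod>j\<in>J - {ii k}. inverse (fJ \<xi> j \<zeta>) ^ m j"
  let ?F = "\<lambda>\<zeta>. inverse (fJ \<xi> (ii k) \<zeta>) ^ m (ii k)"
  let ?F' = "\<lambda>\<zeta>. of_nat (m (ii k)) * inverse (fJ \<xi> (ii k) \<zeta>) ^ Suc (m (ii k))"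
  have "pder k ?A (\<lambda>\<zeta>. (0 * pw (\<lambda>k. expo \<gamma> (ii k)) \<zeta> + chr ed fd \<xi> \<gamma> * 0) * (\<Prod>i\<in>- J. inverse (z (Inl i)) * pw (\<lambda>k. - of_bool (ii k = i)) \<zeta>)
     + chr ed fd \<xi> \<gamma> * pw (\<lambda>k. expo \<gamma> (ii k)) \<zeta> * 0)"
  proof (intro pder_mult pder_const pder_pw_zero k(1) expo_J k(2) pder_prod_zero)
    fix i assume i: "i \<in> - J"
    have "pder k (\<lambda>\<zeta>. inverse (z (Inl i)) * pw (\<lambda>k. - of_bool (ii k = i)) \<zeta>) (\<lambda>_. inverse (z (Inl i)) * 0)"
      by (rule pder_cmult[OF pder_pw_zero[OF k(1)]]) (use i k(2) in auto)
    then show "pder k (\<lambda>\<zeta>. inverse (z (Inl i)) * pw (\<lambda>k. - of_bool (ii k = i)) \<zeta>) (\<lambda>_. 0)" by simp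
  qed simp
  then have A: "pder k ?A (\<lambda>_. 0)" by simp
  have inv: "pder k (\<lambda>\<zeta>. inverse (fJ \<xi> j \<zeta>)) (\<lambda>\<zeta>. -1 * ((if j = ii k then -1 else 0) * (inverse (fJ \<xi> j \<zeta>) * inverse (fJ \<xi> j \<zeta>))))"
    if "j \<in> J" for j by (rule pder_inv[OF pder_fJ[OF k(1,2) that] fJ_nonzero[OF x that]])
  have P: "pder k ?P (\<lambda>_. 0)"
  proof (rule pder_prod_zero)
    fix j assume j: "j \<in> J - {ii k}"
    then show "pder k (\<lambda>\<zeta>. inverse (fJ \<xi> j \<zeta>) ^ m j) (\<lambda>_. 0)"
      by (intro pder_cong[OF pder_power[OF inv]]) auto
  qed simp
  have F: "pder k ?F ?F'"
  proof (rule pder_cong[OF pder_power[OF inv[OF k(2)]]])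
    fix \<zeta>
    obtain p where p: "m (ii k) = Suc p" using k(3) by (cases "m (ii k)") auto
    show "of_nat (m (ii k)) * (- 1 * ((if ii k = ii k then - 1 else 0) * (inverse (fJ \<xi> (ii k) \<zeta>) * inverse (fJ \<xi> (ii k) \<zeta>))) *
        inverse (fJ \<xi> (ii k) \<zeta>) ^ (m (ii k) - 1)) = ?F' \<zeta>"
      unfolding p by (simp add: mult_ac)
  qed
  have p1: "pder k (\<lambda>\<zeta>. ?A \<zeta> * (?F \<zeta> * ?P \<zeta>)) (\<lambda>\<zeta>. 0 * (?F \<zeta> * ?P \<zeta>) + ?A \<zeta> * (?F' \<zeta> * ?P \<zeta> + ?F \<zeta> * 0))"
    by (intro pder_mult A F P)
  have p2: "(\<lambda>\<zeta>. ?A \<zeta> * (?F \<zeta> * ?P \<zeta>)) = G \<xi> m"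
    by (rule ext) (simp add: G_def prod.remove[OF _ k(2)])
  have p3: "0 * (?F \<zeta> * ?P \<zeta>) + ?A \<zeta> * (?F' \<zeta> * ?P \<zeta> + ?F \<zeta> * 0) = of_nat (m (ii k)) * G \<xi> (m(ii k := Suc (m (ii k)))) \<zeta>" for \<zeta>
  proof -
    have "(\<Prod>j\<in>J - {ii k}. inverse (fJ \<xi> j \<zeta>) ^ (m(ii k := Suc (m (ii k)))) j) = ?P \<zeta>" by (rule prod.cong) auto
    then show ?thesis by (simp add: G_def prod.remove[OF _ k(2)])
  qed
  show ?thesis by (rule pder_cong[OF p1[unfolded p2] p3])
qed

lemma ders_G_replicate:
  assumes x: "\<xi> \<in> Sol (cz z)" and k: "k < n" "ii k \<in> J"
  shows "m (ii k) = Suc p \<Longrightarrow> ders (replicate c k) (\<lambda>\<zeta>. C * fact p * G \<xi> m \<zeta>) (\<lambda>\<zeta>. C * fact (p + c) * G \<xi> (m(ii k := Suc (p + c))) \<zeta>)"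
proof (induction c arbitrary: p m)
  case 0
  then have "m(ii k := Suc p) = m" by auto
  then show ?case by (simp add: ders_Nil ha_mult ha_const ha_G[OF x])
next
  case (Suc c)
  have 1: "pder k (\<lambda>\<zeta>. C * fact p * G \<xi> m \<zeta>) (\<lambda>\<zeta>. C * fact p * (of_nat (m (ii k)) * G \<xi> (m(ii k := Suc (m (ii k)))) \<zeta>))"
    by (rule pder_cmult[OF pder_G[OF x k]]) (use Suc in simp)
  have 2: "(\<lambda>\<zeta>. C * fact p * (of_nat (m (ii k)) * G \<xi> (m(ii k := Suc (m (ii k)))) \<zeta>)) = (\<lambda>\<zeta>. C * fact (Suc p) * G \<xi> (m(ii k := Suc (Suc p))) \<zeta>)"
    unfolding Suc.prems by (simp add: mult_ac)
  have 3: "ders (replicate c k) (\<lambda>\<zeta>. C * fact (Suc p) * G \<xi> (m(ii k := Suc (Suc p))) \<zeta>) (\<lambda>\<zeta>. C * fact (p + Suc c) * G \<xi> (m(ii k := Suc (p + Suc c))) \<zeta>)"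
    using Suc.IH[of "m(ii k := Suc (Suc p))" "Suc p"] by (simp only: fun_upd_upd fun_upd_same add_Suc_right add_Suc)
  show ?case unfolding replicate_Suc
    by (rule ders_cons[OF k(1) _ 1]) (use 3 ha_G[OF x] ha_mult[OF ha_const] in \<open>simp_all only: 2\<close>)
qed

lemma ders_G_word:
  assumes x: "\<xi> \<in> Sol (cz z)" and "distinct ks" "\<And>k. k \<in> set ks \<Longrightarrow> k < n \<and> ii k \<in> J \<and> m (ii k) = 1"
  shows "ders (word_of b ks) (\<lambda>\<zeta>. C * G \<xi> m \<zeta>)
    (\<lambda>\<zeta>. C * (\<Prod>k\<in>set ks. fact (b k)) * G \<xi> (fold (\<lambda>k m. m(ii k := Suc (b k))) ks m) \<zeta>)"
  using assms(2,3)
proof (induction ks arbitrary: C m)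
  case Nil
  then show ?case by (simp add: word_of_def ders_Nil ha_mult ha_const ha_G[OF x])
next
  case (Cons k ks)
  have k: "k < n" "ii k \<in> J" "m (ii k) = Suc 0" using Cons.prems(2)[of k] by auto
  have 1: "ders (replicate (b k) k) (\<lambda>\<zeta>. C * G \<xi> m \<zeta>) (\<lambda>\<zeta>. C * fact (b k) * G \<xi> (m(ii k := Suc (b k))) \<zeta>)"
    using ders_G_replicate[OF x k(1,2), of m 0 "b k" C, OF k(3)] by (simp only: fact_0 mult_1_right add_0)
  have 2: "ders (word_of b ks) (\<lambda>\<zeta>. C * fact (b k) * G \<xi> (m(ii k := Suc (b k))) \<zeta>)
    (\<lambda>\<zeta>. C * fact (b k) * (\<Prod>k\<in>set ks. fact (b k)) * G \<xi> (fold (\<lambda>k m. m(ii k := Suc (b k))) ks (m(ii k := Suc (b k)))) \<zeta>)"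
  proof (rule Cons.IH)
    fix l assume l: "l \<in> set ks"
    then have "l < n" "ii l \<in> J" "m (ii l) = 1" "l \<noteq> k" using Cons.prems by auto
    then show "l < n \<and> ii l \<in> J \<and> (m(ii k := Suc (b k))) (ii l) = 1" using ii_inj[of l k] k(1) by auto
  qed (use Cons.prems in simp)
  have "word_of b (k # ks) = replicate (b k) k @ word_of b ks" by (simp add: word_of_def)
  moreover have "(\<Prod>k\<in>set (k # ks). fact (b k)) = (fact (b k) * (\<Prod>k\<in>set ks. fact (b k)) :: complex)"
    using Cons.prems(1) by simp
  ultimately show ?case using ders_appendI[OF 1 2] by (simp only: fold_Cons o_apply mult.assoc)
qed

lemma fold_upd_at:
  assumes "\<And>k. k \<in> set ks \<Longrightarrow> k < n"
  shows "fold (\<lambda>k m. m(ii k := Suc (b (ii k)))) ks m i = (if i \<in> ii ` set ks then Suc (b i) else m i)"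
  using assms by (induction ks arbitrary: m) auto

abbreviation evz :: "(nat \<Rightarrow> complex) \<Rightarrow> 'n + 'n \<Rightarrow> complex" where "evz \<equiv> ev z (\<lambda>k. Inl (ii k))"

lemma inj_Inl_ii: "inj_on (\<lambda>k. Inl (ii k)) {..<n}"
  using ii_inj by (auto simp: inj_on_def)

lemma evz_Inl: "k < n \<Longrightarrow> evz \<zeta> (Inl (ii k)) = z (Inl (ii k)) - \<zeta> k"
  by (rule ev_at[OF inj_Inl_ii])

lemma evz_Inr: "evz \<zeta> (Inr i) = z (Inr i)"
  by (rule ev_other) auto

lemma evz_zero: "evz (\<lambda>_. 0) = z"
  by (simp add: ev_def fun_eq_iff)

text \<open>The zeros for the diminished \<open>x\<close> are the old zeros multiplied by the branch
  through 1, so the sum can be reindexed over the fixed set \<open>Sol (cz z)\<close>.\<close>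

lemma Rsum_evz:
  assumes zt: "\<zeta> \<in> Pd"
  shows "Rsum m (evz \<zeta>) = (\<Sum>\<xi>\<in>Sol (cz z). G \<xi> m \<zeta>)"
proof -
  define s where "s = tt (\<lambda>l\<in>{..<ed}. 1) \<zeta>"
  have one: "(\<lambda>l\<in>{..<ed}. 1) \<in> torus ed" by (auto simp: torus_def)
  have cs: "chr ed fd s v = pw (\<lambda>k. expo v (ii k)) \<zeta>" for v
    unfolding s_def chr_tt by (simp add: chr_def)
  have xe: "evz \<zeta> (Inl i) = z (Inl i) * pw (\<lambda>k. of_bool (ii k = i)) \<zeta>"
    and xi: "1 / evz \<zeta> (Inl i) = inverse (z (Inl i)) * pw (\<lambda>k. - of_bool (ii k = i)) \<zeta>" for i
  proof -
    obtain k where k: "k < n" "i = ii k" by (rule ii_ex[of i])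
    have f: "z (Inl (ii k)) - \<zeta> k = z (Inl (ii k)) * (1 - \<zeta> k / z (Inl (ii k)))" using znz by (simp add: field_simps)
    show "evz \<zeta> (Inl i) = z (Inl i) * pw (\<lambda>k. of_bool (ii k = i)) \<zeta>"
      unfolding k(2) evz_Inl[OF k(1)] pw_ii(1)[OF k(1) zt] by (rule f)
    show "1 / evz \<zeta> (Inl i) = inverse (z (Inl i)) * pw (\<lambda>k. - of_bool (ii k = i)) \<zeta>"
      unfolding k(2) evz_Inl[OF k(1)] pw_ii(2)[OF k(1) zt] f by (simp add: field_simps)
  qed
  have b: "bij_betw (\<lambda>t. \<lambda>k\<in>{..<ed}. s k * t k) (Sol (cz z)) (Sol (cz (evz \<zeta>)))"
  proof (rule Sol_translate)
    show "s \<in> torus ed" unfolding s_def by (rule tt_torus[OF one])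
    fix i assume i: "i \<in> - J"
    show "chr ed fd s (a i) * cz z i = cz (evz \<zeta>) i"
      unfolding cs expo_a[OF i] cz_def xe evz_Inr by simp
  qed
  have stt: "(\<lambda>k\<in>{..<ed}. s k * t k) = tt t \<zeta>" for t
    by (auto simp: s_def tt_def fun_eq_iff)
  have "Rsum m (evz \<zeta>) = (\<Sum>t\<in>Sol (cz z). chr ed fd (tt t \<zeta>) \<gamma> * (\<Prod>i\<in>- J. 1 / evz \<zeta> (Inl i)) * (\<Prod>j\<in>J. 1 / fz (evz \<zeta>) j (tt t \<zeta>) ^ m j))"
    unfolding Rsum_def sum.reindex_bij_betw[OF b, symmetric] stt ..
  also have "\<dots> = (\<Sum>\<xi>\<in>Sol (cz z). G \<xi> m \<zeta>)"
  proof (rule sum.cong[OF refl])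
    fix \<xi>
    have "1 / fz (evz \<zeta>) j (tt \<xi> \<zeta>) ^ m j = inverse (fJ \<xi> j \<zeta>) ^ m j" for j
      unfolding fz_def xe evz_Inr chr_tt fJ_def by (simp add: inverse_eq_divide power_one_over mult_ac)
    then show "chr ed fd (tt \<xi> \<zeta>) \<gamma> * (\<Prod>i\<in>- J. 1 / evz \<zeta> (Inl i)) * (\<Prod>j\<in>J. 1 / fz (evz \<zeta>) j (tt \<xi> \<zeta>) ^ m j) = G \<xi> m \<zeta>"
      unfolding G_def xi chr_tt by simp
  qed
  finally show ?thesis .
qed

text \<open>The derivatives in \<open>x j\<close>, \<open>j \<in> J\<close>, are taken first: they
  raise the exponents in \<open>G\<close> and contribute factorials. The remaining ones are left as
  derivatives of \<open>G\<close> at 0, the form in which Cauchy's formula delivers a residue of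
  higher order.\<close>

theorem fold_pd_Rsum:
  fixes b :: "'n \<Rightarrow> nat"
  obtains H where "\<And>\<xi>. \<xi> \<in> Sol (cz z) \<Longrightarrow> ders (word_of (\<lambda>k. b (ii k)) [0..<ed]) (G \<xi> (\<lambda>i. Suc (b i))) (H \<xi>)"
    "fold pd (map (\<lambda>k. Inl (ii k)) (word_of (\<lambda>k. b (ii k)) ([ed..<n] @ [0..<ed]))) (Rsum (\<lambda>_. 1)) z
      = (-1) ^ (\<Sum>i\<in>UNIV. b i) * (\<Prod>k\<in>{ed..<n}. fact (b (ii k))) * (\<Sum>\<xi>\<in>Sol (cz z). H \<xi> (\<lambda>_. 0))"
proof -
  let ?b = "\<lambda>k. b (ii k)" let ?C = "\<Prod>k\<in>{ed..<n}. fact (b (ii k)) :: complex"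
  have ex: "\<exists>h. ders (word_of ?b [0..<ed]) (G \<xi> (\<lambda>i. Suc (b i))) h" if "\<xi> \<in> Sol (cz z)" for \<xi>
    by (rule ders_exists[OF ha_G[OF that]]) (use set_word_of[of ?b "[0..<ed]"] ed_le in auto)
  define H where "H \<xi> = (SOME h. ders (word_of ?b [0..<ed]) (G \<xi> (\<lambda>i. Suc (b i))) h)" for \<xi>
  have H: "ders (word_of ?b [0..<ed]) (G \<xi> (\<lambda>i. Suc (b i))) (H \<xi>)" if "\<xi> \<in> Sol (cz z)" for \<xi>
    unfolding H_def by (rule someI_ex[OF ex[OF that]])
  have d: "ders (word_of ?b ([ed..<n] @ [0..<ed])) (G \<xi> (\<lambda>_. 1)) (\<lambda>\<zeta>. ?C * H \<xi> \<zeta>)" if x: "\<xi> \<in> Sol (cz z)" for \<xi>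
  proof -
    have "ders (word_of ?b [ed..<n]) (\<lambda>\<zeta>. 1 * G \<xi> (\<lambda>_. 1) \<zeta>)
      (\<lambda>\<zeta>. 1 * (\<Prod>k\<in>set [ed..<n]. fact (?b k)) * G \<xi> (fold (\<lambda>k m. m(ii k := Suc (?b k))) [ed..<n] (\<lambda>_. 1)) \<zeta>)"
      by (rule ders_G_word[OF x]) (use iiJ in auto)
    moreover have "G \<xi> (fold (\<lambda>k m. m(ii k := Suc (?b k))) [ed..<n] (\<lambda>_. 1)) = G \<xi> (\<lambda>i. Suc (b i))"
    proof (rule G_cong)
      fix j assume j: "j \<in> J"
      obtain k where k: "k < n" "j = ii k" by (rule ii_ex[of j])
      then have "j \<in> ii ` set [ed..<n]" using j iiJ by auto
      then show "fold (\<lambda>k m. m(ii k := Suc (?b k))) [ed..<n] (\<lambda>_. 1) j = Suc (b j)" by (subst fold_upd_at) auto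
    qed
    ultimately have "ders (word_of ?b [ed..<n]) (G \<xi> (\<lambda>_. 1)) (\<lambda>\<zeta>. ?C * G \<xi> (\<lambda>i. Suc (b i)) \<zeta>)" by simp
    then show ?thesis unfolding word_of_append by (rule ders_appendI[OF _ ders_cmult[OF H[OF x]]])
  qed
  have lt: "k < n" if "k \<in> set (word_of ?b ([ed..<n] @ [0..<ed]))" for k
    using set_word_of[of ?b "[ed..<n] @ [0..<ed]"] that ed_le by auto
  have "ders (word_of ?b ([ed..<n] @ [0..<ed])) (\<lambda>\<zeta>. \<Sum>\<xi>\<in>Sol (cz z). G \<xi> (\<lambda>_. 1) \<zeta>) (\<lambda>\<zeta>. \<Sum>\<xi>\<in>Sol (cz z). ?C * H \<xi> \<zeta>)"
    by (rule ders_sum[OF finite_Sol lt d])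
  from fold_pd_ders[OF this inj_Inl_ii, where F = "Rsum (\<lambda>_. 1)" and c = 1 and z = z and \<zeta> = "\<lambda>_. 0"]
  have "fold pd (map (\<lambda>k. Inl (ii k)) (word_of ?b ([ed..<n] @ [0..<ed]))) (Rsum (\<lambda>_. 1)) z
    = (-1) ^ length (word_of ?b ([ed..<n] @ [0..<ed])) * (\<Sum>\<xi>\<in>Sol (cz z). ?C * H \<xi> (\<lambda>_. 0))"
    using Rsum_evz zero_Pd by (simp add: evz_zero)
  moreover have "length (word_of ?b ([ed..<n] @ [0..<ed])) = (\<Sum>i\<in>UNIV. b i)"
  proof -
    have "length (word_of ?b ([ed..<n] @ [0..<ed])) = (\<Sum>k\<in>set ([ed..<n] @ [0..<ed]). ?b k)"
      unfolding length_word_of by (rule sum_list_distinct_conv_sum_set) auto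
    also have "set ([ed..<n] @ [0..<ed]) = {..<n}" using ed_le by auto
    also have "(\<Sum>k<n. ?b k) = (\<Sum>i\<in>UNIV. b i)" by (rule sum.reindex_bij_betw[OF ii])
    finally show ?thesis .
  qed
  ultimately have "fold pd (map (\<lambda>k. Inl (ii k)) (word_of ?b ([ed..<n] @ [0..<ed]))) (Rsum (\<lambda>_. 1)) z
      = (-1) ^ (\<Sum>i\<in>UNIV. b i) * ?C * (\<Sum>\<xi>\<in>Sol (cz z). H \<xi> (\<lambda>_. 0))"
    by (simp add: sum_distrib_left mult_ac)
  from that[OF H this] show thesis .
qed

end

lemma (in toric) toric_germ_exists:
  assumes gz: "good z" and ii: "bij_betw ii {..<n} UNIV" and iiI: "bij_betw ii {..<ed} (- J)" and ed_le: "ed \<le> n"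
  obtains \<delta> where "toric_germ a J g ed fd n z ii \<delta>"
proof -
  have z: "z v \<noteq> 0" for v using gz by (simp add: good_def)
  let ?E = "\<lambda>r \<zeta>. exp (\<Sum>k<n. r k * Ln (1 - \<zeta> k / z (Inl (ii k))))"
  let ?L = "\<lambda>\<xi> j \<zeta>. z (Inl j) * ?E (\<lambda>k. of_bool (ii k = j)) \<zeta> + z (Inr j) * chr ed fd \<xi> (a j) * ?E (\<lambda>k. expo (a j) (ii k)) \<zeta>"
  have e1: "\<forall>\<^sub>F \<delta> in at_right 0. \<forall>k\<in>{..<n}. 2 * \<delta> < cmod (z (Inl (ii k)))"
  proof (rule eventually_ball_finite)
    show "\<forall>k\<in>{..<n}. \<forall>\<^sub>F \<delta> in at_right 0. 2 * \<delta> < cmod (z (Inl (ii k)))"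
    proof
      fix k
      show "\<forall>\<^sub>F \<delta> in at_right 0. 2 * \<delta> < cmod (z (Inl (ii k)))"
        unfolding eventually_at_right_field
        by (rule exI[of _ "cmod (z (Inl (ii k))) / 2"]) (use z in auto)
    qed
  qed simp
  have e2: "\<forall>\<^sub>F \<delta> in at_right 0. \<forall>(\<xi>, j)\<in>Sol (cz z) \<times> J. \<forall>\<zeta>. (\<forall>k<n. cmod (\<zeta> k) < \<delta>) \<longrightarrow> cmod (fz z j \<xi>) / 2 \<le> cmod (?L \<xi> j \<zeta>)"
  proof (rule eventually_ball_finite)
    show "finite (Sol (cz z) \<times> J)" using finite_Sol by simp
    show "\<forall>p\<in>Sol (cz z) \<times> J. \<forall>\<^sub>F \<delta> in at_right 0. case p of (\<xi>, j) \<Rightarrow> \<forall>\<zeta>. (\<forall>k<n. cmod (\<zeta> k) < \<delta>) \<longrightarrow> cmod (fz z j \<xi>) / 2 \<le> cmod (?L \<xi> j \<zeta>)"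
    proof (clarify)
      fix \<xi> j assume x: "\<xi> \<in> Sol (cz z)" "j \<in> J"
      define P Q where "P = z (Inl j)" and "Q = z (Inr j) * chr ed fd \<xi> (a j)"
      have f: "fz z j \<xi> = P + Q" by (simp add: fz_def P_def Q_def)
      have fnz: "cmod (P + Q) > 0" using fz_nonzero[OF gz x(2,1)] f by simp
      \<comment> \<open>Changing \<open>P\<close> and \<open>Q\<close> by relative errors below
        \<theta> alters \<open>P + Q\<close> by at most half its modulus; the summand 1 keeps the
        denominator positive.\<close>
      define \<theta> where "\<theta> = cmod (P + Q) / (2 * (cmod P + cmod Q + 1))"
      have th: "\<theta> > 0" using fnz unfolding \<theta>_def by (intro divide_pos_pos) (auto intro: add_nonneg_pos)
      have th2: "(cmod P + cmod Q) * \<theta> \<le> cmod (P + Q) / 2"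
      proof -
        have "(cmod P + cmod Q) * \<theta> \<le> (cmod P + cmod Q + 1) * \<theta>" using th by (intro mult_right_mono) auto
        also have "\<dots> = cmod (P + Q) / 2"
        proof -
          have "cmod P + cmod Q + 1 \<noteq> 0" using norm_ge_zero[of P] norm_ge_zero[of Q] by linarith
          then show ?thesis unfolding \<theta>_def by (simp add: divide_simps)
        qed
        finally show ?thesis .
      qed
      show "\<forall>\<^sub>F \<delta> in at_right 0. \<forall>\<zeta>. (\<forall>k<n. cmod (\<zeta> k) < \<delta>) \<longrightarrow> cmod (fz z j \<xi>) / 2 \<le> cmod (?L \<xi> j \<zeta>)"
        using eventually_conj[OF eventually_exp_Ln_near_one[of n "\<lambda>k. z (Inl (ii k))" \<theta> "\<lambda>k. of_bool (ii k = j)"]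
          eventually_exp_Ln_near_one[of n "\<lambda>k. z (Inl (ii k))" \<theta> "\<lambda>k. expo (a j) (ii k)"]]
      proof (rule eventually_mono)
        fix \<delta> assume h: "(\<forall>\<zeta>. (\<forall>k<n. cmod (\<zeta> k) < \<delta>) \<longrightarrow> cmod (?E (\<lambda>k. of_bool (ii k = j)) \<zeta> - 1) < \<theta>) \<and>
          (\<forall>\<zeta>. (\<forall>k<n. cmod (\<zeta> k) < \<delta>) \<longrightarrow> cmod (?E (\<lambda>k. expo (a j) (ii k)) \<zeta> - 1) < \<theta>)"
        show "\<forall>\<zeta>. (\<forall>k<n. cmod (\<zeta> k) < \<delta>) \<longrightarrow> cmod (fz z j \<xi>) / 2 \<le> cmod (?L \<xi> j \<zeta>)"
        proof (intro allI impI)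
          fix \<zeta> :: "nat \<Rightarrow> complex" assume s: "\<forall>k<n. cmod (\<zeta> k) < \<delta>"
          define u v where "u = ?E (\<lambda>k. of_bool (ii k = j)) \<zeta>" and "v = ?E (\<lambda>k. expo (a j) (ii k)) \<zeta>"
          have uv: "cmod (u - 1) < \<theta>" "cmod (v - 1) < \<theta>" using h s unfolding u_def v_def by blast+
          have "cmod (P * (u - 1) + Q * (v - 1)) \<le> cmod P * \<theta> + cmod Q * \<theta>"
            using uv by (intro norm_triangle_mono) (auto simp: norm_mult intro!: mult_left_mono)
          also have "\<dots> \<le> cmod (P + Q) / 2" using th2 by (simp add: distrib_right)
          finally have "cmod (P + Q) \<le> cmod (P * u + Q * v) + cmod (P + Q) / 2"
            using norm_triangle_ineq4[of "P * u + Q * v" "P * (u - 1) + Q * (v - 1)"] by (simp add: algebra_simps)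
          then show "cmod (fz z j \<xi>) / 2 \<le> cmod (?L \<xi> j \<zeta>)" unfolding f u_def[symmetric] v_def[symmetric] P_def[symmetric] Q_def[symmetric] by simp
        qed
      qed (use z th in auto)
    qed
  qed
  have "\<exists>\<delta>. 0 < \<delta> \<and> (\<forall>k\<in>{..<n}. 2 * \<delta> < cmod (z (Inl (ii k)))) \<and> (\<forall>(\<xi>, j)\<in>Sol (cz z) \<times> J. \<forall>\<zeta>. (\<forall>k<n. cmod (\<zeta> k) < \<delta>) \<longrightarrow> cmod (fz z j \<xi>) / 2 \<le> cmod (?L \<xi> j \<zeta>))"
    by (rule eventually_happens'[OF _ eventually_conj[OF eventually_at_right_less eventually_conj[OF e1 e2]]]) simp
  then obtain \<delta> where d: "\<delta> > 0" "\<forall>k\<in>{..<n}. 2 * \<delta> < cmod (z (Inl (ii k)))"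
    "\<forall>(\<xi>, j)\<in>Sol (cz z) \<times> J. \<forall>\<zeta>. (\<forall>k<n. cmod (\<zeta> k) < \<delta>) \<longrightarrow> cmod (fz z j \<xi>) / 2 \<le> cmod (?L \<xi> j \<zeta>)"
    by (elim exE conjE)
  have "toric_germ a J g ed fd n z ii \<delta>"
  proof (unfold_locales)
    fix k assume "k < n" then show "2 * \<delta> < cmod (z (Inl (ii k)))" using d(2) by simp
  next
    fix \<xi> j and \<zeta> :: "nat \<Rightarrow> complex" assume h: "\<xi> \<in> Sol (cz z)" "j \<in> J" "\<And>k. k < n \<Longrightarrow> cmod (\<zeta> k) < \<delta>"
    have "(\<xi>, j) \<in> Sol (cz z) \<times> J" using h by simp
    from bspec[OF d(3) this] show "cmod (fz z j \<xi>) / 2 \<le> cmod (?L \<xi> j \<zeta>)" using h(3) by simp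
  qed (use d gz ii iiI ed_le in auto)
  then show thesis by (rule that)
qed

section \<open>Parametrisation of the residue cycle\<close>

lemma cyc_has_vector_derivative: "(cyc \<epsilon> has_vector_derivative (2 * of_real pi * \<i>) * cyc \<epsilon> r) (at r)"
proof -
  have "((\<lambda>w. of_real \<epsilon> * exp (2 * of_real pi * \<i> * w)) has_field_derivative (2 * of_real pi * \<i>) * cyc \<epsilon> r) (at (of_real r))"
    by (auto intro!: derivative_eq_intros simp: cyc_def)
  from has_vector_derivative_real_field[OF this] show ?thesis by (simp add: cyc_def[abs_def])
qed

lemma cyc_inj:
  assumes "\<epsilon> > 0" "r \<in> {0..<1}" "r' \<in> {0..<1}" "cyc \<epsilon> r = cyc \<epsilon> r'" shows "r = r'"
proof -
  have "exp (2 * of_real pi * \<i> * of_real r) = exp (2 * of_real pi * \<i> * of_real r')"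
    using assms(1,4) by (simp add: cyc_def)
  then have "2 * of_real pi * \<i> * of_real r = 2 * of_real pi * \<i> * of_real r'"
  proof (rule exp_complex_eqI[rotated])
    have "\<bar>2 * pi * (r - r')\<bar> < 2 * pi" using assms(2,3) by (simp add: abs_mult) (auto simp: abs_if)
    then show "\<bar>Im (2 * of_real pi * \<i> * of_real r) - Im (2 * of_real pi * \<i> * of_real r')\<bar> < 2 * pi"
      by (simp add: algebra_simps)
  qed
  then show ?thesis by simp
qed

lemma cyc_surj:
  assumes "w \<noteq> 0" obtains r where "r \<in> {0..<1}" "cyc (cmod w) r = w"
proof (rule that[of "Arg2pi w / (2 * pi)"])
  show "Arg2pi w / (2 * pi) \<in> {0..<1}" using Arg2pi[of w] by simp
  have "2 * of_real pi * \<i> * of_real (Arg2pi w / (2 * pi)) = \<i> * of_real (Arg2pi w)" by simp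
  then show "cyc (cmod w) (Arg2pi w / (2 * pi)) = w" unfolding cyc_def using Arg2pi_eq[of w] by simp
qed

context toric
begin

lemma chr_inverse: "chr ed fd (\<lambda>k. inverse (t k)) v = inverse (chr ed fd t v)"
  by (simp add: chr_def power_int_inverse prod_inversef[unfolded o_def])

lemma Sol_zeros:
  assumes "\<And>v. z v \<noteq> 0" shows "{\<xi> \<in> torus ed. \<forall>i\<in>- J. fz z i \<xi> = 0} = Sol (cz z)"
proof -
  have "fz z i \<xi> = 0 \<longleftrightarrow> chr ed fd \<xi> (a i) = cz z i" for i \<xi>
    using assms[of "Inr i"] by (simp add: fz_def cz_def field_simps add_eq_0_iff2) (auto simp: add_eq_0_iff2 mult.commute)
  then show ?thesis by (simp add: Sol_def)
qed

text \<open>Two points with the same characters of the \<open>a i\<close>,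
  \<open>i \<notin> J\<close>, differ by an element of the finite group
  \<open>Sol (\<lambda>_. 1)\<close>. In a small polydisc their quotient is close to 1, and only the
  identity is.\<close>

lemma eventually_polydisc_separated:
  assumes x: "\<xi> \<in> torus ed"
  shows "\<forall>\<^sub>F r in at_right 0. r > 0 \<and> polydisc ed \<xi> r \<subseteq> torus ed \<and>
     (\<forall>t\<in>polydisc ed \<xi> r. \<forall>t'\<in>polydisc ed \<xi> r. (\<forall>i\<in>- J. chr ed fd t (a i) = chr ed fd t' (a i)) \<longrightarrow> t = t')"
proof -
  have xl: "cmod (\<xi> l) > 0" if "l < ed" for l using x that by (auto simp: torus_def PiE_iff)
  have "\<forall>\<^sub>F \<eta> in at_right (0::real). \<forall>u\<in>Sol (\<lambda>_. 1). (\<forall>l<ed. cmod (u l - 1) < \<eta>) \<longrightarrow> (\<forall>l<ed. u l = 1)"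
  proof (rule eventually_ball_finite[OF finite_Sol], rule ballI)
    fix u assume "u \<in> Sol (\<lambda>_. 1)"
    show "\<forall>\<^sub>F \<eta> in at_right 0. (\<forall>l<ed. cmod (u l - 1) < \<eta>) \<longrightarrow> (\<forall>l<ed. u l = 1)"
    proof (cases "\<forall>l<ed. u l = 1")
      case False
      then obtain l where l: "l < ed" "u l \<noteq> 1" by auto
      show ?thesis unfolding eventually_at_right_field
      proof (intro exI[of _ "cmod (u l - 1)"] conjI allI impI)
        show "0 < cmod (u l - 1)" using l by simp
        fix y l' assume "0 < y" "y < cmod (u l - 1)" "\<forall>l<ed. cmod (u l - 1) < y"
        then show "u l' = 1" using l(1) by (meson less_asym)
      qed
    qed simp
  qed
  from eventually_happens'[OF _ eventually_conj[OF eventually_at_right_less this]]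
  obtain \<eta> where e: "\<eta> > 0" "\<And>u. u \<in> Sol (\<lambda>_. 1) \<Longrightarrow> (\<And>l. l < ed \<Longrightarrow> cmod (u l - 1) < \<eta>) \<Longrightarrow> (\<forall>l<ed. u l = 1)"
    by auto
  have "\<forall>\<^sub>F r in at_right 0. \<forall>l\<in>{..<ed}. r < cmod (\<xi> l) / 2 \<and> 4 * r < \<eta> * cmod (\<xi> l)"
  proof (rule eventually_ball_finite, simp, rule ballI)
    fix l assume "l \<in> {..<ed}"
    then have l: "cmod (\<xi> l) > 0" using xl by simp
    show "\<forall>\<^sub>F r in at_right 0. r < cmod (\<xi> l) / 2 \<and> 4 * r < \<eta> * cmod (\<xi> l)"
      unfolding eventually_at_right_field
      by (rule exI[of _ "min (cmod (\<xi> l) / 2) (\<eta> * cmod (\<xi> l) / 4)"]) (use l e in auto)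
  qed
  from eventually_conj[OF eventually_at_right_less this] show ?thesis
  proof (rule eventually_mono)
    fix r assume r: "0 < r \<and> (\<forall>l\<in>{..<ed}. r < cmod (\<xi> l) / 2 \<and> 4 * r < \<eta> * cmod (\<xi> l))"
    have half: "cmod (t l) > cmod (\<xi> l) / 2" if "t \<in> polydisc ed \<xi> r" "l < ed" for t l
    proof -
      have "cmod (t l - \<xi> l) < r" "r < cmod (\<xi> l) / 2" using that r by (auto simp: polydisc_def dist_norm)
      then show ?thesis using norm_triangle_ineq2[of "\<xi> l" "\<xi> l - t l"] by (simp add: norm_minus_commute)
    qed
    have sub: "polydisc ed \<xi> r \<subseteq> torus ed"
    proof
      fix t assume t: "t \<in> polydisc ed \<xi> r"
      have "t l \<noteq> 0" if "l < ed" for l using half[OF t that] xl[OF that] by auto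
      then show "t \<in> torus ed" using t by (auto simp: polydisc_def torus_def PiE_iff)
    qed
    have "t = t'" if t: "t \<in> polydisc ed \<xi> r" "t' \<in> polydisc ed \<xi> r" and eq: "\<forall>i\<in>- J. chr ed fd t (a i) = chr ed fd t' (a i)" for t t'
    proof -
      have nz: "t l \<noteq> 0" "t' l \<noteq> 0" if "l < ed" for l using sub t that by (auto simp: torus_def PiE_iff)
      define u where "u = (\<lambda>l\<in>{..<ed}. t l * inverse (t' l))"
      have "u \<in> torus ed" using nz by (auto simp: u_def torus_def)
      moreover have "chr ed fd u (a i) = 1" if "i \<in> - J" for i
        unfolding u_def chr_mult chr_inverse using eq that chr_nonzero[of t' "a i"] sub t(2) by auto
      ultimately have uS: "u \<in> Sol (\<lambda>_. 1)" by (simp add: Sol_def)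
      have "cmod (u l - 1) < \<eta>" if l: "l < ed" for l
      proof -
        have "u l - 1 = (t l - t' l) / t' l" using nz[OF l] l by (simp add: u_def field_simps)
        then have 1: "cmod (u l - 1) = cmod (t l - t' l) / cmod (t' l)" by (simp add: norm_divide)
        have "cmod (t l - \<xi> l) < r" "cmod (t' l - \<xi> l) < r" using t l by (auto simp: polydisc_def dist_norm)
        then have "cmod (t l - t' l) < 2 * r" using norm_triangle_ineq4[of "t l - \<xi> l" "t' l - \<xi> l"] by simp
        also have "2 * r < \<eta> * (cmod (\<xi> l) / 2)" using r l by auto
        also have "\<dots> < \<eta> * cmod (t' l)" using half[OF t(2) l] e(1) by (intro mult_strict_left_mono) auto
        finally show ?thesis unfolding 1 using nz[OF l] by (simp add: divide_less_eq)
      qed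
      from e(2)[OF uS this] have "u l = 1" if "l < ed" for l using that by blast
      then have "t l = t' l" if "l < ed" for l using that nz[OF that] by (auto simp: u_def field_simps)
      then show "t = t'" using t by (intro extensionalityI[of t "{..<ed}" t']) (auto simp: polydisc_def PiE_iff)
    qed
    then show "r > 0 \<and> polydisc ed \<xi> r \<subseteq> torus ed \<and>
     (\<forall>t\<in>polydisc ed \<xi> r. \<forall>t'\<in>polydisc ed \<xi> r. (\<forall>i\<in>- J. chr ed fd t (a i) = chr ed fd t' (a i)) \<longrightarrow> t = t')"
      using r sub by blast
  qed
qed

end

context toric_germ
begin

text \<open>The residue variables run over circles; the coordinates from \<open>ed\<close> on are 0,
  so the \<open>x j\<close> with \<open>j \<in> J\<close> keep their values.\<close>

definition zz :: "(nat \<Rightarrow> real) \<Rightarrow> (nat \<Rightarrow> real) \<Rightarrow> nat \<Rightarrow> complex" where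
  "zz \<epsilon> s = (\<lambda>k. if k \<in> set [0..<ed] then cyc (\<epsilon> k) (s k) else 0)"

definition Mx :: "nat \<Rightarrow> nat \<Rightarrow> complex" where
  "Mx l k = of_int (mm l (ii k)) / of_nat idxD"

lemma dets_Mx: "dets ed Mx \<noteq> 0"
proof -
  have "dets ed (\<lambda>k l. of_int (a (ii k) $ fd l)) * dets ed Mx = 1"
  proof (rule dets_inverse_nonzero)
    fix k k' assume k: "k < ed" "k' < ed"
    have "(\<Sum>l<ed. of_int (a (ii k) $ fd l) * Mx l k') = expo (a (ii k)) (ii k')"
      by (simp add: expo_def Mx_def)
    also have "\<dots> = of_bool (k = k')"
      unfolding expo_a[OF iiI_mem[OF k(1)]] using ii_inj[of k' k] k ed_le by auto
    finally show "(\<Sum>l<ed. of_int (a (ii k) $ fd l) * Mx l k') = of_bool (k = k')" .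
  qed
  then show ?thesis by auto
qed

context
  fixes \<epsilon> :: "nat \<Rightarrow> real" and \<xi> :: "nat \<Rightarrow> complex"
  assumes eps: "\<And>k. k < ed \<Longrightarrow> 0 < \<epsilon> k \<and> \<epsilon> k < \<delta>" and xi: "\<xi> \<in> Sol (cz z)"
begin

lemma zz_Pd: "zz \<epsilon> s \<in> Pd"
  using eps \<delta>(1) by (auto simp: Pd_def zz_def norm_cyc)

lemma fz_zz: "k < ed \<Longrightarrow> fz z (ii k) (tt \<xi> (zz \<epsilon> s)) = cyc (\<epsilon> k) (s k)"
  by (subst fz_tt[OF xi _ zz_Pd]) (auto simp: zz_def)

lemma fz_zz_J: 
  assumes "j \<in> J" shows "fz z j (tt \<xi> (zz \<epsilon> s)) = fJ \<xi> j (zz \<epsilon> s)"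
proof -
  obtain k where k: "k < n" "j = ii k" by (rule ii_ex[of j])
  then have "zz \<epsilon> s k = 0" using assms iiJ[OF k(1)] by (simp add: zz_def)
  then have "pw (\<lambda>l. of_bool (ii l = j)) (zz \<epsilon> s) = 1"
    unfolding k(2) pw_ii(1)[OF k(1) zz_Pd] by simp
  then show ?thesis unfolding fJ_def fz_def chr_tt by (simp add: mult.assoc)
qed

text \<open>The derivative of \<open>Ln (1 - cyc / x)\<close> along the circle of coordinate
  \<open>k\<close>.\<close>

abbreviation q :: "nat \<Rightarrow> (nat \<Rightarrow> real) \<Rightarrow> complex" where
  "q k s \<equiv> - (2 * of_real pi * \<i>) * (cyc (\<epsilon> k) (s k) * inverse (z (Inl (ii k)) - cyc (\<epsilon> k) (s k)))"

lemma tt_derivative: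
  assumes j: "j < ed" and k: "k < ed"
  shows "((\<lambda>r. tt \<xi> (zz \<epsilon> (s(k := r))) j) has_vector_derivative tt \<xi> (zz \<epsilon> s) j * Mx j k * q k s) (at (s k))"
proof -
  have kn: "k < n" using k ed_le by simp
  let ?\<zeta> = "zz \<epsilon> s" let ?x = "z (Inl (ii k))"
  have upd: "zz \<epsilon> (s(k := r)) = ?\<zeta>(k := cyc (\<epsilon> k) r)" for r using k by (auto simp: zz_def)
  have zk: "?\<zeta> k = cyc (\<epsilon> k) (s k)" using k by (simp add: zz_def)
  have e: "(if l = k then -1 else 0) = (- of_bool (l = k) :: complex)" for l by auto
  have "((\<lambda>t. pw (Mx j) (?\<zeta>(k := t))) has_field_derivative - Mx j k / ?x * (pw (Mx j) ?\<zeta> * inverse (1 - ?\<zeta> k / ?x))) (at (?\<zeta> k))"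
    unfolding pw_single(2)[OF kn zz_Pd[of s], symmetric]
    by (rule bspec[OF pder_pw[OF kn, of "Mx j", unfolded pder_def e] zz_Pd[of s]])
  from field_vector_diff_chain_at[OF cyc_has_vector_derivative this[unfolded zk]]
  have "((\<lambda>r. pw (Mx j) (?\<zeta>(k := cyc (\<epsilon> k) r))) has_vector_derivative
     (2 * of_real pi * \<i>) * cyc (\<epsilon> k) (s k) * (- Mx j k / ?x * (pw (Mx j) ?\<zeta> * inverse (1 - cyc (\<epsilon> k) (s k) / ?x)))) (at (s k))"
    unfolding o_def .
  from has_vector_derivative_mult_right[OF this, of "\<xi> j"]
  have d: "((\<lambda>r. \<xi> j * pw (Mx j) (?\<zeta>(k := cyc (\<epsilon> k) r))) has_vector_derivative
     \<xi> j * ((2 * of_real pi * \<i>) * cyc (\<epsilon> k) (s k) * (- Mx j k / ?x * (pw (Mx j) ?\<zeta> * inverse (1 - cyc (\<epsilon> k) (s k) / ?x))))) (at (s k))" .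
  have t: "tt \<xi> \<zeta> j = \<xi> j * pw (Mx j) \<zeta>" for \<zeta> using j by (simp add: tt_def Mx_def)
  have "1 - ?\<zeta> k / ?x \<noteq> 0" using Pd_slit[OF zz_Pd[of s] kn] by auto
  then have nz: "?x - cyc (\<epsilon> k) (s k) \<noteq> 0" unfolding zk using znz by (auto simp: field_simps)
  have "inverse (1 - cyc (\<epsilon> k) (s k) / ?x) = ?x * inverse (?x - cyc (\<epsilon> k) (s k))"
    using nz znz[of "Inl (ii k)"] by (simp add: divide_simps)
  then show ?thesis using d unfolding upd t using znz[of "Inl (ii k)"] by (simp add: mult_ac)
qed

lemma pdiff_tt: "j < ed \<Longrightarrow> k < ed \<Longrightarrow> pdiff k (\<lambda>s. tt \<xi> (zz \<epsilon> s) j) s = tt \<xi> (zz \<epsilon> s) j * Mx j k * q k s"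
  unfolding pdiff_def by (rule vector_derivative_at[OF tt_derivative])

lemma continuous_cyc_coord: "continuous_on S (\<lambda>s::nat \<Rightarrow> real. cyc e (s k))"
  unfolding cyc_def by (intro continuous_intros continuous_on_subset[OF continuous_on_product_coordinates]) auto

lemma C1_tt: "C1_map ed (\<lambda>s. tt \<xi> (zz \<epsilon> s))"
  unfolding C1_map_def
proof (intro allI impI conjI ballI)
  fix j k assume jk: "j < ed" "k < ed"
  show "(\<lambda>r. tt \<xi> (zz \<epsilon> (s(k := r))) j) differentiable at (s k)" for s
    by (rule differentiableI_vector[OF tt_derivative[OF jk]])
  have kn: "k < n" using jk ed_le by simp
  have z0: "continuous_on S (\<lambda>s. zz \<epsilon> s l)" for S l
    by (cases "l \<in> set [0..<ed]") (simp_all only: zz_def if_True if_False continuous_cyc_coord continuous_on_const)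
  have sl: "1 - zz \<epsilon> s l / z (Inl (ii l)) \<notin> \<real>\<^sub>\<le>\<^sub>0" if "l < n" for s l by (rule Pd_slit[OF zz_Pd that])
  have c1: "continuous_on S (\<lambda>s. tt \<xi> (zz \<epsilon> s) j)" for S
  proof -
    have "continuous_on S (\<lambda>s. \<xi> j * pw (Mx j) (zz \<epsilon> s))"
      by (intro continuous_intros z0) (use sl znz in auto)
    then show ?thesis using jk by (simp add: tt_def Mx_def)
  qed
  have nz: "z (Inl (ii k)) - cyc (\<epsilon> k) (s k) \<noteq> 0" for s :: "nat \<Rightarrow> real"
    using sl[OF kn, of s] znz[of "Inl (ii k)"] jk(2) by (auto simp: zz_def)
  have "continuous_on S (\<lambda>s. tt \<xi> (zz \<epsilon> s) j * Mx j k * q k s)" for S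
    by (intro continuous_on_mult c1 continuous_on_const continuous_on_inverse continuous_on_diff continuous_cyc_coord ballI nz)
  then show "continuous_on ({..<ed} \<rightarrow>\<^sub>E UNIV) (pdiff k (\<lambda>s. tt \<xi> (zz \<epsilon> s) j))"
    using pdiff_tt[OF jk] by (simp cong: continuous_on_cong)
qed

text \<open>In this parametrisation \<open>f j\<close> is the point of its circle at angle
  \<open>2 * pi * s j\<close>, so the matrix is \<open>2 * pi\<close> times the identity.\<close>

lemma orientation_tt:
  "dets ed (\<lambda>j k. Im (pdiff k (\<lambda>s. fz z (ii j) (tt \<xi> (zz \<epsilon> s))) s / fz z (ii j) (tt \<xi> (zz \<epsilon> s)))) > 0"
proof -
  have "dets ed (\<lambda>j k. Im (pdiff k (\<lambda>s. fz z (ii j) (tt \<xi> (zz \<epsilon> s))) s / fz z (ii j) (tt \<xi> (zz \<epsilon> s))))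
    = dets ed (\<lambda>j k. 1 * of_bool (j = k) * (2 * pi))"
  proof (rule dets_cong)
    fix j k assume jk: "j < ed" "k < ed"
    have nz: "cyc (\<epsilon> j) (s j) \<noteq> 0" using eps[OF jk(1)] cyc_nonzero by blast
    have "((\<lambda>r. cyc (\<epsilon> j) ((s(k := r)) j)) has_vector_derivative (if j = k then (2 * of_real pi * \<i>) * cyc (\<epsilon> j) (s j) else 0)) (at (s k))"
      using cyc_has_vector_derivative[of "\<epsilon> k" "s k"] by (auto intro: has_vector_derivative_const)
    then have "pdiff k (\<lambda>s. fz z (ii j) (tt \<xi> (zz \<epsilon> s))) s = (if j = k then (2 * of_real pi * \<i>) * cyc (\<epsilon> j) (s j) else 0)"
      unfolding fz_zz[OF jk(1)] pdiff_def by (rule vector_derivative_at)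
    then show "Im (pdiff k (\<lambda>s. fz z (ii j) (tt \<xi> (zz \<epsilon> s))) s / fz z (ii j) (tt \<xi> (zz \<epsilon> s))) = 1 * of_bool (j = k) * (2 * pi)"
      unfolding fz_zz[OF jk(1)] using nz by (cases "j = k") auto
  qed
  also have "\<dots> = (2 * pi) ^ ed" unfolding dets_scale dets_one by simp
  finally show ?thesis by simp
qed

abbreviation form :: "('n \<Rightarrow> nat) \<Rightarrow> (nat \<Rightarrow> complex) \<Rightarrow> complex" where
  "form b t \<equiv> chr ed fd t \<gamma> / (\<Prod>i\<in>UNIV. fz z i t ^ Suc (b i)) / (\<Prod>k<ed. t k)"

text \<open>The coordinates of the branch in the Jacobian cancel the denominator of the logarithmic
  form. The circle points in \<open>q\<close> lower the exponents \<open>Suc (b i)\<close> of the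
  divisors to \<open>b i\<close>, and the factors \<open>1 / (x - cyc)\<close> are those already
  present in \<open>G\<close>.\<close>

lemma form_pullback:
  "form b (tt \<xi> (zz \<epsilon> s)) * dets ed (\<lambda>j k. pdiff k (\<lambda>s. tt \<xi> (zz \<epsilon> s) j) s)
   = (- (2 * of_real pi * \<i>)) ^ ed * dets ed Mx *
     (G \<xi> (\<lambda>i. Suc (b i)) (zz \<epsilon> s) * (\<Prod>k\<in>set [0..<ed]. inverse (cyc (\<epsilon> k) (s k)) ^ b (ii k)))"
proof -
  let ?t = "tt \<xi> (zz \<epsilon> s)" and ?c = "\<lambda>k. cyc (\<epsilon> k) (s k)"
  define P where "P = (\<Prod>k<ed. ?t k)"
  define Z where "Z = (\<Prod>k<ed. ?c k)"
  define W where "W = (\<Prod>k<ed. ?c k ^ b (ii k))"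
  define X where "X = (\<Prod>k<ed. inverse (z (Inl (ii k)) - ?c k))"
  define F where "F = (\<Prod>j\<in>J. fJ \<xi> j (zz \<epsilon> s) ^ Suc (b j))"
  have tt: "?t \<in> torus ed" using tt_torus xi by (simp add: Sol_def)
  have P: "P \<noteq> 0" unfolding P_def using tt by (auto simp: torus_def PiE_iff)
  have cnz: "?c k \<noteq> 0" if "k < ed" for k using eps[OF that] cyc_nonzero by blast
  have Z: "Z \<noteq> 0" and W: "W \<noteq> 0" unfolding Z_def W_def using cnz by auto
  have F: "F \<noteq> 0" unfolding F_def using fJ_nonzero[OF xi _ zz_Pd] by auto
  have "(\<Prod>i\<in>UNIV. fz z i ?t ^ Suc (b i)) = (\<Prod>i\<in>- J. fz z i ?t ^ Suc (b i)) * (\<Prod>j\<in>J. fz z j ?t ^ Suc (b j))"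
    by (subst prod.union_disjoint[symmetric]) (auto intro: prod.cong simp: Compl_partition2)
  also have "(\<Prod>i\<in>- J. fz z i ?t ^ Suc (b i)) = (\<Prod>k<ed. fz z (ii k) ?t ^ Suc (b (ii k)))"
    by (rule prod.reindex_bij_betw[OF iiI, symmetric])
  also have "\<dots> = (\<Prod>k<ed. ?c k ^ Suc (b (ii k)))" by (rule prod.cong) (auto simp: fz_zz)
  also have "\<dots> = Z * W" unfolding Z_def W_def by (simp add: prod.distrib)
  also have "(\<Prod>j\<in>J. fz z j ?t ^ Suc (b j)) = F" unfolding F_def by (rule prod.cong) (auto simp: fz_zz_J)
  finally have d: "(\<Prod>i\<in>UNIV. fz z i ?t ^ Suc (b i)) = Z * W * F" .
  have "dets ed (\<lambda>j k. pdiff k (\<lambda>s. tt \<xi> (zz \<epsilon> s) j) s) = dets ed (\<lambda>j k. ?t j * Mx j k * q k s)"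
    by (rule dets_cong) (rule pdiff_tt)
  also have "\<dots> = P * (\<Prod>k<ed. q k s) * dets ed Mx" unfolding dets_scale P_def ..
  also have "(\<Prod>k<ed. q k s) = (- (2 * of_real pi * \<i>)) ^ ed * (Z * X)"
    unfolding Z_def X_def by (simp only: prod.distrib prod_constant card_lessThan)
  finally have e: "dets ed (\<lambda>j k. pdiff k (\<lambda>s. tt \<xi> (zz \<epsilon> s) j) s) = P * ((- (2 * of_real pi * \<i>)) ^ ed * (Z * X)) * dets ed Mx" .
  have "(\<Prod>i\<in>- J. inverse (z (Inl i)) * pw (\<lambda>k. - of_bool (ii k = i)) (zz \<epsilon> s))
     = (\<Prod>k<ed. inverse (z (Inl (ii k))) * pw (\<lambda>l. - of_bool (ii l = ii k)) (zz \<epsilon> s))"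
    by (rule prod.reindex_bij_betw[OF iiI, symmetric])
  also have "\<dots> = X" unfolding X_def
  proof (rule prod.cong[OF refl])
    fix k assume "k \<in> {..<ed}"
    then have k: "k < n" "zz \<epsilon> s k = ?c k" using ed_le by (auto simp: zz_def)
    show "inverse (z (Inl (ii k))) * pw (\<lambda>l. - of_bool (ii l = ii k)) (zz \<epsilon> s) = inverse (z (Inl (ii k)) - ?c k)"
      unfolding pw_ii(2)[OF k(1) zz_Pd] k(2) inverse_mult_distrib[symmetric] using znz[of "Inl (ii k)"] by (simp add: right_diff_distrib)
  qed
  finally have g: "G \<xi> (\<lambda>i. Suc (b i)) (zz \<epsilon> s) = chr ed fd ?t \<gamma> * X * inverse F"
    unfolding G_def F_def chr_tt by (simp only: power_inverse prod_inversef[unfolded o_def])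
  have w: "(\<Prod>k\<in>set [0..<ed]. inverse (?c k) ^ b (ii k)) = inverse W"
    unfolding W_def by (simp add: power_inverse prod_inversef[unfolded o_def] atLeast0LessThan)
  show ?thesis unfolding d e g w P_def[symmetric] using P Z W F by (simp add: field_simps)
qed

end

text \<open>The branch through \<xi> carries the product of circles onto the whole cycle: on it the
  \<open>f\<close> have the prescribed values, and inside the polydisc these values determine the
  point. So one cube suffices, and the pulled back integral is Cauchy's formula for
  \<open>G\<close>.\<close>

theorem local_residue:
  assumes xi: "\<xi> \<in> Sol (cz z)"
    and H: "ders (word_of (\<lambda>k. b (ii k)) [0..<ed]) (G \<xi> (\<lambda>i. Suc (b i))) H"
  shows "has_local_residue ed (\<lambda>k. fz z (ii k))
     (\<lambda>t. chr ed fd t \<gamma> / (\<Prod>i\<in>UNIV. fz z i t ^ Suc (b i)) / (\<Prod>k<ed. t k)) \<xi>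
     ((-1) ^ ed * dets ed Mx * (H (\<lambda>_. 0) / (\<Prod>k<ed. fact (b (ii k)))))"
proof -
  have xt: "\<xi> \<in> torus ed" using xi by (simp add: Sol_def)
  have xl: "\<xi> l \<noteq> 0" if "l < ed" for l using xt that by (auto simp: torus_def PiE_iff)
  have chr_eq: "\<forall>i\<in>- J. chr ed fd t (a i) = chr ed fd t' (a i)" if "\<And>k. k < ed \<Longrightarrow> fz z (ii k) t = fz z (ii k) t'" for t t'
  proof
    fix i assume "i \<in> - J"
    then obtain k where "k < ed" "i = ii k" using iiI by (auto simp: bij_betw_def)
    then show "chr ed fd t (a i) = chr ed fd t' (a i)" using that[of k] znz by (simp add: fz_def)
  qed
  have fz0: "fz z (ii k) \<xi> = 0" if "k < ed" for k
    using xi Sol_zeros[of z] znz iiI_mem[OF that] by blast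
  show ?thesis unfolding has_local_residue_def
    using eventually_polydisc_separated[OF xt]
  proof (rule eventually_mono)
    fix r assume "r > 0 \<and> polydisc ed \<xi> r \<subseteq> torus ed \<and>
     (\<forall>t\<in>polydisc ed \<xi> r. \<forall>t'\<in>polydisc ed \<xi> r. (\<forall>i\<in>- J. chr ed fd t (a i) = chr ed fd t' (a i)) \<longrightarrow> t = t')"
    then have r: "r > 0" "polydisc ed \<xi> r \<subseteq> torus ed"
      and sep: "\<And>t t'. t \<in> polydisc ed \<xi> r \<Longrightarrow> t' \<in> polydisc ed \<xi> r \<Longrightarrow> (\<And>k. k < ed \<Longrightarrow> fz z (ii k) t = fz z (ii k) t') \<Longrightarrow> t = t'"
      using chr_eq by blast+
    have xp: "\<xi> \<in> polydisc ed \<xi> r" using r(1) xt by (auto simp: polydisc_def torus_def PiE_iff)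
    have zero: "{t \<in> polydisc ed \<xi> r. \<forall>k<ed. fz z (ii k) t = 0} = {\<xi>}"
    proof (intro equalityI subsetI)
      fix t assume t: "t \<in> {t \<in> polydisc ed \<xi> r. \<forall>k<ed. fz z (ii k) t = 0}"
      have "t = \<xi>" by (rule sep[OF _ xp]) (use t fz0 in auto)
      then show "t \<in> {\<xi>}" by simp
    qed (use xp fz0 in auto)
    have "\<forall>\<^sub>F d in at_right 0. \<forall>l\<in>{..<ed}. \<forall>\<zeta>. (\<forall>k<n. cmod (\<zeta> k) < d) \<longrightarrow> cmod (pw (Mx l) \<zeta> - 1) < r / cmod (\<xi> l)"
      by (rule eventually_ball_finite, simp, rule ballI, rule eventually_exp_Ln_near_one) (use xk r xl in auto)
    from eventually_happens'[OF _ eventually_conj[OF eventually_at_right_less this]]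
    obtain d where d: "d > 0" "\<And>l \<zeta>. l < ed \<Longrightarrow> (\<And>k. k < n \<Longrightarrow> cmod (\<zeta> k) < d) \<Longrightarrow> cmod (pw (Mx l) \<zeta> - 1) < r / cmod (\<xi> l)"
      by auto
    have tp: "tt \<xi> \<zeta> \<in> polydisc ed \<xi> r" if "\<And>k. k < n \<Longrightarrow> cmod (\<zeta> k) < d" for \<zeta>
      unfolding polydisc_def
    proof (intro CollectI conjI allI impI)
      show "tt \<xi> \<zeta> \<in> {..<ed} \<rightarrow>\<^sub>E UNIV" by (auto simp: tt_def)
      fix l assume l: "l < ed"
      have "tt \<xi> \<zeta> l - \<xi> l = \<xi> l * (pw (Mx l) \<zeta> - 1)" using l by (simp add: tt_def Mx_def algebra_simps)
      then have "cmod (tt \<xi> \<zeta> l - \<xi> l) = cmod (\<xi> l) * cmod (pw (Mx l) \<zeta> - 1)" by (simp only: norm_mult)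
      also have "\<dots> < r" using d(2)[OF l that] xl[OF l] by (simp add: pos_less_divide_eq mult.commute)
      finally show "dist (tt \<xi> \<zeta> l) (\<xi> l) < r" by (simp add: dist_norm)
    qed
    let ?h = "\<lambda>t. chr ed fd t \<gamma> / (\<Prod>i\<in>UNIV. fz z i t ^ Suc (b i)) / (\<Prod>k<ed. t k)"
    let ?F = "\<lambda>k. fz z (ii k)"
    let ?I = "(2 * of_real pi * \<i>) ^ ed * ((-1) ^ ed * dets ed Mx * (H (\<lambda>_. 0) / (\<Prod>k<ed. fact (b (ii k)))))"
    \<comment> \<open>Radii below \<open>d\<close> keep the branch inside the polydisc around \<xi>,
      radii below \<delta> keep it inside the domain of the branch.\<close>
    have "has_cycle_integral ed ?F (residue_cycle ed ?F (polydisc ed \<xi> r) \<epsilon>) ?h ?I"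
      if e: "\<forall>k<ed. 0 < \<epsilon> k \<and> \<epsilon> k < min d \<delta>" for \<epsilon>
    proof -
      have eps: "\<And>k. k < ed \<Longrightarrow> 0 < \<epsilon> k \<and> \<epsilon> k < \<delta>" using e by simp
      let ?\<phi> = "\<lambda>s. tt \<xi> (zz \<epsilon> s)" let ?A = "{..<ed} \<rightarrow>\<^sub>E {0..<1::real}"
      let ?\<Gamma> = "residue_cycle ed ?F (polydisc ed \<xi> r) \<epsilon>"
      have fzz: "fz z (ii k) (?\<phi> s) = cyc (\<epsilon> k) (s k)" if "k < ed" for k s
        by (rule fz_zz[OF _ xi that]) (rule eps)
      have pb: "?h (?\<phi> s) * dets ed (\<lambda>j k. pdiff k (\<lambda>s. ?\<phi> s j) s) = (- (2 * of_real pi * \<i>)) ^ ed * dets ed Mx *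
     (G \<xi> (\<lambda>i. Suc (b i)) (zz \<epsilon> s) * (\<Prod>k\<in>set [0..<ed]. inverse (cyc (\<epsilon> k) (s k)) ^ b (ii k)))" for s
        by (rule form_pullback[OF _ xi]) (rule eps)
      have C1: "C1_map ed ?\<phi>" by (rule C1_tt[OF _ xi]) (rule eps)
      have ori: "dets ed (\<lambda>j k. Im (pdiff k (\<lambda>s. fz z (ii j) (?\<phi> s)) s / fz z (ii j) (?\<phi> s))) > 0" for s
        by (rule orientation_tt[OF _ xi]) (rule eps)
      have mem: "?\<phi> s \<in> ?\<Gamma>" for s
        unfolding residue_cycle_def
      proof (intro CollectI conjI allI impI)
        show "?\<phi> s \<in> polydisc ed \<xi> r"
          by (rule tp) (use e d(1) in \<open>auto simp: zz_def norm_cyc\<close>)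
        fix k assume "k < ed"
        then show "cmod (fz z (ii k) (?\<phi> s)) = \<epsilon> k" using fzz eps[of k] by (simp add: norm_cyc)
      qed
      have inj: "inj_on ?\<phi> ?A"
      proof (rule inj_onI)
        fix s s' assume s: "s \<in> ?A" "s' \<in> ?A" "?\<phi> s = ?\<phi> s'"
        show "s = s'"
        proof (rule extensionalityI[of _ "{..<ed}"])
          fix k assume "k \<in> {..<ed}"
          then have k: "k < ed" by simp
          have "cyc (\<epsilon> k) (s k) = cyc (\<epsilon> k) (s' k)" unfolding fzz[OF k, symmetric] s(3) ..
          then show "s k = s' k" by (rule cyc_inj[rotated 3]) (use eps[OF k] s k in \<open>auto simp: PiE_iff\<close>)
        qed (use s in \<open>auto simp: PiE_iff\<close>)
      qed
      have surj: "\<exists>s\<in>?A. t = ?\<phi> s" if t: "t \<in> ?\<Gamma>" for t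
      proof -
        have tF: "cmod (fz z (ii k) t) = \<epsilon> k" if "k < ed" for k using t that by (simp add: residue_cycle_def)
        have ex: "\<exists>y. y \<in> {0..<1} \<and> cyc (\<epsilon> k) y = fz z (ii k) t" if k: "k < ed" for k
        proof -
          have "fz z (ii k) t \<noteq> 0" using tF[OF k] eps[OF k] by auto
          then obtain y where "y \<in> {0..<1}" "cyc (cmod (fz z (ii k) t)) y = fz z (ii k) t" by (rule cyc_surj)
          then show ?thesis using tF[OF k] by auto
        qed
        define s where "s = (\<lambda>k\<in>{..<ed}. SOME y. y \<in> {0..<1} \<and> cyc (\<epsilon> k) y = fz z (ii k) t)"
        have s: "s k \<in> {0..<1} \<and> cyc (\<epsilon> k) (s k) = fz z (ii k) t" if "k < ed" for k
          using someI_ex[OF ex[OF that]] that by (simp add: s_def)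
        have "t = ?\<phi> s"
        proof (rule sep)
          show "t \<in> polydisc ed \<xi> r" "?\<phi> s \<in> polydisc ed \<xi> r" using t mem[of s] by (auto simp: residue_cycle_def)
        qed (simp only: fzz s)
        moreover have "s \<in> ?A" using s by (auto simp: s_def)
        ultimately show ?thesis by blast
      qed
      have b1: "bij_betw ?\<phi> ?A ?\<Gamma>"
      proof (rule bij_betw_imageI[OF inj], intro equalityI subsetI)
        fix t assume "t \<in> ?\<phi> ` ?A"
        then obtain s where "t = ?\<phi> s" by (rule imageE)
        then show "t \<in> ?\<Gamma>" by (simp only: mem)
      next
        fix t assume "t \<in> ?\<Gamma>"
        from surj[OF this] obtain s where "s \<in> ?A" "t = ?\<phi> s" by (elim bexE)
        show "t \<in> ?\<phi> ` ?A" by (rule image_eqI) fact+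
      qed
      have bs: "bij_betw snd ({..<1::nat} \<times> B) B" for B :: "(nat \<Rightarrow> real) set"
        by (rule bij_betwI[where g = "\<lambda>s. (0, s)"]) auto
      have b2: "bij_betw (\<lambda>(m, s). ?\<phi> s) ({..<1::nat} \<times> ?A) ?\<Gamma>"
      proof -
        have "(\<lambda>(m :: nat, s). ?\<phi> s) = ?\<phi> \<circ> snd" by (rule ext) (simp only: case_prod_beta o_apply)
        then show ?thesis using bij_betw_trans[OF bs b1] by (simp only:)
      qed
      have "(LINT s : ?A | PiM {..<ed} (\<lambda>_. lborel). ?h (?\<phi> s) * dets ed (\<lambda>j k. pdiff k (\<lambda>s. ?\<phi> s j) s))
        = (LINT s : ?A | PiM {..<ed} (\<lambda>_. lborel). (- (2 * of_real pi * \<i>)) ^ ed * dets ed Mx *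
     (G \<xi> (\<lambda>i. Suc (b i)) (zz \<epsilon> s) * (\<Prod>k\<in>set [0..<ed]. inverse (cyc (\<epsilon> k) (s k)) ^ b (ii k))))"
        by (simp only: pb)
      also have "\<dots> = (- (2 * of_real pi * \<i>)) ^ ed * dets ed Mx * (LINT s : ?A | PiM {..<ed} (\<lambda>_. lborel).
           G \<xi> (\<lambda>i. Suc (b i)) (zz \<epsilon> s) * (\<Prod>k\<in>set [0..<ed]. inverse (cyc (\<epsilon> k) (s k)) ^ b (ii k)))"
        unfolding set_lebesgue_integral_def by (simp only: mult_scaleR_right[symmetric] integral_mult_right_zero)
      also have "(LINT s : ?A | PiM {..<ed} (\<lambda>_. lborel).
           G \<xi> (\<lambda>i. Suc (b i)) (zz \<epsilon> s) * (\<Prod>k\<in>set [0..<ed]. inverse (cyc (\<epsilon> k) (s k)) ^ b (ii k)))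
         = H (\<lambda>_. 0) / (\<Prod>k<ed. fact (b (ii k)))"
      proof -
        have "(LINT s : (set [0..<ed] \<rightarrow>\<^sub>E {0..<1}) | PiM (set [0..<ed]) (\<lambda>_. lborel).
           G \<xi> (\<lambda>i. Suc (b i)) (\<lambda>k. if k \<in> set [0..<ed] then cyc (\<epsilon> k) (s k) else (\<lambda>_. 0) k) * (\<Prod>k\<in>set [0..<ed]. inverse (cyc (\<epsilon> k) (s k)) ^ b (ii k)))
           = H (\<lambda>k. if k \<in> set [0..<ed] then 0 else (\<lambda>_. 0) k) / (\<Prod>k\<in>set [0..<ed]. fact (b (ii k)))"
          by (rule polydisc_cauchy[OF _ _ H zero_Pd]) (use eps ed_le in auto)
        then show ?thesis unfolding zz_def by (simp add: atLeast0LessThan)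
      qed
      also have "(- (2 * of_real pi * \<i>)) ^ ed * dets ed Mx * (H (\<lambda>_. 0) / (\<Prod>k<ed. fact (b (ii k)))) = ?I"
        by (subst power_minus) (simp only: mult_ac)
      finally have int: "?I = (\<Sum>m<1::nat. LINT s : ?A | PiM {..<ed} (\<lambda>_. lborel). ?h (?\<phi> s) * dets ed (\<lambda>j k. pdiff k (\<lambda>s. ?\<phi> s j) s))"
        by simp
      show ?thesis unfolding has_cycle_integral_def
        by (rule exI[of _ "1::nat"], rule exI[of _ "\<lambda>_. ?\<phi>"], intro conjI allI impI ballI b2 int C1 ori)
    qed
    then show "{t \<in> polydisc ed \<xi> r. \<forall>k<ed. fz z (ii k) t = 0} = {\<xi>} \<and>
        (\<exists>\<delta>>0. \<forall>\<epsilon>. (\<forall>k<ed. 0 < \<epsilon> k \<and> \<epsilon> k < \<delta>) \<and>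
           (\<forall>t\<in>residue_cycle ed ?F (polydisc ed \<xi> r) \<epsilon>. dets ed (\<lambda>j k. deriv (\<lambda>z'. fz z (ii j) (t(k := z'))) (t k)) \<noteq> 0) \<longrightarrow>
           has_cycle_integral ed ?F (residue_cycle ed ?F (polydisc ed \<xi> r) \<epsilon>) ?h ?I)"
      using zero d(1) \<delta>(1) by (intro conjI exI[of _ "min d \<delta>"]) auto
  qed
qed

end

text \<open>All factors that relate the residue sum to the derivative of \<open>Rsum\<close> are
  nonzero and independent of \<open>z\<close>; only therefore can they be absorbed in constant
  coefficients.\<close>

theorem (in toric) residue_sum:
  assumes gz: "good z" and ii: "bij_betw ii {..<n} UNIV" "bij_betw ii {..<ed} (- J)" "ed \<le> n"
  obtains \<rho> where "\<And>\<xi>. \<xi> \<in> Sol (cz z) \<Longrightarrow> has_local_residue ed (\<lambda>k. fz z (ii k))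
     (\<lambda>t. chr ed fd t \<gamma> / (\<Prod>i\<in>UNIV. fz z i t ^ Suc (b i)) / (\<Prod>k<ed. t k)) \<xi> (\<rho> \<xi>)"
    "(\<Sum>\<xi>\<in>Sol (cz z). \<rho> \<xi>) * ((-1) ^ (\<Sum>i\<in>UNIV. b i) * (\<Prod>k\<in>{ed..<n}. fact (b (ii k)))) =
       (-1) ^ ed * dets ed (\<lambda>l k. of_int (mm l (ii k)) / of_nat idxD) / (\<Prod>k<ed. fact (b (ii k)))
        * fold pd (map (\<lambda>k. Inl (ii k)) (word_of (\<lambda>k. b (ii k)) ([ed..<n] @ [0..<ed]))) (Rsum (\<lambda>_. 1)) z"
    "dets ed (\<lambda>l k. of_int (mm l (ii k)) / of_nat idxD :: complex) \<noteq> 0"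
proof -
  obtain \<delta> where "toric_germ a J g ed fd n z ii \<delta>" by (rule toric_germ_exists[OF gz ii]) (rule that)
  then interpret toric_germ a J g \<gamma> ed fd n z ii \<delta> .
  obtain H where H: "\<And>\<xi>. \<xi> \<in> Sol (cz z) \<Longrightarrow> ders (word_of (\<lambda>k. b (ii k)) [0..<ed]) (G \<xi> (\<lambda>i. Suc (b i))) (H \<xi>)"
    "fold pd (map (\<lambda>k. Inl (ii k)) (word_of (\<lambda>k. b (ii k)) ([ed..<n] @ [0..<ed]))) (Rsum (\<lambda>_. 1)) z
      = (-1) ^ (\<Sum>i\<in>UNIV. b i) * (\<Prod>k\<in>{ed..<n}. fact (b (ii k))) * (\<Sum>\<xi>\<in>Sol (cz z). H \<xi> (\<lambda>_. 0))"
    by (rule fold_pd_Rsum[of b]) (rule that)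
  have M: "(\<lambda>l k. of_int (mm l (ii k)) / of_nat idxD) = Mx" by (simp add: Mx_def fun_eq_iff)
  have S: "(\<Sum>\<xi>\<in>Sol (cz z). (-1) ^ ed * dets ed Mx * (H \<xi> (\<lambda>_. 0) / (\<Prod>k<ed. fact (b (ii k)))))
    = (-1) ^ ed * dets ed Mx / (\<Prod>k<ed. fact (b (ii k))) * (\<Sum>\<xi>\<in>Sol (cz z). H \<xi> (\<lambda>_. 0))"
    by (simp add: sum_distrib_left)
  show thesis
  proof (rule that[OF local_residue[OF _ H(1)]])
    show "(\<Sum>\<xi>\<in>Sol (cz z). (-1) ^ ed * dets ed Mx * (H \<xi> (\<lambda>_. 0) / (\<Prod>k<ed. fact (b (ii k))))) * ((-1) ^ (\<Sum>i\<in>UNIV. b i) * (\<Prod>k\<in>{ed..<n}. fact (b (ii k)))) =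
       (-1) ^ ed * dets ed (\<lambda>l k. of_int (mm l (ii k)) / of_nat idxD) / (\<Prod>k<ed. fact (b (ii k)))
        * fold pd (map (\<lambda>k. Inl (ii k)) (word_of (\<lambda>k. b (ii k)) ([ed..<n] @ [0..<ed]))) (Rsum (\<lambda>_. 1)) z"
      unfolding S M H(2) by (simp only: mult_ac)
  qed (use dets_Mx in \<open>simp_all only: M not_False_eq_True\<close>)
qed

section \<open>Rational functions of two vectors\<close>

definition unc :: "'n xy_fun \<Rightarrow> ('n::finite + 'n \<Rightarrow> complex) \<Rightarrow> complex" where
  "unc f z = f (\<chi> i. z (Inl i)) (\<chi> i. z (Inr i))"

definition zv :: "complex ^ 'n \<Rightarrow> complex ^ 'n \<Rightarrow> 'n + 'n \<Rightarrow> complex" where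
  "zv x y = case_sum (\<lambda>i. x $ i) (\<lambda>i. y $ i)"

lemma zv_simps [simp]: "zv x y (Inl i) = x $ i" "zv x y (Inr i) = y $ i"
  by (simp_all add: zv_def)

lemma unc_zv: "unc f (zv x y) = f x y"
  by (simp add: unc_def)

lemma zv_vec: "zv (\<chi> i. z (Inl i)) (\<chi> i. z (Inr i)) = z"
  by (rule ext) (simp add: zv_def split: sum.split)

lemma polynomial_fun_pol: "polynomial_fun p \<Longrightarrow> \<exists>P. pol (unc p) P"
proof (induction rule: polynomial_fun.induct)
  case (const c)
  show ?case unfolding unc_def[abs_def] by (rule exI, rule pol_const)
next
  case (x i)
  show ?case unfolding unc_def[abs_def] vec_lambda_beta by (rule exI, rule pol_var)
next
  case (y i)
  show ?case unfolding unc_def[abs_def] vec_lambda_beta by (rule exI, rule pol_var)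
next
  case (add p q)
  from add.IH obtain P Q where "pol (unc p) P" "pol (unc q) Q" by (elim exE)
  from pol_add[OF this] show ?case unfolding unc_def[abs_def] by (rule exI[of _ "\<lambda>c m. P c m + Q c m"])
next
  case (mult p q)
  from mult.IH obtain P Q where "pol (unc p) P" "pol (unc q) Q" by (elim exE)
  from pol_mult[OF this] show ?case unfolding unc_def[abs_def] by (rule exI[of _ "\<lambda>c. P (Q c)"])
qed

lemma pol_polynomial_fun: "pol g G \<Longrightarrow> polynomial_fun (\<lambda>x y. g (zv x y))"
proof (induction rule: pol.induct)
  case (pol_const a)
  show ?case by (rule polynomial_fun.const)
next
  case (pol_var v)
  show ?case by (cases v) (simp_all add: polynomial_fun.x polynomial_fun.y)
next
  case (pol_add p P q Q)
  show ?case by (rule polynomial_fun.add[OF pol_add.IH])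
next
  case (pol_mult p P q Q)
  show ?case by (rule polynomial_fun.mult[OF pol_mult.IH])
qed

lemma generically_iff_gen: "generically P \<longleftrightarrow> gen (\<lambda>z. P (\<chi> i. z (Inl i)) (\<chi> i. z (Inr i)))"
proof
  assume "generically P"
  then obtain g x0 y0 where g: "polynomial_fun g" "g x0 y0 \<noteq> 0" "\<forall>x y. g x y \<noteq> 0 \<longrightarrow> P x y"
    unfolding generically_def by (elim exE conjE)
  from polynomial_fun_pol[OF g(1)] obtain G where G: "pol (unc g) G" by (elim exE)
  show "gen (\<lambda>z. P (\<chi> i. z (Inl i)) (\<chi> i. z (Inr i)))"
    by (rule genI[OF G, of "zv x0 y0"]) (use g in \<open>simp_all add: unc_def\<close>)
next
  assume "gen (\<lambda>z. P (\<chi> i. z (Inl i)) (\<chi> i. z (Inr i)))"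
  then obtain g G z0 where g: "pol g G" "g z0 \<noteq> 0" "\<And>z. g z \<noteq> 0 \<Longrightarrow> P (\<chi> i. z (Inl i)) (\<chi> i. z (Inr i))"
    by (rule genE) (rule that)
  show "generically P" unfolding generically_def
  proof (intro exI[of _ "\<lambda>x y. g (zv x y)"] conjI allI impI pol_polynomial_fun[OF g(1)])
    show "\<exists>x y. g (zv x y) \<noteq> 0"
      by (rule exI[of _ "\<chi> i. z0 (Inl i)"], rule exI[of _ "\<chi> i. z0 (Inr i)"]) (simp only: zv_vec g(2) not_False_eq_True)
    fix x y assume "g (zv x y) \<noteq> 0"
    from g(3)[OF this] show "P x y" by simp
  qed
qed

lemma unc_dx:
  fixes f :: "'n::finite xy_fun"
  shows "unc (dx i f) = pd (Inl i) (unc f)"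
proof
  fix z :: "'n + 'n \<Rightarrow> complex"
  have e: "(\<chi> j. (z(Inl i := z (Inl i) + t)) (Inl j)) = (\<chi> j. z (Inl j)) + axis i t" for t
    by (simp add: Finite_Cartesian_Product.vec_eq_iff axis_def)
  have "(\<lambda>t. unc f (z(Inl i := t))) \<circ> (\<lambda>x. z (Inl i) + x) = (\<lambda>t. unc f (z(Inl i := z (Inl i) + t)))"
    by (rule ext) (simp only: o_apply)
  then have "pd (Inl i) (unc f) z = deriv (\<lambda>t. unc f (z(Inl i := z (Inl i) + t))) 0"
    unfolding pd_def deriv_shift_0[where f = "\<lambda>t. unc f (z(Inl i := t))" and z = "z (Inl i)"] by (rule arg_cong)
  then show "unc (dx i f) z = pd (Inl i) (unc f) z"
    unfolding unc_def e dx_def by simp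
qed

lemma unc_dy:
  fixes f :: "'n::finite xy_fun"
  shows "unc (dy i f) = pd (Inr i) (unc f)"
proof
  fix z :: "'n + 'n \<Rightarrow> complex"
  have e: "(\<chi> j. (z(Inr i := z (Inr i) + t)) (Inr j)) = (\<chi> j. z (Inr j)) + axis i t" for t
    by (simp add: Finite_Cartesian_Product.vec_eq_iff axis_def)
  have "(\<lambda>t. unc f (z(Inr i := t))) \<circ> (\<lambda>x. z (Inr i) + x) = (\<lambda>t. unc f (z(Inr i := z (Inr i) + t)))"
    by (rule ext) (simp only: o_apply)
  then have "pd (Inr i) (unc f) z = deriv (\<lambda>t. unc f (z(Inr i := z (Inr i) + t))) 0"
    unfolding pd_def deriv_shift_0[where f = "\<lambda>t. unc f (z(Inr i := t))" and z = "z (Inr i)"] by (rule arg_cong)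
  then show "unc (dy i f) z = pd (Inr i) (unc f) z"
    unfolding unc_def e dy_def by simp
qed

lemma unc_funpow:
  fixes D :: "'n::finite xy_fun \<Rightarrow> 'n xy_fun"
  assumes "\<And>f. unc (D f) = E (unc f)" shows "unc ((D ^^ m) f) = (E ^^ m) (unc f)"
proof (induction m)
  case 0
  show ?case by (simp only: funpow.simps id_apply)
next
  case (Suc m)
  show ?case by (simp only: funpow.simps o_apply assms Suc.IH)
qed

lemma unc_dxy:
  "unc (dxy u v f) = fold (\<lambda>w. pd w ^^ case_sum u v w) (map Inr (sorted_list_of_set UNIV) @ map Inl (sorted_list_of_set UNIV)) (unc f)"
proof -
  have fx: "unc ((dx i ^^ m) f) = (pd (Inl i) ^^ m) (unc f)" for i m f
    by (rule unc_funpow) (rule unc_dx)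
  have fy: "unc ((dy i ^^ m) f) = (pd (Inr i) ^^ m) (unc f)" for i m f
    by (rule unc_funpow) (rule unc_dy)
  have x: "unc (fold (\<lambda>i. dx i ^^ u i) L f) = fold (\<lambda>w. pd w ^^ case_sum u v w) (map Inl L) (unc f)" for L f
    by (induction L arbitrary: f) (simp_all add: fx)
  have y: "unc (fold (\<lambda>i. dy i ^^ v i) L f) = fold (\<lambda>w. pd w ^^ case_sum u v w) (map Inr L) (unc f)" for L f
    by (induction L arbitrary: f) (simp_all add: fy)
  show ?thesis unfolding iter_deriv_def x y by simp
qed

lemma expands_dxy:
  fixes f :: "'n::{finite,linorder} xy_fun"
  assumes "expands w (unc f) c" shows "expands w (unc (dxy u v f)) (Dop (case_sum u v) c)"
proof -
  let ?xs = "map Inr (sorted_list_of_set (UNIV :: 'n set)) @ map Inl (sorted_list_of_set (UNIV :: 'n set))"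
  have "distinct ?xs" by (auto simp: distinct_map)
  from expands_fold_pd[OF assms this, of "case_sum u v"]
  have "expands w (unc (dxy u v f)) (Dop (\<lambda>w. if w \<in> set ?xs then case_sum u v w else 0) c)"
    unfolding unc_dxy .
  moreover have "w \<in> set ?xs" for w by (cases w) auto
  ultimately show ?thesis by (simp only: if_True)
qed

lemma expands_euler: "expands w f c \<Longrightarrow> expands w (\<lambda>z. z v * pd v f z) (\<lambda>m. of_int (m v) * c m)"
proof -
  assume f: "expands w f c"
  have "shift v (sder v c) = (\<lambda>m. of_int (m v) * c m)" by (rule ext) (simp add: shift_def sder_def)
  then show ?thesis using expands_mult_pol[OF expands_pd[OF f] pol_var, of v v] by simp
qed

section \<open>From the differential equations to the final combination\<close>

text \<open>Euler operators act diagonally on monomials and so cut down the support; toric operators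
  become identities between formal derivatives. Each passes to the series because a generically
  vanishing function has the zero expansion.\<close>

lemma hypergeometric_series:
  fixes a :: "'n::{finite,linorder} \<Rightarrow> int ^ 'd"
  assumes h: "hypergeometric a \<beta> \<gamma> f" and e: "expands w (unc f) c"
  shows "hyper_series a \<beta> \<gamma> c"
proof -
  have 1: "\<And>u v :: 'n \<Rightarrow> nat. (\<Sum>i\<in>UNIV. int (u i) *s a i) = (\<Sum>i\<in>UNIV. int (v i) *s a i) \<Longrightarrow>
        generically (\<lambda>x y. dxy u v f x y - dxy v u f x y = 0)"
    and 2: "\<And>i. generically (\<lambda>x y. x $ i * dx i f x y + y $ i * dy i f x y + of_int (\<beta> i) * f x y = 0)"
    and 3: "\<And>j. generically (\<lambda>x y. (\<Sum>i\<in>UNIV. of_int (a i $ j) * y $ i * dy i f x y) + of_int (\<gamma> $ j) * f x y = 0)"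
    using h unfolding hypergeometric_def by blast+
  show ?thesis unfolding hyper_series_def
  proof (intro conjI allI impI)
    fix m i assume m: "c m \<noteq> 0"
    have "expands w (\<lambda>z. (z (Inl i) * pd (Inl i) (unc f) z + z (Inr i) * pd (Inr i) (unc f) z) + of_int (\<beta> i) * unc f z)
      (\<lambda>m. (of_int (m (Inl i)) * c m + of_int (m (Inr i)) * c m) + of_int (\<beta> i) * c m)"
      by (intro expands_add expands_euler expands_scale e)
    moreover have "gen (\<lambda>z. (z (Inl i) * pd (Inl i) (unc f) z + z (Inr i) * pd (Inr i) (unc f) z) + of_int (\<beta> i) * unc f z = 0)"
      using 2[of i] unfolding generically_iff_gen vec_lambda_beta unc_def[symmetric] unc_dx unc_dy .
    ultimately have "(\<lambda>m. (of_int (m (Inl i)) * c m + of_int (m (Inr i)) * c m) + of_int (\<beta> i) * c m) = (\<lambda>_. 0)"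
      by (rule expands_zero_fun)
    from fun_cong[OF this, of m] have "(of_int (m (Inl i) + m (Inr i) + \<beta> i) :: complex) * c m = 0" by (simp add: algebra_simps)
    then show "m (Inl i) + m (Inr i) = - \<beta> i" using m by (simp only: mult_eq_0_iff of_int_eq_0_iff) simp
  next
    fix m assume m: "c m \<noteq> 0"
    have "(\<Sum>i\<in>UNIV. m (Inr i) *s a i) $ j = (- \<gamma>) $ j" for j
    proof -
      have "expands w (\<lambda>z. (\<Sum>i\<in>UNIV. of_int (a i $ j) * (z (Inr i) * pd (Inr i) (unc f) z)) + of_int (\<gamma> $ j) * unc f z)
        (\<lambda>m. (\<Sum>i\<in>UNIV. of_int (a i $ j) * (of_int (m (Inr i)) * c m)) + of_int (\<gamma> $ j) * c m)"
        by (intro expands_add expands_sum expands_euler expands_scale e) simp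
      moreover have "gen (\<lambda>z. (\<Sum>i\<in>UNIV. of_int (a i $ j) * (z (Inr i) * pd (Inr i) (unc f) z)) + of_int (\<gamma> $ j) * unc f z = 0)"
        using 3[of j] unfolding generically_iff_gen vec_lambda_beta unc_def[symmetric] unc_dx unc_dy mult.assoc .
      ultimately have "(\<lambda>m. (\<Sum>i\<in>UNIV. of_int (a i $ j) * (of_int (m (Inr i)) * c m)) + of_int (\<gamma> $ j) * c m) = (\<lambda>_. 0)"
        by (rule expands_zero_fun)
      from fun_cong[OF this, of m] have "(of_int ((\<Sum>i\<in>UNIV. m (Inr i) * a i $ j) + \<gamma> $ j) :: complex) * c m = 0"
        by (simp add: algebra_simps sum_distrib_left)
      then have "(\<Sum>i\<in>UNIV. m (Inr i) * a i $ j) + \<gamma> $ j = 0" using m by (simp only: mult_eq_0_iff of_int_eq_0_iff) simp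
      then show ?thesis by simp
    qed
    then show "(\<Sum>i\<in>UNIV. m (Inr i) *s a i) = - \<gamma>" unfolding Finite_Cartesian_Product.vec_eq_iff by (rule allI)
  next
    fix u v :: "'n \<Rightarrow> nat" assume uv: "(\<Sum>i\<in>UNIV. int (u i) *s a i) = (\<Sum>i\<in>UNIV. int (v i) *s a i)"
    have "gen (\<lambda>z. unc (dxy u v f) z - unc (dxy v u f) z = 0)"
      using 1[OF uv] unfolding generically_iff_gen unc_def[symmetric] .
    then have "gen (\<lambda>z. unc (dxy u v f) z = unc (dxy v u f) z)" by (simp only: right_minus_eq)
    then show "Dop (case_sum u v) c = Dop (case_sum v u) c"
      by (rule expands_unique[OF expands_dxy[OF e] expands_dxy[OF e]])
  qed
qed

text \<open>If every relation vanishes at \<open>i\<close>, the \<open>i\<close>-th coefficient in a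
  representation by the \<open>a l\<close> is unique and hence linear in the vector. It is 1 on
  \<open>a i\<close> and 0 on all the others, which makes it a forbidden functional.\<close>

lemma no_coloop_vectorsI:
  fixes a :: "'n::finite \<Rightarrow> int ^ 'd"
  assumes generate: "int_lattice a UNIV = UNIV"
    and no_coloop: "\<not> (\<exists>\<phi> :: real ^ 'd \<Rightarrow> real. linear \<phi> \<and> (\<exists>!i. \<phi> (real_vec (a i)) \<noteq> 0))"
  shows "no_coloop_vectors a"
proof (unfold_locales, rule ccontr)
  fix i assume n: "\<not> (\<exists>e\<in>rel_lattice a. e i > 0)"
  have z: "e i = 0" if e: "e \<in> rel_lattice a" for e
  proof -
    have "(\<lambda>k. (-1) * e k + 0 * e k) \<in> rel_lattice a"
      using closed_comb_rel_lattice[of a] e unfolding closed_comb_def by blast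
    then have "\<not> (-1) * e i + 0 * e i > 0" using n by (metis (no_types, lifting))
    moreover have "\<not> e i > 0" using n e by blast
    ultimately show ?thesis by simp
  qed
  have "\<exists>C. axis j 1 = (\<Sum>l\<in>UNIV. C l *s a l)" for j :: 'd
  proof -
    have "axis j 1 \<in> int_lattice a UNIV" using generate by simp
    then obtain C where "axis j 1 = (\<Sum>l\<in>UNIV. C l *s a l)" by (rule int_latticeE)
    then show ?thesis by (rule exI[of _ C])
  qed
  then obtain C where C: "\<And>j. axis j 1 = (\<Sum>l\<in>UNIV. C j l *s a l)" by metis
  define \<phi> :: "real ^ 'd \<Rightarrow> real" where "\<phi> v = (\<Sum>j\<in>UNIV. v $ j * of_int (C j i))" for v
  have lin: "linear \<phi>" unfolding \<phi>_def
    by (rule linearI) (simp_all add: sum.distrib sum_distrib_left algebra_simps)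
  have val: "\<phi> (real_vec (a l)) = of_bool (l = i)" for l
  proof -
    \<comment> \<open>The difference of two representations of \<open>a l\<close>: the one through
      the unit vectors and the trivial one.\<close>
    define e where "e k = (\<Sum>j\<in>UNIV. a l $ j * C j k) - of_bool (k = l)" for k
    have "(\<Sum>k\<in>UNIV. (\<Sum>j\<in>UNIV. a l $ j * C j k) *s a k) = (\<Sum>j\<in>UNIV. (a l $ j) *s (\<Sum>k\<in>UNIV. C j k *s a k))"
      by (simp add: Finite_Cartesian_Product.vec_eq_iff sum_distrib_left sum_distrib_right mult_ac) (intro allI sum.swap)
    also have "\<dots> = (\<Sum>j\<in>UNIV. (a l $ j) *s axis j 1)" by (simp only: C)
    also have "\<dots> = a l"
    proof -
      have "(\<Sum>j\<in>UNIV. (a l $ j) *s axis j 1) $ k = a l $ k" for k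
      proof -
        have "(\<Sum>j\<in>UNIV. (a l $ j) *s axis j 1) $ k = (\<Sum>j\<in>UNIV. if j = k then a l $ k else 0)"
          unfolding sum_component by (rule sum.cong) (auto simp: axis_def)
        then show ?thesis by simp
      qed
      then show ?thesis unfolding Finite_Cartesian_Product.vec_eq_iff by (rule allI)
    qed
    finally have s: "(\<Sum>k\<in>UNIV. (\<Sum>j\<in>UNIV. a l $ j * C j k) *s a k) = a l" .
    have "(\<Sum>k\<in>UNIV. of_bool (k = l) *s a k) = (\<Sum>k\<in>UNIV. if k = l then a k else 0)"
      by (rule sum.cong) auto
    then have "(\<Sum>k\<in>UNIV. e k *s a k) = 0"
      unfolding e_def using s sum_smult_diff[of "\<lambda>k. \<Sum>j\<in>UNIV. a l $ j * C j k" "\<lambda>k. of_bool (k = l)" a] by simp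
    then have "e \<in> rel_lattice a" by (simp add: rel_lattice_def)
    from z[OF this] have "(\<Sum>j\<in>UNIV. a l $ j * C j i) = of_bool (l = i)" by (auto simp: e_def)
    then have "real_of_int (\<Sum>j\<in>UNIV. a l $ j * C j i) = of_bool (l = i)" by simp
    then show ?thesis by (simp add: \<phi>_def real_vec_def)
  qed
  have "\<exists>!l. \<phi> (real_vec (a l)) \<noteq> 0" unfolding val by simp
  then show False using no_coloop lin by blast
qed

text \<open>Elementary vectors with the same zero set are proportional, and there are finitely many
  zero sets, so genericity on infinitely many vectors costs finitely many conditions.\<close>

lemma finite_elementary_representatives:
  fixes L :: "('n::finite \<Rightarrow> int) set"
  obtains E where "finite E" "(\<lambda>_. 0) \<notin> E"
    "\<forall>W e. (\<forall>e'\<in>E. wt W e' \<noteq> 0) \<longrightarrow> elementary L UNIV e \<longrightarrow> wt W e \<noteq> 0"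
proof -
  define Q where "Q T e \<longleftrightarrow> elementary L UNIV e \<and> {i. e i = 0} = T" for T e
  define E where "E = (\<lambda>T. SOME e. Q T e) ` {T. \<exists>e. Q T e}"
  have some: "Q T (SOME e. Q T e)" if "Q T e" for T e using that by (rule someI[of "Q T"])
  have fin: "finite E" unfolding E_def by simp
  have nz: "(\<lambda>_. 0) \<notin> E"
  proof
    assume "(\<lambda>_. 0) \<in> E"
    then obtain T e where "(\<lambda>_. 0) = (SOME e. Q T e)" "Q T e" unfolding E_def by (elim imageE CollectE exE)
    then have "Q T (\<lambda>_. 0)" using some[of T e] by simp
    then show False by (simp add: Q_def elementary_def)
  qed
  show thesis
  proof (rule that[OF fin nz], intro allI impI)
    fix W e assume W: "\<forall>e'\<in>E. wt W e' \<noteq> 0" and e: "elementary L UNIV e"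
    define T where "T = {i. e i = 0}"
    define e0 where "e0 = (SOME e. Q T e)"
    have Qe: "Q T e" using e by (simp add: Q_def T_def)
    have Q0: "Q T e0" unfolding e0_def by (rule some[OF Qe])
    have "e0 \<in> E" unfolding E_def e0_def by (rule imageI) (use Qe in blast)
    then have w0: "wt W e0 \<noteq> 0" by (rule W[rule_format])
    have "\<forall>j\<in>UNIV. e j = 0 \<longrightarrow> e0 j = 0" using Q0 by (auto simp: Q_def T_def)
    moreover have "e0 \<in> L" using Q0 by (simp add: Q_def elementary_def)
    ultimately obtain p q where pq: "p \<noteq> 0" "\<forall>i. p * e0 i = q * e i" using e unfolding elementary_def by blast
    have "p * wt W e0 = (\<Sum>i\<in>UNIV. W i * (p * e0 i))" by (simp add: wt_def sum_distrib_left mult_ac)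
    also have "\<dots> = q * wt W e" by (simp add: pq(2) wt_def sum_distrib_left mult_ac)
    finally show "wt W e \<noteq> 0" using pq(1) w0 by auto
  qed
qed

text \<open>The numbering \<open>ii\<close> of all indices agrees with the sorted list of the
  complement of \<open>J\<close> only below the dimension, and this is all that the residue
  sees.\<close>

lemma has_local_residue_cong:
  assumes F: "\<And>k. k < e \<Longrightarrow> F k = F' k"
  shows "has_local_residue e F h \<xi> R = has_local_residue e F' h \<xi> R"
proof -
  have D: "dets e (\<lambda>j k. Im (pdiff k (\<lambda>s. F j (\<psi> s)) s / F j (\<psi> s))) = dets e (\<lambda>j k. Im (pdiff k (\<lambda>s. F' j (\<psi> s)) s / F' j (\<psi> s)))" for \<psi> s
    by (rule dets_cong) (simp add: F)
  have D2: "dets e (\<lambda>j k. deriv (\<lambda>z. F j (t(k := z))) (t k)) = dets e (\<lambda>j k. deriv (\<lambda>z. F' j (t(k := z))) (t k))" for t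
    by (rule dets_cong) (simp add: F)
  have C: "residue_cycle e F U \<epsilon> = residue_cycle e F' U \<epsilon>" for U \<epsilon>
    unfolding residue_cycle_def using F by (intro Collect_cong) auto
  have I: "has_cycle_integral e F = has_cycle_integral e F'"
    by (intro ext) (simp only: has_cycle_integral_def D)
  have Z: "{t \<in> U. \<forall>k<e. F k t = 0} = {t \<in> U. \<forall>k<e. F' k t = 0}" for U
    using F by (intro Collect_cong) auto
  show ?thesis unfolding has_local_residue_def C I D2 Z ..
qed

text \<open>Every cobasis series is the expansion of a toric residue, up to a nonzero scalar: take
  \<open>S = UNIV\<close>, the divisors with \<open>i \<notin> J\<close>, and the exponents
  \<open>Suc (b i)\<close>, obtained from 1 by \<open>b i\<close> derivatives in
  \<open>x i\<close>.\<close>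

lemma toric_residue_exists:
  fixes a :: "'n::{finite,linorder} \<Rightarrow> int ^ 'd" and b :: "'n \<Rightarrow> nat"
  assumes generate: "int_lattice a UNIV = UNIV" and J: "cobasis (rel_lattice a) J"
    and w: "\<And>e. elementary (rel_lattice a) UNIV e \<Longrightarrow> wt (weight_diff w) e \<noteq> 0"
  obtains R \<kappa> where "\<kappa> \<noteq> 0" "toric_residue a UNIV R"
    "expands w (unc R) (\<lambda>m. \<kappa> * residue_series w a (\<lambda>i. int (b i) + 1) \<gamma> J m)"
proof -
  obtain g where g: "\<And>j. j \<in> J \<Longrightarrow> g j \<in> rel_lattice a \<and> g j j > 0 \<and> (\<forall>j'\<in>J - {j}. g j j' = 0)"
    by (rule cobasis_dual[OF J]) (rule that)
  obtain fd :: "nat \<Rightarrow> 'd" where fd: "bij_betw fd {0..<CARD('d)} UNIV"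
    using ex_bij_betw_nat_finite[of "UNIV :: 'd set"] by auto
  have span: "spanning (rel_lattice a) J" using J by (simp add: cobasis_def)
  interpret toric a J g \<gamma> "CARD('d)" fd
    by unfold_locales (use span g fd generate in \<open>simp_all add: atLeast0LessThan\<close>)
  define n where "n = CARD('n)"
  let ?ed = "CARD('d)"
  have wg: "wt (weight_diff w) (g j) \<noteq> 0" if "j \<in> J" for j
    by (rule w[OF dual_elementary[OF closed_comb_rel_lattice span subset_UNIV that g[OF that]]])
  \<comment> \<open>Listing the complement of \<open>J\<close> in increasing order first makes the
    order of the divisors the one that the definition of toric residues prescribes.\<close>
  define L1 L2 where "L1 = sorted_list_of_set (- J)" and "L2 = sorted_list_of_set J"
  define ii where "ii = (!) (L1 @ L2)"
  have dist: "distinct (L1 @ L2)" and set: "set (L1 @ L2) = UNIV" by (auto simp: L1_def L2_def)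
  have len: "length (L1 @ L2) = n" using distinct_card[OF dist] unfolding set n_def by simp
  have len1: "length L1 = ?ed" unfolding L1_def by (simp add: card_cobasis_complement)
  have ii: "bij_betw ii {..<n} UNIV"
    unfolding ii_def by (rule bij_betw_nth[OF dist]) (use len set in auto)
  have ii1: "ii k = sorted_list_of_set (- J) ! k" if "k < ?ed" for k
    using that len1 by (simp add: ii_def nth_append L1_def)
  have "bij_betw ((!) L1) {..<?ed} (- J)"
    by (rule bij_betw_nth) (use len1 in \<open>auto simp: L1_def\<close>)
  then have iiI: "bij_betw ii {..<?ed} (- J)"
    by (rule bij_betw_cong[THEN iffD1, rotated]) (simp add: ii1 L1_def)
  have le: "?ed \<le> n" using len len1 by simp
  let ?ks = "[?ed..<n] @ [0..<?ed]" let ?i = "\<lambda>k. Inl (ii k) :: 'n + 'n"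
  define F where "F = fold pd (map ?i (word_of (\<lambda>k. b (ii k)) ?ks)) (Rsum (\<lambda>_. 1))"
  define U where "U = case_sum b (\<lambda>_ :: 'n. 0 :: nat)"
  have F: "F = fold (\<lambda>v. pd v ^^ U v) (map ?i ?ks) (Rsum (\<lambda>_. 1))"
    unfolding F_def fold_word_of map_word_of by (simp add: U_def)
  have set_ks: "set ?ks = {..<n}" using le by auto
  have inj: "inj_on ?i (set ?ks)"
    unfolding set_ks using ii by (auto simp: bij_betw_def inj_on_def)
  have dxs: "distinct (map ?i ?ks)" unfolding distinct_map using inj by auto
  have sxs: "set (map ?i ?ks) = range Inl"
  proof -
    have "set (map ?i ?ks) = Inl ` (ii ` {..<n})" unfolding set_map set_ks by (simp only: image_image)
    then show ?thesis using ii by (simp add: bij_betw_def)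
  qed
  define N where "N = (of_nat (card (Sol (\<lambda>_. 1))) :: complex)"
  have N: "N \<noteq> 0" using card_Sol_pos by (simp add: N_def)
  have gg: "gen good" by (rule gen_good) (rule wg)
  have ecf: "expands w closed_form (\<lambda>m. orient w * residue_series w a (\<lambda>_. 1) \<gamma> J m)"
    by (rule expands_closed_form) (rule wg)
  have "expands w (Rsum (\<lambda>_. 1)) (\<lambda>m. N * (orient w * residue_series w a (\<lambda>_. 1) \<gamma> J m))"
  proof (rule expands_cong[OF expands_scale[OF ecf] gen_mono[OF gg]])
    fix z assume "good z"
    then show "N * closed_form z = Rsum (\<lambda>_. 1) z" unfolding N_def by (rule Rsum_closed_form[symmetric])
  qed
  then have e1: "expands w (Rsum (\<lambda>_. 1)) (\<lambda>m. N * orient w * residue_series w a (\<lambda>_. 1) \<gamma> J m)"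
    by (simp only: mult.assoc)
  have "(\<lambda>v. if v \<in> set (map ?i ?ks) then U v else 0) = case_sum b (\<lambda>_. 0)"
    unfolding sxs by (rule ext) (simp add: U_def split: sum.split)
  then have eF: "expands w F (\<lambda>m. N * orient w * (-1) ^ (\<Sum>i\<in>UNIV. b i) * residue_series w a (\<lambda>i. int (b i) + 1) \<gamma> J m)"
    using expands_fold_pd[OF e1 dxs, of U] unfolding F[symmetric] by (simp only: Dop_residue_series)
  then obtain p P q Q where pq: "pol p P" "pol q Q" "reg_op w Q" "gen (\<lambda>z. F z * q z = p z)"
    unfolding expands_def by (elim exE conjE)
  have qnz: "\<exists>z. q z \<noteq> 0" by (rule reg_op_nonzero[OF pq(3,2)])
  define D where "D = dets ?ed (\<lambda>l k. of_int (mm l (ii k)) / of_nat idxD :: complex)"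
  define A where "A = ((-1) ^ (\<Sum>i\<in>UNIV. b i) * (\<Prod>k\<in>{?ed..<n}. fact (b (ii k))) :: complex)"
  define K where "K = (-1) ^ ?ed * D / (\<Prod>k<?ed. fact (b (ii k))) / A"
  have A: "A \<noteq> 0" by (simp add: A_def)
  have res: "\<exists>\<rho>. (\<forall>\<xi>\<in>Sol (cz z). has_local_residue ?ed (\<lambda>k. fz z (ii k))
     (\<lambda>t. chr ?ed fd t \<gamma> / (\<Prod>i\<in>UNIV. fz z i t ^ Suc (b i)) / (\<Prod>k<?ed. t k)) \<xi> (\<rho> \<xi>)) \<and>
     (\<Sum>\<xi>\<in>Sol (cz z). \<rho> \<xi>) = K * F z \<and> D \<noteq> 0" if z: "good z" for z
  proof -
    obtain \<rho> where r: "\<And>\<xi>. \<xi> \<in> Sol (cz z) \<Longrightarrow> has_local_residue ?ed (\<lambda>k. fz z (ii k))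
     (\<lambda>t. chr ?ed fd t \<gamma> / (\<Prod>i\<in>UNIV. fz z i t ^ Suc (b i)) / (\<Prod>k<?ed. t k)) \<xi> (\<rho> \<xi>)"
    "(\<Sum>\<xi>\<in>Sol (cz z). \<rho> \<xi>) * A = (-1) ^ ?ed * D / (\<Prod>k<?ed. fact (b (ii k))) * F z" "D \<noteq> 0"
      by (rule residue_sum[OF z ii iiI le, of b, folded A_def D_def F_def]) (rule that)
    have "(\<Sum>\<xi>\<in>Sol (cz z). \<rho> \<xi>) = K * F z" using r(2) A by (simp add: K_def field_simps)
    then show ?thesis using r(1,3) by (intro exI[of _ \<rho>] conjI ballI)
  qed
  obtain z0 where "good z0" using gg by (rule genE) (use gg in \<open>auto simp: gen_def\<close>)
  from res[OF this] have "D \<noteq> 0" by (elim exE conjE)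
  then have K: "K \<noteq> 0" using A by (simp add: K_def)
  \<comment> \<open>\<open>F\<close> is an iterated derivative and equals a quotient of polynomials
    only generically, so the rational function is built from the pair that witnesses its
    expansion.\<close>
  define R where "R = (\<lambda>x y. (K * p (zv x y)) / q (zv x y))"
  from qnz obtain z1 where z1: "q z1 \<noteq> 0" by (elim exE)
  have rat: "rational_fun R" unfolding rational_fun_def
  proof (intro exI conjI)
    show "R = (\<lambda>x y. (K * p (zv x y)) / q (zv x y))" by (rule R_def)
    show "polynomial_fun (\<lambda>x y. K * p (zv x y))" by (rule pol_polynomial_fun[OF pol_mult[OF pol_const pq(1)]])
    show "polynomial_fun (\<lambda>x y. q (zv x y))" by (rule pol_polynomial_fun[OF pq(2)])
    show "q (zv (\<chi> i. z1 (Inl i)) (\<chi> i. z1 (Inr i))) \<noteq> 0" unfolding zv_vec by (rule z1)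
  qed
  have uR: "unc R z = K * p z / q z" for z unfolding unc_def R_def zv_vec ..
  have gR: "gen (\<lambda>z. K * F z = unc R z)"
    by (rule gen_mono[OF gen_conj[OF pq(4) gen_pol[OF pq(2) qnz]]]) (auto simp: uR field_simps)
  have tr: "toric_residue a UNIV R" unfolding toric_residue_def
  proof (intro exI conjI)
    show "lattice_basis ?ed bas (int_lattice a UNIV)" by (rule lattice_basis_bas)
    show "- J \<subseteq> UNIV" "card (- J) = ?ed" "independent_family a (- J)" "\<forall>i\<in>UNIV. Suc (b i) > 0" "\<gamma> \<in> int_lattice a UNIV"
      using card_cobasis_complement LI_independent generate by simp_all
    show "toric_residue_data a UNIV ?ed bas (- J) (\<lambda>i. Suc (b i)) \<gamma> R"
      unfolding toric_residue_data_def Let_def generically_iff_gen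
    proof (intro conjI rat, rule gen_mono[OF gen_conj[OF gg gR]])
      fix z assume z: "good z \<and> K * F z = unc R z"
      have bf: "binom_fun a ?ed bas (\<chi> i. z (Inl i)) (\<chi> i. z (Inr i)) = fz z"
        by (intro ext) (simp add: binom_fun_def fz_def monomial_chr)
      have Z: "{\<xi> \<in> torus ?ed. \<forall>i\<in>- J. fz z i \<xi> = 0} = Sol (cz z)"
        by (rule Sol_zeros) (use z in \<open>simp add: good_def\<close>)
      have gz: "good z" using z by (rule conjunct1)
      from res[OF gz] obtain \<rho> where \<rho>: "\<forall>\<xi>\<in>Sol (cz z). has_local_residue ?ed (\<lambda>k. fz z (ii k))
          (\<lambda>t. chr ?ed fd t \<gamma> / (\<Prod>i\<in>UNIV. fz z i t ^ Suc (b i)) / (\<Prod>k<?ed. t k)) \<xi> (\<rho> \<xi>)"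
        "(\<Sum>\<xi>\<in>Sol (cz z). \<rho> \<xi>) = K * F z" by (elim exE conjE) (rule that)
      have c: "has_local_residue ?ed (\<lambda>k. fz z (sorted_list_of_set (- J) ! k)) = has_local_residue ?ed (\<lambda>k. fz z (ii k))"
        by (intro ext) (rule has_local_residue_cong, simp add: ii1)
      have mc: "monomial ?ed bas \<gamma> t = chr ?ed fd t \<gamma>" for t by (rule monomial_chr)
      show "finite {\<xi> \<in> torus ?ed. \<forall>i\<in>- J. binom_fun a ?ed bas (\<chi> i. z (Inl i)) (\<chi> i. z (Inr i)) i \<xi> = 0} \<and>
         (\<exists>\<rho>. (\<forall>\<xi>\<in>{\<xi> \<in> torus ?ed. \<forall>i\<in>- J. binom_fun a ?ed bas (\<chi> i. z (Inl i)) (\<chi> i. z (Inr i)) i \<xi> = 0}.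
               has_local_residue ?ed (\<lambda>k. binom_fun a ?ed bas (\<chi> i. z (Inl i)) (\<chi> i. z (Inr i)) (sorted_list_of_set (- J) ! k))
                (\<lambda>t. monomial ?ed bas \<gamma> t / (\<Prod>i\<in>UNIV. binom_fun a ?ed bas (\<chi> i. z (Inl i)) (\<chi> i. z (Inr i)) i t ^ Suc (b i)) / (\<Prod>k<?ed. t k)) \<xi> (\<rho> \<xi>)) \<and>
           R (\<chi> i. z (Inl i)) (\<chi> i. z (Inr i)) = (\<Sum>\<xi>\<in>{\<xi> \<in> torus ?ed. \<forall>i\<in>- J. binom_fun a ?ed bas (\<chi> i. z (Inl i)) (\<chi> i. z (Inr i)) i \<xi> = 0}. \<rho> \<xi>))"
        unfolding bf Z c mc unc_def[symmetric]
        by (intro conjI finite_Sol exI[of _ \<rho>] \<rho>(1)) (simp only: \<rho>(2) z)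
    qed
  qed
  have "expands w (unc R) (\<lambda>m. K * (N * orient w * (-1) ^ (\<Sum>i\<in>UNIV. b i) * residue_series w a (\<lambda>i. int (b i) + 1) \<gamma> J m))"
    by (rule expands_cong[OF expands_scale[OF eF] gR])
  then have "expands w (unc R) (\<lambda>m. K * (N * orient w * (-1) ^ (\<Sum>i\<in>UNIV. b i)) * residue_series w a (\<lambda>i. int (b i) + 1) \<gamma> J m)"
    by (simp only: mult.assoc)
  moreover have "K * (N * orient w * (-1) ^ (\<Sum>i\<in>UNIV. b i)) \<noteq> 0"
    using K N orient_nonzero by simp
  ultimately show thesis using that tr by blast
qed

lemma facial_subset_lawrence_UNIV: "facial_subset (lawrence a) (Inl ` UNIV \<union> Inr ` UNIV)"
proof -
  let ?C = "convex_cone hull range (\<lambda>c. real_vec (column c (lawrence a)))"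
  have mem: "real_vec (column c (lawrence a)) \<in> ?C" for c by (rule hull_inc) (rule rangeI)
  have "?C face_of ?C" by (rule face_of_refl) (rule convex_convex_cone_hull)
  moreover have "?C \<noteq> {}" using mem by blast
  moreover have "Inl ` UNIV \<union> Inr ` UNIV = {c. real_vec (column c (lawrence a)) \<in> ?C}"
    using mem by (auto simp: UNIV_sum[symmetric])
  ultimately show ?thesis unfolding facial_subset_def by blast
qed

theorem theorem5p4:
  fixes a :: "'n::{finite,linorder} \<Rightarrow> int ^ 'd"
    and f :: "'n xy_fun"
    and \<beta> :: "'n \<Rightarrow> int" and \<gamma> :: "int ^ 'd"
  assumes nonzero: "\<And>i. a i \<noteq> 0"
    and generate: "int_lattice a UNIV = UNIV"
    and no_coloop: "\<not> (\<exists>\<phi> :: real ^ 'd \<Rightarrow> real. linear \<phi> \<and> (\<exists>!i. \<phi> (real_vec (a i)) \<noteq> 0))"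
    and rational: "rational_fun f"
    and hypergeometric: "hypergeometric a \<beta> \<gamma> f"
  shows "\<exists>(u :: 'n \<Rightarrow> nat) (v :: 'n \<Rightarrow> nat) (N::nat) (c :: nat \<Rightarrow> complex) R.
      (\<forall>k<N. \<exists>S. S \<noteq> {} \<and> facial_subset (lawrence a) (Inl ` S \<union> Inr ` S) \<and> toric_residue a S (R k)) \<and>
      generically (\<lambda>x y. dxy u v f x y = (\<Sum>k<N. c k * R k x y))"
proof -
  interpret no_coloop_vectors a by (rule no_coloop_vectorsI[OF generate no_coloop])
  from rational obtain p q x0 y0 where pq: "polynomial_fun p" "polynomial_fun q" "q x0 y0 \<noteq> 0" "f = (\<lambda>x y. p x y / q x y)"
    unfolding rational_fun_def by (elim exE conjE)
  from polynomial_fun_pol[OF pq(1)] obtain P where P: "pol (unc p) P" by (elim exE)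
  from polynomial_fun_pol[OF pq(2)] obtain Q where Q: "pol (unc q) Q" by (elim exE)
  from pol_nform[OF Q] obtain K s where K: "nform Q (unc q) K s" by (elim exE)
  obtain E where E: "finite E" "(\<lambda>_. 0) \<notin> E"
    "\<forall>W e. (\<forall>e'\<in>E. wt W e' \<noteq> 0) \<longrightarrow> elementary (rel_lattice a) UNIV e \<longrightarrow> wt W e \<noteq> 0"
    by (rule finite_elementary_representatives[of "rel_lattice a"]) (rule that)
  have E0: "(\<lambda>_. 0) \<notin> idx (\<lambda>_. 0) ` E"
  proof
    assume "(\<lambda>_. 0) \<in> idx (\<lambda>_. 0) ` E"
    then obtain e where e: "e \<in> E" "(\<lambda>_. 0) = idx (\<lambda>_. 0) e" by (elim imageE)
    have "e i = 0" for i using fun_cong[OF e(2), of "Inr i"] by (simp add: idx_def)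
    then have "e = (\<lambda>_. 0)" by (rule ext)
    then show False using e(1) E(2) by simp
  qed
  have "finite K" using K by (simp add: nform_def)
  \<comment> \<open>One weight has to serve both the monomials of the denominator and the circuits.
    The latter enter as exponent vectors \<open>idx (\<lambda>_. 0) e\<close>, whose weight is the
    \<open>weight_diff\<close> weight of \<open>e\<close>.\<close>
  from ex_separating_weight[OF this finite_imageI[OF E(1)] E0]
  obtain w where w: "separates w K" "\<forall>e\<in>idx (\<lambda>_. 0) ` E. wt w e \<noteq> 0" by (elim exE conjE)
  have gen: "wt (weight_diff w) e \<noteq> 0" if "elementary (rel_lattice a) UNIV e" for e
    by (rule E(3)[rule_format, OF _ that]) (use w(2) in \<open>simp add: wt_idx0\<close>)
  have "\<exists>z. unc q z \<noteq> 0" by (rule exI[of _ "zv x0 y0"]) (simp add: unc_zv pq(3))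
  from expands_exists[OF P Q this K w(1)] obtain c where "expands w (\<lambda>z. unc p z / unc q z) c" by (elim exE)
  moreover have "(\<lambda>z. unc p z / unc q z) = unc f" unfolding unc_def[abs_def] pq(4) ..
  ultimately have c: "expands w (unc f) c" by simp
  obtain M :: nat where M: "\<And>i. \<beta> i + 2 * int M \<ge> 1"
    "\<And>m. Dop (\<lambda>_. M) c m \<noteq> 0 \<Longrightarrow> pure (\<lambda>i. \<beta> i + 2 * int M) (\<lambda>i. m (Inr i))"
    "\<And>k. pure (\<lambda>i. \<beta> i + 2 * int M) k \<Longrightarrow> (\<Sum>i\<in>UNIV. k i *s a i) = - (\<gamma> + (\<Sum>i\<in>UNIV. int M *s a i)) \<Longrightarrow>
        \<exists>d\<in>rel_lattice a. \<forall>i. (k i \<ge> 0 \<and> d i > 0) \<or> (k i < 0 \<and> d i < 0)"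
    by (rule derivative_support[OF hypergeometric_series[OF hypergeometric c]]) (rule that)
  define \<gamma>' where "\<gamma>' = \<gamma> + (\<Sum>i\<in>UNIV. int M *s a i)"
  \<comment> \<open>The \<open>M\<close> derivatives in \<open>x i\<close> and the \<open>M\<close>
    in \<open>y i\<close> raise \<beta> i by \<open>2 * M\<close>. One is subtracted because the
    residue for \<open>b i\<close> has the exponent \<open>b i + 1\<close> at
    \<open>f i\<close>.\<close>
  define b where "b i = nat (\<beta> i + 2 * int M - 1)" for i
  have b: "(\<lambda>i. \<beta> i + 2 * int M) = (\<lambda>i. int (b i) + 1)"
  proof
    fix i show "\<beta> i + 2 * int M = int (b i) + 1" using M(1)[of i] by (simp add: b_def)
  qed
  have "(\<lambda>i. \<beta> i + int M + int M) = (\<lambda>i. int (b i) + 1)" unfolding b[symmetric] by auto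
  then have hs: "hyper_series a (\<lambda>i. int (b i) + 1) \<gamma>' (Dop (\<lambda>_. M) c)"
    using hyper_series_Dop[OF hypergeometric_series[OF hypergeometric c], of "\<lambda>_. M"] by (simp only: \<gamma>'_def)
  have dM: "expands w (unc (dxy (\<lambda>_. M) (\<lambda>_. M) f)) (Dop (\<lambda>_. M) c)"
  proof -
    have "case_sum (\<lambda>_. M) (\<lambda>_. M) = (\<lambda>_ :: 'n + 'n. M)" by (rule ext) (simp split: sum.split)
    then show ?thesis using expands_dxy[OF c, of "\<lambda>_. M" "\<lambda>_. M"] by simp
  qed
  have bd: "bdd w (Dop (\<lambda>_. M) c)" using dM unfolding expands_def by (elim exE conjE)
  have "\<exists>x. Dop (\<lambda>_. M) c = (\<lambda>m. \<Sum>J | cobasis (rel_lattice a) J. x J * residue_series w a (\<lambda>i. int (b i) + 1) \<gamma>' J m)"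
  proof (rule series_decomposition[OF hs bd])
    show "1 \<le> int (b i) + 1" for i by simp
    show "pure (\<lambda>i. int (b i) + 1) (\<lambda>i. m (Inr i))" if "Dop (\<lambda>_. M) c m \<noteq> 0" for m
      using M(2)[OF that] unfolding b .
    show "\<exists>d\<in>rel_lattice a. \<forall>i. (k i \<ge> 0 \<and> d i > 0) \<or> (k i < 0 \<and> d i < 0)"
      if "pure (\<lambda>i. int (b i) + 1) k" "(\<Sum>i\<in>UNIV. k i *s a i) = - \<gamma>'" for k
      by (rule M(3)) (use that in \<open>simp_all only: b \<gamma>'_def\<close>)
  qed (rule gen)
  then obtain x where x: "Dop (\<lambda>_. M) c = (\<lambda>m. \<Sum>J | cobasis (rel_lattice a) J. x J * residue_series w a (\<lambda>i. int (b i) + 1) \<gamma>' J m)"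
    by (elim exE)
  have "\<exists>R \<kappa>. \<kappa> \<noteq> 0 \<and> toric_residue a UNIV R \<and> expands w (unc R) (\<lambda>m. \<kappa> * residue_series w a (\<lambda>i. int (b i) + 1) \<gamma>' J m)"
    if J: "cobasis (rel_lattice a) J" for J
  proof -
    obtain R \<kappa> where R: "\<kappa> \<noteq> 0" "toric_residue a UNIV R"
      "expands w (unc R) (\<lambda>m. \<kappa> * residue_series w a (\<lambda>i. int (b i) + 1) \<gamma>' J m)"
      by (rule toric_residue_exists[OF generate J gen, of b \<gamma>']) (assumption, rule that)
    then show ?thesis by (intro exI[of _ R] exI[of _ \<kappa>] conjI)
  qed
  then have "\<forall>J. \<exists>R \<kappa>. cobasis (rel_lattice a) J \<longrightarrow> \<kappa> \<noteq> 0 \<and> toric_residue a UNIV R \<and>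
      expands w (unc R) (\<lambda>m. \<kappa> * residue_series w a (\<lambda>i. int (b i) + 1) \<gamma>' J m)" by simp
  from choice[OF this] obtain R where "\<forall>J. \<exists>\<kappa>. cobasis (rel_lattice a) J \<longrightarrow> \<kappa> \<noteq> 0 \<and> toric_residue a UNIV (R J) \<and>
      expands w (unc (R J)) (\<lambda>m. \<kappa> * residue_series w a (\<lambda>i. int (b i) + 1) \<gamma>' J m)" by (elim exE)
  from choice[OF this] obtain \<kappa> where "\<forall>J. cobasis (rel_lattice a) J \<longrightarrow> \<kappa> J \<noteq> 0 \<and> toric_residue a UNIV (R J) \<and>
      expands w (unc (R J)) (\<lambda>m. \<kappa> J * residue_series w a (\<lambda>i. int (b i) + 1) \<gamma>' J m)" by (elim exE)
  then have R: "\<And>J. cobasis (rel_lattice a) J \<Longrightarrow> \<kappa> J \<noteq> 0 \<and> toric_residue a UNIV (R J) \<and>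
      expands w (unc (R J)) (\<lambda>m. \<kappa> J * residue_series w a (\<lambda>i. int (b i) + 1) \<gamma>' J m)" by simp
  define Cob where "Cob = {J. cobasis (rel_lattice a) J}"
  have fin: "finite Cob" by simp
  from ex_bij_betw_nat_finite[OF fin] obtain h where "bij_betw h {0..<card Cob} Cob" by (elim exE)
  then have h: "bij_betw h {..<card Cob} Cob" by (simp add: atLeast0LessThan)
  have hC: "cobasis (rel_lattice a) (h k)" if "k < card Cob" for k
  proof -
    have "h k \<in> Cob" using h that by (auto simp: bij_betw_def)
    then show ?thesis by (simp add: Cob_def)
  qed
  let ?c = "\<lambda>k. x (h k) / \<kappa> (h k)"
  have "expands w (\<lambda>z. \<Sum>k<card Cob. ?c k * unc (R (h k)) z)
     (\<lambda>m. \<Sum>k<card Cob. ?c k * (\<kappa> (h k) * residue_series w a (\<lambda>i. int (b i) + 1) \<gamma>' (h k) m))"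
    by (intro expands_sum expands_scale) (use R hC in auto)
  moreover have "(\<lambda>m. \<Sum>k<card Cob. ?c k * (\<kappa> (h k) * residue_series w a (\<lambda>i. int (b i) + 1) \<gamma>' (h k) m)) = Dop (\<lambda>_. M) c"
  proof
    fix m
    have "(\<Sum>k<card Cob. ?c k * (\<kappa> (h k) * residue_series w a (\<lambda>i. int (b i) + 1) \<gamma>' (h k) m))
      = (\<Sum>k<card Cob. x (h k) * residue_series w a (\<lambda>i. int (b i) + 1) \<gamma>' (h k) m)"
      by (rule sum.cong) (use R hC in auto)
    also have "\<dots> = (\<Sum>J\<in>Cob. x J * residue_series w a (\<lambda>i. int (b i) + 1) \<gamma>' J m)"
      by (rule sum.reindex_bij_betw[OF h])
    finally show "(\<Sum>k<card Cob. ?c k * (\<kappa> (h k) * residue_series w a (\<lambda>i. int (b i) + 1) \<gamma>' (h k) m)) = Dop (\<lambda>_. M) c m"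
      unfolding x Cob_def .
  qed
  ultimately have "expands w (\<lambda>z. \<Sum>k<card Cob. ?c k * unc (R (h k)) z) (Dop (\<lambda>_. M) c)" by simp
  \<comment> \<open>Both functions have the same series for the same weight, so they agree
    generically.\<close>
  from expands_determines[OF dM this]
  have g: "generically (\<lambda>x y. dxy (\<lambda>_. M) (\<lambda>_. M) f x y = (\<Sum>k<card Cob. ?c k * R (h k) x y))"
    unfolding generically_iff_gen unc_def .
  have t: "\<forall>k<card Cob. \<exists>S. S \<noteq> {} \<and> facial_subset (lawrence a) (Inl ` S \<union> Inr ` S) \<and> toric_residue a S (R (h k))"
    by (intro allI impI exI[of _ UNIV] conjI facial_subset_lawrence_UNIV) (use R hC in auto)
  show ?thesis
    by (rule exI[of _ "\<lambda>_. M"], rule exI[of _ "\<lambda>_. M"], rule exI[of _ "card Cob"], rule exI[of _ ?c],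
        rule exI[of _ "\<lambda>k. R (h k)"], rule conjI[OF t g])
qed

end
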